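(* Let $(M,g)$ be a 3-Sasaki manifold of dimension $4m+3$, $m>0$, let $\mathfrak T$ be the contorsion tensor of a metric-compatible connection, and let the pair $(g,\mathfrak T)$ be critical for the action $\bar J_{\mathcal D}$ (with the four distributions $\mathcal D_1,\mathcal D_2,\mathcal D_3,\mathcal D_4$ of the 3-Sasaki structure) with respect to adapted variations of $g$ preserving the volume of $(M,g)$ and all variations of $\mathfrak T$. Suppose that $\langle\mathfrak T_XY,Z\rangle=0$ for all $X\in\mathcal D_\mu$, $Y\in\mathcal D_\rho$, $Z\in\mathcal D_\xi$ with $\mu,\rho,\xi$ pairwise distinct. Then the following equations are valid for some $\lambda\in\mathbb R$: $$-\frac{4+n_4}{n_4}\,{\rm div}\Big(P_4^\bot{\rm Tr}_4^\top\mathfrak T+\sum_{\nu\ne4}P_\nu{\rm Tr}_\nu^\bot\mathfrak T\Big)=\lambda-30-2\,\overline{\rm S}_{\mathcal D_1,\mathcal D_2,\mathcal D_3,\mathcal D_4}+\sum_\nu{\rm div}\big(P_\nu{\rm Tr}_\nu^\bot\mathfrak T+P_\nu^\bot{\rm Tr}_\nu^\top\mathfrak T\big),$$ $$-9\sum_{a=1}^3{\rm div}\Big(P_a^\bot\mathfrak T_{\xi_a}\xi_a+\sum_{\nu\ne a}P_\nu{\rm Tr}_\nu^\bot\mathfrak T\Big)=\lambda+10+2n_4-2\,\overline{\rm S}_{\mathcal D_1,\mathcal D_2,\mathcal D_3,\mathcal D_4}+\sum_\nu{\rm div}\big(P_\nu{\rm Tr}_\nu^\bot\mathfrak T+P_\nu^\bot{\rm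 Tr}_\nu^\top\mathfrak T\big).$$ In particular, no manifold admits complete 3-Sasaki structures and metric connections whose contorsion satisfies $\langle\mathfrak T_XY,Z\rangle=0$ for all $X,Y,Z$ from pairwise different distributions, critical for $\bar J_{\mathcal D}$ with respect to adapted variations of $g$ and all variations of $\mathfrak T$.
   Context: On a 3-Sasaki manifold $(M^{4m+3},g)$ with orthonormal Reeb fields $\xi_1,\xi_2,\xi_3$, $\mathcal D_a$ ($a=1,2,3$) is spanned by $\xi_a$ and $\mathcal D_4$ is the orthogonal complement of $\mathcal D_1\oplus\mathcal D_2\oplus\mathcal D_3$, $n_4=4m$. $P_\mu,P_\mu^\bot$ are the orthoprojectors onto $\mathcal D_\mu$ and $\mathcal D_\mu^\bot$. $\nabla$ is the Levi-Civita connection, $\bar\nabla=\nabla+\mathfrak T$ with contorsion $(1,2)$-tensor $\mathfrak T$; $\bar\nabla$ is metric-compatible iff $\langle\mathfrak T_XY,Z\rangle=-\langle\mathfrak T_XZ,Y\rangle$. With local orthonormal frames $\{E_{\mu,a}\}$ of $\mathcal D_\mu$ and $\{\mathcal E_{\mu,i}\}$ of $\mathcal D_\mu^\bot$: ${\rm Tr}_\mu^\top\mathfrak T=\sum_a\mathfrak T_{E_{\mu,a}}E_{\mu,a}$, ${\rm Tr}_\mu^\bot\mathfrak T=\sum_i\mathfrak T_{\mathcal E_{\mu,i}}\mathcal E_{\mu,i}$. Mixed scalar curvature: with $\bar R_{X,Y}=[\bar\nabla_Y,\bar\nabla_X]+\bar\nabla_{[X,Y]}$, $\overline{\rm S}_{\mathcal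 D_1,\ldots,\mathcal D_4}=\frac12\sum_{\nu<\mu}\sum_{a,b}(\langle\bar R_{E_{\nu,a},E_{\mu,b}}E_{\nu,a},E_{\mu,b}\rangle+\langle\bar R_{E_{\mu,b},E_{\nu,a}}E_{\mu,b},E_{\nu,a}\rangle)$. The action is $\bar J_{\mathcal D}(g,\mathfrak T)=\int_M\overline{\rm S}_{\mathcal D_1,\ldots,\mathcal D_4}\,{\rm d\,vol}_g$ (over a relatively compact domain $\Omega$ containing the supports of variations if $M$ is non-compact; volume-preserving then refers to $\Omega$). Adapted variation: smooth family $g_t$ of metrics for which $\mathcal D_1,\ldots,\mathcal D_4$ are pairwise orthogonal, $g_0=g$, $\partial_tg_t$ supported in $\Omega$. Variation of $\mathfrak T$: smooth family of $(1,2)$-tensors $\mathfrak T_t$, $\mathfrak T_0=\mathfrak T$, $\partial_t\mathfrak T_t$ supported in $\Omega$. The pair is critical if the derivative of the action at $t=0$ vanishes for all (volume-preserving, where stated) adapted variations of $g$ with $\mathfrak T$ fixed and for all variations of $\mathfrak T$ with $g$ fixed. *)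

theory Defs
  imports "HOL-Analysis.Analysis" "HOL-Library.Function_Algebras"
begin

text \<open>
  A manifold is a topological type \<open>'a\<close> with an atlas of charts
  into \<open>real ^ 'n\<close>.  Tangent vectors are derivations of the algebra of smooth functions;
  they are added and scaled pointwise, via the following instance.
\<close>

instantiation "fun" :: (type, real_vector) real_vector
begin

definition scaleR_fun :: "real \<Rightarrow> ('a \<Rightarrow> 'b) \<Rightarrow> 'a \<Rightarrow> 'b"
  where "scaleR_fun r f = (\<lambda>x. r *\<^sub>R f x)"

instance
  by standard (auto simp: scaleR_fun_def fun_eq_iff algebra_simps)

end


section \<open>Smooth manifolds\<close>

primrec Ck_on :: "nat \<Rightarrow> ('e::euclidean_space \<Rightarrow> 'f::real_normed_vector) \<Rightarrow> 'e set \<Rightarrow> bool"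
  where
    "Ck_on 0 f S \<longleftrightarrow> continuous_on S f"
  | "Ck_on (Suc k) f S \<longleftrightarrow> (\<forall>x\<in>S. f differentiable (at x)) \<and>
       (\<forall>v. Ck_on k (\<lambda>x. frechet_derivative f (at x) v) S)"

text \<open>Only used for open sets \<open>S\<close>.\<close>

definition smooth_on :: "('e::euclidean_space \<Rightarrow> 'f::real_normed_vector) \<Rightarrow> 'e set \<Rightarrow> bool"
  where "smooth_on f S \<longleftrightarrow> (\<forall>k. Ck_on k f S)"

type_synonym ('a, 'n) atlas = "('a set \<times> ('a \<Rightarrow> real ^ 'n)) set"

text \<open>The atlas is not required to be maximal; nothing below depends on that.\<close>

definition smooth_atlas :: "('a::topological_space, 'n::finite) atlas \<Rightarrow> bool"
  where "smooth_atlas A \<longleftrightarrow>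
     \<Union> (fst ` A) = UNIV \<and>
     (\<forall>(U, \<phi>)\<in>A. open U \<and> open (\<phi> ` U) \<and> homeomorphism U (\<phi> ` U) \<phi> (inv_into U \<phi>)) \<and>
     (\<forall>(U, \<phi>)\<in>A. \<forall>(V, \<psi>)\<in>A. smooth_on (\<psi> \<circ> inv_into U \<phi>) (\<phi> ` (U \<inter> V)))"

definition smooth_funs :: "('a, 'n::finite) atlas \<Rightarrow> ('a \<Rightarrow> real) set"
  where "smooth_funs A = {f. \<forall>(U, \<phi>)\<in>A. smooth_on (f \<circ> inv_into U \<phi>) (\<phi> ` U)}"

text \<open>Smoothness of a one-parameter family of functions jointly in the parameter
  \<open>t \<in> (-\<epsilon>, \<epsilon>)\<close> and the point.\<close>

definition smooth_family :: "('a, 'n::finite) atlas \<Rightarrow> real \<Rightarrow> (real \<Rightarrow> 'a \<Rightarrow> real) \<Rightarrow> bool"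
  where "smooth_family A \<epsilon> F \<longleftrightarrow>
     (\<forall>(U, \<phi>)\<in>A. smooth_on (\<lambda>(t, x). F t (inv_into U \<phi> x)) ({-\<epsilon><..<\<epsilon>} \<times> \<phi> ` U))"

type_synonym 'a tvec = "('a \<Rightarrow> real) \<Rightarrow> real"
type_synonym 'a vfield = "'a \<Rightarrow> 'a tvec"
type_synonym 'a distribution = "'a \<Rightarrow> 'a tvec set"
type_synonym 'a rmetric = "'a \<Rightarrow> 'a tvec \<Rightarrow> 'a tvec \<Rightarrow> real"
type_synonym 'a tensor12 = "'a \<Rightarrow> 'a tvec \<Rightarrow> 'a tvec \<Rightarrow> 'a tvec"
type_synonym 'a connection = "'a vfield \<Rightarrow> 'a vfield \<Rightarrow> 'a vfield"

text \<open>The first condition makes a tangent vector determined by its values on smooth functions.\<close>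

definition tangent :: "('a, 'n::finite) atlas \<Rightarrow> 'a \<Rightarrow> 'a tvec set"
  where "tangent A p = {v.
     (\<forall>f. f \<notin> smooth_funs A \<longrightarrow> v f = 0) \<and>
     (\<forall>f\<in>smooth_funs A. \<forall>h\<in>smooth_funs A. \<forall>a b.
        v (\<lambda>x. a * f x + b * h x) = a * v f + b * v h) \<and>
     (\<forall>f\<in>smooth_funs A. \<forall>h\<in>smooth_funs A.
        v (\<lambda>x. f x * h x) = f p * v h + h p * v f)}"

definition smooth_vfields :: "('a, 'n::finite) atlas \<Rightarrow> 'a vfield set"
  where "smooth_vfields A = {X. (\<forall>p. X p \<in> tangent A p) \<and>
     (\<forall>f\<in>smooth_funs A. (\<lambda>p. X p f) \<in> smooth_funs A)}"

definition lie_bracket :: "'a vfield \<Rightarrow> 'a vfield \<Rightarrow> 'a vfield"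
  where "lie_bracket X Y = (\<lambda>p f. X p (\<lambda>q. Y q f) - Y p (\<lambda>q. X q f))"

definition extend_vec :: "('a, 'n::finite) atlas \<Rightarrow> 'a \<Rightarrow> 'a tvec \<Rightarrow> 'a vfield"
  where "extend_vec A p v = (SOME X. X \<in> smooth_vfields A \<and> X p = v)"

definition coord_vec :: "('a, 'n::finite) atlas \<Rightarrow> 'a set \<Rightarrow> ('a \<Rightarrow> real ^ 'n) \<Rightarrow> 'n \<Rightarrow> 'a vfield"
  where "coord_vec A U \<phi> i p = (\<lambda>f. if f \<in> smooth_funs A
     then frechet_derivative (f \<circ> inv_into U \<phi>) (at (\<phi> p)) (axis i 1) else 0)"


section \<open>Riemannian metrics\<close>

definition riemannian_metric :: "('a, 'n::finite) atlas \<Rightarrow> 'a rmetric \<Rightarrow> bool"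
  where "riemannian_metric A g \<longleftrightarrow>
     (\<forall>p. \<forall>u\<in>tangent A p. \<forall>v\<in>tangent A p. \<forall>w\<in>tangent A p. \<forall>a b.
        g p u v = g p v u \<and>
        g p (a *\<^sub>R u + b *\<^sub>R v) w = a * g p u w + b * g p v w \<and>
        (u \<noteq> 0 \<longrightarrow> 0 < g p u u)) \<and>
     (\<forall>X\<in>smooth_vfields A. \<forall>Y\<in>smooth_vfields A. (\<lambda>p. g p (X p) (Y p)) \<in> smooth_funs A)"

definition volume_form_measure :: "('a::topological_space, 'n::finite) atlas \<Rightarrow> 'a rmetric \<Rightarrow> 'a measure"
  where "volume_form_measure A g = (THE \<mu>. sets \<mu> = sets borel \<and>
     (\<forall>(U, \<phi>)\<in>A. \<forall>B\<in>sets borel. B \<subseteq> U \<longrightarrow>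
        emeasure \<mu> B = (\<integral>\<^sup>+ x. ennreal (sqrt (det (\<chi> i j.
            g (inv_into U \<phi> x) (coord_vec A U \<phi> i (inv_into U \<phi> x))
              (coord_vec A U \<phi> j (inv_into U \<phi> x))))) * indicator (\<phi> ` B) x \<partial>lborel)))"

definition orthonormal_basis :: "'a rmetric \<Rightarrow> 'a \<Rightarrow> 'a tvec set \<Rightarrow> 'a tvec set \<Rightarrow> bool"
  where "orthonormal_basis g p V B \<longleftrightarrow> finite B \<and> span B = V \<and>
     (\<forall>u\<in>B. \<forall>v\<in>B. g p u v = (if u = v then 1 else 0))"

text \<open>Traces do not depend on the choice of the orthonormal basis.\<close>

definition onb :: "'a rmetric \<Rightarrow> 'a \<Rightarrow> 'a tvec set \<Rightarrow> 'a tvec set"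
  where "onb g p V = (SOME B. orthonormal_basis g p V B)"

definition ortho_compl :: "('a, 'n::finite) atlas \<Rightarrow> 'a rmetric \<Rightarrow> 'a distribution \<Rightarrow> 'a distribution"
  where "ortho_compl A g D p = {v\<in>tangent A p. \<forall>w\<in>D p. g p v w = 0}"

definition ortho_proj :: "'a rmetric \<Rightarrow> 'a distribution \<Rightarrow> 'a \<Rightarrow> 'a tvec \<Rightarrow> 'a tvec"
  where "ortho_proj g D p v = (THE u. u \<in> D p \<and> (\<forall>w\<in>D p. g p (v - u) w = 0))"

definition smooth_curves :: "('a::topological_space, 'n::finite) atlas \<Rightarrow> (real \<Rightarrow> 'a) set"
  where "smooth_curves A =
     {c. continuous_on UNIV c \<and> (\<forall>f\<in>smooth_funs A. smooth_on (f \<circ> c) UNIV)}"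

definition velocity :: "('a, 'n::finite) atlas \<Rightarrow> (real \<Rightarrow> 'a) \<Rightarrow> real \<Rightarrow> 'a tvec"
  where "velocity A c t = (\<lambda>f. if f \<in> smooth_funs A then deriv (f \<circ> c) t else 0)"

definition curve_length :: "('a, 'n::finite) atlas \<Rightarrow> 'a rmetric \<Rightarrow> (real \<Rightarrow> 'a) \<Rightarrow> real"
  where "curve_length A g c =
     integral {0..1} (\<lambda>t. sqrt (g (c t) (velocity A c t) (velocity A c t)))"

text \<open>Smooth curves need not be regular, so a piecewise smooth curve can be reparametrised to a
  smooth one of the same length (stopping at the corners); hence this is the usual distance.\<close>

definition riemannian_dist :: "('a::topological_space, 'n::finite) atlas \<Rightarrow> 'a rmetric \<Rightarrow> 'a \<Rightarrow> 'a \<Rightarrow> real"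
  where "riemannian_dist A g p q =
     Inf {curve_length A g c | c. c \<in> smooth_curves A \<and> c 0 = p \<and> c 1 = q}"

definition complete_metric :: "('a::topological_space, 'n::finite) atlas \<Rightarrow> 'a rmetric \<Rightarrow> bool"
  where "complete_metric A g \<longleftrightarrow> Metric_space.mcomplete UNIV (riemannian_dist A g)"


section \<open>Connections\<close>

definition affine_connection :: "('a, 'n::finite) atlas \<Rightarrow> 'a connection \<Rightarrow> bool"
  where "affine_connection A nabla \<longleftrightarrow>
     (\<forall>X\<in>smooth_vfields A. \<forall>Y\<in>smooth_vfields A. \<forall>Z\<in>smooth_vfields A. \<forall>f\<in>smooth_funs A.
        nabla X Y \<in> smooth_vfields A \<and>
        nabla (X + Y) Z = nabla X Z + nabla Y Z \<and>
        nabla (\<lambda>p. f p *\<^sub>R X p) Y = (\<lambda>p. f p *\<^sub>R nabla X Y p) \<and>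
        nabla X (Y + Z) = nabla X Y + nabla X Z \<and>
        nabla X (\<lambda>p. f p *\<^sub>R Y p) = (\<lambda>p. X p f *\<^sub>R Y p + f p *\<^sub>R nabla X Y p))"

definition metric_compatible :: "('a, 'n::finite) atlas \<Rightarrow> 'a rmetric \<Rightarrow> 'a connection \<Rightarrow> bool"
  where "metric_compatible A g nabla \<longleftrightarrow>
     (\<forall>X\<in>smooth_vfields A. \<forall>Y\<in>smooth_vfields A. \<forall>Z\<in>smooth_vfields A. \<forall>p.
        X p (\<lambda>q. g q (Y q) (Z q)) = g p (nabla X Y p) (Z p) + g p (Y p) (nabla X Z p))"

definition torsion_free :: "('a, 'n::finite) atlas \<Rightarrow> 'a connection \<Rightarrow> bool"
  where "torsion_free A nabla \<longleftrightarrow>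
     (\<forall>X\<in>smooth_vfields A. \<forall>Y\<in>smooth_vfields A. nabla X Y - nabla Y X = lie_bracket X Y)"

text \<open>Only the values on smooth vector fields are relevant (and determined), whence the choice
  instead of a definite description.\<close>

definition levi_civita :: "('a, 'n::finite) atlas \<Rightarrow> 'a rmetric \<Rightarrow> 'a connection"
  where "levi_civita A g =
     (SOME nabla. affine_connection A nabla \<and> metric_compatible A g nabla \<and> torsion_free A nabla)"

definition divergence :: "('a, 'n::finite) atlas \<Rightarrow> 'a rmetric \<Rightarrow> 'a vfield \<Rightarrow> 'a \<Rightarrow> real"
  where "divergence A g X p =
     (\<Sum>e\<in>onb g p (tangent A p). g p (levi_civita A g (extend_vec A p e) X p) e)"

definition smooth_tensor12 :: "('a, 'n::finite) atlas \<Rightarrow> 'a tensor12 \<Rightarrow> bool"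
  where "smooth_tensor12 A T \<longleftrightarrow>
     (\<forall>p. \<forall>u\<in>tangent A p. \<forall>v\<in>tangent A p. \<forall>w\<in>tangent A p. \<forall>a b.
        T p (a *\<^sub>R u + b *\<^sub>R v) w = a *\<^sub>R T p u w + b *\<^sub>R T p v w \<and>
        T p w (a *\<^sub>R u + b *\<^sub>R v) = a *\<^sub>R T p w u + b *\<^sub>R T p w v) \<and>
     (\<forall>X\<in>smooth_vfields A. \<forall>Y\<in>smooth_vfields A. (\<lambda>p. T p (X p) (Y p)) \<in> smooth_vfields A)"

definition contorted_connection :: "('a, 'n::finite) atlas \<Rightarrow> 'a rmetric \<Rightarrow> 'a tensor12 \<Rightarrow> 'a connection"
  where "contorted_connection A g T X Y = (\<lambda>p. levi_civita A g X Y p + T p (X p) (Y p))"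

text \<open>Curvature with the sign convention \<open>R X Y = [\<nabla> Y, \<nabla> X] + \<nabla> [X, Y]\<close>,
  evaluated on tangent vectors through arbitrary smooth extensions.\<close>

definition curvature :: "('a, 'n::finite) atlas \<Rightarrow> 'a connection \<Rightarrow> 'a \<Rightarrow> 'a tvec \<Rightarrow> 'a tvec \<Rightarrow> 'a tvec \<Rightarrow> 'a tvec"
  where "curvature A nabla p u v w =
     (let X = extend_vec A p u; Y = extend_vec A p v; Z = extend_vec A p w
      in nabla Y (nabla X Z) p - nabla X (nabla Y Z) p + nabla (lie_bracket X Y) Z p)"


section \<open>Mixed scalar curvature and its action\<close>

text \<open>The distributions are \<open>D 1, \<dots>, D 4\<close>.\<close>

definition mixed_scalar_curvature ::
  "('a, 'n::finite) atlas \<Rightarrow> (nat \<Rightarrow> 'a distribution) \<Rightarrow> 'a rmetric \<Rightarrow> 'a tensor12 \<Rightarrow> 'a \<Rightarrow> real"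
  where "mixed_scalar_curvature A D g T p =
     (let R = curvature A (contorted_connection A g T) p in
      (1/2) * (\<Sum>\<mu>\<in>{1..4}. \<Sum>\<nu>\<in>{1..<\<mu>}. \<Sum>e\<in>onb g p (D \<nu> p). \<Sum>e'\<in>onb g p (D \<mu> p).
         g p (R e e' e) e' + g p (R e' e e') e))"

definition action ::
  "('a::topological_space, 'n::finite) atlas \<Rightarrow> (nat \<Rightarrow> 'a distribution) \<Rightarrow> 'a set \<Rightarrow> 'a rmetric \<Rightarrow> 'a tensor12 \<Rightarrow> real"
  where "action A D \<Omega> g T =
     set_lebesgue_integral (volume_form_measure A g) \<Omega> (mixed_scalar_curvature A D g T)"

definition rel_compact_domain :: "'a::topological_space set \<Rightarrow> bool"
  where "rel_compact_domain \<Omega> \<longleftrightarrow> open \<Omega> \<and> connected \<Omega> \<and> compact (closure \<Omega>)"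

text \<open>If the manifold is compact, it is itself one of the domains \<open>\<Omega>\<close>.\<close>

definition adapted_variation ::
  "('a::topological_space, 'n::finite) atlas \<Rightarrow> (nat \<Rightarrow> 'a distribution) \<Rightarrow> 'a set \<Rightarrow> 'a rmetric \<Rightarrow>
   real \<Rightarrow> (real \<Rightarrow> 'a rmetric) \<Rightarrow> bool"
  where "adapted_variation A D \<Omega> g \<epsilon> \<gamma> \<longleftrightarrow>
     0 < \<epsilon> \<and> \<gamma> 0 = g \<and>
     (\<forall>t\<in>{-\<epsilon><..<\<epsilon>}. riemannian_metric A (\<gamma> t)) \<and>
     (\<forall>X\<in>smooth_vfields A. \<forall>Y\<in>smooth_vfields A. smooth_family A \<epsilon> (\<lambda>t p. \<gamma> t p (X p) (Y p))) \<and>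
     (\<forall>t\<in>{-\<epsilon><..<\<epsilon>}. \<forall>\<mu>\<in>{1..4}. \<forall>\<nu>\<in>{1..4}. \<mu> \<noteq> \<nu> \<longrightarrow>
        (\<forall>p. \<forall>u\<in>D \<mu> p. \<forall>v\<in>D \<nu> p. \<gamma> t p u v = 0)) \<and>
     (\<forall>t\<in>{-\<epsilon><..<\<epsilon>}.
        closure {p. \<exists>u\<in>tangent A p. \<exists>v\<in>tangent A p. deriv (\<lambda>s. \<gamma> s p u v) t \<noteq> 0} \<subseteq> \<Omega>)"

definition volume_preserving ::
  "('a::topological_space, 'n::finite) atlas \<Rightarrow> 'a set \<Rightarrow> real \<Rightarrow> (real \<Rightarrow> 'a rmetric) \<Rightarrow> bool"
  where "volume_preserving A \<Omega> \<epsilon> \<gamma> \<longleftrightarrow> (\<forall>t\<in>{-\<epsilon><..<\<epsilon>}.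
     emeasure (volume_form_measure A (\<gamma> t)) \<Omega> = emeasure (volume_form_measure A (\<gamma> 0)) \<Omega>)"

definition tensor_variation ::
  "('a::topological_space, 'n::finite) atlas \<Rightarrow> 'a set \<Rightarrow> 'a tensor12 \<Rightarrow> real \<Rightarrow> (real \<Rightarrow> 'a tensor12) \<Rightarrow> bool"
  where "tensor_variation A \<Omega> T \<epsilon> \<tau> \<longleftrightarrow>
     0 < \<epsilon> \<and> \<tau> 0 = T \<and>
     (\<forall>t\<in>{-\<epsilon><..<\<epsilon>}. smooth_tensor12 A (\<tau> t)) \<and>
     (\<forall>X\<in>smooth_vfields A. \<forall>Y\<in>smooth_vfields A. \<forall>f\<in>smooth_funs A.
        smooth_family A \<epsilon> (\<lambda>t p. \<tau> t p (X p) (Y p) f)) \<and>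
     (\<forall>t\<in>{-\<epsilon><..<\<epsilon>}.
        closure {p. \<exists>u\<in>tangent A p. \<exists>v\<in>tangent A p. \<exists>f\<in>smooth_funs A.
          deriv (\<lambda>s. \<tau> s p u v f) t \<noteq> 0} \<subseteq> \<Omega>)"

definition critical_metric ::
  "('a::topological_space, 'n::finite) atlas \<Rightarrow> (nat \<Rightarrow> 'a distribution) \<Rightarrow> 'a rmetric \<Rightarrow> 'a tensor12 \<Rightarrow> bool"
  where "critical_metric A D g T \<longleftrightarrow>
     (\<forall>\<Omega> \<epsilon> \<gamma>. rel_compact_domain \<Omega> \<and> adapted_variation A D \<Omega> g \<epsilon> \<gamma> \<longrightarrow>
        ((\<lambda>t. action A D \<Omega> (\<gamma> t) T) has_real_derivative 0) (at 0))"

definition critical_metric_fixed_volume ::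
  "('a::topological_space, 'n::finite) atlas \<Rightarrow> (nat \<Rightarrow> 'a distribution) \<Rightarrow> 'a rmetric \<Rightarrow> 'a tensor12 \<Rightarrow> bool"
  where "critical_metric_fixed_volume A D g T \<longleftrightarrow>
     (\<forall>\<Omega> \<epsilon> \<gamma>. rel_compact_domain \<Omega> \<and> adapted_variation A D \<Omega> g \<epsilon> \<gamma> \<and>
        volume_preserving A \<Omega> \<epsilon> \<gamma> \<longrightarrow>
        ((\<lambda>t. action A D \<Omega> (\<gamma> t) T) has_real_derivative 0) (at 0))"

definition critical_contorsion ::
  "('a::topological_space, 'n::finite) atlas \<Rightarrow> (nat \<Rightarrow> 'a distribution) \<Rightarrow> 'a rmetric \<Rightarrow> 'a tensor12 \<Rightarrow> bool"
  where "critical_contorsion A D g T \<longleftrightarrow>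
     (\<forall>\<Omega> \<epsilon> \<tau>. rel_compact_domain \<Omega> \<and> tensor_variation A \<Omega> T \<epsilon> \<tau> \<longrightarrow>
        ((\<lambda>t. action A D \<Omega> g (\<tau> t)) has_real_derivative 0) (at 0))"


section \<open>3-Sasaki structures\<close>

text \<open>A unit Killing field \<open>\<xi>\<close> is the Reeb field of a Sasaki structure if
  \<open>\<Phi> X = - \<nabla> X \<xi>\<close> satisfies
  \<open>\<nabla> X (\<Phi> Y) - \<Phi> (\<nabla> X Y) = g(X, Y) \<xi> - g(\<xi>, Y) X\<close>.\<close>

definition killing_field :: "('a, 'n::finite) atlas \<Rightarrow> 'a rmetric \<Rightarrow> 'a vfield \<Rightarrow> bool"
  where "killing_field A g \<xi> \<longleftrightarrow> \<xi> \<in> smooth_vfields A \<and>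
     (\<forall>X\<in>smooth_vfields A. \<forall>Y\<in>smooth_vfields A. \<forall>p.
        \<xi> p (\<lambda>q. g q (X q) (Y q)) =
          g p (lie_bracket \<xi> X p) (Y p) + g p (X p) (lie_bracket \<xi> Y p))"

definition sasakian_field :: "('a, 'n::finite) atlas \<Rightarrow> 'a rmetric \<Rightarrow> 'a vfield \<Rightarrow> bool"
  where "sasakian_field A g \<xi> \<longleftrightarrow> killing_field A g \<xi> \<and> (\<forall>p. g p (\<xi> p) (\<xi> p) = 1) \<and>
     (let nabla = levi_civita A g; \<Phi> = (\<lambda>X. - nabla X \<xi>) in
      \<forall>X\<in>smooth_vfields A. \<forall>Y\<in>smooth_vfields A. \<forall>p.
        nabla X (\<Phi> Y) p - \<Phi> (nabla X Y) p = g p (X p) (Y p) *\<^sub>R \<xi> p - g p (\<xi> p) (Y p) *\<^sub>R X p)"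

text \<open>The Reeb fields are \<open>\<xi> 1, \<xi> 2, \<xi> 3\<close>.\<close>

definition three_sasaki :: "('a, 'n::finite) atlas \<Rightarrow> 'a rmetric \<Rightarrow> (nat \<Rightarrow> 'a vfield) \<Rightarrow> bool"
  where "three_sasaki A g \<xi> \<longleftrightarrow> riemannian_metric A g \<and>
     (\<forall>a\<in>{1..3}. sasakian_field A g (\<xi> a)) \<and>
     (\<forall>a\<in>{1..3}. \<forall>b\<in>{1..3}. \<forall>p. g p (\<xi> a p) (\<xi> b p) = (if a = b then 1 else 0)) \<and>
     lie_bracket (\<xi> 1) (\<xi> 2) = 2 *\<^sub>R \<xi> 3 \<and>
     lie_bracket (\<xi> 2) (\<xi> 3) = 2 *\<^sub>R \<xi> 1 \<and>
     lie_bracket (\<xi> 3) (\<xi> 1) = 2 *\<^sub>R \<xi> 2"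

definition sasaki_distr ::
  "('a, 'n::finite) atlas \<Rightarrow> 'a rmetric \<Rightarrow> (nat \<Rightarrow> 'a vfield) \<Rightarrow> nat \<Rightarrow> 'a distribution"
  where "sasaki_distr A g \<xi> \<mu> =
     (if \<mu> = 4 then ortho_compl A g (\<lambda>p. span {\<xi> 1 p, \<xi> 2 p, \<xi> 3 p})
      else (\<lambda>p. span {\<xi> \<mu> p}))"

definition no_mixed_contorsion ::
  "'a rmetric \<Rightarrow> (nat \<Rightarrow> 'a distribution) \<Rightarrow> 'a tensor12 \<Rightarrow> bool"
  where "no_mixed_contorsion g D T \<longleftrightarrow>
     (\<forall>\<mu>\<in>{1..4}. \<forall>\<rho>\<in>{1..4}. \<forall>\<kappa>\<in>{1..4}. \<mu> \<noteq> \<rho> \<and> \<rho> \<noteq> \<kappa> \<and> \<mu> \<noteq> \<kappa> \<longrightarrow>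
        (\<forall>p. \<forall>x\<in>D \<mu> p. \<forall>y\<in>D \<rho> p. \<forall>z\<in>D \<kappa> p. g p (T p x y) z = 0))"

text \<open>A metric-compatible connection is given by its contorsion tensor.\<close>

definition metric_contorsion :: "('a, 'n::finite) atlas \<Rightarrow> 'a rmetric \<Rightarrow> 'a tensor12 \<Rightarrow> bool"
  where "metric_contorsion A g T \<longleftrightarrow>
     smooth_tensor12 A T \<and> metric_compatible A g (contorted_connection A g T)"

definition trace_on :: "'a rmetric \<Rightarrow> 'a distribution \<Rightarrow> 'a tensor12 \<Rightarrow> 'a vfield"
  where "trace_on g D T p = (\<Sum>e\<in>onb g p (D p). T p e e)"

text \<open>The vector fields \<open>P\<^sub>D Tr\<^sub>D\<^sup>\<bottom> T\<close> and
  \<open>P\<^sub>D\<^sup>\<bottom> Tr\<^sub>D\<^sup>\<top> T\<close>, where \<open>Tr\<^sub>D\<^sup>\<top>\<close> and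
  \<open>Tr\<^sub>D\<^sup>\<bottom>\<close> are the traces over \<open>D\<close> and its orthogonal complement.\<close>

definition proj_perp_trace ::
  "('a, 'n::finite) atlas \<Rightarrow> 'a rmetric \<Rightarrow> 'a distribution \<Rightarrow> 'a tensor12 \<Rightarrow> 'a vfield"
  where "proj_perp_trace A g D T =
     (\<lambda>p. ortho_proj g D p (trace_on g (ortho_compl A g D) T p))"

definition perp_proj_trace ::
  "('a, 'n::finite) atlas \<Rightarrow> 'a rmetric \<Rightarrow> 'a distribution \<Rightarrow> 'a tensor12 \<Rightarrow> 'a vfield"
  where "perp_proj_trace A g D T =
     (\<lambda>p. ortho_proj g (ortho_compl A g D) p (trace_on g D T p))"

end

theory Submission
  imports Defs
begin

text \<open>
  The assumptions on \<open>(g, T)\<close> contradict each other, so that both claims hold vacuously. On a small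
  coordinate domain choose an adapted orthonormal frame containing the Reeb fields. Varying \<open>T\<close> by
  tensors \<open>s E\<^sub>k\<^sup>* \<otimes> (E\<^sub>l \<and> E\<^sub>m)\<close>, and using that the Reeb fields are
  Killing and hence divergence free, one finds that the metric connection \<open>nb\<close> with contorsion \<open>T\<close>
  satisfies \<open>nb \<xi>\<^sub>a \<xi>\<^sub>a = 0\<close> and \<open>nb \<xi>\<^sub>a E\<^sub>k = [\<xi>\<^sub>a, E\<^sub>k]\<close>
  for horizontal \<open>E\<^sub>k\<close>. Therefore the sectional curvature of \<open>\<xi>\<^sub>a, \<xi>\<^sub>b\<close>
  is \<open>1\<close>, and the sectional curvatures of \<open>\<xi>\<^sub>a, E\<^sub>k\<close> add up to \<open>0\<close> over the
  horizontal \<open>k\<close>.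

  Now scale \<open>g\<close> by \<open>exp (- N t \<sigma>)\<close> along \<open>\<xi>\<^sub>1\<close> and by \<open>exp (t \<sigma>)\<close> on the
  complement of dimension \<open>N\<close>; this preserves the volume form. The connection of the deformed metric
  with contorsion \<open>T\<close> is the connection of \<open>g\<close> with a contorsion \<open>T + K\<^sub>t\<close>, and since the pair is
  critical with respect to \<open>T\<close>, the change of the connection does not contribute to the first variation.
  What remains is \<open>\<integral> \<sigma> (N Q\<^sub>1 - Q\<^sub>2)\<close>, where \<open>Q\<^sub>1 = 2\<close> and
  \<open>Q\<^sub>2 = 4\<close> are the sums of the mixed sectional curvatures \<open>sec (E\<^sub>i, E\<^sub>j)\<close> with
  \<open>E\<^sub>i = \<xi>\<^sub>1\<close> and with \<open>E\<^sub>i \<noteq> \<xi>\<^sub>1\<close>. Hence \<open>2 N = 4\<close>,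
  which is impossible.
\<close>

section \<open>Calculus of smooth functions\<close>

text \<open>The obstacle is the Levi-Civita connection: a metric variation changes it, and the
  curvature of the new connection involves second derivatives of \<open>\<sigma>\<close>. Two
  actions are therefore compared, that of the deformed metric with \<open>T\<close> and that of
  \<open>g\<close> with \<open>T + K\<^sub>t\<close>. They belong to the same connection and the
  same volume form, both are stationary at 0, and they differ only by the metric that contracts the
  curvature. The comparison needs variations of \<open>T\<close> that are not metric compatible with
  \<open>g\<close>, since \<open>K\<^sub>t\<close> is symmetric. After normalising the frame for the
  deformed metric, the term of the pair \<open>(i, j)\<close> carries the factor
  \<open>1 / w i\<close> alone, with \<open>w i\<close> the scale of direction \<open>i\<close>:
  normalisation gives \<open>1 / (w i * w j)\<close> and contraction gives \<open>w j\<close>. This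
  is why the curvatures are grouped by their first index. Since criticality includes the existence
  of the derivatives, the difference quotient is followed only along \<open>t = 1 / (n + 1)\<close>.
  The value 2 counts the planes of \<open>\<xi>\<^sub>1\<close> with the other two Reeb fields, and
  4 comes from the two planes of each of these; the horizontal sums vanish.\<close>

lemma Ck_on_cong:
  fixes f g :: "'e::euclidean_space \<Rightarrow> 'f::real_normed_vector"
  assumes "open S" "\<And>x. x \<in> S \<Longrightarrow> f x = g x"
  shows "Ck_on k f S \<longleftrightarrow> Ck_on k g S"
  using assms(2)
proof (induction k arbitrary: f g)
  case 0
  then show ?case by (simp cong: continuous_on_cong)
next
  case (Suc k)
  have aux: "Ck_on (Suc k) g S" if e: "\<And>x. x \<in> S \<Longrightarrow> f x = g x" and c: "Ck_on (Suc k) f S" for f g :: "'e \<Rightarrow> 'f"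
  proof -
    have d: "f differentiable at x" if "x \<in> S" for x using c that by simp
    have d': "g differentiable at x" if "x \<in> S" for x
      using d[OF that] e that assms(1)
      by (meson differentiable_def has_derivative_transform_within_open)
    have "frechet_derivative f (at x) = frechet_derivative g (at x)" if "x \<in> S" for x
      using frechet_derivative_transform_within_open[OF d[OF that] assms(1) that e] .
    then have "Ck_on k (\<lambda>x. frechet_derivative g (at x) v) S" for v
      using c Suc.IH[of "\<lambda>x. frechet_derivative f (at x) v" "\<lambda>x. frechet_derivative g (at x) v"] by simp
    then show ?thesis using d' by simp
  qed
  show ?case using aux[of f g] aux[of g f] Suc.prems by metis
qed

text \<open>Derivatives are unique, so the chosen \<open>frechet_derivative\<close> may be replaced
  by any explicit \<open>f'\<close>; openness of \<open>S\<close> makes the replacement valid at all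
  orders.\<close>

lemma Ck_on_SucI:
  assumes "open S" "\<And>x. x \<in> S \<Longrightarrow> (f has_derivative f' x) (at x)" "\<And>v. Ck_on k (\<lambda>x. f' x v) S"
  shows "Ck_on (Suc k) f S"
proof -
  have "Ck_on k (\<lambda>x. frechet_derivative f (at x) v) S" for v
    using assms(3)[of v] Ck_on_cong[OF assms(1), of "\<lambda>x. frechet_derivative f (at x) v" "\<lambda>x. f' x v" k]
      frechet_derivative_at[OF assms(2)] by simp
  then show ?thesis using assms(2) by (auto simp: differentiable_def)
qed

lemma Ck_on_has_derivative:
  assumes "Ck_on (Suc k) f S" "x \<in> S"
  shows "(f has_derivative frechet_derivative f (at x)) (at x)"
  using assms frechet_derivative_works by auto

text \<open>\<open>Ck_on (Suc k)\<close> speaks of continuity only for the highest derivatives, so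
  lowering the order requires an induction over all directional derivatives at once.\<close>

lemma Ck_on_SucD:
  assumes "Ck_on (Suc k) f S" shows "Ck_on k f S"
  using assms
proof (induction k arbitrary: f)
  case 0
  then show ?case
    by (auto intro!: continuous_at_imp_continuous_on differentiable_imp_continuous_within)
next
  case (Suc k)
  then show ?case by (metis Ck_on.simps(2))
qed

lemma Ck_on_subset: "Ck_on k f S \<Longrightarrow> T \<subseteq> S \<Longrightarrow> Ck_on k f T"
  by (induction k arbitrary: f) (auto intro: continuous_on_subset)

lemma Ck_on_local:
  assumes "\<And>x. x \<in> S \<Longrightarrow> \<exists>T. open T \<and> x \<in> T \<and> Ck_on k f T"
  shows "Ck_on k f S"
  using assms
proof (induction k arbitrary: f)
  case 0
  then show ?case
    by (simp) (metis continuous_at_imp_continuous_on continuous_on_eq_continuous_at)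
next
  case (Suc k)
  have "f differentiable at x" if "x \<in> S" for x using Suc.prems[OF that] by auto
  moreover have "Ck_on k (\<lambda>x. frechet_derivative f (at x) v) S" for v
    by (rule Suc.IH) (use Suc.prems in force)
  ultimately show ?case by simp
qed

lemma Ck_on_const: "open S \<Longrightarrow> Ck_on k (\<lambda>x. c) S"
  by (induction k arbitrary: c) (auto intro!: Ck_on_SucI[where f'="\<lambda>x v. 0"] simp del: Ck_on.simps(2))

lemma Ck_on_linear:
  assumes "bounded_linear L" "open S" shows "Ck_on k L S"
proof (cases k)
  case 0
  then show ?thesis using assms by (simp add: linear_continuous_on)
next
  case (Suc j)
  show ?thesis unfolding Suc
    by (rule Ck_on_SucI[where f'="\<lambda>x. L"])
      (auto intro!: assms bounded_linear_imp_has_derivative Ck_on_const)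
qed

lemma Ck_on_add:
  assumes "open S" "Ck_on k f S" "Ck_on k g S" shows "Ck_on k (\<lambda>x. f x + g x) S"
  using assms(2,3)
proof (induction k arbitrary: f g)
  case 0
  then show ?case by (auto intro: continuous_on_add)
next
  case (Suc k)
  show ?case
    by (rule Ck_on_SucI[OF assms(1), where f'="\<lambda>x v. frechet_derivative f (at x) v + frechet_derivative g (at x) v"])
      (use Suc in \<open>auto intro!: has_derivative_add simp: frechet_derivative_works[symmetric]\<close>)
qed

text \<open>The Leibniz rule gives two terms of the same shape with one factor differentiated, so
  the induction must leave both factors arbitrary. Products, scalar multiples and inner products are
  all instances.\<close>

lemma Ck_on_bilinear:
  assumes "bounded_bilinear pr" "open S" "Ck_on k f S" "Ck_on k g S"
  shows "Ck_on k (\<lambda>x. pr (f x) (g x)) S"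
  using assms(3,4)
proof (induction k arbitrary: f g)
  case 0
  then show ?case by (auto intro: bounded_bilinear.continuous_on[OF assms(1)])
next
  case (Suc k)
  show ?case
  proof (rule Ck_on_SucI[OF assms(2), where f'="\<lambda>x v. pr (f x) (frechet_derivative g (at x) v)
      + pr (frechet_derivative f (at x) v) (g x)"])
    show "((\<lambda>x. pr (f x) (g x)) has_derivative (\<lambda>v. pr (f x) (frechet_derivative g (at x) v)
      + pr (frechet_derivative f (at x) v) (g x))) (at x)" if "x \<in> S" for x
      using Suc.prems that by (auto intro!: bounded_bilinear.FDERIV[OF assms(1)] simp: frechet_derivative_works[symmetric])
    show "Ck_on k (\<lambda>x. pr (f x) (frechet_derivative g (at x) v)
      + pr (frechet_derivative f (at x) v) (g x)) S" for v
      using Suc.prems Ck_on_SucD[OF Suc.prems(1)] Ck_on_SucD[OF Suc.prems(2)]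
      by (intro Ck_on_add Suc.IH assms) auto
  qed
qed

lemma Ck_on_sum:
  assumes "open S" "\<And>i. i \<in> I \<Longrightarrow> Ck_on k (f i) S"
  shows "Ck_on k (\<lambda>x. \<Sum>i\<in>I. f i x) S"
  using assms(2)
  by (induction I rule: infinite_finite_induct) (auto intro!: Ck_on_add Ck_on_const assms(1))

text \<open>Induction on the order by the chain rule. \<open>Ck_on\<close> differentiates in fixed
  directions only, whereas the chain rule evaluates the derivative of \<open>g\<close> in a
  direction that moves with the point.\<close>

lemma Ck_on_compose:
  fixes f :: "'e::euclidean_space \<Rightarrow> 'f::euclidean_space"
  assumes "open S" "open T" "Ck_on k f S" "Ck_on k g T" "f ` S \<subseteq> T"
  shows "Ck_on k (\<lambda>x. g (f x)) S"
  using assms(3,4)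
proof (induction k arbitrary: g)
  case 0
  then show ?case using continuous_on_compose2[OF _ _ assms(5)] by auto
next
  case (Suc k)
  let ?f' = "\<lambda>x. frechet_derivative f (at x)" and ?g' = "\<lambda>x. frechet_derivative g (at x)"
  \<comment> \<open>Expanding the moving direction in the standard basis turns the derivative into a
    sum of products of scalar coefficients and derivatives of \<open>g\<close> in fixed
    directions.\<close>
  have eq: "?g' (f x) (?f' x v) = (\<Sum>b\<in>Basis. (?f' x v \<bullet> b) *\<^sub>R ?g' (f x) b)" if "x \<in> S" for x v
  proof -
    have "linear (?g' (f x))"
      using Suc.prems(2) that assms(5) by (auto intro!: linear_frechet_derivative)
    then show ?thesis
      by (subst euclidean_representation[symmetric, of "?f' x v"]) (simp add: linear_sum linear_scale)
  qed
  have "Ck_on k (\<lambda>x. \<Sum>b\<in>Basis. (?f' x v \<bullet> b) *\<^sub>R ?g' (f x) b) S" for v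
  proof (intro Ck_on_sum assms Ck_on_bilinear[OF bounded_bilinear_scaleR])
    fix b :: 'f
    show "Ck_on k (\<lambda>x. ?f' x v \<bullet> b) S"
      using Suc.prems by (intro Ck_on_bilinear[OF bounded_bilinear_inner] assms Ck_on_const) auto
    show "Ck_on k (\<lambda>x. ?g' (f x) b) S"
      using Suc.prems Ck_on_SucD[OF Suc.prems(1)] by (intro Suc.IH[of "\<lambda>y. ?g' y b"]) auto
  qed
  then have C: "Ck_on k (\<lambda>x. ?g' (f x) (?f' x v)) S" for v
    using Ck_on_cong[OF assms(1), of "\<lambda>x. ?g' (f x) (?f' x v)"
        "\<lambda>x. \<Sum>b\<in>Basis. (?f' x v \<bullet> b) *\<^sub>R ?g' (f x) b" k] eq by blast
  show ?case
  proof (rule Ck_on_SucI[OF assms(1), where f'="\<lambda>x v. ?g' (f x) (?f' x v)"])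
    fix x assume "x \<in> S"
    then show "((\<lambda>x. g (f x)) has_derivative (\<lambda>v. ?g' (f x) (?f' x v))) (at x)"
      using Suc.prems assms(5)
      by (auto intro!: has_derivative_compose[of f _ x UNIV g] simp: frechet_derivative_works[symmetric])
  qed (rule C)
qed

lemma smooth_on_cong: "open S \<Longrightarrow> (\<And>x. x \<in> S \<Longrightarrow> f x = g x) \<Longrightarrow> smooth_on f S \<longleftrightarrow> smooth_on g S"
  unfolding smooth_on_def using Ck_on_cong by blast

lemma smooth_on_eq: "smooth_on g S \<Longrightarrow> open S \<Longrightarrow> (\<And>x. x \<in> S \<Longrightarrow> f x = g x) \<Longrightarrow> smooth_on f S"
  using smooth_on_cong[of S f g] by simp

lemma smooth_on_subset: "smooth_on f S \<Longrightarrow> T \<subseteq> S \<Longrightarrow> smooth_on f T"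
  unfolding smooth_on_def using Ck_on_subset by blast

lemma smooth_on_local:
  "(\<And>x. x \<in> S \<Longrightarrow> \<exists>T. open T \<and> x \<in> T \<and> smooth_on f T) \<Longrightarrow> smooth_on f S"
  unfolding smooth_on_def using Ck_on_local by meson

lemma smooth_on_imp_continuous_on: "smooth_on f S \<Longrightarrow> continuous_on S f"
  unfolding smooth_on_def by (metis Ck_on.simps(1))

lemma smooth_on_has_derivative:
  "smooth_on f S \<Longrightarrow> x \<in> S \<Longrightarrow> (f has_derivative frechet_derivative f (at x)) (at x)"
  unfolding smooth_on_def using Ck_on_has_derivative by blast

lemma smooth_on_derivative: "smooth_on f S \<Longrightarrow> smooth_on (\<lambda>x. frechet_derivative f (at x) v) S"
  unfolding smooth_on_def by (metis Ck_on.simps(2))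

lemma smooth_on_const: "open S \<Longrightarrow> smooth_on (\<lambda>x. c) S"
  unfolding smooth_on_def using Ck_on_const by blast

lemma smooth_on_linear: "bounded_linear L \<Longrightarrow> open S \<Longrightarrow> smooth_on L S"
  unfolding smooth_on_def using Ck_on_linear by blast

lemma smooth_on_id: "open S \<Longrightarrow> smooth_on (\<lambda>x. x) S"
  by (rule smooth_on_linear[OF bounded_linear_ident])

lemma smooth_on_add: "open S \<Longrightarrow> smooth_on f S \<Longrightarrow> smooth_on g S \<Longrightarrow> smooth_on (\<lambda>x. f x + g x) S"
  unfolding smooth_on_def using Ck_on_add by blast

lemma smooth_on_bilinear:
  "bounded_bilinear pr \<Longrightarrow> open S \<Longrightarrow> smooth_on f S \<Longrightarrow> smooth_on g S \<Longrightarrow> smooth_on (\<lambda>x. pr (f x) (g x)) S"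
  unfolding smooth_on_def using Ck_on_bilinear by blast

lemmas smooth_on_scaleR = smooth_on_bilinear[OF bounded_bilinear_scaleR]

lemma smooth_on_mult:
  fixes f g :: "'e::euclidean_space \<Rightarrow> real"
  shows "open S \<Longrightarrow> smooth_on f S \<Longrightarrow> smooth_on g S \<Longrightarrow> smooth_on (\<lambda>x. f x * g x) S"
  by (rule smooth_on_bilinear[OF bounded_bilinear_mult])

lemma smooth_on_sum:
  "open S \<Longrightarrow> (\<And>i. i \<in> I \<Longrightarrow> smooth_on (f i) S) \<Longrightarrow> smooth_on (\<lambda>x. \<Sum>i\<in>I. f i x) S"
  by (simp add: smooth_on_def Ck_on_sum)

lemma smooth_on_uminus:
  assumes "open S" "smooth_on f S" shows "smooth_on (\<lambda>x. - f x) S"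
  using smooth_on_scaleR[OF assms(1) smooth_on_const[OF assms(1), of "-1"] assms(2)] by simp

lemma smooth_on_diff:
  "open S \<Longrightarrow> smooth_on f S \<Longrightarrow> smooth_on g S \<Longrightarrow> smooth_on (\<lambda>x. f x - g x) S"
  using smooth_on_add[of S f "\<lambda>x. - g x"] smooth_on_uminus by auto

lemma smooth_on_compose:
  fixes f :: "'e::euclidean_space \<Rightarrow> 'f::euclidean_space"
  shows "open S \<Longrightarrow> open T \<Longrightarrow> smooth_on f S \<Longrightarrow> smooth_on g T \<Longrightarrow> f ` S \<subseteq> T \<Longrightarrow> smooth_on (\<lambda>x. g (f x)) S"
  by (simp add: smooth_on_def Ck_on_compose)

text \<open>Bootstrapping: if the derivative is an expression in \<open>f\<close>, then regularity
  of order \<open>k\<close> for \<open>f\<close> passes to \<open>f'\<close>, which is order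
  \<open>k + 1\<close> for \<open>f\<close>.\<close>

lemma smooth_on_realI:
  fixes f f' :: "real \<Rightarrow> real"
  assumes "open S" "\<And>x. x \<in> S \<Longrightarrow> (f has_real_derivative f' x) (at x)"
    and "\<And>k. Ck_on k f S \<Longrightarrow> Ck_on k f' S"
  shows "smooth_on f S"
proof -
  have "Ck_on k f S" for k
  proof (induction k)
    case 0
    then show ?case using assms(2)
      by (auto intro!: continuous_at_imp_continuous_on DERIV_isCont)
  next
    case (Suc k)
    show ?case
    proof (rule Ck_on_SucI[OF assms(1), where f'="\<lambda>x v. f' x * v"])
      show "(f has_derivative (\<lambda>v. f' x * v)) (at x)" if "x \<in> S" for x
        using assms(2)[OF that] by (simp add: has_field_derivative_def)
      show "Ck_on k (\<lambda>x. f' x * v) S" for v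
        by (intro Ck_on_bilinear[OF bounded_bilinear_mult] assms Ck_on_const Suc)
    qed
  qed
  then show ?thesis by (simp add: smooth_on_def)
qed

section \<open>Elementary smooth functions of one real variable\<close>

lemma smooth_on_exp: "smooth_on (exp :: real \<Rightarrow> real) UNIV"
  by (rule smooth_on_realI[where f'=exp]) (auto intro!: derivative_eq_intros)

lemma smooth_on_inverse: "smooth_on (inverse :: real \<Rightarrow> real) {0<..}"
proof (rule smooth_on_realI[where f'="\<lambda>x. -1 * (inverse x * inverse x)"])
  show "(inverse has_real_derivative -1 * (inverse x * inverse x)) (at x)" if "x \<in> {0<..}" for x :: real
    using that by (auto intro!: derivative_eq_intros)
  show "Ck_on k (\<lambda>x::real. -1 * (inverse x * inverse x)) {0<..}" if "Ck_on k (inverse :: real \<Rightarrow> real) {0<..}" for k :: nat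
    using that by (intro Ck_on_bilinear[OF bounded_bilinear_mult] Ck_on_const) auto
qed auto

lemma smooth_on_inverse_sqrt: "smooth_on (\<lambda>x::real. inverse (sqrt x)) {0<..}"
proof (rule smooth_on_realI[where f'="\<lambda>x. (-1/2) * (inverse (sqrt x) * (inverse (sqrt x) * inverse (sqrt x)))"])
  show "((\<lambda>x. inverse (sqrt x)) has_real_derivative
      (-1/2) * (inverse (sqrt x) * (inverse (sqrt x) * inverse (sqrt x)))) (at x)" if "x \<in> {0<..}" for x :: real
    using that by (auto intro!: derivative_eq_intros simp: field_simps)
  show "Ck_on k (\<lambda>x. (-1/2) * (inverse (sqrt x) * (inverse (sqrt x) * inverse (sqrt x)))) {0<..}"
    if "Ck_on k (\<lambda>x. inverse (sqrt x)) {0<..}" for k :: nat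
    using that by (intro Ck_on_bilinear[OF bounded_bilinear_mult] Ck_on_const) auto
qed auto

text \<open>The derivative of \<open>x\<^sup>-\<^sup>k exp (-1/x)\<close> is a combination of such functions; hence the parameter \<open>k\<close>.\<close>

definition flat_fun :: "nat \<Rightarrow> real \<Rightarrow> real"
  where "flat_fun k x = (if 0 < x then inverse x ^ k * exp (- inverse x) else 0)"

text \<open>On the right, the substitution of the reciprocal turns the claim into the decay of
  \<open>y ^ k * exp (- y)\<close> at infinity; on the left the function is 0.\<close>

lemma flat_fun_tendsto_0: "(flat_fun k \<longlongrightarrow> 0) (at 0)"
proof -
  have "((\<lambda>y::real. y ^ k * exp (- y)) \<longlongrightarrow> 0) at_top"
    using tendsto_power_div_exp_0[of k] by (simp add: exp_minus divide_inverse)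
  then have "((\<lambda>x::real. inverse x ^ k * exp (- inverse x)) \<longlongrightarrow> 0) (at_right 0)"
    using filterlim_compose[OF _ filterlim_inverse_at_top_right, of "\<lambda>y. y ^ k * exp (- y)" "nhds 0"] by simp
  then have r: "(flat_fun k \<longlongrightarrow> 0) (at_right 0)"
    by (rule Lim_transform_eventually) (auto simp: flat_fun_def eventually_at_filter)
  have l: "(flat_fun k \<longlongrightarrow> 0) (at_left 0)"
    by (rule tendsto_eventually) (auto simp: flat_fun_def eventually_at_filter)
  show ?thesis using r l by (simp add: filterlim_split_at)
qed

lemma flat_fun_deriv: "(flat_fun k has_real_derivative flat_fun (k + 2) x - k * flat_fun (k + 1) x) (at x)"
proof -
  consider "x > 0" | "x < 0" | "x = 0" by linarith
  then show ?thesis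
  proof cases
    case 1
    have "((\<lambda>x. inverse x ^ k * exp (- inverse x)) has_real_derivative
        inverse x ^ k * (exp (- inverse x) * (inverse x * inverse x))
        + k * inverse x ^ (k - 1) * (- (inverse x * inverse x)) * exp (- inverse x)) (at x)"
      using 1 by (auto intro!: derivative_eq_intros simp: power2_eq_square)
    \<comment> \<open>The case split on \<open>k\<close> takes care of the truncated exponent
      \<open>k - 1\<close>.\<close>
    also have "inverse x ^ k * (exp (- inverse x) * (inverse x * inverse x))
        + k * inverse x ^ (k - 1) * (- (inverse x * inverse x)) * exp (- inverse x)
      = flat_fun (k + 2) x - k * flat_fun (k + 1) x"
      using 1 by (cases k) (simp_all add: flat_fun_def algebra_simps)
    finally have "((\<lambda>x. inverse x ^ k * exp (- inverse x)) has_real_derivative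
        flat_fun (k + 2) x - k * flat_fun (k + 1) x) (at x)" .
    then show ?thesis
      by (rule has_field_derivative_transform_within_open[where S="{0<..}"])
        (use 1 in \<open>auto simp: flat_fun_def\<close>)
  next
    case 2
    have "((\<lambda>x. 0) has_real_derivative flat_fun (k + 2) x - k * flat_fun (k + 1) x) (at x)"
      using 2 by (simp add: flat_fun_def)
    then show ?thesis
      by (rule has_field_derivative_transform_within_open[where S="{..<0}"])
        (use 2 in \<open>auto simp: flat_fun_def\<close>)
  next
    case 3
    \<comment> \<open>The difference quotient at 0 is the next function of the family, so its limit
      is already known.\<close>
    have "(\<lambda>h. flat_fun k h / h) = flat_fun (k + 1)"
      by (auto simp: flat_fun_def divide_inverse)
    then have "(flat_fun k has_real_derivative 0) (at 0)"
      using flat_fun_tendsto_0[of "k+1"] by (simp add: DERIV_def) (simp add: flat_fun_def)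
    then show ?thesis using 3 by (simp add: flat_fun_def)
  qed
qed

lemma smooth_on_flat_fun: "smooth_on (flat_fun k) UNIV"
proof -
  have "Ck_on n (flat_fun k) UNIV" for n k
  proof (induction n arbitrary: k)
    case 0
    then show ?case using flat_fun_deriv
      by (auto intro!: continuous_at_imp_continuous_on DERIV_isCont)
  next
    case (Suc n)
    show ?case
    proof (rule Ck_on_SucI[where f'="\<lambda>x v. (flat_fun (k + 2) x + (- real k) * flat_fun (k + 1) x) * v"])
      show "(flat_fun k has_derivative (\<lambda>v. (flat_fun (k + 2) x + (- real k) * flat_fun (k + 1) x) * v)) (at x)" for x
        using flat_fun_deriv[of k x] by (simp add: has_field_derivative_def)
      show "Ck_on n (\<lambda>x. (flat_fun (k + 2) x + (- real k) * flat_fun (k + 1) x) * v) UNIV" for v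
        by (intro Ck_on_bilinear[OF bounded_bilinear_mult] Ck_on_add Ck_on_const Suc) auto
    qed auto
  qed
  then show ?thesis by (simp add: smooth_on_def)
qed

section \<open>Cut-off functions on the line\<close>

definition bump :: "real \<Rightarrow> real \<Rightarrow> real"
  where "bump r x = flat_fun 0 (4 * r - x) * inverse (flat_fun 0 (4 * r - x) + flat_fun 0 (x - r))"

lemma flat_fun_pos: "x > 0 \<Longrightarrow> flat_fun 0 x > 0"
  by (simp add: flat_fun_def)

lemma flat_fun_nonneg: "flat_fun 0 x \<ge> 0"
  by (simp add: flat_fun_def)

lemma bump_denominator:
  assumes "r > 0" shows "flat_fun 0 (4 * r - x) + flat_fun 0 (x - r) > 0"
proof -
  have "4 * r - x > 0 \<or> x - r > 0" using assms by linarith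
  then show ?thesis using flat_fun_pos flat_fun_nonneg by (metis add_nonneg_pos add_pos_nonneg)
qed

lemma bump_smooth: assumes "r > 0" shows "smooth_on (bump r) UNIV"
proof -
  have a: "smooth_on (\<lambda>x. flat_fun 0 (4 * r - x)) UNIV" "smooth_on (\<lambda>x. flat_fun 0 (x - r)) UNIV"
    by (auto intro!: smooth_on_compose[OF _ _ _ smooth_on_flat_fun] smooth_on_diff smooth_on_const smooth_on_id)
  have "smooth_on (\<lambda>x. inverse (flat_fun 0 (4 * r - x) + flat_fun 0 (x - r))) UNIV"
    using bump_denominator[OF assms]
    by (intro smooth_on_compose[OF _ _ _ smooth_on_inverse] smooth_on_add a) auto
  then show ?thesis unfolding bump_def[abs_def] by (intro smooth_on_mult a) auto
qed

lemma bump_eq_1: "r > 0 \<Longrightarrow> x \<le> r \<Longrightarrow> bump r x = 1"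
  using bump_denominator[of r x] by (simp add: bump_def flat_fun_def)

lemma bump_eq_0: "x \<ge> 4 * r \<Longrightarrow> bump r x = 0"
  by (simp add: bump_def flat_fun_def)

lemma bump_nonneg: "r > 0 \<Longrightarrow> bump r x \<ge> 0"
  using bump_denominator[of r x] flat_fun_nonneg by (simp add: bump_def)

section \<open>Integrals along segments and Hadamard's lemma\<close>

lemma convex_segment_mem:
  fixes a x :: "'e::real_vector"
  assumes "convex S" "a \<in> S" "x \<in> S" "t \<in> {0..1}"
  shows "a + t *\<^sub>R (x - a) \<in> S"
proof -
  have "(1 - t) *\<^sub>R a + t *\<^sub>R x \<in> S"
    using assms by (intro convexD) auto
  then show ?thesis by (simp add: algebra_simps)
qed

lemma continuous_on_segment:
  fixes f :: "'e::euclidean_space \<Rightarrow> real"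
  assumes "continuous_on S f" "convex S" "a \<in> S"
  shows "continuous_on (S \<times> cbox 0 1) (\<lambda>(x, t). t ^ m * f (a + t *\<^sub>R (x - a)))"
proof -
  have "continuous_on (S \<times> cbox 0 1) (\<lambda>z. f (a + snd z *\<^sub>R (fst z - a)))"
    by (rule continuous_on_compose2[OF assms(1)])
      (auto intro!: continuous_intros convex_segment_mem[OF assms(2,3)])
  then show ?thesis by (auto simp: case_prod_beta intro!: continuous_intros)
qed

text \<open>Differentiation under the integral replaces the integrand by one of the same form: the
  chain rule brings out one more factor \<open>t\<close>. The weight \<open>t ^ m\<close> is there
  to close the induction.\<close>

lemma Ck_on_segment_integral:
  fixes F :: "'e::euclidean_space \<Rightarrow> real"
  assumes S: "open S" "convex S" "a \<in> S" and F: "smooth_on F S"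
  shows "Ck_on k (\<lambda>x. integral (cbox 0 1) (\<lambda>t. t ^ m * F (a + t *\<^sub>R (x - a)))) S"
  using F
proof (induction k arbitrary: F m)
  case 0
  show ?case
    using integral_continuous_on_param[OF continuous_on_segment[OF smooth_on_imp_continuous_on[OF 0] S(2,3)]]
    by (simp add: case_prod_beta)
next
  case (Suc k)
  define F' where "F' = (\<lambda>x. frechet_derivative F (at x))"
  have F': "(F has_derivative F' y) (at y)" if "y \<in> S" for y
    unfolding F'_def using smooth_on_has_derivative[OF Suc.prems that] .
  have bl: "bounded_linear (F' y)" if "y \<in> S" for y
    using F'[OF that] has_derivative_bounded_linear by blast
  \<comment> \<open>The derivative of the integrand bundled as a bounded linear map, which is the
    form required by the Leibniz rule for parameter integrals.\<close>
  define B where "B = (\<lambda>x t. Blinfun (\<lambda>v. t ^ Suc m * F' (a + t *\<^sub>R (x - a)) v))"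
  have B: "blinfun_apply (B x t) v = t ^ Suc m * F' (a + t *\<^sub>R (x - a)) v"
    if "x \<in> S" "t \<in> cbox 0 1" for x t v
  proof -
    have "a + t *\<^sub>R (x - a) \<in> S" using convex_segment_mem S that by auto
    from bounded_linear_const_mult[OF bl[OF this], of "t ^ Suc m"]
    show ?thesis unfolding B_def by (simp add: bounded_linear_Blinfun_apply)
  qed
  have contF': "continuous_on S (\<lambda>y. F' y v)" for v
    unfolding F'_def by (rule smooth_on_imp_continuous_on[OF smooth_on_derivative[OF Suc.prems]])
  have contB: "continuous_on (S \<times> cbox 0 1) (\<lambda>(x, t). B x t)"
  proof (rule continuous_on_blinfun_componentwise)
    fix i :: 'e
    show "continuous_on (S \<times> cbox 0 1) (\<lambda>x. blinfun_apply (case x of (x, t) \<Rightarrow> B x t) i)"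
      by (rule continuous_on_eq[OF continuous_on_segment[OF contF' S(2,3), of "Suc m" i]]) (use B in auto)
  qed
  have int: "(\<lambda>t. t ^ m * F (a + t *\<^sub>R (x - a))) integrable_on cbox 0 1" if "x \<in> S" for x
  proof (rule integrable_continuous)
    have "continuous_on (cbox 0 1) (\<lambda>t. (\<lambda>(x, t). t ^ m * F (a + t *\<^sub>R (x - a))) (x, t))"
      by (rule continuous_on_compose2[OF continuous_on_segment[OF smooth_on_imp_continuous_on[OF Suc.prems] S(2,3), of m]])
        (use that in \<open>auto intro!: continuous_intros\<close>)
    then show "continuous_on (cbox 0 1) (\<lambda>t. t ^ m * F (a + t *\<^sub>R (x - a)))" by simp
  qed
  have leib: "((\<lambda>x. integral (cbox 0 1) (\<lambda>t. t ^ m * F (a + t *\<^sub>R (x - a)))) has_derivative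
      blinfun_apply (integral (cbox 0 1) (B x))) (at x)" if "x \<in> S" for x
  proof -
    have "((\<lambda>x. integral (cbox 0 1) (\<lambda>t. t ^ m * F (a + t *\<^sub>R (x - a)))) has_derivative
      blinfun_apply (integral (cbox 0 1) (B x))) (at x within S)"
    proof (rule leibniz_rule[OF _ int contB that S(2)])
      fix x t assume xt: "x \<in> S" "t \<in> cbox (0::real) 1"
      have m: "a + t *\<^sub>R (x - a) \<in> S" using convex_segment_mem S xt by auto
      have "((\<lambda>x. F (a + t *\<^sub>R (x - a))) has_derivative (\<lambda>v. F' (a + t *\<^sub>R (x - a)) (t *\<^sub>R v))) (at x)"
        by (rule has_derivative_compose[where f="\<lambda>x. a + t *\<^sub>R (x - a)" and g=F, OF _ F'[OF m]])
          (auto intro!: derivative_eq_intros)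
      then have "((\<lambda>x. t ^ m * F (a + t *\<^sub>R (x - a))) has_derivative
          (\<lambda>v. t ^ m * F' (a + t *\<^sub>R (x - a)) (t *\<^sub>R v))) (at x)"
        by (rule has_derivative_mult_right)
      moreover have "(\<lambda>v. t ^ m * F' (a + t *\<^sub>R (x - a)) (t *\<^sub>R v)) = blinfun_apply (B x t)"
        using B[OF xt] bl[OF m] by (auto simp: fun_eq_iff linear_simps)
      ultimately show "((\<lambda>x. t ^ m * F (a + t *\<^sub>R (x - a))) has_derivative blinfun_apply (B x t)) (at x within S)"
        by (simp add: has_derivative_at_withinI)
    qed
    then show ?thesis using at_within_open[OF that S(1)] by simp
  qed
  show ?case
  proof (rule Ck_on_SucI[OF S(1) leib])
    fix v
    have "Ck_on k (\<lambda>x. integral (cbox 0 1) (\<lambda>t. t ^ Suc m * F' (a + t *\<^sub>R (x - a)) v)) S"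
      unfolding F'_def by (rule Suc.IH[OF smooth_on_derivative[OF Suc.prems]])
    moreover have "blinfun_apply (integral (cbox 0 1) (B x)) v
        = integral (cbox 0 1) (\<lambda>t. t ^ Suc m * F' (a + t *\<^sub>R (x - a)) v)" if "x \<in> S" for x
    proof -
      have "B x integrable_on cbox 0 1"
      proof (rule integrable_continuous)
        have "continuous_on (cbox 0 1) (\<lambda>t. (\<lambda>(x, t). B x t) (x, t))"
          by (rule continuous_on_compose2[OF contB]) (use that in \<open>auto intro!: continuous_intros\<close>)
        then show "continuous_on (cbox 0 1) (B x)" by simp
      qed
      then have "blinfun_apply (integral (cbox 0 1) (B x)) v = integral (cbox 0 1) (\<lambda>t. blinfun_apply (B x t) v)"
        by (rule blinfun_apply_integral)
      also have "\<dots> = integral (cbox 0 1) (\<lambda>t. t ^ Suc m * F' (a + t *\<^sub>R (x - a)) v)"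
        by (rule integral_cong) (use B[OF that] in simp)
      finally show ?thesis .
    qed
    ultimately show "Ck_on k (\<lambda>x. blinfun_apply (integral (cbox 0 1) (B x)) v) S"
      by (subst Ck_on_cong[OF S(1)]) auto
  qed
qed

text \<open>Integrate the derivative of \<open>F\<close> along the segment from \<open>a\<close> to
  \<open>x\<close>; \<open>G b\<close> is the integral of the partial derivative in direction
  \<open>b\<close>. It is what reduces derivations to coordinate derivatives in
  \<open>tangent_coord_rep\<close>.\<close>

lemma hadamard:
  fixes F :: "'e::euclidean_space \<Rightarrow> real"
  assumes S: "open S" "convex S" "a \<in> S" and F: "smooth_on F S"
  obtains G where "\<And>b. smooth_on (G b) S" "\<And>b. G b a = frechet_derivative F (at a) b"
    "\<And>x. x \<in> S \<Longrightarrow> F x = F a + (\<Sum>b\<in>Basis. ((x - a) \<bullet> b) * G b x)"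
proof
  define G where "G = (\<lambda>b x. integral (cbox 0 1) (\<lambda>t. t ^ 0 * frechet_derivative F (at (a + t *\<^sub>R (x - a))) b))"
  show "smooth_on (G b) S" for b
    unfolding smooth_on_def G_def
    using Ck_on_segment_integral[OF S smooth_on_derivative[OF F]] by blast
  show "G b a = frechet_derivative F (at a) b" for b
    unfolding G_def by simp
  fix x assume x: "x \<in> S"
  define F' where "F' = (\<lambda>x. frechet_derivative F (at x))"
  have F': "(F has_derivative F' y) (at y)" if "y \<in> S" for y
    unfolding F'_def using smooth_on_has_derivative[OF F that] .
  have m: "a + t *\<^sub>R (x - a) \<in> S" if "t \<in> {0..1}" for t using convex_segment_mem S x that by auto
  have "((\<lambda>t. F' (a + t *\<^sub>R (x - a)) (x - a)) has_integral F (a + 1 *\<^sub>R (x - a)) - F (a + 0 *\<^sub>R (x - a))) {0..1}"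
  proof (rule fundamental_theorem_of_calculus)
    fix t :: real assume t: "t \<in> {0..1}"
    have "((\<lambda>t. F (a + t *\<^sub>R (x - a))) has_derivative (\<lambda>s. F' (a + t *\<^sub>R (x - a)) (s *\<^sub>R (x - a)))) (at t)"
      by (rule has_derivative_compose[where f="\<lambda>t. a + t *\<^sub>R (x - a)" and g=F, OF _ F'[OF m[OF t]]])
          (auto intro!: derivative_eq_intros)
    moreover have "(\<lambda>s. F' (a + t *\<^sub>R (x - a)) (s *\<^sub>R (x - a))) = (\<lambda>s. s *\<^sub>R F' (a + t *\<^sub>R (x - a)) (x - a))"
      using has_derivative_bounded_linear[OF F'[OF m[OF t]]] by (auto simp: linear_simps)
    ultimately show "((\<lambda>t. F (a + t *\<^sub>R (x - a))) has_vector_derivative F' (a + t *\<^sub>R (x - a)) (x - a)) (at t within {0..1})"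
      by (simp add: has_vector_derivative_def has_derivative_at_withinI)
  qed simp
  then have 1: "F x - F a = integral {0..1} (\<lambda>t. F' (a + t *\<^sub>R (x - a)) (x - a))"
    by (simp add: integral_unique)
  have int: "(\<lambda>t. F' (a + t *\<^sub>R (x - a)) b) integrable_on {0..1}" for b
  proof -
    have "continuous_on (cbox 0 1) (\<lambda>t. (\<lambda>(x, t). t ^ 0 * F' (a + t *\<^sub>R (x - a)) b) (x, t))"
      unfolding F'_def
      by (rule continuous_on_compose2[OF continuous_on_segment[OF smooth_on_imp_continuous_on[OF smooth_on_derivative[OF F]] S(2,3), of 0]])
        (use x in \<open>auto intro!: continuous_intros\<close>)
    then show ?thesis using integrable_continuous_real by auto
  qed
  have "integral {0..1} (\<lambda>t. F' (a + t *\<^sub>R (x - a)) (x - a))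
      = integral {0..1} (\<lambda>t. \<Sum>b\<in>Basis. ((x - a) \<bullet> b) * F' (a + t *\<^sub>R (x - a)) b)"
  proof (rule integral_cong)
    fix t :: real assume t: "t \<in> {0..1}"
    have "linear (F' (a + t *\<^sub>R (x - a)))"
      using has_derivative_linear[OF F'[OF m[OF t]]] .
    then show "F' (a + t *\<^sub>R (x - a)) (x - a) = (\<Sum>b\<in>Basis. ((x - a) \<bullet> b) * F' (a + t *\<^sub>R (x - a)) b)"
      by (subst (2) euclidean_representation[symmetric, of "x - a"]) (simp add: linear_sum linear_scale)
  qed
  also have "\<dots> = (\<Sum>b\<in>Basis. ((x - a) \<bullet> b) * integral {0..1} (\<lambda>t. F' (a + t *\<^sub>R (x - a)) b))"
    using int by (subst integral_sum) (auto intro: integrable_on_mult_right)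
  finally show "F x = F a + (\<Sum>b\<in>Basis. ((x - a) \<bullet> b) * G b x)"
    using 1 by (simp add: G_def F'_def)
qed

section \<open>Smooth functions and tangent vectors\<close>

lemma sum_fun_apply: "sum F I x = (\<Sum>i\<in>I. F i x)" for F :: "'i \<Rightarrow> 'b \<Rightarrow> 'c::comm_monoid_add"
  by (induction I rule: infinite_finite_induct) (auto simp: zero_fun_def plus_fun_def)

locale smooth_manifold =
  fixes A :: "('a::t2_space, 'n::finite) atlas"
  assumes atlas: "smooth_atlas A"
begin

lemma chart_ex: obtains U \<phi> where "(U, \<phi>) \<in> A" "p \<in> U"
proof -
  have "p \<in> \<Union> (fst ` A)" using atlas unfolding smooth_atlas_def by blast
  then show ?thesis using that by auto
qed

lemma chart_open: "(U, \<phi>) \<in> A \<Longrightarrow> open U"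
  and chart_open_image: "(U, \<phi>) \<in> A \<Longrightarrow> open (\<phi> ` U)"
  and chart_homeomorphism: "(U, \<phi>) \<in> A \<Longrightarrow> homeomorphism U (\<phi> ` U) \<phi> (inv_into U \<phi>)"
  using atlas unfolding smooth_atlas_def by fastforce+

lemma chart_inv: "(U, \<phi>) \<in> A \<Longrightarrow> p \<in> U \<Longrightarrow> inv_into U \<phi> (\<phi> p) = p"
  using chart_homeomorphism unfolding homeomorphism_def by blast

lemma chart_inv_mem: "(U, \<phi>) \<in> A \<Longrightarrow> x \<in> \<phi> ` U \<Longrightarrow> inv_into U \<phi> x \<in> U"
  by (rule inv_into_into)

lemma chart_inv2: "x \<in> \<phi> ` U \<Longrightarrow> \<phi> (inv_into U \<phi> x) = x"
  by (rule f_inv_into_f)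

lemma chart_continuous: "(U, \<phi>) \<in> A \<Longrightarrow> continuous_on U \<phi>"
  and chart_inv_continuous: "(U, \<phi>) \<in> A \<Longrightarrow> continuous_on (\<phi> ` U) (inv_into U \<phi>)"
  using chart_homeomorphism unfolding homeomorphism_def by blast+

lemma chart_vimage_open:
  assumes "(U, \<phi>) \<in> A" "open S" shows "open {q\<in>U. \<phi> q \<in> S}"
  using continuous_open_preimage[OF chart_continuous[OF assms(1)] chart_open[OF assms(1)] assms(2)]
  by (simp add: vimage_def Int_def)

lemma chart_image_eq:
  assumes "(U, \<phi>) \<in> A" shows "\<phi> ` (U \<inter> V) = {x \<in> \<phi> ` U. inv_into U \<phi> x \<in> V}"
  using chart_inv[OF assms] by auto

lemma chart_image_open:
  assumes "(U, \<phi>) \<in> A" "open V" shows "open (\<phi> ` (U \<inter> V))"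
  unfolding chart_image_eq[OF assms(1)]
  using continuous_open_preimage[OF chart_inv_continuous[OF assms(1)] chart_open_image[OF assms(1)] assms(2)]
  by (simp add: vimage_def Int_def)

lemma transition_smooth:
  "(U, \<phi>) \<in> A \<Longrightarrow> (V, \<psi>) \<in> A \<Longrightarrow> smooth_on (\<psi> \<circ> inv_into U \<phi>) (\<phi> ` (U \<inter> V))"
  using atlas unfolding smooth_atlas_def by fastforce

lemma smooth_funsD: "f \<in> smooth_funs A \<Longrightarrow> (U, \<phi>) \<in> A \<Longrightarrow> smooth_on (f \<circ> inv_into U \<phi>) (\<phi> ` U)"
  unfolding smooth_funs_def by fastforce

text \<open>Smoothness in one chart transfers to any other through the smooth transition map on the
  overlap. This is the gluing principle behind all functions that are extended by 0.\<close>

lemma smooth_funsI_local: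
  assumes "\<And>p. \<exists>U \<phi> S. (U, \<phi>) \<in> A \<and> p \<in> U \<and> open S \<and> \<phi> p \<in> S \<and> S \<subseteq> \<phi> ` U
      \<and> smooth_on (f \<circ> inv_into U \<phi>) S"
  shows "f \<in> smooth_funs A"
  unfolding smooth_funs_def
proof (clarify, rule smooth_on_local)
  fix V \<psi> x assume V: "(V, \<psi>) \<in> A" and x: "x \<in> \<psi> ` V"
  define p where "p = inv_into V \<psi> x"
  obtain U \<phi> S where U: "(U, \<phi>) \<in> A" "p \<in> U" "open S" "\<phi> p \<in> S" "S \<subseteq> \<phi> ` U"
    and f: "smooth_on (f \<circ> inv_into U \<phi>) S" using assms[of p] by blast
  have pV: "p \<in> V" "\<psi> p = x" using x unfolding p_def by (auto intro: inv_into_into f_inv_into_f)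
  define T where "T = \<psi> ` (V \<inter> {q\<in>U. \<phi> q \<in> S})"
  have T: "open T" unfolding T_def
    by (rule chart_image_open[OF V chart_vimage_open[OF U(1,3)]])
  have tr: "smooth_on (\<phi> \<circ> inv_into V \<psi>) T"
    by (rule smooth_on_subset[OF transition_smooth[OF V U(1)]]) (auto simp: T_def)
  have im: "(\<phi> \<circ> inv_into V \<psi>) ` T \<subseteq> S"
    unfolding T_def using chart_inv[OF V] by auto
  have "smooth_on (\<lambda>y. (f \<circ> inv_into U \<phi>) ((\<phi> \<circ> inv_into V \<psi>) y)) T"
    by (rule smooth_on_compose[OF T U(3) tr f im])
  then have "smooth_on (f \<circ> inv_into V \<psi>) T"
    by (rule smooth_on_eq[OF _ T]) (use chart_inv[OF V] chart_inv[OF U(1)] T_def in auto)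
  moreover have "x \<in> T" unfolding T_def using pV U by auto
  ultimately show "\<exists>T. open T \<and> x \<in> T \<and> smooth_on (f \<circ> inv_into V \<psi>) T" using T by blast
qed

lemma smooth_funs_local:
  assumes "\<And>p. \<exists>V h. open V \<and> p \<in> V \<and> h \<in> smooth_funs A \<and> (\<forall>q\<in>V. f q = h q)"
  shows "f \<in> smooth_funs A"
proof (rule smooth_funsI_local)
  fix p
  obtain V h where V: "open V" "p \<in> V" "h \<in> smooth_funs A" "\<And>q. q \<in> V \<Longrightarrow> f q = h q" using assms[of p] by blast
  obtain U \<phi> where U: "(U, \<phi>) \<in> A" "p \<in> U" by (rule chart_ex)
  have o: "open (\<phi> ` (U \<inter> V))" by (rule chart_image_open[OF U(1) V(1)])
  have "smooth_on (h \<circ> inv_into U \<phi>) (\<phi> ` (U \<inter> V))"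
    by (rule smooth_on_subset[OF smooth_funsD[OF V(3) U(1)]]) auto
  then have "smooth_on (f \<circ> inv_into U \<phi>) (\<phi> ` (U \<inter> V))"
    by (rule smooth_on_eq[OF _ o]) (use V(4) chart_inv[OF U(1)] in auto)
  then show "\<exists>U \<phi> S. (U, \<phi>) \<in> A \<and> p \<in> U \<and> open S \<and> \<phi> p \<in> S \<and> S \<subseteq> \<phi> ` U
      \<and> smooth_on (f \<circ> inv_into U \<phi>) S" using U V o by blast
qed

lemma smooth_funs_const: "(\<lambda>p. c) \<in> smooth_funs A"
  unfolding smooth_funs_def using chart_open_image by (auto simp: o_def intro!: smooth_on_const)

lemma smooth_funs_add: "f \<in> smooth_funs A \<Longrightarrow> h \<in> smooth_funs A \<Longrightarrow> (\<lambda>p. f p + h p) \<in> smooth_funs A"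
  unfolding smooth_funs_def using chart_open_image by (force simp: o_def intro!: smooth_on_add)

lemma smooth_funs_mult: "f \<in> smooth_funs A \<Longrightarrow> h \<in> smooth_funs A \<Longrightarrow> (\<lambda>p. f p * h p) \<in> smooth_funs A"
  unfolding smooth_funs_def using chart_open_image by (force simp: o_def intro!: smooth_on_mult)

lemma smooth_funs_scale: "f \<in> smooth_funs A \<Longrightarrow> (\<lambda>p. c * f p) \<in> smooth_funs A"
  by (intro smooth_funs_mult smooth_funs_const)

lemma smooth_funs_uminus: "f \<in> smooth_funs A \<Longrightarrow> (\<lambda>p. - f p) \<in> smooth_funs A"
  using smooth_funs_scale[of f "-1"] by simp

lemma smooth_funs_diff: "f \<in> smooth_funs A \<Longrightarrow> h \<in> smooth_funs A \<Longrightarrow> (\<lambda>p. f p - h p) \<in> smooth_funs A"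
  using smooth_funs_add[OF _ smooth_funs_uminus, of f h] by simp

lemma smooth_funs_sum: "(\<And>i. i \<in> I \<Longrightarrow> f i \<in> smooth_funs A) \<Longrightarrow> (\<lambda>p. \<Sum>i\<in>I. f i p) \<in> smooth_funs A"
  by (induction I rule: infinite_finite_induct) (auto intro: smooth_funs_const smooth_funs_add)

lemma smooth_funs_compose:
  assumes "f \<in> smooth_funs A" "smooth_on h UNIV" shows "(\<lambda>p. h (f p)) \<in> smooth_funs A"
proof -
  have "smooth_on (\<lambda>x. h ((f \<circ> inv_into U \<phi>) x)) (\<phi> ` U)" if "(U, \<phi>) \<in> A" for U \<phi>
    by (rule smooth_on_compose[OF chart_open_image[OF that] open_UNIV smooth_funsD[OF assms(1) that] assms(2)]) auto
  then show ?thesis unfolding smooth_funs_def by (auto simp: o_def)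
qed

lemmas smooth_funs_intros [simp, intro] = smooth_funs_const smooth_funs_add smooth_funs_mult
  smooth_funs_uminus smooth_funs_diff smooth_funs_sum

lemma smooth_funs_continuous:
  assumes "f \<in> smooth_funs A" shows "continuous_on S f"
proof -
  have "isCont f p" for p
  proof -
    obtain U \<phi> where U: "(U, \<phi>) \<in> A" "p \<in> U" by (rule chart_ex)
    have "continuous_on U (\<lambda>q. (f \<circ> inv_into U \<phi>) (\<phi> q))"
      by (rule continuous_on_compose2[OF smooth_on_imp_continuous_on[OF smooth_funsD[OF assms U(1)]] chart_continuous[OF U(1)]]) auto
    then have "continuous_on U f"
      by (rule continuous_on_eq) (use chart_inv[OF U(1)] in auto)
    then show ?thesis using continuous_on_eq_continuous_at[OF chart_open[OF U(1)]] U(2) by blast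
  qed
  then show ?thesis by (simp add: continuous_at_imp_continuous_on)
qed

section \<open>Bump functions and the extension of local functions\<close>

lemma chart_closed_ball:
  assumes "(U, \<phi>) \<in> A" "cball (\<phi> p) e \<subseteq> \<phi> ` U"
  shows "compact (inv_into U \<phi> ` cball (\<phi> p) e)" "closed (inv_into U \<phi> ` cball (\<phi> p) e)"
proof -
  show "compact (inv_into U \<phi> ` cball (\<phi> p) e)"
    by (rule compact_continuous_image[OF continuous_on_subset[OF chart_inv_continuous[OF assms(1)] assms(2)]]) simp
  then show "closed (inv_into U \<phi> ` cball (\<phi> p) e)" by (rule compact_imp_closed)
qed

text \<open>A radial cut-off is transported from a chart and extended by 0. The preimage
  \<open>K\<close> of a closed coordinate ball is compact, hence closed because the space is
  Hausdorff, and this makes the extension smooth at points outside the chart domain.\<close>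

lemma smooth_bump:
  assumes "open V" "p \<in> V"
  obtains \<theta> N where "\<theta> \<in> smooth_funs A" "open N" "p \<in> N" "\<And>q. q \<in> N \<Longrightarrow> \<theta> q = 1"
    "\<And>q. 0 \<le> \<theta> q" "compact (closure {q. \<theta> q \<noteq> 0})" "closure {q. \<theta> q \<noteq> 0} \<subseteq> V"
proof -
  obtain U \<phi> where U: "(U, \<phi>) \<in> A" "p \<in> U" by (rule chart_ex)
  define a where "a = \<phi> p"
  have "open (\<phi> ` (U \<inter> V))" "a \<in> \<phi> ` (U \<inter> V)"
    using chart_image_open[OF U(1) assms(1)] U assms a_def by auto
  then obtain e where e: "e > 0" "cball a e \<subseteq> \<phi> ` (U \<inter> V)" using open_contains_cball by blast
  \<comment> \<open>\<open>bump r\<close> is applied to the squared distance from \<open>a\<close>;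
    its thresholds \<open>r\<close> and \<open>4 * r\<close> then are the radii \<open>e / 2\<close>
    and \<open>e\<close>.\<close>
  define r where "r = (e / 2)\<^sup>2"
  have r: "r > 0" "4 * r = e\<^sup>2" using e by (auto simp: r_def power_divide)
  define \<theta> where "\<theta> = (\<lambda>q. if q \<in> U then bump r ((\<phi> q - a) \<bullet> (\<phi> q - a)) else 0)"
  define K where "K = inv_into U \<phi> ` cball a e"
  have K: "compact K" "closed K" "K \<subseteq> V" "K \<subseteq> U"
  proof -
    have sub: "cball a e \<subseteq> \<phi> ` U" using e by auto
    show "compact K" "closed K" using chart_closed_ball[OF U(1)] sub unfolding K_def a_def by blast+
    show "K \<subseteq> V" "K \<subseteq> U" using e(2) chart_inv[OF U(1)] unfolding K_def by fastforce+
  qed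
  have supp: "q \<in> K" if "\<theta> q \<noteq> 0" for q
  proof -
    have q: "q \<in> U" using that unfolding \<theta>_def by (auto split: if_splits)
    have "(\<phi> q - a) \<bullet> (\<phi> q - a) < e\<^sup>2"
      using bump_eq_0[of r] that r(2) unfolding \<theta>_def by (metis not_le)
    then have "(norm (\<phi> q - a))\<^sup>2 < e\<^sup>2" by (simp add: power2_norm_eq_inner)
    then have "norm (\<phi> q - a) < e" using e(1) power_less_imp_less_base[of "norm (\<phi> q - a)" 2 e] by simp
    then have "\<phi> q \<in> cball a e" by (simp add: dist_norm norm_minus_commute)
    then show ?thesis unfolding K_def using chart_inv[OF U(1) q] by (metis image_eqI)
  qed
  then have supp': "\<theta> q = 0" if "q \<notin> K" for q using that by blast
  have cl: "closure {q. \<theta> q \<noteq> 0} \<subseteq> K" using supp K(2) by (intro closure_minimal) auto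
  have smooth: "\<theta> \<in> smooth_funs A"
  proof (rule smooth_funsI_local)
    fix q
    show "\<exists>U \<phi> S. (U, \<phi>) \<in> A \<and> q \<in> U \<and> open S \<and> \<phi> q \<in> S \<and> S \<subseteq> \<phi> ` U
      \<and> smooth_on (\<theta> \<circ> inv_into U \<phi>) S"
    proof (cases "q \<in> U")
      case True
      have "smooth_on (\<lambda>x. bump r ((x - a) \<bullet> (x - a))) (\<phi> ` U)"
        using chart_open_image[OF U(1)]
        by (intro smooth_on_compose[OF _ _ _ bump_smooth[OF r(1)]] smooth_on_bilinear[OF bounded_bilinear_inner]
            smooth_on_diff smooth_on_id smooth_on_const) auto
      then have "smooth_on (\<theta> \<circ> inv_into U \<phi>) (\<phi> ` U)"
        by (rule smooth_on_eq[OF _ chart_open_image[OF U(1)]]) (use chart_inv[OF U(1)] \<theta>_def in auto)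
      then show ?thesis using True U chart_open_image[OF U(1)] by blast
    next
      case False
      obtain W \<psi> where W: "(W, \<psi>) \<in> A" "q \<in> W" by (rule chart_ex)
      have o: "open (\<psi> ` (W \<inter> - K))" by (rule chart_image_open[OF W(1)]) (use K in auto)
      have "smooth_on (\<theta> \<circ> inv_into W \<psi>) (\<psi> ` (W \<inter> - K))"
        by (rule smooth_on_eq[OF smooth_on_const[OF o, of 0] o]) (use supp' chart_inv[OF W(1)] in auto)
      then show ?thesis using W o False K(4) by blast
    qed
  qed
  define N where "N = {q\<in>U. \<phi> q \<in> ball a (e / 2)}"
  have "\<theta> q = 1" if "q \<in> N" for q
  proof -
    have "norm (\<phi> q - a) \<le> e / 2" using that unfolding N_def by (auto simp: dist_norm norm_minus_commute)
    then have "(norm (\<phi> q - a))\<^sup>2 \<le> r" unfolding r_def by (rule power_mono) simp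
    then have "(\<phi> q - a) \<bullet> (\<phi> q - a) \<le> r" by (simp add: power2_norm_eq_inner)
    then show ?thesis using that r bump_eq_1 unfolding \<theta>_def N_def by auto
  qed
  moreover have "open N" unfolding N_def by (rule chart_vimage_open[OF U(1)]) simp
  moreover have "p \<in> N" using U e unfolding N_def a_def by auto
  moreover have "0 \<le> \<theta> q" for q unfolding \<theta>_def using bump_nonneg[OF r(1)] by auto
  moreover have "compact (closure {q. \<theta> q \<noteq> 0})"
    using compact_Int_closed[OF K(1), of "closure {q. \<theta> q \<noteq> 0}"] cl by (simp add: Int_absorb1)
  ultimately show ?thesis using that smooth cl K(3) by (meson subset_trans)
qed

text \<open>Derivations act on globally defined smooth functions only. A local function, such as a
  coordinate, is therefore multiplied by a bump that equals 1 near \<open>p\<close>.\<close>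

lemma smooth_extension:
  assumes U: "(U, \<phi>) \<in> A" "p \<in> U" "open S" "\<phi> p \<in> S" "S \<subseteq> \<phi> ` U" and f: "smooth_on (f \<circ> inv_into U \<phi>) S"
  obtains h N where "h \<in> smooth_funs A" "open N" "p \<in> N" "\<And>q. q \<in> N \<Longrightarrow> h q = f q"
proof -
  define V where "V = {q\<in>U. \<phi> q \<in> S}"
  have V: "open V" "p \<in> V" using chart_vimage_open[OF U(1,3)] U unfolding V_def by auto
  obtain \<theta> N where \<theta>: "\<theta> \<in> smooth_funs A" "open N" "p \<in> N" "\<And>q. q \<in> N \<Longrightarrow> \<theta> q = 1"
    "closure {q. \<theta> q \<noteq> 0} \<subseteq> V"
    by (rule smooth_bump[OF V]) blast
  have "(\<lambda>q. \<theta> q * f q) \<in> smooth_funs A"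
  proof (rule smooth_funsI_local)
    fix q
    show "\<exists>U \<phi> S. (U, \<phi>) \<in> A \<and> q \<in> U \<and> open S \<and> \<phi> q \<in> S \<and> S \<subseteq> \<phi> ` U
      \<and> smooth_on ((\<lambda>q. \<theta> q * f q) \<circ> inv_into U \<phi>) S"
    proof (cases "q \<in> V")
      case True
      have "smooth_on (\<lambda>x. (\<theta> \<circ> inv_into U \<phi>) x * (f \<circ> inv_into U \<phi>) x) S"
        by (intro smooth_on_mult U(3) f smooth_on_subset[OF smooth_funsD[OF \<theta>(1) U(1)] U(5)])
      then have "smooth_on ((\<lambda>q. \<theta> q * f q) \<circ> inv_into U \<phi>) S" by (simp add: o_def)
      then show ?thesis using True U unfolding V_def by blast
    next
      case False
      obtain W \<psi> where W: "(W, \<psi>) \<in> A" "q \<in> W" by (rule chart_ex)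
      let ?K = "closure {q. \<theta> q \<noteq> 0}"
      have o: "open (\<psi> ` (W \<inter> - ?K))" by (rule chart_image_open[OF W(1)]) auto
      have "smooth_on ((\<lambda>q. \<theta> q * f q) \<circ> inv_into W \<psi>) (\<psi> ` (W \<inter> - ?K))"
      proof (rule smooth_on_eq[OF smooth_on_const[OF o, of 0] o])
        fix x assume "x \<in> \<psi> ` (W \<inter> - ?K)"
        then obtain r where "r \<in> W" "r \<notin> ?K" "x = \<psi> r" by blast
        then show "((\<lambda>q. \<theta> q * f q) \<circ> inv_into W \<psi>) x = 0"
          using chart_inv[OF W(1)] closure_subset[of "{q. \<theta> q \<noteq> 0}"] by auto
      qed
      then show ?thesis using W o False \<theta>(5) by blast
    qed
  qed
  then show ?thesis using that[OF _ \<theta>(2,3)] \<theta>(4) by simp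
qed

text \<open>Serves outer functions that are smooth on part of the line only, such as the inverse
  square root that normalises a vector field.\<close>

lemma smooth_local_compose:
  assumes f: "f \<in> smooth_funs A" and h: "smooth_on h J" "open J" "f p \<in> J"
  obtains k N where "k \<in> smooth_funs A" "open N" "p \<in> N" "\<And>q. q \<in> N \<Longrightarrow> k q = h (f q)"
proof -
  obtain U \<phi> where U: "(U, \<phi>) \<in> A" "p \<in> U" by (rule chart_ex)
  define S where "S = {x \<in> \<phi> ` U. (f \<circ> inv_into U \<phi>) x \<in> J}"
  have S: "open S" "\<phi> p \<in> S" "S \<subseteq> \<phi> ` U"
  proof -
    show "open S"
      using continuous_open_preimage[OF smooth_on_imp_continuous_on[OF smooth_funsD[OF f U(1)]] chart_open_image[OF U(1)] h(2)]
      by (simp add: S_def vimage_def Int_def)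
    show "\<phi> p \<in> S" "S \<subseteq> \<phi> ` U" using U chart_inv h(3) unfolding S_def by auto
  qed
  have "smooth_on (\<lambda>x. h ((f \<circ> inv_into U \<phi>) x)) S"
    by (rule smooth_on_compose[OF S(1) h(2) smooth_on_subset[OF smooth_funsD[OF f U(1)] S(3)] h(1)])
      (auto simp: S_def)
  then have "smooth_on ((\<lambda>q. h (f q)) \<circ> inv_into U \<phi>) S" by (simp add: o_def)
  from smooth_extension[OF U S(1,2,3) this] that show ?thesis by metis
qed

section \<open>Tangent vectors as derivations\<close>

lemma
  assumes "v \<in> tangent A p"
  shows tangent_nonsmooth: "f \<notin> smooth_funs A \<Longrightarrow> v f = 0"
    and tangent_lin: "f \<in> smooth_funs A \<Longrightarrow> h \<in> smooth_funs A \<Longrightarrow> v (\<lambda>x. a * f x + b * h x) = a * v f + b * v h"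
    and tangent_mult: "f \<in> smooth_funs A \<Longrightarrow> h \<in> smooth_funs A \<Longrightarrow> v (\<lambda>x. f x * h x) = f p * v h + h p * v f"
  using assms unfolding tangent_def by blast+

lemma tangent_add_fun:
  "v \<in> tangent A p \<Longrightarrow> f \<in> smooth_funs A \<Longrightarrow> h \<in> smooth_funs A \<Longrightarrow> v (\<lambda>x. f x + h x) = v f + v h"
  using tangent_lin[of v p f h 1 1] by simp

lemma tangent_diff_fun:
  "v \<in> tangent A p \<Longrightarrow> f \<in> smooth_funs A \<Longrightarrow> h \<in> smooth_funs A \<Longrightarrow> v (\<lambda>x. f x - h x) = v f - v h"
  using tangent_lin[of v p f h 1 "-1"] by simp

lemma tangent_const: assumes "v \<in> tangent A p" shows "v (\<lambda>x. c) = 0"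
proof -
  have "v (\<lambda>x. 1 * 1) = 0" using tangent_mult[OF assms, of "\<lambda>x. 1" "\<lambda>x. 1"] by simp
  then show ?thesis using tangent_lin[OF assms, of "\<lambda>x. 1" "\<lambda>x. 1" c 0] by simp
qed

lemma tangent_scale_fun:
  "v \<in> tangent A p \<Longrightarrow> f \<in> smooth_funs A \<Longrightarrow> v (\<lambda>x. c * f x) = c * v f"
  using tangent_mult[of v p "\<lambda>x. c" f] tangent_const by simp

lemma tangent_sum_fun:
  assumes "v \<in> tangent A p" "\<And>i. i \<in> I \<Longrightarrow> f i \<in> smooth_funs A"
  shows "v (\<lambda>x. \<Sum>i\<in>I. f i x) = (\<Sum>i\<in>I. v (f i))"
  using assms(2)
proof (induction I rule: infinite_finite_induct)
  case (insert i I)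
  then show ?case
    using tangent_add_fun[OF assms(1), of "f i" "\<lambda>x. \<Sum>i\<in>I. f i x"] smooth_funs_sum[of I f] by simp
qed (auto simp: tangent_const[OF assms(1)])

text \<open>With a bump \<open>\<theta>\<close> supported in \<open>V\<close>, the difference
  \<open>f - h\<close> equals \<open>(1 - \<theta>) * (f - h)\<close>. Both factors vanish at
  \<open>p\<close>, so the Leibniz rule gives 0.\<close>

lemma tangent_local:
  assumes v: "v \<in> tangent A p" and f: "f \<in> smooth_funs A" "h \<in> smooth_funs A"
    and V: "open V" "p \<in> V" "\<And>q. q \<in> V \<Longrightarrow> f q = h q"
  shows "v f = v h"
proof -
  obtain \<theta> N where \<theta>: "\<theta> \<in> smooth_funs A" "p \<in> N" "\<And>q. q \<in> N \<Longrightarrow> \<theta> q = 1" "closure {q. \<theta> q \<noteq> 0} \<subseteq> V"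
    by (rule smooth_bump[OF V(1,2)]) blast
  have eq: "(\<lambda>q. f q - h q) = (\<lambda>q. (1 - \<theta> q) * (f q - h q))"
  proof
    fix q show "f q - h q = (1 - \<theta> q) * (f q - h q)"
    proof (cases "q \<in> V")
      case False
      then have "\<theta> q = 0" using \<theta>(4) closure_subset[of "{q. \<theta> q \<noteq> 0}"] by blast
      then show ?thesis by simp
    qed (use V(3) in simp)
  qed
  have "v (\<lambda>q. (1 - \<theta> q) * (f q - h q)) = (1 - \<theta> p) * v (\<lambda>q. f q - h q) + (f p - h p) * v (\<lambda>q. 1 - \<theta> q)"
    using f \<theta> by (intro tangent_mult[OF v]) auto
  also have "\<dots> = 0" using \<theta> V by auto
  finally have "v (\<lambda>q. f q - h q) = 0" using eq by metis
  then show ?thesis using tangent_diff_fun[OF v f] by simp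
qed

lemma subspace_tangent: "subspace (tangent A p)"
  unfolding subspace_def tangent_def by (auto simp: scaleR_fun_def plus_fun_def zero_fun_def algebra_simps)

lemma tangent_zero [simp]: "0 \<in> tangent A p"
  by (rule subspace_0[OF subspace_tangent])

lemma tangent_add [simp, intro]: "u \<in> tangent A p \<Longrightarrow> v \<in> tangent A p \<Longrightarrow> u + v \<in> tangent A p"
  by (rule subspace_add[OF subspace_tangent])

lemma tangent_scaleR [simp, intro]: "v \<in> tangent A p \<Longrightarrow> c *\<^sub>R v \<in> tangent A p"
  by (rule subspace_mul[OF subspace_tangent])

lemma tangent_diff [simp, intro]: "u \<in> tangent A p \<Longrightarrow> v \<in> tangent A p \<Longrightarrow> u - v \<in> tangent A p"
  by (rule subspace_diff[OF subspace_tangent])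

lemma tangent_uminus [simp, intro]: "v \<in> tangent A p \<Longrightarrow> - v \<in> tangent A p"
  by (rule subspace_neg[OF subspace_tangent])

lemma tangent_sum [simp, intro]: "(\<And>i. i \<in> I \<Longrightarrow> w i \<in> tangent A p) \<Longrightarrow> sum w I \<in> tangent A p"
  by (rule subspace_sum[OF subspace_tangent])

lemma tangent_eqI:
  assumes "u \<in> tangent A p" "v \<in> tangent A p" "\<And>f. f \<in> smooth_funs A \<Longrightarrow> u f = v f"
  shows "u = v"
proof
  fix f show "u f = v f"
    using assms(3) tangent_nonsmooth[OF assms(1)] tangent_nonsmooth[OF assms(2)]
    by (cases "f \<in> smooth_funs A") auto
qed

lemma coord_vec_tangent:
  assumes "(U, \<phi>) \<in> A" "p \<in> U" shows "coord_vec A U \<phi> i p \<in> tangent A p"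
proof -
  let ?D = "\<lambda>f. frechet_derivative (f \<circ> inv_into U \<phi>) (at (\<phi> p)) (axis i 1)"
  have d: "((f \<circ> inv_into U \<phi>) has_derivative frechet_derivative (f \<circ> inv_into U \<phi>) (at (\<phi> p))) (at (\<phi> p))"
    if "f \<in> smooth_funs A" for f
    using smooth_on_has_derivative[OF smooth_funsD[OF that assms(1)]] assms(2) by blast
  have "?D (\<lambda>x. a * f x + b * h x) = a * ?D f + b * ?D h" if "f \<in> smooth_funs A" "h \<in> smooth_funs A" for f h a b
  proof -
    have "((\<lambda>x. a * (f \<circ> inv_into U \<phi>) x + b * (h \<circ> inv_into U \<phi>) x) has_derivative
        (\<lambda>v. a * frechet_derivative (f \<circ> inv_into U \<phi>) (at (\<phi> p)) v + b * frechet_derivative (h \<circ> inv_into U \<phi>) (at (\<phi> p)) v)) (at (\<phi> p))"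
      by (intro has_derivative_add has_derivative_mult_right d that)
    then show ?thesis by (subst frechet_derivative_at[symmetric]) (auto simp: o_def)
  qed
  moreover have "?D (\<lambda>x. f x * h x) = f p * ?D h + h p * ?D f" if "f \<in> smooth_funs A" "h \<in> smooth_funs A" for f h
  proof -
    have "((\<lambda>x. (f \<circ> inv_into U \<phi>) x * (h \<circ> inv_into U \<phi>) x) has_derivative
        (\<lambda>v. (f \<circ> inv_into U \<phi>) (\<phi> p) * frechet_derivative (h \<circ> inv_into U \<phi>) (at (\<phi> p)) v
          + frechet_derivative (f \<circ> inv_into U \<phi>) (at (\<phi> p)) v * (h \<circ> inv_into U \<phi>) (\<phi> p))) (at (\<phi> p))"
      by (intro has_derivative_mult d that)
    then show ?thesis using chart_inv[OF assms]
      by (subst frechet_derivative_at[symmetric]) (auto simp: o_def algebra_simps)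
  qed
  ultimately show ?thesis unfolding tangent_def coord_vec_def by auto
qed

lemma coord_fun_ex:
  assumes "(U, \<phi>) \<in> A" "p \<in> U"
  obtains x N where "\<And>i. x i \<in> smooth_funs A" "open N" "p \<in> N" "\<And>i q. q \<in> N \<Longrightarrow> x i q = \<phi> q $ i"
proof -
  have "\<exists>h N. h \<in> smooth_funs A \<and> open N \<and> p \<in> N \<and> (\<forall>q\<in>N. h q = \<phi> q $ i)" for i
  proof -
    have "smooth_on (\<lambda>x. x $ i) (\<phi> ` U)"
      by (rule smooth_on_linear[OF bounded_linear_vec_nth chart_open_image[OF assms(1)]])
    then have "smooth_on ((\<lambda>q. \<phi> q $ i) \<circ> inv_into U \<phi>) (\<phi> ` U)"
      by (rule smooth_on_eq[OF _ chart_open_image[OF assms(1)]]) (simp add: chart_inv2)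
    from smooth_extension[OF assms chart_open_image[OF assms(1)] _ _ this] assms(2) show ?thesis by (metis imageI subset_refl)
  qed
  then obtain h N where h: "\<And>i. h i \<in> smooth_funs A" "\<And>i. open (N i)" "\<And>i. p \<in> N i" "\<And>i q. q \<in> N i \<Longrightarrow> h i q = \<phi> q $ i"
    by metis
  show ?thesis
    by (rule that[of h "\<Inter>i. N i"]) (use h in auto)
qed

lemma coord_vec_coord_fun:
  assumes U: "(U, \<phi>) \<in> A" "p \<in> U" and x: "x \<in> smooth_funs A" "open N" "p \<in> N" "\<And>q. q \<in> N \<Longrightarrow> x q = \<phi> q $ j"
  shows "coord_vec A U \<phi> i p x = (if i = j then 1 else 0)"
proof -
  have o: "open (\<phi> ` (U \<inter> N))" by (rule chart_image_open[OF U(1) x(2)])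
  have "((\<lambda>y. y $ j) has_derivative (\<lambda>v. v $ j)) (at (\<phi> p))"
    by (rule bounded_linear_imp_has_derivative[OF bounded_linear_vec_nth])
  then have "((x \<circ> inv_into U \<phi>) has_derivative (\<lambda>v. v $ j)) (at (\<phi> p))"
    by (rule has_derivative_transform_within_open[OF _ o]) (use U x chart_inv[OF U(1)] in auto)
  then show ?thesis unfolding coord_vec_def using x(1)
    by (auto simp: frechet_derivative_at[symmetric] axis_def)
qed

text \<open>By Hadamard's lemma \<open>f\<close> is, near \<open>p\<close>, a constant plus a sum of
  products of \<open>x i - x i p\<close> with smooth functions. Each first factor vanishes at
  \<open>p\<close>, so the Leibniz rule leaves \<open>v (x i)\<close> times the partial derivative
  of \<open>f\<close>.\<close>

lemma tangent_coord_rep: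
  assumes U: "(U, \<phi>) \<in> A" "p \<in> U" and v: "v \<in> tangent A p"
    and x: "\<And>i. x i \<in> smooth_funs A" "open N" "p \<in> N" "\<And>i q. q \<in> N \<Longrightarrow> x i q = \<phi> q $ i"
  shows "v = (\<Sum>i\<in>UNIV. v (x i) *\<^sub>R coord_vec A U \<phi> i p)"
proof (rule tangent_eqI[OF v])
  show "(\<Sum>i\<in>UNIV. v (x i) *\<^sub>R coord_vec A U \<phi> i p) \<in> tangent A p"
    using coord_vec_tangent[OF U] by auto
  fix f assume f: "f \<in> smooth_funs A"
  define F where "F = f \<circ> inv_into U \<phi>"
  obtain e where e: "e > 0" "ball (\<phi> p) e \<subseteq> \<phi> ` U"
    using chart_open_image[OF U(1)] U(2) open_contains_ball by (metis imageI)
  let ?S = "ball (\<phi> p) e"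
  have F: "smooth_on F ?S" unfolding F_def by (rule smooth_on_subset[OF smooth_funsD[OF f U(1)] e(2)])
  obtain G where G: "\<And>b. smooth_on (G b) ?S" "\<And>b. G b (\<phi> p) = frechet_derivative F (at (\<phi> p)) b"
    "\<And>y. y \<in> ?S \<Longrightarrow> F y = F (\<phi> p) + (\<Sum>b\<in>Basis. ((y - \<phi> p) \<bullet> b) * G b y)"
    using hadamard[OF open_ball convex_ball centre_in_ball[THEN iffD2, OF e(1)] F] by blast
  have "\<exists>h M. h \<in> smooth_funs A \<and> open M \<and> p \<in> M \<and> (\<forall>q\<in>M. h q = G (axis i 1) (\<phi> q))" for i
  proof -
    have "smooth_on ((\<lambda>q. G (axis i 1) (\<phi> q)) \<circ> inv_into U \<phi>) ?S"
      by (rule smooth_on_eq[OF G(1)[of "axis i 1"] open_ball]) (use chart_inv2[OF subsetD[OF e(2)]] in simp)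
    from smooth_extension[OF U open_ball _ e(2) this] e(1) show ?thesis by (metis centre_in_ball)
  qed
  then obtain h M where h: "\<And>i. h i \<in> smooth_funs A" "\<And>i. open (M i)" "\<And>i. p \<in> M i"
    "\<And>i q. q \<in> M i \<Longrightarrow> h i q = G (axis i 1) (\<phi> q)" by metis
  define V where "V = {q\<in>U. \<phi> q \<in> ?S} \<inter> N \<inter> (\<Inter>i. M i)"
  have V: "open V" "p \<in> V"
  proof -
    show "open V" unfolding V_def
      by (intro open_Int open_INT chart_vimage_open U x h open_ball) (use h in auto)
    show "p \<in> V" unfolding V_def using U x h e by auto
  qed
  have "v f = v (\<lambda>q. f p + (\<Sum>i\<in>UNIV. (x i q - \<phi> p $ i) * h i q))"
  proof (rule tangent_local[OF v f _ V])
    show "(\<lambda>q. f p + (\<Sum>i\<in>UNIV. (x i q - \<phi> p $ i) * h i q)) \<in> smooth_funs A" using x h by auto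
    fix q assume q: "q \<in> V"
    then have "F (\<phi> q) = F (\<phi> p) + (\<Sum>b\<in>Basis. ((\<phi> q - \<phi> p) \<bullet> b) * G b (\<phi> q))" using G(3) unfolding V_def by blast
    also have "(\<Sum>b\<in>Basis. ((\<phi> q - \<phi> p) \<bullet> b) * G b (\<phi> q)) = (\<Sum>i\<in>UNIV. (\<phi> q $ i - \<phi> p $ i) * G (axis i 1) (\<phi> q))"
    proof -
      have B: "(Basis :: (real^'n) set) = (\<lambda>i. axis i 1) ` UNIV" by (auto simp: Basis_vec_def)
      have "inj (\<lambda>i::'n. axis i (1::real))" by (auto simp: inj_def axis_eq_axis)
      then show ?thesis unfolding B by (simp add: sum.reindex inner_axis)
    qed
    also have "\<dots> = (\<Sum>i\<in>UNIV. (x i q - \<phi> p $ i) * h i q)"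
      using q x h unfolding V_def by (intro sum.cong) auto
    finally show "f q = f p + (\<Sum>i\<in>UNIV. (x i q - \<phi> p $ i) * h i q)"
      using q chart_inv[OF U(1)] U(2) unfolding F_def V_def by auto
  qed
  also have "\<dots> = (\<Sum>i\<in>UNIV. v (\<lambda>q. (x i q - \<phi> p $ i) * h i q))"
    using x h by (subst tangent_add_fun[OF v]) (auto simp: tangent_const[OF v] tangent_sum_fun[OF v])
  also have "\<dots> = (\<Sum>i\<in>UNIV. h i p * v (x i))"
  proof (rule sum.cong[OF refl])
    fix i
    have "v (\<lambda>q. (x i q - \<phi> p $ i) * h i q) = (x i p - \<phi> p $ i) * v (h i) + h i p * v (\<lambda>q. x i q - \<phi> p $ i)"
      using x h by (intro tangent_mult[OF v]) auto
    also have "\<dots> = h i p * v (x i)" using x by (simp add: tangent_diff_fun[OF v] tangent_const[OF v])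
    finally show "v (\<lambda>q. (x i q - \<phi> p $ i) * h i q) = h i p * v (x i)" .
  qed
  also have "\<dots> = (\<Sum>i\<in>UNIV. v (x i) *\<^sub>R coord_vec A U \<phi> i p) f"
    using G(2) h f by (simp add: coord_vec_def F_def scaleR_fun_def sum_fun_apply mult.commute)
  finally show "v f = (\<Sum>i\<in>UNIV. v (x i) *\<^sub>R coord_vec A U \<phi> i p) f" .
qed

end

section \<open>Vector fields\<close>

context smooth_manifold
begin

lemma vf_tangent [simp, intro]: "X \<in> smooth_vfields A \<Longrightarrow> X p \<in> tangent A p"
  unfolding smooth_vfields_def by blast

lemma vf_apply [simp, intro]: "X \<in> smooth_vfields A \<Longrightarrow> f \<in> smooth_funs A \<Longrightarrow> (\<lambda>p. X p f) \<in> smooth_funs A"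
  unfolding smooth_vfields_def by blast

lemma vfI:
  "(\<And>p. X p \<in> tangent A p) \<Longrightarrow> (\<And>f. f \<in> smooth_funs A \<Longrightarrow> (\<lambda>p. X p f) \<in> smooth_funs A) \<Longrightarrow> X \<in> smooth_vfields A"
  unfolding smooth_vfields_def by blast

lemma vf_local:
  assumes "\<And>p. \<exists>V Y. open V \<and> p \<in> V \<and> Y \<in> smooth_vfields A \<and> (\<forall>q\<in>V. X q = Y q)"
  shows "X \<in> smooth_vfields A"
proof (rule vfI)
  show "X p \<in> tangent A p" for p using assms[of p] vf_tangent by metis
  fix f assume f: "f \<in> smooth_funs A"
  show "(\<lambda>p. X p f) \<in> smooth_funs A"
  proof (rule smooth_funs_local)
    fix p
    obtain V Y where "open V" "p \<in> V" "Y \<in> smooth_vfields A" "\<forall>q\<in>V. X q = Y q" using assms[of p] by blast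
    then show "\<exists>V h. open V \<and> p \<in> V \<and> h \<in> smooth_funs A \<and> (\<forall>q\<in>V. X q f = h q)"
      using vf_apply[OF _ f] by (intro exI[of _ V] exI[of _ "\<lambda>q. Y q f"]) auto
  qed
qed

lemma vf_zero [simp, intro]: "(\<lambda>p. 0) \<in> smooth_vfields A"
  by (rule vfI, simp, simp add: zero_fun_def)

lemma vf_add [simp, intro]: "X \<in> smooth_vfields A \<Longrightarrow> Y \<in> smooth_vfields A \<Longrightarrow> (\<lambda>p. X p + Y p) \<in> smooth_vfields A"
  by (rule vfI) auto

lemma vf_scale [simp, intro]: "f \<in> smooth_funs A \<Longrightarrow> X \<in> smooth_vfields A \<Longrightarrow> (\<lambda>p. f p *\<^sub>R X p) \<in> smooth_vfields A"
  by (rule vfI, simp, simp add: scaleR_fun_def)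

lemma vf_scale_const [simp, intro]: "X \<in> smooth_vfields A \<Longrightarrow> (\<lambda>p. c *\<^sub>R X p) \<in> smooth_vfields A"
  by (rule vf_scale[OF smooth_funs_const])

lemma vf_uminus [simp, intro]: "X \<in> smooth_vfields A \<Longrightarrow> (\<lambda>p. - X p) \<in> smooth_vfields A"
  using vf_scale_const[of X "-1"] by simp

lemma vf_diff [simp, intro]: "X \<in> smooth_vfields A \<Longrightarrow> Y \<in> smooth_vfields A \<Longrightarrow> (\<lambda>p. X p - Y p) \<in> smooth_vfields A"
  using vf_add[OF _ vf_uminus, of X Y] by simp

lemma vf_sum [simp, intro]: "(\<And>i. i \<in> I \<Longrightarrow> X i \<in> smooth_vfields A) \<Longrightarrow> (\<lambda>p. \<Sum>i\<in>I. X i p) \<in> smooth_vfields A"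
  by (induction I rule: infinite_finite_induct) auto

lemma vf_apply_local:
  assumes "X \<in> smooth_vfields A" "f \<in> smooth_funs A" "h \<in> smooth_funs A" "open V" "p \<in> V" "\<And>q. q \<in> V \<Longrightarrow> f q = h q"
  shows "X p f = X p h"
  by (rule tangent_local[OF vf_tangent[OF assms(1)] assms(2-6)])

lemma lie_bracket_apply: "lie_bracket X Y p f = X p (\<lambda>q. Y q f) - Y p (\<lambda>q. X q f)"
  by (simp add: lie_bracket_def)

lemma lie_bracket_vf [simp, intro]:
  assumes X: "X \<in> smooth_vfields A" and Y: "Y \<in> smooth_vfields A"
  shows "lie_bracket X Y \<in> smooth_vfields A"
proof (rule vfI)
  fix p
  have t: "X q \<in> tangent A q" "Y q \<in> tangent A q" for q using X Y by auto
  have non: "lie_bracket X Y p f = 0" if "f \<notin> smooth_funs A" for f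
    using tangent_nonsmooth[OF t(1) that] tangent_nonsmooth[OF t(2) that]
      tangent_const[OF t(1), of p 0] tangent_const[OF t(2), of p 0]
    by (simp add: lie_bracket_apply)
  have lin: "lie_bracket X Y p (\<lambda>x. a * f x + b * h x) = a * lie_bracket X Y p f + b * lie_bracket X Y p h"
    if f: "f \<in> smooth_funs A" and h: "h \<in> smooth_funs A" for f h a b
    using tangent_lin[OF t(1) f h] tangent_lin[OF t(2) f h]
      tangent_lin[OF t(1)[of p] vf_apply[OF Y f] vf_apply[OF Y h], of a b]
      tangent_lin[OF t(2)[of p] vf_apply[OF X f] vf_apply[OF X h], of a b]
    by (simp add: lie_bracket_apply algebra_simps)
  have mult: "lie_bracket X Y p (\<lambda>x. f x * h x) = f p * lie_bracket X Y p h + h p * lie_bracket X Y p f"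
    if f: "f \<in> smooth_funs A" and h: "h \<in> smooth_funs A" for f h
  proof -
    have a: "Z p (\<lambda>q. W q (\<lambda>x. f x * h x)) = f p * Z p (\<lambda>q. W q h) + W p h * Z p f + h p * Z p (\<lambda>q. W q f) + W p f * Z p h"
      if Z: "Z \<in> smooth_vfields A" and W: "W \<in> smooth_vfields A" for Z W
    proof -
      have "(\<lambda>q. W q (\<lambda>x. f x * h x)) = (\<lambda>q. f q * W q h + h q * W q f)"
        using tangent_mult[OF vf_tangent[OF W] f h] by auto
      moreover have "Z p (\<lambda>q. f q * W q h + h q * W q f) = Z p (\<lambda>q. f q * W q h) + Z p (\<lambda>q. h q * W q f)"
        by (rule tangent_add_fun[OF vf_tangent[OF Z]]) (use f h W in auto)
      ultimately show ?thesis
        using tangent_mult[OF vf_tangent[OF Z, of p] f vf_apply[OF W h]]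
          tangent_mult[OF vf_tangent[OF Z, of p] h vf_apply[OF W f]] by simp
    qed
    show ?thesis using a[OF X Y] a[OF Y X] by (simp add: lie_bracket_apply algebra_simps)
  qed
  show "lie_bracket X Y p \<in> tangent A p" unfolding tangent_def using non lin mult by blast
next
  fix f assume "f \<in> smooth_funs A"
  then show "(\<lambda>p. lie_bracket X Y p f) \<in> smooth_funs A"
    using X Y unfolding lie_bracket_apply by auto
qed

lemma lie_bracket_antisym: "lie_bracket X Y p = - lie_bracket Y X p"
  by (rule ext) (simp add: lie_bracket_apply uminus_apply)

lemma lie_bracket_add_left:
  assumes "X \<in> smooth_vfields A" "Y \<in> smooth_vfields A" "Z \<in> smooth_vfields A"
  shows "lie_bracket (\<lambda>p. X p + Y p) Z p = lie_bracket X Z p + lie_bracket Y Z p"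
  by (rule tangent_eqI[of _ p])
    (use assms in \<open>auto simp: lie_bracket_apply tangent_add_fun[OF vf_tangent[OF assms(3)]]\<close>)

lemma lie_bracket_scale_left:
  assumes f: "f \<in> smooth_funs A" and X: "X \<in> smooth_vfields A" and Y: "Y \<in> smooth_vfields A"
  shows "lie_bracket (\<lambda>p. f p *\<^sub>R X p) Y p = f p *\<^sub>R lie_bracket X Y p - Y p f *\<^sub>R X p"
proof (rule tangent_eqI[of _ p])
  show "lie_bracket (\<lambda>p. f p *\<^sub>R X p) Y p \<in> tangent A p"
    "f p *\<^sub>R lie_bracket X Y p - Y p f *\<^sub>R X p \<in> tangent A p" using assms by auto
  fix h assume h: "h \<in> smooth_funs A"
  show "lie_bracket (\<lambda>p. f p *\<^sub>R X p) Y p h = (f p *\<^sub>R lie_bracket X Y p - Y p f *\<^sub>R X p) h"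
    using tangent_mult[OF vf_tangent[OF Y, of p] f vf_apply[OF X h]]
    by (simp add: lie_bracket_apply scaleR_fun_def algebra_simps)
qed

lemma lie_bracket_add_right:
  assumes "X \<in> smooth_vfields A" "Y \<in> smooth_vfields A" "Z \<in> smooth_vfields A"
  shows "lie_bracket Z (\<lambda>p. X p + Y p) p = lie_bracket Z X p + lie_bracket Z Y p"
  using lie_bracket_add_left[OF assms, of p] by (subst (1 2 3) lie_bracket_antisym) simp

lemma lie_bracket_scale_right:
  assumes f: "f \<in> smooth_funs A" and X: "X \<in> smooth_vfields A" and Y: "Y \<in> smooth_vfields A"
  shows "lie_bracket X (\<lambda>p. f p *\<^sub>R Y p) p = f p *\<^sub>R lie_bracket X Y p + X p f *\<^sub>R Y p"
  using lie_bracket_scale_left[OF f Y X, of p]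
  by (subst (1 2) lie_bracket_antisym) simp

text \<open>Vector fields are global objects here; coordinate fields become global after
  multiplication by a bump and keep their values near \<open>p\<close>.\<close>

lemma coord_frame_ex:
  assumes U: "(U, \<phi>) \<in> A" "p \<in> U"
  obtains E N where "\<And>i. E i \<in> smooth_vfields A" "open N" "p \<in> N" "N \<subseteq> U"
    "\<And>i q. q \<in> N \<Longrightarrow> E i q = coord_vec A U \<phi> i q"
proof -
  obtain \<theta> N where \<theta>: "\<theta> \<in> smooth_funs A" "open N" "p \<in> N" "\<And>q. q \<in> N \<Longrightarrow> \<theta> q = 1" "closure {q. \<theta> q \<noteq> 0} \<subseteq> U"
    by (rule smooth_bump[OF chart_open[OF U(1)] U(2)]) blast
  define E where "E i q = (if q \<in> U then \<theta> q *\<^sub>R coord_vec A U \<phi> i q else 0)" for i q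
  have "E i \<in> smooth_vfields A" for i
  proof (rule vfI)
    show "E i q \<in> tangent A q" for q unfolding E_def using coord_vec_tangent[OF U(1)] by auto
    fix f assume f: "f \<in> smooth_funs A"
    show "(\<lambda>q. E i q f) \<in> smooth_funs A"
    proof (rule smooth_funsI_local)
      fix q
      show "\<exists>W \<psi> S. (W, \<psi>) \<in> A \<and> q \<in> W \<and> open S \<and> \<psi> q \<in> S \<and> S \<subseteq> \<psi> ` W
          \<and> smooth_on ((\<lambda>q. E i q f) \<circ> inv_into W \<psi>) S"
      proof (cases "q \<in> U")
        case True
        have "smooth_on (\<lambda>x. (\<theta> \<circ> inv_into U \<phi>) x * frechet_derivative (f \<circ> inv_into U \<phi>) (at x) (axis i 1)) (\<phi> ` U)"
          by (intro smooth_on_mult chart_open_image[OF U(1)] smooth_funsD[OF \<theta>(1) U(1)] smooth_on_derivative smooth_funsD[OF f U(1)])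
        then have "smooth_on ((\<lambda>q. E i q f) \<circ> inv_into U \<phi>) (\<phi> ` U)"
          by (rule smooth_on_eq[OF _ chart_open_image[OF U(1)]])
            (use chart_inv[OF U(1)] f in \<open>auto simp: E_def coord_vec_def scaleR_fun_def\<close>)
        then show ?thesis using True U chart_open_image[OF U(1)] by blast
      next
        case False
        obtain W \<psi> where W: "(W, \<psi>) \<in> A" "q \<in> W" by (rule chart_ex)
        let ?K = "closure {q. \<theta> q \<noteq> 0}"
        have o: "open (\<psi> ` (W \<inter> - ?K))" by (rule chart_image_open[OF W(1)]) auto
        have "smooth_on ((\<lambda>q. E i q f) \<circ> inv_into W \<psi>) (\<psi> ` (W \<inter> - ?K))"
        proof (rule smooth_on_eq[OF smooth_on_const[OF o, of 0] o])
          fix x assume "x \<in> \<psi> ` (W \<inter> - ?K)"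
          then obtain r where "r \<in> W" "r \<notin> ?K" "x = \<psi> r" by blast
          then show "((\<lambda>q. E i q f) \<circ> inv_into W \<psi>) x = 0"
            using chart_inv[OF W(1)] closure_subset[of "{q. \<theta> q \<noteq> 0}"]
            by (auto simp: E_def scaleR_fun_def zero_fun_def)
        qed
        then show ?thesis using W o False \<theta>(5) by blast
      qed
    qed
  qed
  moreover have "E i q = coord_vec A U \<phi> i q" if "q \<in> N \<inter> U" for i q using that \<theta>(4) by (simp add: E_def)
  ultimately show ?thesis using that[of E "N \<inter> U"] open_Int[OF \<theta>(2) chart_open[OF U(1)]] \<theta>(3) U by auto
qed

lemma vf_coord_rep:
  obtains E x N where "\<And>i. E i \<in> smooth_vfields A" "\<And>i. x i \<in> smooth_funs A" "open N" "p \<in> N"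
    "\<And>X q. X \<in> smooth_vfields A \<Longrightarrow> q \<in> N \<Longrightarrow> X q = (\<Sum>i\<in>(UNIV::'n set). X q (x i) *\<^sub>R E i q)"
proof -
  obtain U \<phi> where U: "(U, \<phi>) \<in> A" "p \<in> U" by (rule chart_ex)
  obtain E N where E: "\<And>i. E i \<in> smooth_vfields A" "open N" "p \<in> N" "N \<subseteq> U"
    "\<And>i q. q \<in> N \<Longrightarrow> E i q = coord_vec A U \<phi> i q" by (rule coord_frame_ex[OF U]) blast
  obtain x M where x: "\<And>i. x i \<in> smooth_funs A" "open M" "p \<in> M" "\<And>i q. q \<in> M \<Longrightarrow> x i q = \<phi> q $ i"
    by (rule coord_fun_ex[OF U]) blast
  show ?thesis
  proof (rule that[of E x "N \<inter> M"])
    fix X q assume X: "X \<in> smooth_vfields A" and q: "q \<in> N \<inter> M"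
    then have "X q = (\<Sum>i\<in>UNIV. X q (x i) *\<^sub>R coord_vec A U \<phi> i q)"
      using E(4) by (intro tangent_coord_rep[OF U(1) _ vf_tangent[OF X] x(1) x(2) _ x(4)]) auto
    then show "X q = (\<Sum>i\<in>UNIV. X q (x i) *\<^sub>R E i q)" using E(5) q by simp
  qed (use E x in auto)
qed

lemma vf_extension:
  assumes "v \<in> tangent A p" obtains X where "X \<in> smooth_vfields A" "X p = v"
proof -
  obtain U \<phi> where U: "(U, \<phi>) \<in> A" "p \<in> U" by (rule chart_ex)
  obtain E N where E: "\<And>i. E i \<in> smooth_vfields A" "p \<in> N" "\<And>i q. q \<in> N \<Longrightarrow> E i q = coord_vec A U \<phi> i q"
    by (rule coord_frame_ex[OF U]) blast
  obtain x M where x: "\<And>i. x i \<in> smooth_funs A" "open M" "p \<in> M" "\<And>i q. q \<in> M \<Longrightarrow> x i q = \<phi> q $ i"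
    by (rule coord_fun_ex[OF U]) blast
  show ?thesis
    by (rule that[of "\<lambda>q. \<Sum>i\<in>UNIV. v (x i) *\<^sub>R E i q"])
      (use E tangent_coord_rep[OF U assms x] in auto)
qed

lemma extend_vec:
  assumes "v \<in> tangent A p"
  shows extend_vec_vf [simp, intro]: "extend_vec A p v \<in> smooth_vfields A" and extend_vec_at [simp]: "extend_vec A p v p = v"
proof -
  obtain X where "X \<in> smooth_vfields A \<and> X p = v" using vf_extension[OF assms] by blast
  then have "extend_vec A p v \<in> smooth_vfields A \<and> extend_vec A p v p = v"
    unfolding extend_vec_def by (rule someI[of "\<lambda>X. X \<in> smooth_vfields A \<and> X p = v"])
  then show "extend_vec A p v \<in> smooth_vfields A" "extend_vec A p v p = v" by auto
qed

text \<open>A field that vanishes at \<open>p\<close> is a combination of smooth fields with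
  coefficients vanishing at \<open>p\<close>; linearity over functions then annihilates it. The bump
  is needed because a coordinate frame spans near \<open>p\<close> only.\<close>

lemma tensorial:
  fixes F :: "'a vfield \<Rightarrow> 'b::real_vector"
  assumes add: "\<And>X Y. X \<in> smooth_vfields A \<Longrightarrow> Y \<in> smooth_vfields A \<Longrightarrow> F (\<lambda>q. X q + Y q) = F X + F Y"
    and scale: "\<And>f X. f \<in> smooth_funs A \<Longrightarrow> X \<in> smooth_vfields A \<Longrightarrow> F (\<lambda>q. f q *\<^sub>R X q) = f p *\<^sub>R F X"
    and X: "X \<in> smooth_vfields A" and Y: "Y \<in> smooth_vfields A" and eq: "X p = Y p"
  shows "F X = F Y"
proof -
  have zero: "F Z = 0" if Z: "Z \<in> smooth_vfields A" and Zp: "Z p = 0" for Z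
  proof -
    obtain E x N where E: "\<And>i. E i \<in> smooth_vfields A" and x: "\<And>i. x i \<in> smooth_funs A" and N: "open N" "p \<in> N"
      and rep: "\<And>X q. X \<in> smooth_vfields A \<Longrightarrow> q \<in> N \<Longrightarrow> X q = (\<Sum>i\<in>(UNIV::'n set). X q (x i) *\<^sub>R E i q)"
      by (rule vf_coord_rep[of p]) blast
    obtain \<theta> where \<theta>: "\<theta> \<in> smooth_funs A" "\<theta> p = 1" "closure {q. \<theta> q \<noteq> 0} \<subseteq> N"
      by (rule smooth_bump[OF N]) blast
    \<comment> \<open>All coefficients vanish at \<open>p\<close>: \<open>1 - \<theta> p\<close>
      because \<open>\<theta> p = 1\<close>, and \<open>Z p (x i)\<close> because
      \<open>Z p = 0\<close>.\<close>
    have eq: "Z = (\<lambda>q. (1 - \<theta> q) *\<^sub>R Z q + (\<Sum>i\<in>UNIV. (\<theta> q * Z q (x i)) *\<^sub>R E i q))"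
    proof
      fix q
      have "\<theta> q *\<^sub>R Z q = (\<Sum>i\<in>UNIV. (\<theta> q * Z q (x i)) *\<^sub>R E i q)"
      proof (cases "q \<in> N")
        case True
        show ?thesis by (subst rep[OF Z True]) (simp add: scaleR_sum_right)
      next
        case False
        then have "\<theta> q = 0" using \<theta>(3) closure_subset[of "{q. \<theta> q \<noteq> 0}"] by blast
        then show ?thesis by simp
      qed
      then show "Z q = (1 - \<theta> q) *\<^sub>R Z q + (\<Sum>i\<in>UNIV. (\<theta> q * Z q (x i)) *\<^sub>R E i q)"
        by (simp add: algebra_simps)
    qed
    have "F (\<lambda>q. \<Sum>i\<in>I. (\<theta> q * Z q (x i)) *\<^sub>R E i q) = (\<Sum>i\<in>I. (\<theta> p * Z p (x i)) *\<^sub>R F (E i))" if "finite I" for I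
      using that
    proof induction
      case empty
      show ?case using scale[of "\<lambda>q. 0" "E undefined"] E by (simp add: zero_fun_def)
    next
      case (insert i I)
      have "F (\<lambda>q. (\<theta> q * Z q (x i)) *\<^sub>R E i q + (\<Sum>i\<in>I. (\<theta> q * Z q (x i)) *\<^sub>R E i q))
          = F (\<lambda>q. (\<theta> q * Z q (x i)) *\<^sub>R E i q) + F (\<lambda>q. \<Sum>i\<in>I. (\<theta> q * Z q (x i)) *\<^sub>R E i q)"
        using \<theta> Z x E by (intro add) auto
      also have "F (\<lambda>q. (\<theta> q * Z q (x i)) *\<^sub>R E i q) = (\<theta> p * Z p (x i)) *\<^sub>R F (E i)"
        using \<theta> Z x E by (intro scale) auto
      finally show ?case using insert by simp
    qed
    then have s: "F (\<lambda>q. \<Sum>i\<in>UNIV. (\<theta> q * Z q (x i)) *\<^sub>R E i q) = 0"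
      using Zp by (simp add: zero_fun_def)
    have "F Z = F (\<lambda>q. (1 - \<theta> q) *\<^sub>R Z q) + F (\<lambda>q. \<Sum>i\<in>UNIV. (\<theta> q * Z q (x i)) *\<^sub>R E i q)"
      by (subst eq, rule add) (use \<theta> Z x E in auto)
    also have "F (\<lambda>q. (1 - \<theta> q) *\<^sub>R Z q) = (1 - \<theta> p) *\<^sub>R F Z"
      using \<theta> Z by (intro scale) auto
    finally show "F Z = 0" using s \<theta> by simp
  qed
  have "F X = F (\<lambda>q. Y q + (X q - Y q))" by simp
  also have "\<dots> = F Y + F (\<lambda>q. X q - Y q)" by (intro add) (use X Y in auto)
  also have "F (\<lambda>q. X q - Y q) = 0" by (rule zero) (use X Y eq in auto)
  finally show ?thesis by simp
qed

section \<open>Dimension of the tangent spaces\<close>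

lemma tangent_span_coord:
  assumes "(U, \<phi>) \<in> A" "p \<in> U"
  shows "tangent A p = span (range (\<lambda>i. coord_vec A U \<phi> i p))"
proof
  obtain x M where x: "\<And>i. x i \<in> smooth_funs A" "open M" "p \<in> M" "\<And>i q. q \<in> M \<Longrightarrow> x i q = \<phi> q $ i"
    by (rule coord_fun_ex[OF assms]) blast
  show "tangent A p \<subseteq> span (range (\<lambda>i. coord_vec A U \<phi> i p))"
  proof
    fix v assume "v \<in> tangent A p"
    from tangent_coord_rep[OF assms this x]
    show "v \<in> span (range (\<lambda>i. coord_vec A U \<phi> i p))"
      by (metis (no_types, lifting) span_sum span_scale span_base rangeI)
  qed
  show "span (range (\<lambda>i. coord_vec A U \<phi> i p)) \<subseteq> tangent A p"
    by (rule span_minimal[OF _ subspace_tangent]) (use coord_vec_tangent[OF assms] in auto)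
qed

lemma tangent_independent_bound:
  assumes "B \<subseteq> tangent A p" "independent B"
  shows "finite B" "card B \<le> CARD('n)"
proof -
  obtain U \<phi> where U: "(U, \<phi>) \<in> A" "p \<in> U" by (rule chart_ex)
  have "finite B \<and> card B \<le> card (range (\<lambda>i. coord_vec A U \<phi> i p))"
    by (rule independent_span_bound) (use assms tangent_span_coord[OF U] in auto)
  moreover have "card (range (\<lambda>i. coord_vec A U \<phi> i p)) \<le> CARD('n)" by (rule card_image_le) simp
  ultimately show "finite B" "card B \<le> CARD('n)" by auto
qed

text \<open>The coordinate functions are dual to the coordinate vectors, which are therefore
  distinct and independent. Together with their spanning property this fixes the dimension.\<close>

lemma tangent_basis_card:
  assumes B: "B \<subseteq> tangent A p" "independent B" "span B = tangent A p"
  shows "card B = CARD('n)"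
proof -
  obtain U \<phi> where U: "(U, \<phi>) \<in> A" "p \<in> U" by (rule chart_ex)
  obtain x M where x: "\<And>i. x i \<in> smooth_funs A" "open M" "p \<in> M" "\<And>i q. q \<in> M \<Longrightarrow> x i q = \<phi> q $ i"
    by (rule coord_fun_ex[OF U]) blast
  let ?c = "\<lambda>i. coord_vec A U \<phi> i p"
  have dual: "?c i (x j) = (if i = j then 1 else 0)" for i j
    by (rule coord_vec_coord_fun[OF U x(1-3) x(4)])
  have inj: "inj ?c"
  proof (rule injI)
    fix i j assume "?c i = ?c j"
    then have "?c i (x j) = ?c j (x j)" by simp
    then show "i = j" by (simp add: dual split: if_splits)
  qed
  have fin: "finite (range ?c)" by (rule finite_imageI[OF finite])
  have zero: "u (?c j) = 0" if s: "(\<Sum>w\<in>range ?c. u w *\<^sub>R w) = 0" for u j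
  proof -
    have "(\<Sum>i\<in>UNIV. u (?c i) *\<^sub>R ?c i) (x j) = 0" using s inj by (simp add: sum.reindex zero_fun_def)
    then have "(\<Sum>i\<in>UNIV. u (?c i) * ?c i (x j)) = 0" by (simp only: sum_fun_apply scaleR_fun_def real_scaleR_def)
    also have "(\<Sum>i\<in>UNIV. u (?c i) * ?c i (x j)) = (\<Sum>i\<in>UNIV. if i = j then u (?c i) else 0)"
      by (intro sum.cong refl) (simp add: dual)
    also have "\<dots> = u (?c j)" by simp
    finally show ?thesis .
  qed
  have ind: "independent (range ?c)"
    unfolding dependent_finite[OF fin] using zero by fastforce
  have "finite (range ?c) \<and> card (range ?c) \<le> card B"
    proof (rule independent_span_bound[OF tangent_independent_bound(1)[OF B(1,2)] ind])
    show "range ?c \<subseteq> span B" unfolding B(3) using coord_vec_tangent[OF U] by auto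
  qed
  moreover have "card (range ?c) = CARD('n)" using inj by (simp add: card_image)
  ultimately show ?thesis using tangent_independent_bound[OF B(1,2)] by simp
qed

lemma tangent_span_if_card:
  assumes B: "B \<subseteq> tangent A p" "independent B" "card B = CARD('n)"
  shows "span B = tangent A p"
proof
  show "span B \<subseteq> tangent A p" by (rule span_minimal[OF B(1) subspace_tangent])
  show "tangent A p \<subseteq> span B"
  proof
    fix v assume v: "v \<in> tangent A p"
    show "v \<in> span B"
    proof (rule ccontr)
      assume n: "v \<notin> span B"
      have "independent (insert v B)" using independent_insertI[OF n B(2)] .
      moreover have "v \<notin> B" using n span_base by blast
      ultimately show False
        using tangent_independent_bound[of "insert v B" p] tangent_independent_bound[OF B(1,2)] v B by simp
    qed
  qed
qed

end

section \<open>Riemannian metrics and orthonormal frames\<close>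

lemma (in smooth_manifold) tensorial_sum:
  fixes F :: "'a vfield \<Rightarrow> 'b::real_vector"
  assumes add: "\<And>X Y. X \<in> smooth_vfields A \<Longrightarrow> Y \<in> smooth_vfields A \<Longrightarrow> F (\<lambda>q. X q + Y q) = F X + F Y"
    and scale: "\<And>f X. f \<in> smooth_funs A \<Longrightarrow> X \<in> smooth_vfields A \<Longrightarrow> F (\<lambda>q. f q *\<^sub>R X q) = f p *\<^sub>R F X"
    and I: "finite I" "\<And>i. i \<in> I \<Longrightarrow> a i \<in> smooth_funs A" "\<And>i. i \<in> I \<Longrightarrow> X i \<in> smooth_vfields A"
  shows "F (\<lambda>q. \<Sum>i\<in>I. a i q *\<^sub>R X i q) = (\<Sum>i\<in>I. a i p *\<^sub>R F (X i))"
  using I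
proof (induction I)
  case empty
  show ?case using scale[OF smooth_funs_const vf_zero, of 0] by (simp add: zero_fun_def)
next
  case (insert i I)
  have "F (\<lambda>q. a i q *\<^sub>R X i q + (\<Sum>i\<in>I. a i q *\<^sub>R X i q))
      = F (\<lambda>q. a i q *\<^sub>R X i q) + F (\<lambda>q. \<Sum>i\<in>I. a i q *\<^sub>R X i q)"
    by (intro add vf_scale vf_sum) (use insert in auto)
  also have "F (\<lambda>q. a i q *\<^sub>R X i q) = a i p *\<^sub>R F (X i)"
    by (intro scale) (use insert in auto)
  finally show ?case using insert by simp
qed

locale riemannian = smooth_manifold A for A :: "('a::t2_space, 'n::finite) atlas" +
  fixes g :: "'a rmetric"
  assumes metric: "riemannian_metric A g"
begin

lemma g_sym: "u \<in> tangent A p \<Longrightarrow> v \<in> tangent A p \<Longrightarrow> g p u v = g p v u"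
  using metric unfolding riemannian_metric_def by blast

lemma g_lin: "u \<in> tangent A p \<Longrightarrow> v \<in> tangent A p \<Longrightarrow> w \<in> tangent A p
    \<Longrightarrow> g p (a *\<^sub>R u + b *\<^sub>R v) w = a * g p u w + b * g p v w"
  using metric unfolding riemannian_metric_def by blast

lemma g_pos: "u \<in> tangent A p \<Longrightarrow> u \<noteq> 0 \<Longrightarrow> 0 < g p u u"
  using metric unfolding riemannian_metric_def by blast

lemma g_smooth [simp, intro]:
  "X \<in> smooth_vfields A \<Longrightarrow> Y \<in> smooth_vfields A \<Longrightarrow> (\<lambda>p. g p (X p) (Y p)) \<in> smooth_funs A"
  using metric unfolding riemannian_metric_def by blast

lemma g_add_left [simp]: "u \<in> tangent A p \<Longrightarrow> v \<in> tangent A p \<Longrightarrow> w \<in> tangent A p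
    \<Longrightarrow> g p (u + v) w = g p u w + g p v w"
  using g_lin[of u p v w 1 1] by simp

lemma g_zero_left [simp]: "w \<in> tangent A p \<Longrightarrow> g p 0 w = 0"
  using g_lin[of 0 p 0 w 0 0] by simp

lemma g_scale_left [simp]: "u \<in> tangent A p \<Longrightarrow> w \<in> tangent A p \<Longrightarrow> g p (a *\<^sub>R u) w = a * g p u w"
  using g_lin[of u p 0 w a 0] by simp

lemma g_add_right [simp]: "u \<in> tangent A p \<Longrightarrow> v \<in> tangent A p \<Longrightarrow> w \<in> tangent A p
    \<Longrightarrow> g p w (u + v) = g p w u + g p w v"
  using g_sym[of w p "u + v"] g_sym[of w p u] g_sym[of w p v] by simp

lemma g_zero_right [simp]: "w \<in> tangent A p \<Longrightarrow> g p w 0 = 0"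
  using g_sym[of w p 0] by simp

lemma g_scale_right [simp]: "u \<in> tangent A p \<Longrightarrow> w \<in> tangent A p \<Longrightarrow> g p w (a *\<^sub>R u) = a * g p w u"
  using g_sym[of w p u] g_sym[of w p "a *\<^sub>R u"] by simp

lemma g_uminus_left [simp]: "u \<in> tangent A p \<Longrightarrow> w \<in> tangent A p \<Longrightarrow> g p (- u) w = - g p u w"
  using g_scale_left[of u p w "-1"] by simp

lemma g_uminus_right [simp]: "u \<in> tangent A p \<Longrightarrow> w \<in> tangent A p \<Longrightarrow> g p w (- u) = - g p w u"
  using g_scale_right[of u p w "-1"] by simp

lemma g_diff_left [simp]: "u \<in> tangent A p \<Longrightarrow> v \<in> tangent A p \<Longrightarrow> w \<in> tangent A p
    \<Longrightarrow> g p (u - v) w = g p u w - g p v w"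
  using g_add_left[of u p "- v" w] by simp

lemma g_diff_right [simp]: "u \<in> tangent A p \<Longrightarrow> v \<in> tangent A p \<Longrightarrow> w \<in> tangent A p
    \<Longrightarrow> g p w (u - v) = g p w u - g p w v"
  using g_add_right[of u p "- v" w] by simp

lemma g_sum_left: "(\<And>i. i \<in> I \<Longrightarrow> u i \<in> tangent A p) \<Longrightarrow> w \<in> tangent A p
    \<Longrightarrow> g p (\<Sum>i\<in>I. u i) w = (\<Sum>i\<in>I. g p (u i) w)"
  by (induction I rule: infinite_finite_induct) auto

lemma g_sum_right: "(\<And>i. i \<in> I \<Longrightarrow> u i \<in> tangent A p) \<Longrightarrow> w \<in> tangent A p
    \<Longrightarrow> g p w (\<Sum>i\<in>I. u i) = (\<Sum>i\<in>I. g p w (u i))"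
  by (induction I rule: infinite_finite_induct) auto

lemma g_self_eq_0: "u \<in> tangent A p \<Longrightarrow> g p u u = 0 \<Longrightarrow> u = 0"
  using g_pos[of u p] by fastforce

lemma tangent_eqI_g:
  assumes u: "u \<in> tangent A p" and v: "v \<in> tangent A p" and eq: "\<And>w. w \<in> tangent A p \<Longrightarrow> g p u w = g p v w"
  shows "u = v"
proof -
  have "g p (u - v) (u - v) = 0" using eq[of "u - v"] u v by simp
  then show ?thesis using g_self_eq_0[of "u - v" p] u v by simp
qed

lemma vf_eqI_g:
  assumes "X \<in> smooth_vfields A" "Y \<in> smooth_vfields A"
    and "\<And>Z p. Z \<in> smooth_vfields A \<Longrightarrow> g p (X p) (Z p) = g p (Y p) (Z p)"
  shows "X = Y"
proof
  fix p
  show "X p = Y p"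
    by (rule tangent_eqI_g) (use assms(1,2) assms(3)[OF extend_vec_vf, of _ p p] in auto)
qed

section \<open>Orthonormal bases and frames\<close>

definition ON :: "'a \<Rightarrow> ('n \<Rightarrow> 'a tvec) \<Rightarrow> bool"
  where "ON p e \<longleftrightarrow> (\<forall>i. e i \<in> tangent A p) \<and> (\<forall>i j. g p (e i) (e j) = (if i = j then 1 else 0))"

lemma ON_D: "ON p e \<Longrightarrow> e i \<in> tangent A p" "ON p e \<Longrightarrow> g p (e i) (e j) = (if i = j then 1 else 0)"
  unfolding ON_def by auto

lemma orthonormal_inj_independent:
  assumes "finite J" "\<And>i. i \<in> J \<Longrightarrow> e i \<in> tangent A p"
    and on: "\<And>i j. i \<in> J \<Longrightarrow> j \<in> J \<Longrightarrow> g p (e i) (e j) = (if i = j then 1 else 0)"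
  shows "inj_on e J" "independent (e ` J)"
proof -
  show inj: "inj_on e J"
  proof (rule inj_onI)
    fix i j assume "i \<in> J" "j \<in> J" "e i = e j"
    then have "g p (e i) (e j) = 1" using on[of i i] by simp
    then show "i = j" using on[OF \<open>i \<in> J\<close> \<open>j \<in> J\<close>] by (auto split: if_splits)
  qed
  have "u (e j) = 0" if s: "(\<Sum>w\<in>e ` J. u w *\<^sub>R w) = 0" and j: "j \<in> J" for u j
  proof -
    have "0 = g p (\<Sum>i\<in>J. u (e i) *\<^sub>R e i) (e j)"
      using s inj assms(2) j by (simp add: sum.reindex)
    also have "\<dots> = (\<Sum>i\<in>J. u (e i) * g p (e i) (e j))"
      using assms(2) j by (subst g_sum_left) auto
    also have "\<dots> = (\<Sum>i\<in>J. if i = j then u (e i) else 0)"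
      by (intro sum.cong refl) (simp add: on j)
    also have "\<dots> = u (e j)" using assms(1) j by simp
    finally show ?thesis by simp
  qed
  then show "independent (e ` J)"
    unfolding dependent_finite[OF finite_imageI[OF assms(1)]] by fastforce
qed

text \<open>A family in \<open>ON\<close> is indexed by the same type as the coordinates; being
  independent and of the right cardinality, it spans. No spanning condition has to be part of
  \<open>ON\<close>.\<close>

lemma ON_expand:
  assumes e: "ON p e" and v: "v \<in> tangent A p"
  shows "v = (\<Sum>i\<in>UNIV. g p v (e i) *\<^sub>R e i)"
proof -
  have i: "inj_on e UNIV" "independent (e ` UNIV)"
    using orthonormal_inj_independent[of UNIV e p] ON_D[OF e] by auto
  have "span (e ` UNIV) = tangent A p"
    by (rule tangent_span_if_card) (use i ON_D[OF e] in \<open>auto simp: card_image\<close>)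
  then have "v \<in> span (e ` UNIV)" using v by simp
  then obtain u where u: "v = (\<Sum>w\<in>e ` UNIV. u w *\<^sub>R w)"
    using span_finite[of "e ` UNIV"] by auto
  have u': "v = (\<Sum>i\<in>UNIV. u (e i) *\<^sub>R e i)" using u i(1) by (simp add: sum.reindex)
  have "g p v (e j) = u (e j)" for j
  proof -
    have "g p v (e j) = (\<Sum>i\<in>UNIV. u (e i) * g p (e i) (e j))"
      unfolding u' using ON_D(1)[OF e] by (subst g_sum_left) auto
    also have "\<dots> = (\<Sum>i\<in>UNIV. if i = j then u (e i) else 0)"
      by (intro sum.cong refl) (simp add: ON_D(2)[OF e])
    finally show ?thesis by simp
  qed
  then show ?thesis using u' by simp
qed

lemma ON_expand_g:
  assumes e: "ON p e" and v: "v \<in> tangent A p" and w: "w \<in> tangent A p"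
  shows "g p v w = (\<Sum>i\<in>UNIV. g p v (e i) * g p w (e i))"
proof -
  have "g p v w = g p (\<Sum>i\<in>UNIV. g p v (e i) *\<^sub>R e i) w" using ON_expand[OF e v] by simp
  also have "\<dots> = (\<Sum>i\<in>UNIV. g p v (e i) * g p (e i) w)"
    using ON_D(1)[OF e] w by (subst g_sum_left) auto
  finally show ?thesis using g_sym[OF w ON_D(1)[OF e]] by simp
qed

text \<open>Gram-Schmidt, one missing index at a time. A vector outside the span exists as long as
  an index is missing, because fewer than \<open>CARD('n)\<close> independent vectors cannot
  span.\<close>

lemma ON_extend:
  assumes "\<And>i. i \<in> J \<Longrightarrow> f i \<in> tangent A p"
    and "\<And>i j. i \<in> J \<Longrightarrow> j \<in> J \<Longrightarrow> g p (f i) (f j) = (if i = j then 1 else 0)"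
  obtains e where "ON p e" "\<And>i. i \<in> J \<Longrightarrow> e i = f i"
proof -
  have "\<exists>e. ON p e \<and> (\<forall>i\<in>J. e i = f i)"
    using assms
  proof (induction "card (UNIV - J)" arbitrary: J f)
    case 0
    then have "J = UNIV" by (metis Diff_eq_empty_iff card_0_eq finite subset_UNIV subset_antisym)
    then show ?case using 0 by (intro exI[of _ f]) (auto simp: ON_def)
  next
    case (Suc m)
    then obtain k where k: "k \<notin> J" by (metis DiffE card.empty ex_in_conv nat.distinct(1))
    have fin: "finite J" by simp
    note oi = orthonormal_inj_independent[OF fin Suc.prems]
    have "card (f ` J) < CARD('n)"
      using oi(1) k by (metis card_image psubset_card_mono finite UNIV_I subset_UNIV psubsetI)
    then have "span (f ` J) \<noteq> tangent A p"
      using tangent_basis_card[of "f ` J" p] oi(2) Suc.prems(1) by auto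
    moreover have "span (f ` J) \<subseteq> tangent A p"
      by (rule span_minimal[OF _ subspace_tangent]) (use Suc.prems in auto)
    ultimately obtain v where v: "v \<in> tangent A p" "v \<notin> span (f ` J)" by blast
    define w where "w = v - (\<Sum>j\<in>J. g p v (f j) *\<^sub>R f j)"
    have w: "w \<in> tangent A p" unfolding w_def using v Suc.prems(1) by auto
    have "(\<Sum>j\<in>J. g p v (f j) *\<^sub>R f j) \<in> span (f ` J)"
      by (intro span_sum span_scale span_base) auto
    then have "w \<noteq> 0" using v(2) unfolding w_def by auto
    then have pos: "g p w w > 0" using g_pos w by blast
    have orth: "g p w (f i) = 0" if i: "i \<in> J" for i
    proof -
      have "g p (\<Sum>j\<in>J. g p v (f j) *\<^sub>R f j) (f i) = (\<Sum>j\<in>J. g p v (f j) * g p (f j) (f i))"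
        using Suc.prems(1) i by (subst g_sum_left) auto
      also have "\<dots> = (\<Sum>j\<in>J. if j = i then g p v (f j) else 0)"
        by (intro sum.cong refl) (simp add: Suc.prems(2) i)
      also have "\<dots> = g p v (f i)" using i by simp
      finally show ?thesis unfolding w_def using v Suc.prems(1) i by (subst g_diff_left) auto
    qed
    define c where "c = inverse (sqrt (g p w w))"
    have c: "c * (c * g p w w) = 1"
      unfolding c_def using pos real_sqrt_mult_self[of "g p w w"] by (simp add: field_simps)
    define f' where "f' = f(k := c *\<^sub>R w)"
    have f': "f' i = f i" if "i \<in> J" for i using that k unfolding f'_def by auto
    have f'k: "f' k = c *\<^sub>R w" unfolding f'_def by simp
    have "\<exists>e. ON p e \<and> (\<forall>i\<in>insert k J. e i = f' i)"
    proof (rule Suc.hyps(1))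
      have "UNIV - J = insert k (UNIV - insert k J)" using k by auto
      then have "card (UNIV - J) = Suc (card (UNIV - insert k J))" by (metis card_insert_disjoint DiffD2 finite insertI1)
      then show "m = card (UNIV - insert k J)" using Suc.hyps(2) by simp
      show "f' i \<in> tangent A p" if "i \<in> insert k J" for i
        using that f' f'k w Suc.prems(1) by auto
      show "g p (f' i) (f' j) = (if i = j then 1 else 0)" if "i \<in> insert k J" "j \<in> insert k J" for i j
        using that f' f'k w orth c k Suc.prems g_sym[OF w, of "f _"] by auto
    qed
    then show ?case using f' by fastforce
  qed
  then show ?thesis using that by blast
qed

text \<open>Gram-Schmidt with smooth dependence on the point. The fields with index in
  \<open>J\<close> are orthonormal everywhere and stay untouched, which keeps the Reeb fields
  themselves in the frame; the others are corrected and normalised near \<open>p\<close>.\<close>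

lemma frame_extend:
  assumes F: "\<And>i. F i \<in> smooth_vfields A" and on: "ON p (\<lambda>i. F i p)"
    and J: "\<And>i j q. i \<in> J \<Longrightarrow> j \<in> J \<Longrightarrow> g q (F i q) (F j q) = (if i = j then 1 else 0)"
  obtains E W where "\<And>i. E i \<in> smooth_vfields A" "\<And>i. i \<in> J \<Longrightarrow> E i = F i" "open W" "p \<in> W"
    "\<And>q. q \<in> W \<Longrightarrow> ON q (\<lambda>i. E i q)"
proof -
  have "\<exists>E W. (\<forall>i. E i \<in> smooth_vfields A) \<and> (\<forall>i\<in>J. E i = F i) \<and> (\<forall>i. E i p = F i p) \<and> open W \<and> p \<in> W \<and>
      (\<forall>q\<in>W. \<forall>i\<in>J \<union> I. \<forall>j\<in>J \<union> I. g q (E i q) (E j q) = (if i = j then 1 else 0))"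
    if "finite I" "I \<inter> J = {}" for I
    using that
  proof induction
    case empty
    show ?case using F J by (intro exI[of _ F] exI[of _ UNIV]) auto
  next
    case (insert k I)
    then obtain E W where *: "\<forall>i. E i \<in> smooth_vfields A" "\<forall>i\<in>J. E i = F i" "\<forall>i. E i p = F i p"
      "open W" "p \<in> W" "\<forall>q\<in>W. \<forall>i\<in>J \<union> I. \<forall>j\<in>J \<union> I. g q (E i q) (E j q) = (if i = j then 1 else 0)"
      by (metis Int_insert_left insert_not_empty)
    then have E: "\<And>i. E i \<in> smooth_vfields A" "\<And>i. i \<in> J \<Longrightarrow> E i = F i" "\<And>i. E i p = F i p"
      and W: "open W" "p \<in> W"
      and EW: "\<And>q i j. q \<in> W \<Longrightarrow> i \<in> J \<union> I \<Longrightarrow> j \<in> J \<union> I \<Longrightarrow> g q (E i q) (E j q) = (if i = j then 1 else 0)"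
      by blast+
    have k: "k \<notin> J \<union> I" using insert by auto
    define Z where "Z = (\<lambda>q. E k q - (\<Sum>i\<in>J \<union> I. g q (E k q) (E i q) *\<^sub>R E i q))"
    have Z: "Z \<in> smooth_vfields A" unfolding Z_def using E by (intro vf_diff vf_sum vf_scale g_smooth) auto
    \<comment> \<open>At \<open>p\<close> the fields are already orthonormal and nothing is
      subtracted. So \<open>Z\<close> has length 1 at \<open>p\<close> and can be normalised on a
      neighbourhood.\<close>
    have "g p (E k p) (E i p) = 0" if "i \<in> J \<union> I" for i
      using E(3) ON_D(2)[OF on, of k i] k that by auto
    then have Zp: "Z p = E k p" unfolding Z_def by simp
    have orth: "g q (Z q) (E i q) = 0" if q: "q \<in> W" and i: "i \<in> J \<union> I" for q i
    proof -
      have "g q (\<Sum>j\<in>J \<union> I. g q (E k q) (E j q) *\<^sub>R E j q) (E i q)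
          = (\<Sum>j\<in>J \<union> I. g q (E k q) (E j q) * g q (E j q) (E i q))"
        using E(1) by (subst g_sum_left) auto
      also have "\<dots> = (\<Sum>j\<in>J \<union> I. if j = i then g q (E k q) (E j q) else 0)"
        by (intro sum.cong refl) (use EW[OF q _ i] in simp)
      also have "\<dots> = g q (E k q) (E i q)" using i by simp
      finally show ?thesis unfolding Z_def using E(1) by (subst g_diff_left) auto
    qed
    define f where "f = (\<lambda>q. g q (Z q) (Z q))"
    have f: "f \<in> smooth_funs A" unfolding f_def using Z by auto
    have fp: "f p = 1" unfolding f_def Zp E(3) using ON_D(2)[OF on] by simp
    obtain r N where r: "r \<in> smooth_funs A" "open N" "p \<in> N" "\<And>q. q \<in> N \<Longrightarrow> r q = inverse (sqrt (f q))"
      by (rule smooth_local_compose[OF f smooth_on_inverse_sqrt, of p]) (use fp in auto)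
    define N' where "N' = {q. f q > 0}"
    have N': "open N'" "p \<in> N'"
      using continuous_open_preimage[OF smooth_funs_continuous[OF f, of UNIV] open_UNIV, of "{0<..}"] fp
      by (auto simp: N'_def vimage_def)
    define E' where "E' = E(k := (\<lambda>q. r q *\<^sub>R Z q))"
    have E'k: "E' k = (\<lambda>q. r q *\<^sub>R Z q)" unfolding E'_def by simp
    have E'i: "E' i = E i" if "i \<noteq> k" for i using that unfolding E'_def by simp
    have one: "r q * (r q * g q (Z q) (Z q)) = 1" if "q \<in> N \<inter> N'" for q
    proof -
      have f: "f q > 0" "r q = inverse (sqrt (f q))" using that r unfolding N'_def by auto
      then have "r q * sqrt (f q) = 1" by simp
      moreover have "r q * (r q * (sqrt (f q) * sqrt (f q))) = (r q * sqrt (f q)) * (r q * sqrt (f q))"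
        by (simp only: ac_simps)
      moreover have "sqrt (f q) * sqrt (f q) = f q" using f by simp
      ultimately have "r q * (r q * f q) = 1" by simp
      then show ?thesis unfolding f_def .
    qed
    show ?case
    proof (intro exI conjI allI ballI)
      show "E' i \<in> smooth_vfields A" for i using E'k E'i E(1) Z r by (cases "i = k") auto
      show "E' i = F i" if "i \<in> J" for i using that E'i[of i] E(2)[OF that] k by (metis UnI1)
      show "E' i p = F i p" for i
        using E'k E'i E(3) Zp r fp by (cases "i = k") auto
      show "open (W \<inter> N \<inter> N')" "p \<in> W \<inter> N \<inter> N'" using W r N' by auto
      fix q i j assume q: "q \<in> W \<inter> N \<inter> N'" and ij: "i \<in> J \<union> insert k I" "j \<in> J \<union> insert k I"
      have s: "g q (E l q) (Z q) = g q (Z q) (E l q)" for l using g_sym E(1) Z by auto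
      show "g q (E' i q) (E' j q) = (if i = j then 1 else 0)"
        using ij q k E'k E'i EW orth one Z E(1) s by (cases "i = k"; cases "j = k") auto
    qed
  qed
  from this[of "UNIV - J", OF finite Diff_disjoint[THEN trans[OF Int_commute]]] obtain E W where "\<forall>i. E i \<in> smooth_vfields A" "\<forall>i\<in>J. E i = F i" "open W" "p \<in> W"
    "\<forall>q\<in>W. \<forall>i j. g q (E i q) (E j q) = (if i = j then 1 else 0)" by auto
  then show ?thesis using that[of E W] unfolding ON_def by auto
qed

lemma frame_ex:
  obtains E W where "\<And>i. E i \<in> smooth_vfields A" "open W" "p \<in> W" "\<And>q. q \<in> W \<Longrightarrow> ON q (\<lambda>i. E i q)"
proof -
  obtain e where e: "ON p e" by (rule ON_extend[of "{}" _ p]) auto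
  have "ON p (\<lambda>i. extend_vec A p (e i) p)" using e ON_D(1)[OF e] unfolding ON_def by simp
  then show ?thesis
    by (rule frame_extend[of "\<lambda>i. extend_vec A p (e i)" p "{}", OF extend_vec_vf[OF ON_D(1)[OF e]]])
      (use that in auto)
qed

text \<open>In an orthonormal basis the dual vector is the sum of \<open>\<omega> (E i)\<close>
  times \<open>E i\<close>. It is determined pointwise by its scalar products, so a smooth frame
  near each point shows that it is smooth. It produces the covariant derivative and the
  gradient.\<close>

lemma riesz:
  assumes add: "\<And>X Y p. X \<in> smooth_vfields A \<Longrightarrow> Y \<in> smooth_vfields A \<Longrightarrow> \<omega> (\<lambda>q. X q + Y q) p = \<omega> X p + \<omega> Y p"
    and scale: "\<And>f X p. f \<in> smooth_funs A \<Longrightarrow> X \<in> smooth_vfields A \<Longrightarrow> \<omega> (\<lambda>q. f q *\<^sub>R X q) p = f p * \<omega> X p"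
    and smooth: "\<And>X. X \<in> smooth_vfields A \<Longrightarrow> \<omega> X \<in> smooth_funs A"
  obtains W where "W \<in> smooth_vfields A" "\<And>X p. X \<in> smooth_vfields A \<Longrightarrow> g p (W p) (X p) = \<omega> X p"
proof -
  have key: "g q (\<Sum>i\<in>UNIV. \<omega> (E i) q *\<^sub>R E i q) (X q) = \<omega> X q"
    if E: "\<And>i. E i \<in> smooth_vfields A" and on: "ON q (\<lambda>i. E i q)" and X: "X \<in> smooth_vfields A" for E q X
  proof -
    let ?X = "\<lambda>r. \<Sum>i\<in>UNIV. g r (X r) (E i r) *\<^sub>R E i r"
    have X': "?X \<in> smooth_vfields A" using E X by auto
    have "\<omega> X q = \<omega> ?X q"
      by (rule tensorial[where F="\<lambda>X. \<omega> X q", OF _ _ X X'])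
        (use add scale ON_expand[OF on vf_tangent[OF X]] in auto)
    also have "\<omega> ?X q = (\<Sum>i\<in>UNIV. g q (X q) (E i q) *\<^sub>R \<omega> (E i) q)"
      by (rule tensorial_sum[where F="\<lambda>X. \<omega> X q"]) (use add scale E X in auto)
    also have "\<dots> = g q (\<Sum>i\<in>UNIV. \<omega> (E i) q *\<^sub>R E i q) (X q)"
      using E X g_sym by (subst g_sum_left) (auto intro!: sum.cong)
    finally show ?thesis by simp
  qed
  have "\<exists>E. (\<forall>i. E i \<in> smooth_vfields A) \<and> ON p (\<lambda>i. E i p)" for p
    by (rule frame_ex[of p]) blast
  then obtain E where E: "\<And>p i. E p i \<in> smooth_vfields A" "\<And>p. ON p (\<lambda>i. E p i p)" by metis
  define W where "W = (\<lambda>p. \<Sum>i\<in>UNIV. \<omega> (E p i) p *\<^sub>R E p i p)"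
  have Wt: "W p \<in> tangent A p" for p unfolding W_def using E(1) by auto
  have W: "g p (W p) (X p) = \<omega> X p" if "X \<in> smooth_vfields A" for X p
    unfolding W_def by (rule key[OF E(1) E(2) that])
  have "W \<in> smooth_vfields A"
  proof (rule vf_local)
    fix p
    obtain F N where F: "\<And>i. F i \<in> smooth_vfields A" "open N" "p \<in> N" "\<And>q. q \<in> N \<Longrightarrow> ON q (\<lambda>i. F i q)"
      by (rule frame_ex[of p]) blast
    let ?Y = "\<lambda>q. \<Sum>i\<in>UNIV. \<omega> (F i) q *\<^sub>R F i q"
    have "W q = ?Y q" if q: "q \<in> N" for q
    proof (rule tangent_eqI_g[OF Wt])
      show "?Y q \<in> tangent A q" using F(1) by auto
      fix w assume w: "w \<in> tangent A q"
      show "g q (W q) w = g q (?Y q) w"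
        using W[OF extend_vec_vf[OF w], of q] key[OF F(1) F(4)[OF q] extend_vec_vf[OF w]] w by simp
    qed
    moreover have "?Y \<in> smooth_vfields A" using F(1) smooth by auto
    ultimately show "\<exists>V Y. open V \<and> p \<in> V \<and> Y \<in> smooth_vfields A \<and> (\<forall>q\<in>V. W q = Y q)" using F(2,3) by blast
  qed
  then show ?thesis using that W by blast
qed

end

section \<open>The Levi-Civita connection\<close>

context riemannian
begin

abbreviation ip :: "'a vfield \<Rightarrow> 'a vfield \<Rightarrow> 'a \<Rightarrow> real"
  where "ip X Y \<equiv> (\<lambda>p. g p (X p) (Y p))"

lemma vf_add_fun: "X \<in> smooth_vfields A \<Longrightarrow> f \<in> smooth_funs A \<Longrightarrow> h \<in> smooth_funs A
    \<Longrightarrow> X p (\<lambda>q. f q + h q) = X p f + X p h"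
  by (rule tangent_add_fun[OF vf_tangent])

lemma vf_mult_fun: "X \<in> smooth_vfields A \<Longrightarrow> f \<in> smooth_funs A \<Longrightarrow> h \<in> smooth_funs A
    \<Longrightarrow> X p (\<lambda>q. f q * h q) = f p * X p h + h p * X p f"
  by (rule tangent_mult[OF vf_tangent])

lemma ip_sym: "X \<in> smooth_vfields A \<Longrightarrow> Y \<in> smooth_vfields A \<Longrightarrow> ip X Y = ip Y X"
  using g_sym by auto

lemma scaleR_fun_apply: "(r *\<^sub>R f) x = r *\<^sub>R f x"
  by (simp add: scaleR_fun_def)

lemmas koszul_simps = scaleR_fun_apply
  lie_bracket_add_left lie_bracket_add_right lie_bracket_scale_left lie_bracket_scale_right

definition koszul :: "'a vfield \<Rightarrow> 'a vfield \<Rightarrow> 'a vfield \<Rightarrow> 'a \<Rightarrow> real"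
  where "koszul X Y Z p = (X p (ip Y Z) + Y p (ip X Z) - Z p (ip X Y)
    + g p (lie_bracket X Y p) (Z p) - g p (lie_bracket X Z p) (Y p) - g p (lie_bracket Y Z p) (X p)) / 2"

context
  fixes X Y Z :: "'a vfield"
  assumes X: "X \<in> smooth_vfields A" and Y: "Y \<in> smooth_vfields A" and Z: "Z \<in> smooth_vfields A"
begin

lemma koszul_smooth: "koszul X Y Z \<in> smooth_funs A"
proof -
  note a = vf_apply[OF X g_smooth[OF Y Z]] vf_apply[OF Y g_smooth[OF X Z]] vf_apply[OF Z g_smooth[OF X Y]]
  have "(\<lambda>p. (1/2) * (X p (ip Y Z) + Y p (ip X Z) - Z p (ip X Y)
    + g p (lie_bracket X Y p) (Z p) - g p (lie_bracket X Z p) (Y p) - g p (lie_bracket Y Z p) (X p))) \<in> smooth_funs A"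
    by (intro smooth_funs_mult smooth_funs_const smooth_funs_diff smooth_funs_add a g_smooth lie_bracket_vf X Y Z)
  then show ?thesis by (simp add: koszul_def[abs_def])
qed

lemma koszul_add:
  assumes W: "W \<in> smooth_vfields A"
  shows "koszul (\<lambda>q. W q + X q) Y Z p = koszul W Y Z p + koszul X Y Z p"
    and "koszul X (\<lambda>q. W q + Y q) Z p = koszul X W Z p + koszul X Y Z p"
    and "koszul X Y (\<lambda>q. W q + Z q) p = koszul X Y W p + koszul X Y Z p"
  using X Y Z W by (simp_all add: koszul_def koszul_simps vf_add_fun[OF X] vf_add_fun[OF Y]
      vf_add_fun[OF Z] vf_add_fun[OF W] field_simps)

lemma koszul_scale:
  assumes f: "f \<in> smooth_funs A"
  shows "koszul (\<lambda>q. f q *\<^sub>R X q) Y Z p = f p * koszul X Y Z p"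
    and "koszul X (\<lambda>q. f q *\<^sub>R Y q) Z p = f p * koszul X Y Z p + X p f * g p (Y p) (Z p)"
    and "koszul X Y (\<lambda>q. f q *\<^sub>R Z q) p = f p * koszul X Y Z p"
  using X Y Z f g_sym[of "Z p" p "X p"] g_sym[of "Y p" p "X p"] g_sym[of "Z p" p "Y p"]
  by (simp_all add: koszul_def koszul_simps vf_mult_fun[OF X] vf_mult_fun[OF Y] vf_mult_fun[OF Z] field_simps)

lemma koszul_metric: "koszul X Y Z p + koszul X Z Y p = X p (ip Y Z)"
  using X Y Z ip_sym[OF Y Z] g_sym[of "lie_bracket Y Z p" p "X p"] lie_bracket_antisym[of Z Y p]
  by (simp add: koszul_def field_simps)

lemma koszul_torsion: "koszul X Y Z p - koszul Y X Z p = g p (lie_bracket X Y p) (Z p)"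
  using X Y Z ip_sym[OF X Y] lie_bracket_antisym[of Y X p]
  by (simp add: koszul_def field_simps)

end

definition koszul_connection :: "'a connection"
  where "koszul_connection X Y =
    (SOME W. W \<in> smooth_vfields A \<and> (\<forall>Z\<in>smooth_vfields A. \<forall>p. g p (W p) (Z p) = koszul X Y Z p))"

lemma koszul_connection:
  assumes X: "X \<in> smooth_vfields A" and Y: "Y \<in> smooth_vfields A"
  shows koszul_connection_vf: "koszul_connection X Y \<in> smooth_vfields A"
    and koszul_connection_g: "Z \<in> smooth_vfields A \<Longrightarrow> g p (koszul_connection X Y p) (Z p) = koszul X Y Z p"
proof -
  obtain W where "W \<in> smooth_vfields A" "\<And>Z p. Z \<in> smooth_vfields A \<Longrightarrow> g p (W p) (Z p) = koszul X Y Z p"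
    using riesz[of "koszul X Y", OF koszul_add(3)[OF X Y] koszul_scale(3)[OF X Y] koszul_smooth[OF X Y]] by auto
  then have "W \<in> smooth_vfields A \<and> (\<forall>Z\<in>smooth_vfields A. \<forall>p. g p (W p) (Z p) = koszul X Y Z p)" by blast
  then have "koszul_connection X Y \<in> smooth_vfields A \<and>
      (\<forall>Z\<in>smooth_vfields A. \<forall>p. g p (koszul_connection X Y p) (Z p) = koszul X Y Z p)"
    unfolding koszul_connection_def
    by (rule someI[of "\<lambda>W. W \<in> smooth_vfields A \<and> (\<forall>Z\<in>smooth_vfields A. \<forall>p. g p (W p) (Z p) = koszul X Y Z p)"])
  then show "koszul_connection X Y \<in> smooth_vfields A"
    "Z \<in> smooth_vfields A \<Longrightarrow> g p (koszul_connection X Y p) (Z p) = koszul X Y Z p" by auto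
qed

lemma vf_plus_eq: "X + Y = (\<lambda>p. X p + Y p)" for X Y :: "'a vfield"
  by (rule ext) (simp only: plus_fun_apply)

text \<open>\<open>levi_civita\<close> is defined by choice and means something only once a witness
  exists. Each axiom is checked against all smooth fields \<open>Z\<close>, where it becomes an
  identity for \<open>koszul\<close>.\<close>

lemma koszul_connection_levi_civita:
  "affine_connection A koszul_connection" "metric_compatible A g koszul_connection" "torsion_free A koszul_connection"
proof -
  note [simp] = koszul_connection_vf koszul_connection_g
  show "affine_connection A koszul_connection"
    unfolding affine_connection_def vf_plus_eq
  proof (intro ballI conjI)
    fix X Y Z f assume XYZ [simp]: "X \<in> smooth_vfields A" "Y \<in> smooth_vfields A" "Z \<in> smooth_vfields A" and f [simp]: "f \<in> smooth_funs A"
    show "koszul_connection X Y \<in> smooth_vfields A" by simp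
    show "koszul_connection (\<lambda>p. X p + Y p) Z = (\<lambda>p. koszul_connection X Z p + koszul_connection Y Z p)"
      by (rule vf_eqI_g) (simp_all add: koszul_add)
    show "koszul_connection (\<lambda>p. f p *\<^sub>R X p) Y = (\<lambda>p. f p *\<^sub>R koszul_connection X Y p)"
      by (rule vf_eqI_g) (simp_all add: koszul_scale)
    show "koszul_connection X (\<lambda>p. Y p + Z p) = (\<lambda>p. koszul_connection X Y p + koszul_connection X Z p)"
      by (rule vf_eqI_g) (simp_all add: koszul_add)
    show "koszul_connection X (\<lambda>p. f p *\<^sub>R Y p) = (\<lambda>p. X p f *\<^sub>R Y p + f p *\<^sub>R koszul_connection X Y p)"
      by (rule vf_eqI_g) (simp_all add: koszul_scale)
  qed
  show "metric_compatible A g koszul_connection"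
    unfolding metric_compatible_def
  proof (intro ballI allI)
    fix X Y Z p assume XYZ [simp]: "X \<in> smooth_vfields A" "Y \<in> smooth_vfields A" "Z \<in> smooth_vfields A"
    show "X p (ip Y Z) = g p (koszul_connection X Y p) (Z p) + g p (Y p) (koszul_connection X Z p)"
      using koszul_metric[OF XYZ, of p] g_sym[of "Y p" p "koszul_connection X Z p"] by simp
  qed
  show "torsion_free A koszul_connection"
    unfolding torsion_free_def fun_diff_def[where 'a='a]
  proof (intro ballI)
    fix X Y assume XY [simp]: "X \<in> smooth_vfields A" "Y \<in> smooth_vfields A"
    show "(\<lambda>p. koszul_connection X Y p - koszul_connection Y X p) = lie_bracket X Y"
      by (rule vf_eqI_g) (simp_all add: koszul_torsion)
  qed
qed

abbreviation LC :: "'a connection" where "LC \<equiv> levi_civita A g"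

lemma levi_civita:
  shows levi_civita_affine: "affine_connection A LC"
    and levi_civita_metric: "metric_compatible A g LC"
    and levi_civita_torsion_free: "torsion_free A LC"
proof -
  have "affine_connection A LC \<and> metric_compatible A g LC \<and> torsion_free A LC"
    unfolding levi_civita_def
    by (rule someI[of "\<lambda>n. affine_connection A n \<and> metric_compatible A g n \<and> torsion_free A n" koszul_connection])
      (use koszul_connection_levi_civita in blast)
  then show "affine_connection A LC" "metric_compatible A g LC" "torsion_free A LC" by auto
qed

lemma koszul_formula:
  assumes nab: "affine_connection A nab" "metric_compatible A g nab" "torsion_free A nab"
    and XYZ: "X \<in> smooth_vfields A" "Y \<in> smooth_vfields A" "Z \<in> smooth_vfields A"
  shows "g p (nab X Y p) (Z p) = koszul X Y Z p"
proof -
  have vf [simp]: "nab V W \<in> smooth_vfields A" if "V \<in> smooth_vfields A" "W \<in> smooth_vfields A" for V W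
    using nab(1) that smooth_funs_const unfolding affine_connection_def by blast
  have met: "V p (ip W U) = g p (nab V W p) (U p) + g p (W p) (nab V U p)"
    if "V \<in> smooth_vfields A" "W \<in> smooth_vfields A" "U \<in> smooth_vfields A" for V W U
    using nab(2) that unfolding metric_compatible_def by blast
  have tor: "lie_bracket V W p = nab V W p - nab W V p"
    if "V \<in> smooth_vfields A" "W \<in> smooth_vfields A" for V W
    using nab(3) that unfolding torsion_free_def by (metis minus_apply)
  show ?thesis
    using XYZ g_sym[of "nab Y X p" p "Z p"] g_sym[of "nab X Z p" p "Y p"] g_sym[of "nab Z X p" p "Y p"]
      g_sym[of "nab Z Y p" p "X p"] g_sym[of "nab Y Z p" p "X p"]
    by (simp add: koszul_def met tor field_simps)
qed

text \<open>Both connections satisfy the Koszul formula. Later this recognises the Levi-Civita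
  connection of the deformed metric.\<close>

lemma levi_civita_unique:
  assumes nab: "affine_connection A nab" "metric_compatible A g nab" "torsion_free A nab"
    and XY: "X \<in> smooth_vfields A" "Y \<in> smooth_vfields A"
  shows "nab X Y = LC X Y"
proof (rule vf_eqI_g)
  show "nab X Y \<in> smooth_vfields A" "LC X Y \<in> smooth_vfields A"
    using nab(1) levi_civita_affine XY smooth_funs_const unfolding affine_connection_def by blast+
  show "g p (nab X Y p) (Z p) = g p (LC X Y p) (Z p)" if "Z \<in> smooth_vfields A" for Z p
    using koszul_formula[OF nab XY that] koszul_formula[OF levi_civita XY that] by simp
qed

end

section \<open>Connections and curvature\<close>

locale connection = smooth_manifold A for A :: "('a::t2_space, 'n::finite) atlas" +
  fixes nab :: "'a connection"
  assumes affine: "affine_connection A nab"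
begin

lemma nab_vf [simp, intro]: "X \<in> smooth_vfields A \<Longrightarrow> Y \<in> smooth_vfields A \<Longrightarrow> nab X Y \<in> smooth_vfields A"
  using affine smooth_funs_const unfolding affine_connection_def by blast

lemma vf_plus_eq': "X + Y = (\<lambda>p. X p + Y p)" for X Y :: "'a vfield"
  by (rule ext) (simp only: plus_fun_apply)

lemma
  assumes X: "X \<in> smooth_vfields A" and Y: "Y \<in> smooth_vfields A"
  shows nab_add_left: "Z \<in> smooth_vfields A \<Longrightarrow> nab (\<lambda>p. X p + Z p) Y = (\<lambda>p. nab X Y p + nab Z Y p)"
    and nab_scale_left: "f \<in> smooth_funs A \<Longrightarrow> nab (\<lambda>p. f p *\<^sub>R X p) Y = (\<lambda>p. f p *\<^sub>R nab X Y p)"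
    and nab_add_right: "Z \<in> smooth_vfields A \<Longrightarrow> nab X (\<lambda>p. Y p + Z p) = (\<lambda>p. nab X Y p + nab X Z p)"
    and nab_scale_right: "f \<in> smooth_funs A \<Longrightarrow> nab X (\<lambda>p. f p *\<^sub>R Y p) = (\<lambda>p. X p f *\<^sub>R Y p + f p *\<^sub>R nab X Y p)"
  using affine X Y smooth_funs_const unfolding affine_connection_def vf_plus_eq' by blast+

lemma nab_diff_left:
  assumes X: "X \<in> smooth_vfields A" and Y: "Y \<in> smooth_vfields A" and Z: "Z \<in> smooth_vfields A"
  shows "nab (\<lambda>p. Y p - Z p) X = (\<lambda>p. nab Y X p - nab Z X p)"
  using nab_add_left[OF Y X vf_uminus[OF Z]] nab_scale_left[OF Z X smooth_funs_const, of "-1"] by simp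

lemma nab_local_left:
  assumes "X \<in> smooth_vfields A" "X' \<in> smooth_vfields A" "Y \<in> smooth_vfields A" "X p = X' p"
  shows "nab X Y p = nab X' Y p"
  by (rule tensorial[where F="\<lambda>X. nab X Y p", OF _ _ assms(1,2,4)])
    (use assms in \<open>auto simp: nab_add_left nab_scale_left\<close>)

definition Rm :: "'a vfield \<Rightarrow> 'a vfield \<Rightarrow> 'a vfield \<Rightarrow> 'a \<Rightarrow> 'a tvec"
  where "Rm X Y Z p = nab Y (nab X Z) p - nab X (nab Y Z) p + nab (lie_bracket X Y) Z p"

lemma Rm_vf [simp, intro]:
  "X \<in> smooth_vfields A \<Longrightarrow> Y \<in> smooth_vfields A \<Longrightarrow> Z \<in> smooth_vfields A \<Longrightarrow> Rm X Y Z \<in> smooth_vfields A"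
  unfolding Rm_def[abs_def] by auto

lemma Rm_antisym:
  assumes "X \<in> smooth_vfields A" "Y \<in> smooth_vfields A" "Z \<in> smooth_vfields A"
  shows "Rm X Y Z p = - Rm Y X Z p"
proof -
  have "lie_bracket Y X = (\<lambda>p. (-1) *\<^sub>R lie_bracket X Y p)" using lie_bracket_antisym[of Y X] by auto
  then have "nab (lie_bracket Y X) Z p = - nab (lie_bracket X Y) Z p"
    using nab_scale_left[OF lie_bracket_vf[OF assms(1,2)] assms(3) smooth_funs_const, of "-1"] by simp
  then show ?thesis by (simp add: Rm_def)
qed

lemma Rm_add_left:
  assumes "X \<in> smooth_vfields A" "X' \<in> smooth_vfields A" "Y \<in> smooth_vfields A" "Z \<in> smooth_vfields A"
  shows "Rm (\<lambda>q. X q + X' q) Y Z p = Rm X Y Z p + Rm X' Y Z p"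
proof -
  have "lie_bracket (\<lambda>q. X q + X' q) Y = (\<lambda>q. lie_bracket X Y q + lie_bracket X' Y q)"
    using lie_bracket_add_left[OF assms(1-3)] by auto
  then show ?thesis using assms by (simp add: Rm_def nab_add_left nab_add_right)
qed

lemma Rm_scale_left:
  assumes f: "f \<in> smooth_funs A" and XYZ: "X \<in> smooth_vfields A" "Y \<in> smooth_vfields A" "Z \<in> smooth_vfields A"
  shows "Rm (\<lambda>q. f q *\<^sub>R X q) Y Z p = f p *\<^sub>R Rm X Y Z p"
proof -
  have "lie_bracket (\<lambda>q. f q *\<^sub>R X q) Y = (\<lambda>q. f q *\<^sub>R lie_bracket X Y q - Y q f *\<^sub>R X q)"
    using lie_bracket_scale_left[OF f XYZ(1,2)] by auto
  moreover have "nab (\<lambda>q. f q *\<^sub>R lie_bracket X Y q - Y q f *\<^sub>R X q) Z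
      = (\<lambda>q. f q *\<^sub>R nab (lie_bracket X Y) Z q - Y q f *\<^sub>R nab X Z q)"
    using f XYZ by (subst nab_diff_left) (auto simp: nab_scale_left)
  ultimately show ?thesis using f XYZ
    by (simp add: Rm_def nab_scale_left nab_scale_right scaleR_right_distrib scaleR_right_diff_distrib)
qed

lemma Rm_add_right:
  assumes "X \<in> smooth_vfields A" "Y \<in> smooth_vfields A" "Z \<in> smooth_vfields A" "Z' \<in> smooth_vfields A"
  shows "Rm X Y (\<lambda>q. Z q + Z' q) p = Rm X Y Z p + Rm X Y Z' p"
  using assms by (simp add: Rm_def nab_add_left nab_add_right)

text \<open>The second derivatives of \<open>f\<close> form a commutator, which cancels against the
  derivative of \<open>f\<close> along the bracket.\<close>

lemma Rm_scale_right:
  assumes f: "f \<in> smooth_funs A" and XYZ: "X \<in> smooth_vfields A" "Y \<in> smooth_vfields A" "Z \<in> smooth_vfields A"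
  shows "Rm X Y (\<lambda>q. f q *\<^sub>R Z q) p = f p *\<^sub>R Rm X Y Z p"
proof -
  have *: "nab V (\<lambda>q. W q f *\<^sub>R Z q + f q *\<^sub>R nab W Z q) p
      = V p (\<lambda>q. W q f) *\<^sub>R Z p + W p f *\<^sub>R nab V Z p + V p f *\<^sub>R nab W Z p + f p *\<^sub>R nab V (nab W Z) p"
    if "V \<in> smooth_vfields A" "W \<in> smooth_vfields A" for V W
    using that f XYZ by (subst nab_add_right) (auto simp: nab_scale_right)
  show ?thesis using f XYZ
    by (simp add: Rm_def nab_scale_right * lie_bracket_apply algebra_simps)
qed

text \<open>Tensoriality in the first and third arguments, and antisymmetry for the second. Hence
  the arbitrary extensions chosen in \<open>curvature\<close> are immaterial.\<close>

lemma Rm_cong: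
  assumes "X \<in> smooth_vfields A" "Y \<in> smooth_vfields A" "Z \<in> smooth_vfields A"
    and "X' \<in> smooth_vfields A" "Y' \<in> smooth_vfields A" "Z' \<in> smooth_vfields A"
    and "X p = X' p" "Y p = Y' p" "Z p = Z' p"
  shows "Rm X Y Z p = Rm X' Y' Z' p"
proof -
  have left: "Rm V Y Z p = Rm V' Y Z p"
    if "V \<in> smooth_vfields A" "V' \<in> smooth_vfields A" "V p = V' p" "Y \<in> smooth_vfields A" "Z \<in> smooth_vfields A" for V V' Y Z
    by (rule tensorial[where F="\<lambda>X. Rm X Y Z p", OF _ _ that(1-3)])
      (use that in \<open>auto simp: Rm_add_left Rm_scale_left\<close>)
  have "Rm X Y Z p = Rm X' Y Z p" using assms by (intro left) auto
  also have "\<dots> = - Rm Y X' Z p" using assms by (intro Rm_antisym) auto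
  also have "Rm Y X' Z p = Rm Y' X' Z p" using assms by (intro left) auto
  also have "- Rm Y' X' Z p = Rm X' Y' Z p" using Rm_antisym[of X' Y' Z p] assms by simp
  also have "Rm X' Y' Z p = Rm X' Y' Z' p"
    by (rule tensorial[where F="\<lambda>Z. Rm X' Y' Z p", OF _ _ assms(3,6,9)])
      (use assms in \<open>auto simp: Rm_add_right Rm_scale_right\<close>)
  finally show ?thesis .
qed

lemma curvature_eq_Rm:
  assumes "X \<in> smooth_vfields A" "Y \<in> smooth_vfields A" "Z \<in> smooth_vfields A"
  shows "curvature A nab p (X p) (Y p) (Z p) = Rm X Y Z p"
proof -
  have "curvature A nab p (X p) (Y p) (Z p) = Rm (extend_vec A p (X p)) (extend_vec A p (Y p)) (extend_vec A p (Z p)) p"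
    by (simp add: curvature_def Rm_def Let_def)
  also have "\<dots> = Rm X Y Z p" by (rule Rm_cong) (use assms in auto)
  finally show ?thesis .
qed

end

section \<open>Change of variables for nonnegative integrals\<close>

text \<open>The library proves the change of variables formula only for well-ordered index types,
  so it is transported along the following well-ordered copy of a finite type.\<close>

typedef 'a ordered_copy = "UNIV :: 'a set"
  morphisms of_copy to_copy by simp

lemma bij_of_copy: "bij of_copy"
  by (metis UNIV_I bijI' of_copy_inject of_copy_inverse to_copy_inverse)

instance ordered_copy :: (finite) finite
proof
  show "finite (UNIV :: 'a ordered_copy set)"
    using bij_of_copy bij_is_inj finite_imageD[of of_copy UNIV] by (metis finite bij_betw_def)
qed

definition finite_code :: "'a::finite \<Rightarrow> nat" where "finite_code = (SOME f. inj f)"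

lemma inj_finite_code: "inj finite_code"
proof -
  have "\<exists>f :: 'a \<Rightarrow> nat. inj f" using finite_imp_inj_to_nat_seg[of "UNIV :: 'a set"] by auto
  then show ?thesis unfolding finite_code_def by (rule someI_ex)
qed

instantiation ordered_copy :: (finite) wellorder
begin

definition less_eq_ordered_copy :: "'a ordered_copy \<Rightarrow> 'a ordered_copy \<Rightarrow> bool"
  where "x \<le> y \<longleftrightarrow> finite_code (of_copy x) \<le> finite_code (of_copy y)"

definition less_ordered_copy :: "'a ordered_copy \<Rightarrow> 'a ordered_copy \<Rightarrow> bool"
  where "x < y \<longleftrightarrow> finite_code (of_copy x) < finite_code (of_copy y)"

instance
proof
  fix x y z :: "'a ordered_copy"
  show "x \<le> y \<Longrightarrow> y \<le> x \<Longrightarrow> x = y"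
    unfolding less_eq_ordered_copy_def using inj_finite_code by (metis injD of_copy_inject order_antisym)
  fix P :: "'a ordered_copy \<Rightarrow> bool" and a
  assume h: "\<And>x. (\<And>y. y < x \<Longrightarrow> P y) \<Longrightarrow> P x"
  show "P a"
    by (rule measure_induct_rule[of "\<lambda>a. finite_code (of_copy a)" P], rule h, simp add: less_ordered_copy_def)
qed (auto simp: less_eq_ordered_copy_def less_ordered_copy_def)

end

text \<open>Conjugation by \<open>f\<close> is a sign-preserving bijection between the permutations
  of the two index types.\<close>

lemma det_reindex:
  fixes M :: "real ^ 'n ^ 'n" and f :: "'m::finite \<Rightarrow> 'n::finite"
  assumes "bij f"
  shows "det (\<chi> i j. M $ f i $ f j) = det M"
proof -
  have f: "inj f" "surj f" using assms by (auto simp: bij_def)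
  have mp: "map_permutation UNIV f p = f \<circ> p \<circ> inv f" for p
    using f by (simp add: map_permutation_def restrict_id_def fun_eq_iff)
  have "det M = (\<Sum>p | p permutes (UNIV :: 'n set). of_int (sign p) * (\<Prod>i\<in>UNIV. M $ i $ p i))"
    by (simp add: det_def)
  also have "\<dots> = (\<Sum>p | p permutes (UNIV :: 'm set). of_int (sign (f \<circ> p \<circ> inv f)) * (\<Prod>i\<in>UNIV. M $ i $ (f \<circ> p \<circ> inv f) i))"
  proof (rule sum.reindex_bij_witness[where i="\<lambda>p. f \<circ> p \<circ> inv f" and j="\<lambda>p. inv f \<circ> p \<circ> f"])
    fix p :: "'n \<Rightarrow> 'n" assume p: "p \<in> {p. p permutes UNIV}"
    show e: "f \<circ> (inv f \<circ> p \<circ> f) \<circ> inv f = p" using f by (auto simp: fun_eq_iff surj_f_inv_f)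
    show "inv f \<circ> p \<circ> f \<in> {p. p permutes UNIV}"
      using map_permutation_permutes[of "inv f" UNIV UNIV p] bij_imp_bij_inv[OF assms] p
      by (simp add: map_permutation_def restrict_id_def inv_inv_eq[OF assms] bij_is_surj o_def)
    show "of_int (sign (f \<circ> (inv f \<circ> p \<circ> f) \<circ> inv f)) * (\<Prod>i\<in>UNIV. M $ i $ (f \<circ> (inv f \<circ> p \<circ> f) \<circ> inv f) i)
        = of_int (sign p) * (\<Prod>i\<in>UNIV. M $ i $ p i)" unfolding e ..
  next
    fix p :: "'m \<Rightarrow> 'm" assume p: "p \<in> {p. p permutes UNIV}"
    show "inv f \<circ> (f \<circ> p \<circ> inv f) \<circ> f = p" using f by (auto simp: fun_eq_iff)
    show "f \<circ> p \<circ> inv f \<in> {p. p permutes UNIV}"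
      using map_permutation_permutes[of f UNIV UNIV p] assms p by (simp add: mp)
  qed
  also have "\<dots> = (\<Sum>p | p permutes (UNIV :: 'm set). of_int (sign p) * (\<Prod>i\<in>UNIV. M $ f i $ f (p i)))"
  proof (rule sum.cong[OF refl])
    fix p :: "'m \<Rightarrow> 'm" assume p: "p \<in> {p. p permutes UNIV}"
    have "sign (f \<circ> p \<circ> inv f) = sign p"
      using sign_map_permutation[of f UNIV p] f p by (simp add: mp)
    moreover have "(\<Prod>i\<in>UNIV. M $ i $ (f \<circ> p \<circ> inv f) i) = (\<Prod>i\<in>UNIV. M $ f i $ f (p i))"
      using f by (subst prod.reindex_bij_betw[OF assms, symmetric]) simp
    ultimately show "of_int (sign (f \<circ> p \<circ> inv f)) * (\<Prod>i\<in>UNIV. M $ i $ (f \<circ> p \<circ> inv f) i)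
        = of_int (sign p) * (\<Prod>i\<in>UNIV. M $ f i $ f (p i))" by simp
  qed
  also have "\<dots> = det (\<chi> i j. M $ f i $ f j)" by (simp add: det_def)
  finally show ?thesis by simp
qed

lemma lborel_distr_reindex:
  fixes f :: "'m::finite \<Rightarrow> 'n::finite"
  assumes "bij f"
  shows "distr lborel borel (\<lambda>x :: real ^ 'n. \<chi> i. x $ f i) = (lborel :: (real ^ 'm) measure)"
proof (rule lborel_eqI[symmetric])
  let ?P = "\<lambda>x :: real ^ 'n. (\<chi> i. x $ f i) :: real ^ 'm"
  have P: "?P \<in> borel \<rightarrow>\<^sub>M borel" by (intro borel_measurable_continuous_onI continuous_intros)
  have f: "inj f" "surj f" using assms by (auto simp: bij_def)
  fix l u :: "real ^ 'm" assume lu: "\<And>b. b \<in> Basis \<Longrightarrow> l \<bullet> b \<le> u \<bullet> b"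
  let ?l = "(\<chi> i. l $ inv f i) :: real ^ 'n" and ?u = "(\<chi> i. u $ inv f i) :: real ^ 'n"
  have pre: "?P -` box l u = box ?l ?u"
    using f by (auto simp: box_def Basis_vec_def inner_axis) (metis surj_f_inv_f inv_f_f)+
  have le: "l $ i \<le> u $ i" for i using lu[of "axis i 1"] by (simp add: inner_axis)
  have "emeasure (distr lborel borel ?P) (box l u) = emeasure lborel (box ?l ?u)"
    using P by (subst emeasure_distr) (auto simp: pre)
  also have "\<dots> = (\<Prod>b\<in>Basis. (?u - ?l) \<bullet> b)"
    by (rule emeasure_lborel_box) (use le in \<open>auto simp: Basis_vec_def inner_axis\<close>)
  also have "(\<Prod>b\<in>Basis. (?u - ?l) \<bullet> b) = (\<Prod>i\<in>UNIV. u $ inv f i - l $ inv f i)"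
  proof -
    have B: "(Basis :: (real^'n) set) = (\<lambda>i. axis i 1) ` UNIV" by (auto simp: Basis_vec_def)
    have "inj (\<lambda>i::'n. axis i (1::real))" by (auto simp: inj_def axis_eq_axis)
    then show ?thesis unfolding B by (simp add: prod.reindex inner_axis)
  qed
  also have "\<dots> = (\<Prod>i\<in>UNIV. u $ i - l $ i)"
    using f by (subst prod.reindex_bij_betw[OF assms, symmetric]) simp
  also have "\<dots> = (\<Prod>b\<in>Basis. (u - l) \<bullet> b)"
  proof -
    have B: "(Basis :: (real^'m) set) = (\<lambda>i. axis i 1) ` UNIV" by (auto simp: Basis_vec_def)
    have "inj (\<lambda>i::'m. axis i (1::real))" by (auto simp: inj_def axis_eq_axis)
    then show ?thesis unfolding B by (simp add: prod.reindex inner_axis)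
  qed
  finally show "emeasure (distr lborel borel ?P) (box l u) = (\<Prod>b\<in>Basis. (u - l) \<bullet> b)" .
qed simp

text \<open>Derived from the formula for absolutely integrable vector-valued functions, applied to
  \<open>h\<close> times a fixed unit vector. If one side is finite, absolute integrability passes
  to the other and the values agree; otherwise both sides are infinite.\<close>

lemma change_of_variables_wellorder:
  fixes \<tau> :: "real ^ 'm::{finite,wellorder} \<Rightarrow> real ^ 'm::_" and h :: "real ^ 'm::_ \<Rightarrow> real"
  assumes B: "B \<in> sets borel" "\<tau> ` B \<in> sets borel"
    and der: "\<And>x. x \<in> B \<Longrightarrow> (\<tau> has_derivative \<tau>' x) (at x within B)" and inj: "inj_on \<tau> B"
    and h: "h \<in> borel_measurable borel" "\<And>x. 0 \<le> h x"
    and m: "(\<lambda>x. \<bar>det (matrix (\<tau>' x))\<bar> * h (\<tau> x) * indicator B x) \<in> borel_measurable borel"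
  shows "(\<integral>\<^sup>+x. ennreal (h x * indicator (\<tau> ` B) x) \<partial>lborel)
    = (\<integral>\<^sup>+x. ennreal (\<bar>det (matrix (\<tau>' x))\<bar> * h (\<tau> x) * indicator B x) \<partial>lborel)"
proof -
  let ?J = "\<lambda>x. \<bar>det (matrix (\<tau>' x))\<bar> * h (\<tau> x)"
  let ?v = "axis undefined 1 :: real ^ 'm::_"
  have comp: "(\<lambda>x. k x *\<^sub>R ?v) absolutely_integrable_on S \<longleftrightarrow> k absolutely_integrable_on S" for k :: "real^'m::_ \<Rightarrow> real" and S
  proof
    assume "(\<lambda>x. k x *\<^sub>R ?v) absolutely_integrable_on S"
    from absolutely_integrable_component[OF this, of ?v] show "k absolutely_integrable_on S" by (simp add: inner_axis)
  next
    assume "k absolutely_integrable_on S"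
    then show "(\<lambda>x. k x *\<^sub>R ?v) absolutely_integrable_on S"
      using absolutely_integrable_linear[OF _ bounded_linear_scaleR_left[of ?v], unfolded o_def] by blast
  qed
  have intg: "integral S (\<lambda>x. k x *\<^sub>R ?v) = integral S k *\<^sub>R ?v" if "k absolutely_integrable_on S" for k :: "real^'m::_ \<Rightarrow> real" and S
    using integral_linear[OF set_lebesgue_integral_eq_integral(1)[OF that] bounded_linear_scaleR_left[of ?v]] by (simp add: o_def)
  have S: "B \<in> sets lebesgue" using B by auto
  have cov: "?J absolutely_integrable_on B \<and> integral B ?J = b \<longleftrightarrow> h absolutely_integrable_on \<tau> ` B \<and> integral (\<tau> ` B) h = b" for b
  proof -
    have "(\<lambda>x. ?J x *\<^sub>R ?v) absolutely_integrable_on B \<and> integral B (\<lambda>x. ?J x *\<^sub>R ?v) = b *\<^sub>R ?v \<longleftrightarrow>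
      (\<lambda>x. h x *\<^sub>R ?v) absolutely_integrable_on \<tau> ` B \<and> integral (\<tau> ` B) (\<lambda>x. h x *\<^sub>R ?v) = b *\<^sub>R ?v"
      using has_absolute_integral_change_of_variables[OF S der inj, of "\<lambda>x. h x *\<^sub>R ?v" "b *\<^sub>R ?v"] by (simp add: mult.assoc)
    moreover have "?v \<noteq> 0" by (simp add: axis_eq_0_iff)
    ultimately show ?thesis using intg[where k="?J" and S=B] intg[where k=h and S="\<tau> ` B"] unfolding comp by auto
  qed
  have nn: "(\<integral>\<^sup>+x. ennreal (k x * indicator S x) \<partial>lborel) = ennreal (integral S k)"
    if "k absolutely_integrable_on S" "\<And>x. 0 \<le> k x" for k :: "real^'m::_ \<Rightarrow> real" and S
    using nn_integral_has_integral_lebesgue[of S k "integral S k"] that set_lebesgue_integral_eq_integral(1)[OF that(1)]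
    by (simp add: mult.commute has_integral_integral)
  have ai: "k absolutely_integrable_on S"
    if "(\<lambda>x. k x * indicator S x) \<in> borel_measurable borel" "\<And>x. 0 \<le> k x"
      "(\<integral>\<^sup>+x. ennreal (k x * indicator S x) \<partial>lborel) < \<infinity>" for k :: "real^'m::_ \<Rightarrow> real" and S
  proof -
    have "(\<lambda>x. k x * indicator S x) integrable_on UNIV"
      by (rule nn_integral_integrable_on) (use that in auto)
    moreover have "(\<lambda>x. k x * indicator S x) = (\<lambda>x. if x \<in> S then k x else 0)" by (auto simp: indicator_def)
    ultimately have "k integrable_on S" using integrable_restrict_UNIV[of S k] by simp
    then show ?thesis by (rule nonnegative_absolutely_integrable_1) (use that in auto)
  qed
  have m1: "(\<lambda>x. h x * indicator (\<tau> ` B) x) \<in> borel_measurable borel" using h(1) B(2) by measurable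
  have J0: "0 \<le> ?J x" for x using h(2) by simp
  consider "(\<integral>\<^sup>+x. ennreal (h x * indicator (\<tau> ` B) x) \<partial>lborel) < \<infinity>"
    | "(\<integral>\<^sup>+x. ennreal (?J x * indicator B x) \<partial>lborel) < \<infinity>"
    | "(\<integral>\<^sup>+x. ennreal (h x * indicator (\<tau> ` B) x) \<partial>lborel) = \<infinity>" "(\<integral>\<^sup>+x. ennreal (?J x * indicator B x) \<partial>lborel) = \<infinity>"
    unfolding infinity_ennreal_def less_top[symmetric] by blast
  then show ?thesis
  proof cases
    case 1
    then have "h absolutely_integrable_on \<tau> ` B" using ai[OF m1 h(2)] by simp
    then have "h absolutely_integrable_on \<tau> ` B" "?J absolutely_integrable_on B" "integral B ?J = integral (\<tau> ` B) h"
      using cov by blast+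
    then show ?thesis using nn[where k=h and S="\<tau> ` B"] nn[where k="?J" and S=B] h(2) J0 by simp
  next
    case 2
    then have "?J absolutely_integrable_on B" using ai[OF m J0] by simp
    then have "h absolutely_integrable_on \<tau> ` B" "?J absolutely_integrable_on B" "integral B ?J = integral (\<tau> ` B) h"
      using cov by blast+
    then show ?thesis using nn[where k=h and S="\<tau> ` B"] nn[where k="?J" and S=B] h(2) J0 by simp
  next
    case 3
    then show ?thesis by simp
  qed
qed

text \<open>Renaming the coordinates by \<open>P\<close> preserves Lebesgue measure and the Jacobian
  determinant, so the well-ordered case is conjugated by \<open>P\<close>.\<close>

lemma change_of_variables_nn:
  fixes \<tau> :: "real ^ 'n::finite \<Rightarrow> real ^ 'n" and h :: "real ^ 'n \<Rightarrow> real"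
  assumes B: "B \<in> sets borel" "\<tau> ` B \<in> sets borel"
    and der: "\<And>x. x \<in> B \<Longrightarrow> (\<tau> has_derivative \<tau>' x) (at x within B)" and inj: "inj_on \<tau> B"
    and h: "h \<in> borel_measurable borel" "\<And>x. 0 \<le> h x"
    and m: "(\<lambda>x. \<bar>det (matrix (\<tau>' x))\<bar> * h (\<tau> x) * indicator B x) \<in> borel_measurable borel"
  shows "(\<integral>\<^sup>+x. ennreal (h x * indicator (\<tau> ` B) x) \<partial>lborel)
    = (\<integral>\<^sup>+x. ennreal (\<bar>det (matrix (\<tau>' x))\<bar> * h (\<tau> x) * indicator B x) \<partial>lborel)"
proof -
  define P :: "real ^ 'n \<Rightarrow> real ^ 'n ordered_copy" where "P x = (\<chi> i. x $ of_copy i)" for x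
  define Q :: "real ^ 'n ordered_copy \<Rightarrow> real ^ 'n" where "Q x = (\<chi> i. x $ to_copy i)" for x
  have PQ [simp]: "P (Q x) = x" and QP [simp]: "Q (P y) = y" for x y
    by (simp_all add: P_def Q_def vec_eq_iff of_copy_inverse to_copy_inverse)
  have "linear P" "linear Q"
    by (rule linearI; simp add: P_def Q_def vec_eq_iff)+
  then have blP: "bounded_linear P" and blQ: "bounded_linear Q"
    by (simp_all add: linear_conv_bounded_linear)
  have mP [measurable]: "P \<in> borel \<rightarrow>\<^sub>M borel" and mQ [measurable]: "Q \<in> borel \<rightarrow>\<^sub>M borel"
    using linear_continuous_on[OF blP] linear_continuous_on[OF blQ] by (auto intro: borel_measurable_continuous_onI)
  have dP: "distr lborel borel P = lborel"
    unfolding P_def[abs_def] by (rule lborel_distr_reindex[OF bij_of_copy])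
  have nnP: "(\<integral>\<^sup>+x. F x \<partial>lborel) = (\<integral>\<^sup>+x. F (P x) \<partial>lborel)" if "F \<in> borel_measurable borel" for F
    using that by (subst dP[symmetric], subst nn_integral_distr) auto
  define \<sigma> where "\<sigma> = (\<lambda>x. P (\<tau> (Q x)))"
  define \<sigma>' where "\<sigma>' = (\<lambda>x v. P (\<tau>' (Q x) (Q v)))"
  have im: "\<sigma> ` (P ` B) = P ` (\<tau> ` B)" by (auto simp: \<sigma>_def image_image)
  have ind: "x \<in> P ` S \<longleftrightarrow> Q x \<in> S" for x S by (metis PQ QP imageE imageI)
  have vim: "P ` S = Q -` S" for S by (auto simp: ind)
  have bor: "P ` S \<in> sets borel" if "S \<in> sets borel" for S
    unfolding vim using measurable_sets[OF mQ that] by simp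
  have detm: "det (matrix (\<sigma>' x)) = det (matrix (\<tau>' (Q x)))" for x
  proof -
    have "Q (axis i 1) = axis (of_copy i) 1" for i
      by (auto simp: Q_def axis_def vec_eq_iff to_copy_inverse of_copy_inverse)
    then have "matrix (\<sigma>' x) = (\<chi> i j. matrix (\<tau>' (Q x)) $ of_copy i $ of_copy j)"
      by (simp add: matrix_def \<sigma>'_def P_def)
    then show ?thesis using det_reindex[OF bij_of_copy] by metis
  qed
  have main: "(\<integral>\<^sup>+x. ennreal (h (Q x) * indicator (\<sigma> ` (P ` B)) x) \<partial>lborel)
    = (\<integral>\<^sup>+x. ennreal (\<bar>det (matrix (\<sigma>' x))\<bar> * h (Q (\<sigma> x)) * indicator (P ` B) x) \<partial>lborel)"
  proof (rule change_of_variables_wellorder)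
    show "P ` B \<in> sets borel" "\<sigma> ` (P ` B) \<in> sets borel" unfolding im using bor B by auto
    show "inj_on \<sigma> (P ` B)" using inj by (auto simp: inj_on_def \<sigma>_def) (metis QP)
    show "(\<lambda>x. h (Q x)) \<in> borel_measurable borel" using h(1) by measurable
    show "0 \<le> h (Q x)" for x by (rule h)
    have "(\<lambda>x. (\<lambda>x. \<bar>det (matrix (\<tau>' x))\<bar> * h (\<tau> x) * indicator B x) (Q x)) \<in> borel_measurable borel"
      using m by measurable
    then show "(\<lambda>x. \<bar>det (matrix (\<sigma>' x))\<bar> * h (Q (\<sigma> x)) * indicator (P ` B) x) \<in> borel_measurable borel"
      by (simp add: detm \<sigma>_def indicator_def ind)
    fix x assume x: "x \<in> P ` B"
    have 1: "(Q has_derivative Q) (at x within P ` B)" by (rule bounded_linear_imp_has_derivative[OF blQ])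
    have "Q x \<in> B" "Q ` (P ` B) = B" using x by (auto simp: ind image_image)
    then have 2: "(\<tau> has_derivative \<tau>' (Q x)) (at (Q x) within Q ` (P ` B))" using der by simp
    have "((\<lambda>x. \<tau> (Q x)) has_derivative (\<lambda>v. \<tau>' (Q x) (Q v))) (at x within P ` B)"
      using diff_chain_within[OF 1 2] by (simp add: o_def)
    then show "(\<sigma> has_derivative \<sigma>' x) (at x within P ` B)"
      unfolding \<sigma>_def \<sigma>'_def by (rule bounded_linear.has_derivative[OF blP])
  qed
  have "(\<integral>\<^sup>+x. ennreal (h (Q x) * indicator (\<sigma> ` (P ` B)) x) \<partial>lborel)
      = (\<integral>\<^sup>+x. ennreal (h x * indicator (\<tau> ` B) x) \<partial>lborel)"
  proof -
    define F where "F = (\<lambda>x. ennreal (h x * indicator (\<tau> ` B) x))"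
    have F: "F \<in> borel_measurable borel" unfolding F_def using h(1) B(2) by measurable
    have "(\<integral>\<^sup>+x. F (Q x) \<partial>lborel) = (\<integral>\<^sup>+x. F x \<partial>lborel)"
      using nnP[OF measurable_compose[OF mQ F]] by simp
    then show ?thesis by (simp add: F_def im indicator_def ind)
  qed
  moreover have "(\<integral>\<^sup>+x. ennreal (\<bar>det (matrix (\<sigma>' x))\<bar> * h (Q (\<sigma> x)) * indicator (P ` B) x) \<partial>lborel)
      = (\<integral>\<^sup>+x. ennreal (\<bar>det (matrix (\<tau>' x))\<bar> * h (\<tau> x) * indicator B x) \<partial>lborel)"
  proof -
    have "(\<lambda>x. (\<lambda>x. \<bar>det (matrix (\<tau>' x))\<bar> * h (\<tau> x) * indicator B x) (Q x)) \<in> borel_measurable borel"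
      using m by measurable
    then have "(\<lambda>x. ennreal (\<bar>det (matrix (\<sigma>' x))\<bar> * h (Q (\<sigma> x)) * indicator (P ` B) x)) \<in> borel_measurable borel"
      by (simp add: detm \<sigma>_def indicator_def ind)
    then show ?thesis by (subst nnP) (auto simp: detm \<sigma>_def indicator_def ind)
  qed
  ultimately show ?thesis using main by simp
qed

section \<open>The Riemannian volume measure\<close>

lemma smooth_on_prod:
  fixes f :: "'i \<Rightarrow> 'e::euclidean_space \<Rightarrow> real"
  shows "open S \<Longrightarrow> (\<And>i. i \<in> I \<Longrightarrow> smooth_on (f i) S) \<Longrightarrow> smooth_on (\<lambda>x. \<Prod>i\<in>I. f i x) S"
  by (induction I rule: infinite_finite_induct) (auto intro!: smooth_on_const smooth_on_mult)

lemma smooth_on_det: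
  fixes G :: "'e::euclidean_space \<Rightarrow> real ^ 'n ^ 'n"
  assumes "open S" "\<And>i j. smooth_on (\<lambda>x. G x $ i $ j) S"
  shows "smooth_on (\<lambda>x. det (G x)) S"
  unfolding det_def by (intro smooth_on_sum smooth_on_mult smooth_on_prod smooth_on_const assms)

context riemannian
begin

section \<open>Gram matrices and volume densities\<close>

definition gram :: "'a set \<Rightarrow> ('a \<Rightarrow> real ^ 'n) \<Rightarrow> real ^ 'n \<Rightarrow> real ^ 'n ^ 'n"
  where "gram U \<phi> x = (\<chi> i j. g (inv_into U \<phi> x) (coord_vec A U \<phi> i (inv_into U \<phi> x))
    (coord_vec A U \<phi> j (inv_into U \<phi> x)))"

definition vdens :: "'a set \<Rightarrow> ('a \<Rightarrow> real ^ 'n) \<Rightarrow> real ^ 'n \<Rightarrow> real"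
  where "vdens U \<phi> x = sqrt (det (gram U \<phi> x))"

lemma gram_smooth:
  assumes U: "(U, \<phi>) \<in> A"
  shows "smooth_on (\<lambda>x. gram U \<phi> x $ i $ j) (\<phi> ` U)"
proof (rule smooth_on_local)
  fix x assume x: "x \<in> \<phi> ` U"
  define p where "p = inv_into U \<phi> x"
  have p: "p \<in> U" "\<phi> p = x" using x unfolding p_def by (auto intro: inv_into_into f_inv_into_f)
  obtain E N where E: "\<And>i. E i \<in> smooth_vfields A" "open N" "p \<in> N" "N \<subseteq> U"
    "\<And>i q. q \<in> N \<Longrightarrow> E i q = coord_vec A U \<phi> i q" by (rule coord_frame_ex[OF U p(1)]) blast
  have o: "open (\<phi> ` (U \<inter> N))" by (rule chart_image_open[OF U E(2)])
  have "smooth_on ((\<lambda>q. g q (E i q) (E j q)) \<circ> inv_into U \<phi>) (\<phi> ` (U \<inter> N))"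
    by (rule smooth_on_subset[OF smooth_funsD[OF g_smooth[OF E(1) E(1)] U]]) auto
  then have "smooth_on (\<lambda>x. gram U \<phi> x $ i $ j) (\<phi> ` (U \<inter> N))"
    by (rule smooth_on_eq[OF _ o]) (use E(5) chart_inv[OF U] in \<open>auto simp: gram_def\<close>)
  then show "\<exists>T. open T \<and> x \<in> T \<and> smooth_on (\<lambda>x. gram U \<phi> x $ i $ j) T"
    using o p E(3) by blast
qed

text \<open>The coordinate vectors are expanded in an orthonormal basis; the inverse of the
  coefficient matrix lists the basis vectors in coordinates. This yields the positivity of the Gram
  determinant and, later, the invariance of the volume form under the deformation.\<close>

lemma gram_factor:
  assumes U: "(U, \<phi>) \<in> A" "p \<in> U" and e: "ON p e"
  shows "gram U \<phi> (\<phi> p) = transpose (\<chi> k i. g p (coord_vec A U \<phi> i p) (e k)) ** (\<chi> k i. g p (coord_vec A U \<phi> i p) (e k))"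
    and "det (\<chi> k i. g p (coord_vec A U \<phi> i p) (e k)) \<noteq> 0"
proof -
  let ?c = "\<lambda>i. coord_vec A U \<phi> i p"
  let ?M = "(\<chi> k i. g p (?c i) (e k)) :: real^'n^'n"
  note ct = coord_vec_tangent[OF U]
  show "gram U \<phi> (\<phi> p) = transpose ?M ** ?M"
    using ON_expand_g[OF e ct ct] chart_inv[OF U]
    by (simp add: gram_def matrix_matrix_mult_def transpose_def vec_eq_iff)
  obtain x N where x: "\<And>i. x i \<in> smooth_funs A" "open N" "p \<in> N" "\<And>i q. q \<in> N \<Longrightarrow> x i q = \<phi> q $ i"
    by (rule coord_fun_ex[OF U]) blast
  let ?N = "(\<chi> i l. e l (x i)) :: real^'n^'n"
  have "?M ** ?N = mat 1"
  proof -
    have "(\<Sum>i\<in>UNIV. g p (?c i) (e k) * e l (x i)) = (if k = l then 1 else 0)" for k l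
    proof -
      have "(\<Sum>i\<in>UNIV. g p (?c i) (e k) * e l (x i)) = g p (\<Sum>i\<in>UNIV. e l (x i) *\<^sub>R ?c i) (e k)"
        using ct ON_D(1)[OF e] by (subst g_sum_left) (auto simp: mult.commute)
      also have "(\<Sum>i\<in>UNIV. e l (x i) *\<^sub>R ?c i) = e l"
        by (rule tangent_coord_rep[OF U ON_D(1)[OF e] x, symmetric])
      finally show ?thesis using ON_D(2)[OF e, of l k] by auto
    qed
    then show ?thesis by (simp add: matrix_matrix_mult_def mat_def vec_eq_iff)
  qed
  then have "det ?M * det ?N = 1" by (metis det_mul det_I)
  then show "det ?M \<noteq> 0" by auto
qed

lemma gram_det_pos:
  assumes U: "(U, \<phi>) \<in> A" "x \<in> \<phi> ` U"
  shows "det (gram U \<phi> x) > 0"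
proof -
  obtain p where p: "p \<in> U" "x = \<phi> p" using U by auto
  obtain e where e: "ON p e" by (rule ON_extend[of "{}" _ p]) auto
  show ?thesis unfolding p(2) gram_factor(1)[OF U(1) p(1) e] det_mul det_transpose
    using gram_factor(2)[OF U(1) p(1) e] by (metis not_real_square_gt_zero)
qed

lemma vdens_pos: "(U, \<phi>) \<in> A \<Longrightarrow> x \<in> \<phi> ` U \<Longrightarrow> vdens U \<phi> x > 0"
  using gram_det_pos unfolding vdens_def by simp

lemma gram_det_smooth: "(U, \<phi>) \<in> A \<Longrightarrow> smooth_on (\<lambda>x. det (gram U \<phi> x)) (\<phi> ` U)"
  by (intro smooth_on_det chart_open_image gram_smooth)

lemma vdens_continuous: "(U, \<phi>) \<in> A \<Longrightarrow> continuous_on (\<phi> ` U) (vdens U \<phi>)"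
  unfolding vdens_def[abs_def] using smooth_on_imp_continuous_on[OF gram_det_smooth]
  by (auto intro!: continuous_intros)

lemma coord_vec_transition:
  assumes U: "(U, \<phi>) \<in> A" and V: "(V, \<psi>) \<in> A" and q: "q \<in> U" "q \<in> V"
  shows "coord_vec A V \<psi> j q = (\<Sum>i\<in>UNIV. (frechet_derivative (\<phi> \<circ> inv_into V \<psi>) (at (\<psi> q)) (axis j 1)) $ i *\<^sub>R coord_vec A U \<phi> i q)"
proof -
  obtain x N where x: "\<And>i. x i \<in> smooth_funs A" "open N" "q \<in> N" "\<And>i r. r \<in> N \<Longrightarrow> x i r = \<phi> r $ i"
    by (rule coord_fun_ex[OF U q(1)]) blast
  have "coord_vec A V \<psi> j q (x i) = (frechet_derivative (\<phi> \<circ> inv_into V \<psi>) (at (\<psi> q)) (axis j 1)) $ i" for i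
  proof -
    have o: "open (\<psi> ` (V \<inter> (U \<inter> N)))" by (rule chart_image_open[OF V open_Int[OF chart_open[OF U] x(2)]])
    have "\<psi> q \<in> \<psi> ` (V \<inter> U)" using q by auto
    then have "((\<phi> \<circ> inv_into V \<psi>) has_derivative frechet_derivative (\<phi> \<circ> inv_into V \<psi>) (at (\<psi> q))) (at (\<psi> q))"
      by (rule smooth_on_has_derivative[OF transition_smooth[OF V U]])
    then have "((\<lambda>y. (\<phi> \<circ> inv_into V \<psi>) y $ i) has_derivative (\<lambda>v. frechet_derivative (\<phi> \<circ> inv_into V \<psi>) (at (\<psi> q)) v $ i)) (at (\<psi> q))"
      by (rule bounded_linear.has_derivative[OF bounded_linear_vec_nth])
    then have "((x i \<circ> inv_into V \<psi>) has_derivative (\<lambda>v. frechet_derivative (\<phi> \<circ> inv_into V \<psi>) (at (\<psi> q)) v $ i)) (at (\<psi> q))"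
      by (rule has_derivative_transform_within_open[OF _ o]) (use q x chart_inv[OF V] in auto)
    then show ?thesis unfolding coord_vec_def using x(1) by (simp add: frechet_derivative_at[symmetric])
  qed
  moreover have "coord_vec A V \<psi> j q = (\<Sum>i\<in>UNIV. coord_vec A V \<psi> j q (x i) *\<^sub>R coord_vec A U \<phi> i q)"
    by (rule tangent_coord_rep[OF U q(1) coord_vec_tangent[OF V q(2)] x])
  ultimately show ?thesis by (simp only:)
qed

text \<open>Under a change of chart the Gram matrix is transformed by congruence with the Jacobian
  matrix; the square root of the determinant takes on the absolute Jacobian determinant.\<close>

lemma vdens_transition:
  assumes U: "(U, \<phi>) \<in> A" and V: "(V, \<psi>) \<in> A" and q: "q \<in> U" "q \<in> V"
  shows "vdens V \<psi> (\<psi> q) = \<bar>det (matrix (frechet_derivative (\<phi> \<circ> inv_into V \<psi>) (at (\<psi> q))))\<bar> * vdens U \<phi> (\<phi> q)"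
proof -
  let ?J = "matrix (frechet_derivative (\<phi> \<circ> inv_into V \<psi>) (at (\<psi> q)))"
  note ct = coord_vec_tangent[OF U q(1)]
  have "gram V \<psi> (\<psi> q) = transpose ?J ** (gram U \<phi> (\<phi> q) ** ?J)"
  proof -
    have "g q (coord_vec A V \<psi> i q) (coord_vec A V \<psi> j q)
        = (\<Sum>k\<in>UNIV. ?J $ k $ i * (\<Sum>l\<in>UNIV. g q (coord_vec A U \<phi> k q) (coord_vec A U \<phi> l q) * ?J $ l $ j))" for i j
    proof -
      have "g q (coord_vec A V \<psi> i q) (coord_vec A V \<psi> j q)
        = (\<Sum>k\<in>UNIV. ?J $ k $ i * g q (coord_vec A U \<phi> k q) (\<Sum>l\<in>UNIV. ?J $ l $ j *\<^sub>R coord_vec A U \<phi> l q))"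
        unfolding coord_vec_transition[OF U V q]
        using ct by (subst g_sum_left) (auto simp: matrix_def)
      also have "\<dots> = (\<Sum>k\<in>UNIV. ?J $ k $ i * (\<Sum>l\<in>UNIV. g q (coord_vec A U \<phi> k q) (coord_vec A U \<phi> l q) * ?J $ l $ j))"
        using ct by (intro sum.cong refl, subst g_sum_right) (auto simp: mult.commute)
      finally show ?thesis .
    qed
    then show ?thesis using chart_inv[OF U q(1)] chart_inv[OF V q(2)]
      by (simp add: gram_def matrix_matrix_mult_def transpose_def vec_eq_iff)
  qed
  then have "det (gram V \<psi> (\<psi> q)) = (det ?J)\<^sup>2 * det (gram U \<phi> (\<phi> q))"
    by (simp add: det_mul det_transpose power2_eq_square)
  then show ?thesis by (simp add: vdens_def real_sqrt_mult)
qed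

section \<open>Volumes computed in one chart\<close>

definition chart_vol :: "'a set \<Rightarrow> ('a \<Rightarrow> real ^ 'n) \<Rightarrow> 'a set \<Rightarrow> ennreal"
  where "chart_vol U \<phi> B = (\<integral>\<^sup>+x. ennreal (vdens U \<phi> x) * indicator (\<phi> ` B) x \<partial>lborel)"

text \<open>Outside the chart image \<open>inv_into\<close> has no controlled values; cutting off
  there gives a nonnegative Borel function on the whole space.\<close>

definition vdens0 :: "'a set \<Rightarrow> ('a \<Rightarrow> real ^ 'n) \<Rightarrow> real ^ 'n \<Rightarrow> real"
  where "vdens0 U \<phi> x = indicator (\<phi> ` U) x * vdens U \<phi> x"

lemma vdens0_measurable: assumes "(U, \<phi>) \<in> A" shows "vdens0 U \<phi> \<in> borel_measurable borel"
proof -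
  have "(\<lambda>x. indicator (\<phi> ` U) x *\<^sub>R vdens U \<phi> x) \<in> borel_measurable borel"
    by (rule borel_measurable_continuous_on_indicator) (use chart_open_image[OF assms] vdens_continuous[OF assms] in auto)
  then show ?thesis unfolding vdens0_def[abs_def] by simp
qed

lemma vdens0_nonneg: "(U, \<phi>) \<in> A \<Longrightarrow> 0 \<le> vdens0 U \<phi> x"
  unfolding vdens0_def using vdens_pos[of U \<phi> x] by (auto simp: indicator_def less_imp_le)

lemma chart_vol_eq:
  assumes "B \<subseteq> U" shows "chart_vol U \<phi> B = (\<integral>\<^sup>+x. ennreal (vdens0 U \<phi> x) * indicator (\<phi> ` B) x \<partial>lborel)"
  unfolding chart_vol_def by (rule nn_integral_cong) (use assms in \<open>auto simp: vdens0_def indicator_def\<close>)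

lemma chart_image_borel:
  assumes U: "(U, \<phi>) \<in> A" and B: "B \<in> sets borel" "B \<subseteq> U"
  shows "\<phi> ` B \<in> sets borel"
proof -
  have o: "open (\<phi> ` U)" by (rule chart_open_image[OF U])
  have "inv_into U \<phi> \<in> restrict_space borel (\<phi> ` U) \<rightarrow>\<^sub>M borel"
    by (rule borel_measurable_continuous_on_restrict[OF chart_inv_continuous[OF U]])
  from measurable_sets[OF this B(1)]
  have "inv_into U \<phi> -` B \<inter> \<phi> ` U \<in> sets borel"
    using o by (simp add: space_restrict_space sets_restrict_space_iff)
  moreover have "inv_into U \<phi> -` B \<inter> \<phi> ` U = \<phi> ` B" using B(2) chart_inv[OF U] by (auto simp: image_iff subset_iff)
  ultimately show ?thesis by simp
qed

lemma chart_inj: "(U, \<phi>) \<in> A \<Longrightarrow> inj_on \<phi> U"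
  by (rule inj_on_inverseI[of _ "inv_into U \<phi>"]) (rule chart_inv)

lemma chart_vol_sums:
  assumes U: "(U, \<phi>) \<in> A" and B: "\<And>i::nat. B i \<in> sets borel" "\<And>i. B i \<subseteq> U" "disjoint_family B"
  shows "(\<Sum>i. chart_vol U \<phi> (B i)) = chart_vol U \<phi> (\<Union>i. B i)"
proof -
  have dj: "disjoint_family (\<lambda>i. \<phi> ` B i)"
    using B(2,3) chart_inj[OF U] unfolding disjoint_family_on_def by (metis image_empty inj_on_image_Int)
  have m: "\<phi> ` B i \<in> sets borel" for i by (rule chart_image_borel[OF U B(1,2)])
  have "(\<Sum>i. chart_vol U \<phi> (B i)) = (\<Sum>i. \<integral>\<^sup>+x. ennreal (vdens0 U \<phi> x) * indicator (\<phi> ` B i) x \<partial>lborel)"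
    using chart_vol_eq[OF B(2)] by simp
  also have "\<dots> = (\<integral>\<^sup>+x. (\<Sum>i. ennreal (vdens0 U \<phi> x) * indicator (\<phi> ` B i) x) \<partial>lborel)"
  proof -
    note [measurable] = m vdens0_measurable[OF U]
    show ?thesis by (intro nn_integral_suminf[symmetric]) measurable
  qed
  also have "\<dots> = (\<integral>\<^sup>+x. ennreal (vdens0 U \<phi> x) * indicator (\<phi> ` (\<Union>i. B i)) x \<partial>lborel)"
    using suminf_indicator[OF dj] by (simp add: image_UN)
  also have "\<dots> = chart_vol U \<phi> (\<Union>i. B i)"
    by (rule chart_vol_eq[symmetric]) (use B(2) in auto)
  finally show ?thesis .
qed

text \<open>The transformation of the density is exactly the Jacobian factor of the change of
  variables. This is the consistency on which the description of the volume measure by charts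
  rests.\<close>

lemma chart_vol_transition:
  assumes U: "(U, \<phi>) \<in> A" and V: "(V, \<psi>) \<in> A" and B: "B \<in> sets borel" "B \<subseteq> U" "B \<subseteq> V"
  shows "chart_vol U \<phi> B = chart_vol V \<psi> B"
proof -
  let ?t = "\<phi> \<circ> inv_into V \<psi>"
  let ?J = "\<lambda>x. \<bar>det (matrix (frechet_derivative ?t (at x)))\<bar>"
  have im: "?t ` (\<psi> ` B) = \<phi> ` B" using chart_inv[OF V] B(3) by (auto simp: image_image subset_iff)
  have Jeq: "?J x * vdens0 U \<phi> (?t x) * indicator (\<psi> ` B) x = vdens0 V \<psi> x * indicator (\<psi> ` B) x" for x
  proof (cases "x \<in> \<psi> ` B")
    case True
    then obtain q where q: "q \<in> B" "x = \<psi> q" by auto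
    then have "q \<in> U" "q \<in> V" using B by auto
    from vdens_transition[OF U V this] show ?thesis
      using q chart_inv[OF V \<open>q \<in> V\<close>] \<open>q \<in> U\<close> \<open>q \<in> V\<close> by (simp add: vdens0_def)
  qed simp
  have mB: "\<phi> ` B \<in> sets borel" "\<psi> ` B \<in> sets borel"
    using chart_image_borel[OF U B(1,2)] chart_image_borel[OF V B(1,3)] by auto
  have "(\<integral>\<^sup>+x. ennreal (vdens0 U \<phi> x * indicator (?t ` (\<psi> ` B)) x) \<partial>lborel)
    = (\<integral>\<^sup>+x. ennreal (?J x * vdens0 U \<phi> (?t x) * indicator (\<psi> ` B) x) \<partial>lborel)"
  proof (rule change_of_variables_nn)
    show "\<psi> ` B \<in> sets borel" "?t ` (\<psi> ` B) \<in> sets borel" unfolding im using mB by auto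
    fix x assume "x \<in> \<psi> ` B"
    then have "x \<in> \<psi> ` (V \<inter> U)" using B by auto
    then show "(?t has_derivative frechet_derivative ?t (at x)) (at x within \<psi> ` B)"
      by (rule has_derivative_at_withinI[OF smooth_on_has_derivative[OF transition_smooth[OF V U]]])
  next
    show "inj_on ?t (\<psi> ` B)"
    proof (rule inj_onI)
      fix x y assume "x \<in> \<psi> ` B" "y \<in> \<psi> ` B" and eq: "?t x = ?t y"
      then obtain r s where "r \<in> B" "x = \<psi> r" "s \<in> B" "y = \<psi> s" by auto
      moreover from this have "r \<in> V" "s \<in> V" "r \<in> U" "s \<in> U" using B by auto
      ultimately show "x = y"
        using eq chart_inv[OF V, of r] chart_inv[OF V, of s] inj_onD[OF chart_inj[OF U], of r s] by auto
    qed
    show "vdens0 U \<phi> \<in> borel_measurable borel" by (rule vdens0_measurable[OF U])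
    show "0 \<le> vdens0 U \<phi> x" for x by (rule vdens0_nonneg[OF U])
    show "(\<lambda>x. ?J x * vdens0 U \<phi> (?t x) * indicator (\<psi> ` B) x) \<in> borel_measurable borel"
      unfolding Jeq using vdens0_measurable[OF V] mB(2) by measurable
  qed
  then have "(\<integral>\<^sup>+x. ennreal (vdens0 U \<phi> x * indicator (\<phi> ` B) x) \<partial>lborel)
      = (\<integral>\<^sup>+x. ennreal (vdens0 V \<psi> x * indicator (\<psi> ` B) x) \<partial>lborel)"
    unfolding Jeq im .
  then show ?thesis unfolding chart_vol_eq[OF B(2)] chart_vol_eq[OF B(3)]
    by (simp add: ennreal_mult' ennreal_indicator vdens0_nonneg[OF U] vdens0_nonneg[OF V] ennreal_mult)
qed

end

section \<open>The global volume measure\<close>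

locale riemannian2 = riemannian A g
  for A :: "('a::{t2_space, second_countable_topology}, 'n::finite) atlas" and g
begin

definition vol :: "'a measure" where "vol = volume_form_measure A g"

lemma countable_charts:
  obtains c :: "nat \<Rightarrow> 'a set \<times> ('a \<Rightarrow> real ^ 'n)" where "\<And>k. c k \<in> A" "(\<Union>k. fst (c k)) = UNIV"
proof -
  have "open U" if "U \<in> fst ` A" for U using that chart_open by auto
  then obtain F where F: "F \<subseteq> fst ` A" "countable F" "\<Union>F = \<Union>(fst ` A)" using Lindelof by metis
  have un: "\<Union>F = UNIV" using F(3) atlas unfolding smooth_atlas_def by simp
  then have ne: "F \<noteq> {}" by auto
  have "\<exists>c. c \<in> A \<and> fst c = from_nat_into F k" for k
    using from_nat_into[OF ne, of k] F(1) by (metis imageE subsetD)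
  then obtain c where c: "\<And>k. c k \<in> A" "\<And>k. fst (c k) = from_nat_into F k" by metis
  have "(\<Union>k. fst (c k)) = UNIV" using un range_from_nat_into[OF ne F(2)] by (simp add: c(2))
  with c(1) show ?thesis by (rule that)
qed

text \<open>\<open>volume_form_measure\<close> is a definite description, so both existence and
  uniqueness are required. Second countability gives countably many charts covering the space; cut
  into disjoint pieces, they allow a measure to be assembled chart by chart, and countable
  additivity over the same pieces gives uniqueness.\<close>

lemma vol_ex1:
  "\<exists>!\<mu>. sets \<mu> = sets borel \<and> (\<forall>(U, \<phi>)\<in>A. \<forall>B\<in>sets borel. B \<subseteq> U \<longrightarrow> emeasure \<mu> B = chart_vol U \<phi> B)"
proof -
  obtain c where c: "\<And>k::nat. c k \<in> A" "(\<Union>k. fst (c k)) = UNIV"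
    by (rule countable_charts, rule that)
  define D where "D = disjointed (\<lambda>k. fst (c k))"
  have cA: "(fst (c k), snd (c k)) \<in> A" for k using c(1)[of k] by simp
  have D: "D k \<in> sets borel" "D k \<subseteq> fst (c k)" "disjoint_family D" "(\<Union>k. D k) = UNIV" for k
  proof -
    have "range (\<lambda>k. fst (c k)) \<subseteq> sets borel" using chart_open[OF cA] by auto
    then show "D k \<in> sets borel" unfolding D_def using sets.range_disjointed_sets[of "\<lambda>k. fst (c k)" borel] by blast
    show "D k \<subseteq> fst (c k)" unfolding D_def by (rule disjointed_subset)
    show "disjoint_family D" unfolding D_def by (rule disjoint_family_disjointed)
    show "(\<Union>k. D k) = UNIV" unfolding D_def UN_disjointed_eq by (rule c(2))
  qed
  define \<mu>0 where "\<mu>0 B = (\<Sum>k. chart_vol (fst (c k)) (snd (c k)) (B \<inter> D k))" for B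
  define M where "M = measure_of UNIV (sets borel) \<mu>0"
  have unD: "(\<Union>k. B \<inter> D k) = B" for B using D(4) by auto
  have djD: "disjoint_family (\<lambda>k. B \<inter> D k)" for B using D(3) unfolding disjoint_family_on_def by blast
  have sa: "sigma_algebra UNIV (sets (borel :: 'a measure))" by (metis sets.sigma_algebra_axioms space_borel)
  have sM: "sets M = sets borel" unfolding M_def
    using sigma_algebra.sigma_sets_eq[OF sa] by (simp add: sets_measure_of)
  have pos: "positive (sets borel) \<mu>0" by (simp add: positive_def \<mu>0_def chart_vol_def)
  have ca: "countably_additive (sets borel) \<mu>0"
  proof (rule countably_additiveI)
    fix B :: "nat \<Rightarrow> 'a set" assume B: "range B \<subseteq> sets borel" "disjoint_family B" "\<Union> (range B) \<in> sets borel"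
    \<comment> \<open>The two series are interchanged by Fubini's theorem for counting
      measures.\<close>
    have "(\<Sum>i. \<mu>0 (B i)) = (\<Sum>k. \<Sum>i. chart_vol (fst (c k)) (snd (c k)) (B i \<inter> D k))"
      unfolding \<mu>0_def
      by (simp only: nn_integral_count_space_nat[symmetric]) (rule pair_sigma_finite.Fubini'[symmetric]; simp add: pair_sigma_finite_def sigma_finite_measure_count_space)
    also have "\<dots> = (\<Sum>k. chart_vol (fst (c k)) (snd (c k)) (\<Union>i. B i \<inter> D k))"
    proof (rule suminf_cong)
      fix k
      show "(\<Sum>i. chart_vol (fst (c k)) (snd (c k)) (B i \<inter> D k)) = chart_vol (fst (c k)) (snd (c k)) (\<Union>i. B i \<inter> D k)"
      proof (rule chart_vol_sums[OF cA])
        show "B i \<inter> D k \<in> sets borel" "B i \<inter> D k \<subseteq> fst (c k)" for i using B(1) D(1)[of k] D(2)[of k] by auto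
        show "disjoint_family (\<lambda>i. B i \<inter> D k)" using B(2) unfolding disjoint_family_on_def by blast
      qed
    qed
    also have "\<dots> = \<mu>0 (\<Union> (range B))" by (simp add: \<mu>0_def)
    finally show "(\<Sum>i. \<mu>0 (B i)) = \<mu>0 (\<Union> (range B))" .
  qed
  have eM: "emeasure M B = \<mu>0 B" if "B \<in> sets borel" for B
    unfolding M_def by (rule emeasure_measure_of_sigma[OF sa pos ca that])
  have chart: "\<mu>0 B = chart_vol U \<phi> B" if U: "(U, \<phi>) \<in> A" and B: "B \<in> sets borel" "B \<subseteq> U" for U \<phi> B
  proof -
    have "chart_vol (fst (c k)) (snd (c k)) (B \<inter> D k) = chart_vol U \<phi> (B \<inter> D k)" for k
      by (rule chart_vol_transition[OF cA U]) (use B D(1)[of k] D(2)[of k] in auto)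
    then have "\<mu>0 B = (\<Sum>k. chart_vol U \<phi> (B \<inter> D k))" by (simp add: \<mu>0_def)
    also have "\<dots> = chart_vol U \<phi> (\<Union>k. B \<inter> D k)"
      by (rule chart_vol_sums[OF U _ _ djD]) (use B D in auto)
    finally show ?thesis unfolding unD .
  qed
  show ?thesis
  proof (rule ex1I[of _ M])
    show "sets M = sets borel \<and> (\<forall>(U, \<phi>)\<in>A. \<forall>B\<in>sets borel. B \<subseteq> U \<longrightarrow> emeasure M B = chart_vol U \<phi> B)"
      using sM eM chart by auto
    fix \<mu> assume \<mu>: "sets \<mu> = sets borel \<and> (\<forall>(U, \<phi>)\<in>A. \<forall>B\<in>sets borel. B \<subseteq> U \<longrightarrow> emeasure \<mu> B = chart_vol U \<phi> B)"
    show "\<mu> = M"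
    proof (rule measure_eqI)
      show "sets \<mu> = sets M" using \<mu> sM by simp
      fix B assume "B \<in> sets \<mu>"
      then have B: "B \<in> sets borel" using \<mu> by simp
      have "range (\<lambda>k. B \<inter> D k) \<subseteq> sets \<mu>" using \<mu> B D(1) by auto
      from suminf_emeasure[OF this djD] have "emeasure \<mu> B = (\<Sum>k. emeasure \<mu> (B \<inter> D k))"
        unfolding unD by simp
      also have "\<dots> = \<mu>0 B" unfolding \<mu>0_def
      proof (rule suminf_cong)
        fix k
        have "B \<inter> D k \<in> sets borel" "B \<inter> D k \<subseteq> fst (c k)" using B D(1)[of k] D(2)[of k] by auto
        then show "emeasure \<mu> (B \<inter> D k) = chart_vol (fst (c k)) (snd (c k)) (B \<inter> D k)" using \<mu> cA[of k] by blast
      qed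
      finally show "emeasure \<mu> B = emeasure M B" using eM[OF B] by simp
    qed
  qed
qed

lemma
  shows sets_vol [simp, measurable_cong]: "sets vol = sets borel"
    and emeasure_vol: "(U, \<phi>) \<in> A \<Longrightarrow> B \<in> sets borel \<Longrightarrow> B \<subseteq> U \<Longrightarrow> emeasure vol B = chart_vol U \<phi> B"
proof -
  have "vol = (THE \<mu>. sets \<mu> = sets borel \<and> (\<forall>(U, \<phi>)\<in>A. \<forall>B\<in>sets borel. B \<subseteq> U \<longrightarrow> emeasure \<mu> B = chart_vol U \<phi> B))"
    unfolding vol_def volume_form_measure_def chart_vol_def vdens_def gram_def ..
  then have "sets vol = sets borel \<and> (\<forall>(U, \<phi>)\<in>A. \<forall>B\<in>sets borel. B \<subseteq> U \<longrightarrow> emeasure vol B = chart_vol U \<phi> B)"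
    using theI'[OF vol_ex1] by simp
  then show "sets vol = sets borel" "(U, \<phi>) \<in> A \<Longrightarrow> B \<in> sets borel \<Longrightarrow> B \<subseteq> U \<Longrightarrow> emeasure vol B = chart_vol U \<phi> B"
    by blast+
qed

lemma vol_open_pos:
  assumes "open V" "V \<noteq> {}" shows "emeasure vol V > 0"
proof -
  obtain p where p: "p \<in> V" using assms by auto
  obtain U \<phi> where U: "(U, \<phi>) \<in> A" "p \<in> U" by (rule chart_ex)
  have o: "open (\<phi> ` (U \<inter> V))" by (rule chart_image_open[OF U(1) assms(1)])
  have oUV: "open (U \<inter> V)" using chart_open[OF U(1)] assms(1) by auto
  have "emeasure vol (U \<inter> V) \<noteq> 0"
  proof
    assume "emeasure vol (U \<inter> V) = 0"
    then have "(\<integral>\<^sup>+x. ennreal (vdens0 U \<phi> x) * indicator (\<phi> ` (U \<inter> V)) x \<partial>lborel) = 0"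
      using emeasure_vol[OF U(1), of "U \<inter> V"] oUV chart_vol_eq[of "U \<inter> V" U \<phi>] by auto
    moreover have "(\<lambda>x. ennreal (vdens0 U \<phi> x) * indicator (\<phi> ` (U \<inter> V)) x) \<in> borel_measurable lborel"
    proof -
      note [measurable] = vdens0_measurable[OF U(1)] borel_open[OF o]
      show ?thesis by measurable
    qed
    ultimately have "AE x in lborel. ennreal (vdens0 U \<phi> x) * indicator (\<phi> ` (U \<inter> V)) x = 0"
      using nn_integral_0_iff_AE by blast
    then have "AE x in lborel. x \<notin> \<phi> ` (U \<inter> V)"
    proof (rule AE_mp, intro AE_I2 impI)
      fix x assume "ennreal (vdens0 U \<phi> x) * indicator (\<phi> ` (U \<inter> V)) x = 0"
      then show "x \<notin> \<phi> ` (U \<inter> V)"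
        using vdens_pos[OF U(1), of x] by (auto simp: indicator_def vdens0_def ennreal_eq_0_iff split: if_splits)
    qed
    then have "\<phi> ` (U \<inter> V) \<in> null_sets lborel"
      using o by (subst AE_iff_null_sets) auto
    then have "negligible (\<phi> ` (U \<inter> V))"
      unfolding negligible_iff_null_sets by (rule null_sets_completionI)
    moreover have "\<phi> p \<in> \<phi> ` (U \<inter> V)" using p U by auto
    ultimately show False using open_not_negligible[OF o] by blast
  qed
  moreover have "emeasure vol (U \<inter> V) \<le> emeasure vol V" by (rule emeasure_mono) (use assms in auto)
  ultimately show ?thesis by (metis bot.extremum_unique bot.not_eq_extremum bot_ennreal)
qed

text \<open>\<open>h\<close> is the inverse chart made total by a constant value, which keeps it
  Borel. The identity of measures lets integrals over \<open>\<Omega>\<close> be computed as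
  Lebesgue integrals.\<close>

lemma vol_distr:
  assumes U: "(U, \<phi>) \<in> A" and \<Omega>: "\<Omega> \<in> sets borel" "\<Omega> \<subseteq> U"
  defines "h \<equiv> \<lambda>x. if x \<in> \<phi> ` U then inv_into U \<phi> x else undefined"
  shows "h \<in> borel \<rightarrow>\<^sub>M borel"
    "density vol (\<lambda>x. ennreal (indicator \<Omega> x)) = distr (density lborel (\<lambda>x. ennreal (vdens0 U \<phi> x * indicator (\<phi> ` \<Omega>) x))) borel h"
proof -
  have o: "open (\<phi> ` U)" by (rule chart_open_image[OF U])
  have "inv_into U \<phi> \<in> restrict_space borel (\<phi> ` U) \<rightarrow>\<^sub>M borel"
    by (rule borel_measurable_continuous_on_restrict[OF chart_inv_continuous[OF U]])
  then show h [measurable]: "h \<in> borel \<rightarrow>\<^sub>M borel"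
    unfolding h_def by (subst measurable_If_restrict_space_iff) (use o in auto)
  have m\<Omega> [measurable]: "\<phi> ` \<Omega> \<in> sets borel" by (rule chart_image_borel[OF U \<Omega>])
  note [measurable] = vdens0_measurable[OF U]
  show "density vol (\<lambda>x. ennreal (indicator \<Omega> x)) = distr (density lborel (\<lambda>x. ennreal (vdens0 U \<phi> x * indicator (\<phi> ` \<Omega>) x))) borel h"
  proof (rule measure_eqI)
    fix B assume "B \<in> sets (density vol (\<lambda>x. ennreal (indicator \<Omega> x)))"
    then have B [measurable]: "B \<in> sets borel" by simp
    have im: "indicator (\<phi> ` (\<Omega> \<inter> B)) x = (indicator (\<phi> ` \<Omega>) x * indicator B (h x) :: ennreal)" for x
    proof -
      have hr: "h (\<phi> r) = r" if "r \<in> \<Omega>" for r using that \<Omega>(2) chart_inv[OF U, of r] by (auto simp: h_def)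
      then have "\<phi> ` (\<Omega> \<inter> B) = {x \<in> \<phi> ` \<Omega>. h x \<in> B}" by auto
      then show ?thesis by (simp add: indicator_def)
    qed
    have "emeasure (density vol (\<lambda>x. ennreal (indicator \<Omega> x))) B = emeasure vol (\<Omega> \<inter> B)"
      using \<Omega>(1) B by (subst emeasure_density) (auto simp: ennreal_indicator indicator_inter_arith[symmetric])
    also have "\<dots> = (\<integral>\<^sup>+x. ennreal (vdens0 U \<phi> x) * indicator (\<phi> ` (\<Omega> \<inter> B)) x \<partial>lborel)"
      using \<Omega> B by (subst emeasure_vol[OF U]) (auto intro!: chart_vol_eq)
    also have "\<dots> = (\<integral>\<^sup>+x. ennreal (vdens0 U \<phi> x * indicator (\<phi> ` \<Omega>) x) * indicator (h -` B) x \<partial>lborel)"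
      unfolding im by (intro nn_integral_cong) (auto simp: indicator_def)
    also have "\<dots> = emeasure (distr (density lborel (\<lambda>x. ennreal (vdens0 U \<phi> x * indicator (\<phi> ` \<Omega>) x))) borel h) B"
    proof -
      have "h -` B \<in> sets borel" using measurable_sets[OF h B] by simp
      then show ?thesis by (subst emeasure_distr) (auto simp: emeasure_density)
    qed
    finally show "emeasure (density vol (\<lambda>x. ennreal (indicator \<Omega> x))) B = emeasure (distr (density lborel (\<lambda>x. ennreal (vdens0 U \<phi> x * indicator (\<phi> ` \<Omega>) x))) borel h) B" .
  qed simp
qed

lemma vol_integral:
  fixes f :: "'a \<Rightarrow> real"
  assumes U: "(U, \<phi>) \<in> A" and \<Omega>: "\<Omega> \<in> sets borel" "\<Omega> \<subseteq> U" and f [measurable]: "f \<in> borel_measurable borel"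
  shows "set_lebesgue_integral vol \<Omega> f = (\<integral>x. indicator (\<phi> ` \<Omega>) x *\<^sub>R (vdens U \<phi> x * f (inv_into U \<phi> x)) \<partial>lborel)"
proof -
  define h where "h = (\<lambda>x. if x \<in> \<phi> ` U then inv_into U \<phi> x else undefined)"
  note d = vol_distr[OF U \<Omega>, folded h_def]
  note [measurable] = d(1) vdens0_measurable[OF U] chart_image_borel[OF U \<Omega>]
  have "set_lebesgue_integral vol \<Omega> f = (\<integral>x. f x \<partial>density vol (\<lambda>x. ennreal (indicator \<Omega> x)))"
    unfolding set_lebesgue_integral_def using \<Omega>(1) by (subst integral_density) auto
  also have "\<dots> = (\<integral>x. f (h x) \<partial>density lborel (\<lambda>x. ennreal (vdens0 U \<phi> x * indicator (\<phi> ` \<Omega>) x)))"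
    unfolding d(2) by (rule integral_distr) auto
  also have "\<dots> = (\<integral>x. (vdens0 U \<phi> x * indicator (\<phi> ` \<Omega>) x) *\<^sub>R f (h x) \<partial>lborel)"
    by (rule integral_density) (use vdens0_nonneg[OF U] in auto)
  also have "\<dots> = (\<integral>x. indicator (\<phi> ` \<Omega>) x *\<^sub>R (vdens U \<phi> x * f (inv_into U \<phi> x)) \<partial>lborel)"
    by (rule Bochner_Integration.integral_cong) (use \<Omega>(2) in \<open>auto simp: indicator_def vdens0_def h_def\<close>)
  finally show ?thesis .
qed

end

section \<open>Integration over small coordinate domains\<close>

definition det_deriv :: "real ^ 'n ^ 'n \<Rightarrow> real ^ 'n ^ 'n \<Rightarrow> real"
  where "det_deriv G D = (\<Sum>k\<in>UNIV. det (\<chi> i. if i = k then D $ i else G $ i))"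

lemma det_row_scale:
  fixes D G :: "real ^ 'n ^ 'n"
  shows "det (\<chi> i. if i = k then (c *\<^sub>R D) $ i else G $ i) = c * det (\<chi> i. if i = k then D $ i else G $ i)"
proof -
  have "(\<chi> i. if i = k then (c *\<^sub>R D) $ i else G $ i) = (\<chi> i. if i = k then c *s D $ i else G $ i)"
    by (simp add: vec_eq_iff)
  then show ?thesis using det_row_mul[of k c "\<lambda>i. D $ i" "\<lambda>i. G $ i"] by simp
qed

lemma det_deriv_scale: "det_deriv G (c *\<^sub>R D) = c * det_deriv G D"
  unfolding det_deriv_def det_row_scale by (simp add: sum_distrib_left)

lemma has_derivative_det:
  fixes G :: "'e::real_normed_vector \<Rightarrow> real ^ 'n ^ 'n"
  assumes "\<And>i j. ((\<lambda>x. G x $ i $ j) has_derivative (\<lambda>v. G' v $ i $ j)) (at x)"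
  shows "((\<lambda>x. det (G x)) has_derivative (\<lambda>v. det_deriv (G x) (G' v))) (at x)"
proof -
  have "((\<lambda>x. det (G x)) has_derivative (\<lambda>v. \<Sum>p | p permutes UNIV. of_int (sign p) *
      (\<Sum>k\<in>UNIV. G' v $ k $ p k * (\<Prod>j\<in>UNIV - {k}. G x $ j $ p j)))) (at x)"
    unfolding det_def by (intro has_derivative_sum has_derivative_mult_right has_derivative_prod assms)
  moreover have "(\<Sum>p | p permutes UNIV. of_int (sign p) * (\<Sum>k\<in>UNIV. G' v $ k $ p k * (\<Prod>j\<in>UNIV - {k}. G x $ j $ p j)))
      = det_deriv (G x) (G' v)" for v
  proof -
    have "(\<Prod>i\<in>UNIV. (if i = k then G' v $ i else G x $ i) $ p i) = G' v $ k $ p k * (\<Prod>j\<in>UNIV - {k}. G x $ j $ p j)" for k p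
      by (subst prod.remove[of UNIV k]) (auto intro!: prod.cong)
    then show ?thesis unfolding det_deriv_def det_def
      by (simp add: sum_distrib_left) (rule sum.swap)
  qed
  ultimately show ?thesis by simp
qed

lemma det_deriv_line: "((\<lambda>t. det (G + t *\<^sub>R D)) has_real_derivative det_deriv G D) (at 0)"
proof -
  have "((\<lambda>t. det (G + t *\<^sub>R D)) has_derivative (\<lambda>v. det_deriv (G + 0 *\<^sub>R D) (v *\<^sub>R D))) (at 0)"
    by (rule has_derivative_det) (auto intro!: derivative_eq_intros)
  then show ?thesis by (simp add: has_field_derivative_def det_deriv_scale mult_commute_abs)
qed

text \<open>\<open>det_deriv\<close> is written in terms of rows, but as a directional derivative of
  \<open>det\<close> it inherits invariance under transposition.\<close>

lemma det_deriv_transpose: "det_deriv (transpose G) (transpose D) = det_deriv G D"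
proof -
  have "(\<lambda>t. det (transpose G + t *\<^sub>R transpose D)) = (\<lambda>t. det (G + t *\<^sub>R D))"
  proof
    fix t
    have "transpose G + t *\<^sub>R transpose D = transpose (G + t *\<^sub>R D)" by (simp add: transpose_def vec_eq_iff)
    then show "det (transpose G + t *\<^sub>R transpose D) = det (G + t *\<^sub>R D)" by (simp add: det_transpose)
  qed
  then show ?thesis using det_deriv_line[of "transpose G" "transpose D"] det_deriv_line[of G D] DERIV_unique by metis
qed

lemma det_deriv_add: "det_deriv G (D + D') = det_deriv G D + det_deriv G D'"
proof -
  have "(\<chi> i. if i = k then (D + D') $ i else G $ i) = (\<chi> i. if i = k then D $ i + D' $ i else G $ i)" for k
    by (simp add: vec_eq_iff)
  then show ?thesis
    using det_row_add[of _ "\<lambda>i. D $ i" "\<lambda>i. D' $ i" "\<lambda>i. G $ i"] by (simp add: det_deriv_def sum.distrib)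
qed

text \<open>Jacobi's formula. In row \<open>k\<close> of \<open>C ** G\<close> only the multiple of
  row \<open>k\<close> of \<open>G\<close> counts; any other row would occur twice in the
  determinant.\<close>

lemma det_deriv_mult_left: "det_deriv G (C ** G) = (\<Sum>k\<in>UNIV. C $ k $ k) * det G"
proof -
  have "det (\<chi> i. if i = k then (C ** G) $ i else G $ i) = C $ k $ k * det G" for k
  proof -
    have "(C ** G) $ i = (\<Sum>j\<in>UNIV. C $ i $ j *s G $ j)" for i
      by (simp add: matrix_matrix_mult_def vec_eq_iff)
    then have "(\<chi> i. if i = k then (C ** G) $ i else G $ i) = (\<chi> i. if i = k then \<Sum>j\<in>UNIV. C $ i $ j *s G $ j else G $ i)"
      by presburger
    then have "det (\<chi> i. if i = k then (C ** G) $ i else G $ i)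
        = (\<Sum>j\<in>UNIV. det (\<chi> i. if i = k then C $ i $ j *s G $ j else G $ i))"
      using det_linear_row_sum[of UNIV k "\<lambda>i j. C $ i $ j *s G $ j" "\<lambda>i. G $ i"] by simp
    also have "\<dots> = (\<Sum>j\<in>UNIV. C $ k $ j * det (\<chi> i. if i = k then G $ j else G $ i))"
    proof (rule sum.cong[OF refl])
      fix j
      have "(\<chi> i. if i = k then C $ i $ j *s G $ j else G $ i) = (\<chi> i. if i = k then C $ k $ j *s G $ j else G $ i)"
        by (simp add: vec_eq_iff)
      then show "det (\<chi> i. if i = k then C $ i $ j *s G $ j else G $ i) = C $ k $ j * det (\<chi> i. if i = k then G $ j else G $ i)"
        using det_row_mul[of k "C $ k $ j" "\<lambda>i. G $ j" "\<lambda>i. G $ i"] by simp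
    qed
    also have "\<dots> = (\<Sum>j\<in>UNIV. if j = k then C $ k $ k * det G else 0)"
    proof (rule sum.cong[OF refl])
      fix j
      show "C $ k $ j * det (\<chi> i. if i = k then G $ j else G $ i) = (if j = k then C $ k $ k * det G else 0)"
      proof (cases "j = k")
        case True
        then have "(\<chi> i. if i = k then G $ j else G $ i) = G" by (simp add: vec_eq_iff)
        then show ?thesis using True by simp
      next
        case False
        then have "det (\<chi> i. if i = k then G $ j else G $ i) = 0"
          by (intro det_identical_rows[of j k]) (auto simp: row_def vec_eq_iff)
        then show ?thesis using False by simp
      qed
    qed
    finally show ?thesis by simp
  qed
  then show ?thesis by (simp add: det_deriv_def sum_distrib_right)
qed

text \<open>By translation invariance every difference quotient of \<open>H\<close> has integral 0,
  and dominated convergence carries this over to the derivative.\<close>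

lemma integral_partial_derivative_eq_0:
  fixes H :: "'e::euclidean_space \<Rightarrow> real"
  assumes H: "smooth_on H UNIV" and K: "compact K" "\<And>x. x \<notin> K \<Longrightarrow> H x = 0"
  shows "(\<integral>x. frechet_derivative H (at x) e \<partial>lborel) = 0"
    and "integrable lborel (\<lambda>x. frechet_derivative H (at x) e)"
proof -
  let ?D = "\<lambda>x. frechet_derivative H (at x) e"
  have der: "(H has_derivative frechet_derivative H (at x)) (at x)" for x
    by (rule smooth_on_has_derivative[OF H]) simp
  have cD: "continuous_on UNIV ?D" and cH: "continuous_on UNIV H"
    using smooth_on_imp_continuous_on smooth_on_derivative[OF H] H by blast+
  have D0: "?D x = 0" if "x \<notin> K" for x
  proof -
    have "((\<lambda>x. 0::real) has_derivative (\<lambda>v. 0)) (at x)" by simp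
    then have "(H has_derivative (\<lambda>v. 0)) (at x)"
      by (rule has_derivative_transform_within_open[OF _ open_Compl[OF compact_imp_closed[OF K(1)]]])
        (use K that in auto)
    then show ?thesis using frechet_derivative_at by metis
  qed
  obtain M where M: "\<And>x. \<bar>?D x\<bar> \<le> M"
  proof -
    have "bounded (?D ` K)" by (rule compact_imp_bounded[OF compact_continuous_image[OF continuous_on_subset[OF cD] K(1)]]) simp
    then obtain B where "\<And>x. x \<in> K \<Longrightarrow> \<bar>?D x\<bar> \<le> B" unfolding bounded_iff by auto
    then have "\<bar>?D x\<bar> \<le> \<bar>B\<bar>" for x using D0[of x] by (cases "x \<in> K") force+
    then show ?thesis by (rule that)
  qed
  \<comment> \<open>Contains every point from which a step of length at most 1 along
    \<open>e\<close> can reach \<open>K\<close>: a common compact support for all the difference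
    quotients used.\<close>
  define K' where "K' = (\<lambda>(x, t). x - t *\<^sub>R e) ` (K \<times> {0..1::real})"
  have K': "compact K'" unfolding K'_def
    by (rule compact_continuous_image) (auto intro!: continuous_intros compact_Times K simp: case_prod_beta)
  have KK': "x \<in> K'" if "x + t *\<^sub>R e \<in> K" "t \<in> {0..1}" for x t
    unfolding K'_def using that by (auto intro!: image_eqI[of _ _ "(x + t *\<^sub>R e, t)"])
  have mv: "\<bar>H (x + h *\<^sub>R e) - H x\<bar> \<le> h * M * indicator K' x" if h: "0 < h" "h \<le> 1" for x h
  proof (cases "x \<in> K'")
    case False
    have "x \<notin> K" "x + h *\<^sub>R e \<notin> K" using False KK'[of x 0] KK'[of x h] h by auto
    then show ?thesis using K(2) False by simp
  next
    case True
    have d: "((\<lambda>t. H (x + t *\<^sub>R e)) has_real_derivative ?D (x + t *\<^sub>R e)) (at t)" for t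
    proof -
      have "((\<lambda>t. H (x + t *\<^sub>R e)) has_derivative (\<lambda>s. frechet_derivative H (at (x + t *\<^sub>R e)) (s *\<^sub>R e))) (at t)"
        by (rule has_derivative_compose[where f="\<lambda>t. x + t *\<^sub>R e" and g=H, OF _ der]) (auto intro!: derivative_eq_intros)
      moreover have "(\<lambda>s. frechet_derivative H (at (x + t *\<^sub>R e)) (s *\<^sub>R e)) = (\<lambda>s. ?D (x + t *\<^sub>R e) * s)"
        using has_derivative_bounded_linear[OF der] by (auto simp: linear_simps)
      ultimately show ?thesis by (simp add: has_field_derivative_def)
    qed
    obtain z where "H (x + h *\<^sub>R e) - H (x + 0 *\<^sub>R e) = (h - 0) * ?D (x + z *\<^sub>R e)"
      using MVT2[OF h(1), of "\<lambda>t. H (x + t *\<^sub>R e)" "\<lambda>t. ?D (x + t *\<^sub>R e)"] d by blast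
    then show ?thesis using M[of "x + z *\<^sub>R e"] True h by (simp add: abs_mult mult_left_mono)
  qed
  have mH [measurable]: "H \<in> borel_measurable borel" and mD [measurable]: "?D \<in> borel_measurable borel"
    using cH cD by (auto intro: borel_measurable_continuous_onI)
  have K'b [measurable]: "K' \<in> sets borel" "K \<in> sets borel"
    using K' K(1) by (simp_all add: borel_compact)
  have cI: "integrable lborel (\<lambda>x. c * indicator S x)" if "compact S" for c :: real and S :: "'e set"
    by (intro integrable_mult_right integrable_real_indicator)
      (use that emeasure_compact_finite[OF that] in \<open>auto intro: borel_compact\<close>)
  note finK = cI[OF K', of M]
  show iD: "integrable lborel ?D"
  proof (rule Bochner_Integration.integrable_bound[OF cI[OF K(1), of M]])
    show "AE x in lborel. norm (?D x) \<le> norm (M * indicator K x)"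
    proof (rule AE_I2)
      fix x show "norm (?D x) \<le> norm (M * indicator K x)"
        using M[of x] D0[of x] by (cases "x \<in> K") auto
    qed
  qed simp
  have iH: "integrable lborel H"
  proof -
    have "bounded (H ` K)" by (rule compact_imp_bounded[OF compact_continuous_image[OF continuous_on_subset[OF cH] K(1)]]) simp
    then obtain B where "\<And>x. x \<in> K \<Longrightarrow> \<bar>H x\<bar> \<le> B" unfolding bounded_iff by auto
    then have "norm (H x) \<le> norm (B * indicator K x)" for x using K(2)[of x] by (cases "x \<in> K") force+
    then show ?thesis by (intro Bochner_Integration.integrable_bound[OF cI[OF K(1), of B]] AE_I2) auto
  qed
  define h where "h n = inverse (real (Suc n))" for n
  have h: "0 < h n" "h n \<le> 1" for n by (auto simp: h_def inverse_le_1_iff)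
  have h0: "h \<longlonglongrightarrow> 0" unfolding h_def[abs_def] by (rule LIMSEQ_inverse_real_of_nat)
  define Q where "Q n x = (H (x + h n *\<^sub>R e) - H x) / h n" for n x
  have trans: "(\<integral>x. Q n x \<partial>lborel) = 0" for n
  proof -
    have i2: "integrable lborel (\<lambda>x. H (h n *\<^sub>R e + x))" and e2: "(\<integral>x. H (h n *\<^sub>R e + x) \<partial>lborel) = (\<integral>x. H x \<partial>lborel)"
    proof -
      have l: "distr lborel borel ((+) (h n *\<^sub>R e)) = lborel" by (rule lborel_distr_plus)
      have "integrable (distr lborel borel ((+) (h n *\<^sub>R e))) H" unfolding l by (rule iH)
      then show "integrable lborel (\<lambda>x. H (h n *\<^sub>R e + x))" by (subst (asm) integrable_distr_eq) auto
      have "(\<integral>x. H x \<partial>distr lborel borel ((+) (h n *\<^sub>R e))) = (\<integral>x. H (h n *\<^sub>R e + x) \<partial>lborel)"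
        by (rule integral_distr) auto
      then show "(\<integral>x. H (h n *\<^sub>R e + x) \<partial>lborel) = (\<integral>x. H x \<partial>lborel)" unfolding l by simp
    qed
    show ?thesis unfolding Q_def using i2 e2 iH by (simp add: add.commute)
  qed
  have "(\<lambda>n. \<integral>x. Q n x \<partial>lborel) \<longlonglongrightarrow> (\<integral>x. ?D x \<partial>lborel)"
  proof (rule integral_dominated_convergence[OF _ _ finK])
    show "AE x in lborel. (\<lambda>n. Q n x) \<longlonglongrightarrow> ?D x"
    proof (rule AE_I2)
      fix x
      have "((\<lambda>t. H (x + t *\<^sub>R e)) has_real_derivative ?D x) (at 0)"
      proof -
        have "((\<lambda>t. H (x + t *\<^sub>R e)) has_derivative (\<lambda>s. frechet_derivative H (at (x + 0 *\<^sub>R e)) (s *\<^sub>R e))) (at 0)"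
          by (rule has_derivative_compose[where f="\<lambda>t. x + t *\<^sub>R e" and g=H, OF _ der]) (auto intro!: derivative_eq_intros)
        moreover have "(\<lambda>s. frechet_derivative H (at x) (s *\<^sub>R e)) = (\<lambda>s. ?D x * s)"
          using has_derivative_bounded_linear[OF der] by (auto simp: linear_simps)
        ultimately show ?thesis by (simp add: has_field_derivative_def)
      qed
      then have "((\<lambda>t. (H (x + t *\<^sub>R e) - H x) / t) \<longlongrightarrow> ?D x) (at 0)" by (simp add: DERIV_def)
      moreover have "filterlim h (at 0) sequentially"
        using h0 h(1) by (auto simp: filterlim_at intro!: eventuallyI) (metis less_irrefl)
      ultimately show "(\<lambda>n. Q n x) \<longlonglongrightarrow> ?D x"
        unfolding Q_def using filterlim_compose by blast
    qed
    show "AE x in lborel. norm (Q n x) \<le> M * indicator K' x" for n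
    proof (rule AE_I2)
      fix x
      show "norm (Q n x) \<le> M * indicator K' x"
        using mv[OF h, of x n] h(1)[of n] by (simp add: Q_def abs_divide divide_le_eq mult.assoc mult.commute mult.left_commute)
    qed
  qed (auto simp: Q_def)
  then show "(\<integral>x. ?D x \<partial>lborel) = 0" using trans LIMSEQ_unique[OF _ tendsto_const] by fastforce
qed

text \<open>\<open>\<Omega>\<close> is at the same time an admissible domain for variations and
  small enough to lie in one chart. \<open>x\<close> and \<open>C\<close> are global extensions of
  the coordinate functions and coordinate fields, agreeing with them on \<open>N\<close>, a
  neighbourhood of the closure of \<open>\<Omega>\<close>.\<close>

locale chart_domain = riemannian2 A g
  for A :: "('a::{t2_space, second_countable_topology}, 'n::finite) atlas" and g +
  fixes U :: "'a set" and \<phi> :: "'a \<Rightarrow> real ^ 'n" and N :: "'a set" and x :: "'n \<Rightarrow> 'a \<Rightarrow> real"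
    and C :: "'n \<Rightarrow> 'a vfield" and \<Omega> :: "'a set"
  assumes U: "(U, \<phi>) \<in> A" and N: "open N" "N \<subseteq> U"
    and x: "\<And>i. x i \<in> smooth_funs A" "\<And>i q. q \<in> N \<Longrightarrow> x i q = \<phi> q $ i"
    and C: "\<And>i. C i \<in> smooth_vfields A" "\<And>i q. q \<in> N \<Longrightarrow> C i q = coord_vec A U \<phi> i q"
    and \<Omega>: "open \<Omega>" "connected \<Omega>" "compact (closure \<Omega>)" "closure \<Omega> \<subseteq> N" "emeasure vol \<Omega> < \<infinity>"

text \<open>A small coordinate ball: connected as an image of a ball, with compact closure inside
  the image of the closed ball, and of finite volume because the density is bounded there.\<close>

lemma (in riemannian2) chart_domain_ex:
  assumes W: "open W" "p \<in> W"
  obtains U \<phi> N x C \<Omega> where "chart_domain A g U \<phi> N x C \<Omega>" "p \<in> \<Omega>" "closure \<Omega> \<subseteq> W"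
proof -
  obtain U \<phi> where U: "(U, \<phi>) \<in> A" "p \<in> U" by (rule chart_ex)
  obtain x M where x: "\<And>i. x i \<in> smooth_funs A" "open M" "p \<in> M" "\<And>i q. q \<in> M \<Longrightarrow> x i q = \<phi> q $ i"
    by (rule coord_fun_ex[OF U]) blast
  obtain C M' where C: "\<And>i. C i \<in> smooth_vfields A" "open M'" "p \<in> M'" "M' \<subseteq> U"
    "\<And>i q. q \<in> M' \<Longrightarrow> C i q = coord_vec A U \<phi> i q" by (rule coord_frame_ex[OF U]) blast
  define N where "N = M \<inter> M'"
  have N: "open N" "p \<in> N" "N \<subseteq> U" using x C unfolding N_def by auto
  define a where "a = \<phi> p"
  have "open (\<phi> ` (U \<inter> (N \<inter> W)))" "a \<in> \<phi> ` (U \<inter> (N \<inter> W))"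
    using chart_image_open[OF U(1) open_Int[OF N(1) W(1)]] U N W a_def by auto
  then obtain e where e: "e > 0" "cball a e \<subseteq> \<phi> ` (U \<inter> (N \<inter> W))" using open_contains_cball by blast
  have sub: "cball a e \<subseteq> \<phi> ` U" using e by auto
  define \<Omega> where "\<Omega> = {q\<in>U. \<phi> q \<in> ball a e}"
  define K where "K = inv_into U \<phi> ` cball a e"
  have K: "compact K" "closed K" using chart_closed_ball[OF U(1)] sub unfolding K_def a_def by blast+
  have KNW: "K \<subseteq> N \<inter> W" using e(2) chart_inv[OF U(1)] unfolding K_def by fastforce
  have \<Omega>im: "\<Omega> = inv_into U \<phi> ` ball a e"
  proof
    show "\<Omega> \<subseteq> inv_into U \<phi> ` ball a e" unfolding \<Omega>_def using chart_inv[OF U(1)] by (auto intro!: image_eqI[where x="\<phi> _"])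
    show "inv_into U \<phi> ` ball a e \<subseteq> \<Omega>"
    proof
      fix q assume "q \<in> inv_into U \<phi> ` ball a e"
      then obtain y where y: "y \<in> ball a e" "q = inv_into U \<phi> y" by blast
      then have "y \<in> \<phi> ` U" using sub ball_subset_cball by blast
      then show "q \<in> \<Omega>" using y chart_inv_mem[OF U(1)] chart_inv2[of y \<phi> U] unfolding \<Omega>_def by simp
    qed
  qed
  have \<Omega>K: "\<Omega> \<subseteq> K" unfolding \<Omega>im K_def using ball_subset_cball by blast
  have cl: "closure \<Omega> \<subseteq> K" using \<Omega>K K(2) by (rule closure_minimal)
  have o\<Omega>: "open \<Omega>" unfolding \<Omega>_def by (rule chart_vimage_open[OF U(1) open_ball])
  have conn: "connected \<Omega>" unfolding \<Omega>im
    by (rule connected_continuous_image[OF continuous_on_subset[OF chart_inv_continuous[OF U(1)]]])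
      (use sub ball_subset_cball[of a e] in auto)
  have comp: "compact (closure \<Omega>)" using compact_Int_closed[OF K(1), of "closure \<Omega>"] cl by (simp add: Int_absorb1)
  have \<phi>\<Omega>: "\<phi> ` \<Omega> \<subseteq> cball a e" unfolding \<Omega>_def by auto
  have fin: "emeasure vol \<Omega> < \<infinity>"
  proof -
    have "bounded (vdens U \<phi> ` cball a e)"
      by (rule compact_imp_bounded[OF compact_continuous_image[OF continuous_on_subset[OF vdens_continuous[OF U(1)] sub]]]) simp
    then obtain B where B: "\<And>y. y \<in> cball a e \<Longrightarrow> \<bar>vdens U \<phi> y\<bar> \<le> B"
      unfolding bounded_iff by (auto simp del: mem_cball)
    have "emeasure vol \<Omega> = chart_vol U \<phi> \<Omega>" by (rule emeasure_vol[OF U(1)]) (use o\<Omega> in \<open>auto simp: \<Omega>_def\<close>)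
    also have "\<dots> \<le> (\<integral>\<^sup>+y. ennreal B * indicator (cball a e) y \<partial>lborel)"
      unfolding chart_vol_def
      by (rule nn_integral_mono) (use B \<phi>\<Omega> in \<open>auto simp: indicator_def subset_iff intro!: ennreal_leI intro: order_trans[OF abs_ge_self]\<close>)
    also have "\<dots> = ennreal B * emeasure lborel (cball a e)" by (subst nn_integral_cmult_indicator) auto
    also have "\<dots> < \<infinity>" using emeasure_compact_finite[of "cball a e"] by (simp add: ennreal_mult_less_top)
    finally show ?thesis .
  qed
  have "chart_domain A g U \<phi> N x C \<Omega>"
    by unfold_locales (use U N x C o\<Omega> conn comp cl KNW fin in \<open>auto simp: N_def\<close>)
  moreover have "p \<in> \<Omega>" unfolding \<Omega>_def using U e a_def by auto
  ultimately show ?thesis using that cl KNW by (meson Int_lower2 subset_trans)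
qed

section \<open>Integration and test functions on a coordinate domain\<close>

context chart_domain
begin

lemma \<Omega>_sub: "\<Omega> \<subseteq> N" "\<Omega> \<subseteq> U" "\<Omega> \<in> sets borel"
  using \<Omega>(1,4) N(2) closure_subset[of \<Omega>] by auto

lemma \<Omega>_domain: "rel_compact_domain \<Omega>"
  using \<Omega> by (simp add: rel_compact_domain_def)

lemma set_integrable_bounded:
  fixes f :: "'a \<Rightarrow> real"
  assumes "f \<in> borel_measurable borel" "\<And>q. q \<in> \<Omega> \<Longrightarrow> \<bar>f q\<bar> \<le> B"
  shows "set_integrable vol \<Omega> f"
proof -
  have "f \<in> borel_measurable vol" using assms(1) by simp
  then show ?thesis unfolding set_integrable_def
    by (intro integrableI_bounded_set_indicator[where B=B]) (use assms \<Omega>_sub \<Omega>(5) in auto)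
qed

lemma smooth_bounded:
  assumes "f \<in> smooth_funs A" obtains B where "\<And>q. q \<in> \<Omega> \<Longrightarrow> \<bar>f q\<bar> \<le> B"
proof -
  have "bounded (f ` closure \<Omega>)"
    by (rule compact_imp_bounded[OF compact_continuous_image[OF smooth_funs_continuous[OF assms] \<Omega>(3)]])
  then show ?thesis using that closure_subset[of \<Omega>] unfolding bounded_iff by (metis image_eqI real_norm_def subsetD)
qed

lemma smooth_set_integrable:
  assumes "f \<in> smooth_funs A" shows "set_integrable vol \<Omega> f"
proof -
  obtain B where B: "\<And>q. q \<in> \<Omega> \<Longrightarrow> \<bar>f q\<bar> \<le> B" by (rule smooth_bounded[OF assms], rule that)
  show ?thesis
    by (rule set_integrable_bounded[OF borel_measurable_continuous_onI[OF smooth_funs_continuous[OF assms]] B])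
qed

text \<open>If \<open>f q\<close> were not 0, a bump supported where \<open>f\<close> has the sign
  of \<open>f q\<close> would give a nonnegative integrand with integral 0. It is positive on a
  nonempty open set, which would then be a null set.\<close>

lemma fundamental_lemma:
  assumes f: "f \<in> smooth_funs A"
    and zero: "\<And>s. s \<in> smooth_funs A \<Longrightarrow> (\<And>q. 0 \<le> s q) \<Longrightarrow> closure {q. s q \<noteq> 0} \<subseteq> \<Omega> \<Longrightarrow>
      set_lebesgue_integral vol \<Omega> (\<lambda>q. s q * f q) = 0"
    and q: "q \<in> \<Omega>"
  shows "f q = 0"
proof (rule ccontr)
  assume fq: "f q \<noteq> 0"
  define V where "V = \<Omega> \<inter> {r. f r * f q > 0}"
  have "open {r. f r * f q > 0}"
    using continuous_open_preimage[OF smooth_funs_continuous[OF smooth_funs_mult[OF f smooth_funs_const[of "f q"]], of UNIV] open_UNIV, of "{0<..}"]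
    by (simp add: vimage_def)
  then have V: "open V" "q \<in> V" unfolding V_def using \<Omega>(1) q fq by (auto simp: zero_less_mult_iff)
  obtain s M where s: "s \<in> smooth_funs A" "open M" "q \<in> M" "\<And>r. r \<in> M \<Longrightarrow> s r = 1" "\<And>r. 0 \<le> s r" "closure {r. s r \<noteq> 0} \<subseteq> V"
    by (rule smooth_bump[OF V]) blast
  have sf: "(\<lambda>r. s r * (f r * f q)) \<in> smooth_funs A" using s f by auto
  \<comment> \<open>Multiplication by the constant \<open>f q\<close> treats both signs
    together.\<close>
  have "set_lebesgue_integral vol \<Omega> (\<lambda>r. s r * (f r * f q)) = set_lebesgue_integral vol \<Omega> (\<lambda>r. s r * f r) * f q"
    by (simp add: set_integral_mult_left[symmetric] mult.assoc)
  also have "\<dots> = 0" using zero[OF s(1,5)] s(6) unfolding V_def by simp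
  finally have z: "(\<integral>r. indicator \<Omega> r *\<^sub>R (s r * (f r * f q)) \<partial>vol) = 0" unfolding set_lebesgue_integral_def .
  have nn: "0 \<le> indicator \<Omega> r *\<^sub>R (s r * (f r * f q))" for r
  proof (cases "s r = 0")
    case False
    then have "r \<in> V" using s(6) closure_subset[of "{r. s r \<noteq> 0}"] by auto
    then have "0 \<le> s r * (f r * f q)" using s(5)[of r] unfolding V_def by (auto intro: mult_nonneg_nonneg[of "s r" "f r * f q"])
    then show ?thesis by simp
  qed simp
  have "AE r in vol. indicator \<Omega> r *\<^sub>R (s r * (f r * f q)) = 0"
    using integral_nonneg_eq_0_iff_AE[of vol "\<lambda>r. indicator \<Omega> r *\<^sub>R (s r * (f r * f q))"] z nn
      smooth_set_integrable[OF sf] unfolding set_integrable_def by auto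
  then have "AE r in vol. r \<notin> M \<inter> V"
    by (rule AE_mp, intro AE_I2 impI) (use s(4) in \<open>auto simp: V_def\<close>)
  then have "M \<inter> V \<in> null_sets vol" using s(2) V(1) by (subst AE_iff_null_sets) auto
  then have "emeasure vol (M \<inter> V) = 0" by auto
  then show False using vol_open_pos[of "M \<inter> V"] s(2,3) V by auto
qed

lemma C_rep: "X \<in> smooth_vfields A \<Longrightarrow> q \<in> N \<Longrightarrow> X q = (\<Sum>i\<in>UNIV. X q (x i) *\<^sub>R C i q)"
  using tangent_coord_rep[OF U subsetD[OF N(2)] vf_tangent x(1) N(1) _ x(2)] C(2) by simp

lemma C_coord: assumes "q \<in> N" shows "C i q (x j) = (if i = j then 1 else 0)"
  unfolding C(2)[OF assms]
  by (rule coord_vec_coord_fun[OF U subsetD[OF N(2) assms] x(1) N(1) assms x(2)])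

lemma C_apply:
  assumes "q \<in> N" "f \<in> smooth_funs A"
  shows "C i q f = frechet_derivative (f \<circ> inv_into U \<phi>) (at (\<phi> q)) (axis i 1)"
  unfolding C(2)[OF assms(1)] coord_vec_def using assms(2) by simp

lemma bracket_C:
  assumes X: "X \<in> smooth_vfields A" and q: "q \<in> N"
  shows "lie_bracket X (C k) q = - (\<Sum>j\<in>UNIV. C k q (\<lambda>r. X r (x j)) *\<^sub>R C j q)"
proof -
  have "lie_bracket X (C k) q (x j) = - C k q (\<lambda>r. X r (x j))" for j
  proof -
    have "X q (\<lambda>r. C k r (x j)) = X q (\<lambda>r. if k = j then 1 else 0)"
      by (rule tangent_local[OF vf_tangent[OF X] _ _ N(1) q]) (use C x C_coord in auto)
    then show ?thesis using tangent_const[OF vf_tangent[OF X]] by (simp add: lie_bracket_apply)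
  qed
  then show ?thesis using C_rep[OF lie_bracket_vf[OF X C(1)] q, of k] by (simp add: sum_negf)
qed

text \<open>In coordinates, with components \<open>a i\<close> of \<open>\<xi>\<close> and density
  \<open>\<rho>\<close>, the Killing equation and Jacobi's formula give that the partial derivatives
  of \<open>a i * \<rho>\<close> add up to 0. Hence \<open>\<rho>\<close> times the derivative of
  \<open>s\<close> along \<open>\<xi>\<close> is a sum of partial derivatives of the compactly
  supported functions \<open>a i * s * \<rho>\<close>, each with integral 0.\<close>

lemma killing_divergence_free:
  assumes k: "killing_field A g \<xi>" and s: "s \<in> smooth_funs A" "closure {q. s q \<noteq> 0} \<subseteq> \<Omega>"
  shows "set_lebesgue_integral vol \<Omega> (\<lambda>q. \<xi> q s) = 0"
proof -
  have \<xi>: "\<xi> \<in> smooth_vfields A" using k unfolding killing_field_def by blast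
  define a where "a i = (\<lambda>q. \<xi> q (x i))" for i
  have a: "a i \<in> smooth_funs A" for i unfolding a_def using \<xi> x by auto
  let ?inv = "inv_into U \<phi>" and ?G = "gram U \<phi>" and ?\<rho> = "vdens U \<phi>"
  define Ks where "Ks = closure {q. s q \<noteq> 0}"
  have Ks: "compact Ks" "Ks \<subseteq> \<Omega>" "\<And>q. q \<notin> Ks \<Longrightarrow> s q = 0"
  proof -
    show "compact Ks" using compact_Int_closed[OF \<Omega>(3), of Ks] s(2) closure_subset[of \<Omega>]
      unfolding Ks_def by (simp add: Int_absorb1)
    show "Ks \<subseteq> \<Omega>" using s unfolding Ks_def by simp
    show "s q = 0" if "q \<notin> Ks" for q using that closure_subset[of "{q. s q \<noteq> 0}"] unfolding Ks_def by auto
  qed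
  have \<phi>K: "compact (\<phi> ` Ks)"
    by (rule compact_continuous_image[OF continuous_on_subset[OF chart_continuous[OF U]] Ks(1)]) (use Ks \<Omega>_sub in auto)
  \<comment> \<open>The components of the flux of \<open>s *\<^sub>R \<xi>\<close>, extended by 0
    outside the chart image.\<close>
  define H where "H i y = (if y \<in> \<phi> ` U then a i (?inv y) * s (?inv y) * ?\<rho> y else 0)" for i y
  have oU: "open (\<phi> ` U)" by (rule chart_open_image[OF U])
  have \<rho>s: "smooth_on ?\<rho> (\<phi> ` U)"
  proof -
    have "smooth_on (\<lambda>y. inverse (sqrt (det (?G y)))) (\<phi> ` U)"
      by (rule smooth_on_compose[OF oU _ gram_det_smooth[OF U] smooth_on_inverse_sqrt]) (use gram_det_pos[OF U] in auto)
    then have "smooth_on (\<lambda>y. det (?G y) * inverse (sqrt (det (?G y)))) (\<phi> ` U)"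
      by (rule smooth_on_mult[OF oU gram_det_smooth[OF U]])
    then show ?thesis
      by (rule smooth_on_eq[OF _ oU]) (simp add: vdens_def divide_inverse[symmetric] real_div_sqrt[OF less_imp_le[OF gram_det_pos[OF U]]])
  qed
  have Hout: "H i y = 0" if "y \<notin> \<phi> ` Ks" for i y
  proof (cases "y \<in> \<phi> ` U")
    case True
    then have "?inv y \<notin> Ks" using that chart_inv2[OF True] by (metis imageI)
    then show ?thesis using Ks(3) by (simp add: H_def)
  qed (simp add: H_def)
  have Hs: "smooth_on (H i) UNIV" for i
  proof (rule smooth_on_local)
    fix y :: "real ^ 'n"
    show "\<exists>T. open T \<and> y \<in> T \<and> smooth_on (H i) T"
    proof (cases "y \<in> \<phi> ` U")
      case True
      have "smooth_on (\<lambda>y. (a i \<circ> ?inv) y * (s \<circ> ?inv) y * ?\<rho> y) (\<phi> ` U)"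
        by (intro smooth_on_mult oU \<rho>s smooth_funsD[OF a U] smooth_funsD[OF s(1) U])
      then have "smooth_on (H i) (\<phi> ` U)" by (rule smooth_on_eq[OF _ oU]) (simp add: H_def)
      then show ?thesis using oU True by blast
    next
      case False
      have o: "open (- (\<phi> ` Ks))" using \<phi>K compact_imp_closed by (auto simp: open_Compl)
      have "smooth_on (H i) (- (\<phi> ` Ks))"
        by (rule smooth_on_eq[OF smooth_on_const[OF o, of 0] o]) (use Hout in auto)
      moreover have "y \<in> - (\<phi> ` Ks)" using False Ks(2) \<Omega>_sub(2) by auto
      ultimately show ?thesis using o by blast
    qed
  qed
  have point: "(\<Sum>i\<in>UNIV. frechet_derivative (H i) (at y) (axis i 1)) = indicator (\<phi> ` \<Omega>) y *\<^sub>R (?\<rho> y * \<xi> (?inv y) s)" for y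
  proof (cases "y \<in> \<phi> ` \<Omega>")
    case False
    have o: "open (- (\<phi> ` Ks))" using \<phi>K compact_imp_closed by (auto simp: open_Compl)
    have "(H i has_derivative (\<lambda>v. 0)) (at y)" for i
    proof -
      have "((\<lambda>x. 0::real) has_derivative (\<lambda>v. 0)) (at y)" by simp
      then show ?thesis
        by (rule has_derivative_transform_within_open[OF _ o]) (use False Ks(2) Hout in auto)
    qed
    then show ?thesis using False frechet_derivative_at by (metis (no_types, lifting) indicator_simps(2) scale_zero_left sum.neutral)
  next
    case True
    then obtain q where q: "q \<in> \<Omega>" "y = \<phi> q" by auto
    then have qN: "q \<in> N" and qU: "q \<in> U" using \<Omega>_sub by auto
    have iy: "?inv y = q" using q chart_inv[OF U qU] by simp
    have yU: "y \<in> \<phi> ` U" using q qU by simp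
    define ds where "ds = frechet_derivative (s \<circ> ?inv) (at y)"
    define da where "da i = frechet_derivative (a i \<circ> ?inv) (at y)" for i
    define dG where "dG v = (\<chi> k l. frechet_derivative (\<lambda>y. ?G y $ k $ l) (at y) v)" for v
    have d1: "((s \<circ> ?inv) has_derivative ds) (at y)" "((a i \<circ> ?inv) has_derivative da i) (at y)" for i
      unfolding ds_def da_def using smooth_on_has_derivative[OF smooth_funsD[OF s(1) U] yU]
        smooth_on_has_derivative[OF smooth_funsD[OF a U] yU] by auto
    have dg: "((\<lambda>y. ?G y $ k $ l) has_derivative (\<lambda>v. dG v $ k $ l)) (at y)" for k l
      using smooth_on_has_derivative[OF gram_smooth[OF U] yU] by (simp add: dG_def)
    have ddet: "((\<lambda>y. det (?G y)) has_derivative (\<lambda>v. det_deriv (?G y) (dG v))) (at y)"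
      by (rule has_derivative_det[OF dg])
    have pos: "det (?G y) > 0" by (rule gram_det_pos[OF U yU])
    have \<rho>0: "?\<rho> y > 0" by (rule vdens_pos[OF U yU])
    have d\<rho>: "(?\<rho> has_derivative (\<lambda>v. det_deriv (?G y) (dG v) * (inverse (?\<rho> y) / 2))) (at y)"
    proof -
      have "(sqrt has_derivative (\<lambda>h. h * (inverse (sqrt (det (?G y))) / 2))) (at (det (?G y)))"
        using DERIV_real_sqrt[OF pos] by (simp only: has_field_derivative_def mult_commute_abs)
      from has_derivative_compose[OF ddet this] show ?thesis by (simp add: vdens_def[abs_def])
    qed
    have CG: "\<xi> q (\<lambda>r. g r (C k r) (C l r)) = (\<Sum>i\<in>UNIV. a i q * dG (axis i 1) $ k $ l)" for k l
    proof -
      have "\<xi> q (\<lambda>r. g r (C k r) (C l r)) = (\<Sum>i\<in>UNIV. a i q * C i q (\<lambda>r. g r (C k r) (C l r)))"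
        by (subst C_rep[OF \<xi> qN]) (simp add: sum_fun_apply scaleR_fun_def a_def)
      moreover have "C i q (\<lambda>r. g r (C k r) (C l r)) = dG (axis i 1) $ k $ l" for i
      proof -
        have o: "open (\<phi> ` (U \<inter> N))" by (rule chart_image_open[OF U N(1)])
        have "((\<lambda>r. g r (C k r) (C l r)) \<circ> ?inv has_derivative (\<lambda>v. dG v $ k $ l)) (at y)"
          by (rule has_derivative_transform_within_open[OF dg o])
            (use q qN qU chart_inv[OF U] C(2) in \<open>auto simp: gram_def\<close>)
        then show ?thesis using C_apply[OF qN g_smooth[OF C(1) C(1)]] q(2)
          by (simp add: frechet_derivative_at[symmetric])
      qed
      ultimately show ?thesis by simp
    qed
    \<comment> \<open>The matrix of the bracket with \<open>\<xi>\<close> in the coordinate frame.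
      The Killing equation becomes: the derivative of the Gram matrix along \<open>\<xi>\<close> is
      \<open>M ** G\<close> plus its transpose.\<close>
    define M where "M = (\<chi> k j. - C k q (a j))"
    have Gq: "?G y $ k $ l = g q (C k q) (C l q)" for k l
      using C(2)[OF qN] iy by (simp add: gram_def)
    have br: "g q (lie_bracket \<xi> (C k) q) (C l q) = (M ** ?G y) $ k $ l" for k l
    proof -
      have "lie_bracket \<xi> (C k) q = (\<Sum>j\<in>UNIV. M $ k $ j *\<^sub>R C j q)"
        unfolding bracket_C[OF \<xi> qN] by (simp add: M_def a_def sum_negf)
      then show ?thesis using C(1) by (simp add: g_sum_left matrix_matrix_mult_def Gq)
    qed
    have GT: "transpose (?G y) = ?G y" using g_sym C(1) by (simp add: transpose_def vec_eq_iff Gq)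
    have "(\<Sum>i\<in>UNIV. a i q *\<^sub>R dG (axis i 1)) = M ** ?G y + transpose (M ** ?G y)"
    proof -
      have "(\<Sum>i\<in>UNIV. a i q * dG (axis i 1) $ k $ l) = (M ** ?G y) $ k $ l + (M ** ?G y) $ l $ k" for k l
      proof -
        have "\<xi> q (\<lambda>r. g r (C k r) (C l r)) = g q (lie_bracket \<xi> (C k) q) (C l q) + g q (C k q) (lie_bracket \<xi> (C l) q)"
          using k C(1) unfolding killing_field_def by blast
        then show ?thesis using br[of k l] br[of l k] g_sym[of "C k q" q "lie_bracket \<xi> (C l) q"] CG[of k l] \<xi> C(1) by simp
      qed
      then show ?thesis by (simp add: vec_eq_iff transpose_def)
    qed
    then have "det_deriv (?G y) (\<Sum>i\<in>UNIV. a i q *\<^sub>R dG (axis i 1))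
        = det_deriv (?G y) (M ** ?G y) + det_deriv (?G y) (transpose (M ** ?G y))" by (simp add: det_deriv_add)
    also have "det_deriv (?G y) (transpose (M ** ?G y)) = det_deriv (?G y) (M ** ?G y)"
      using det_deriv_transpose[of "?G y" "M ** ?G y"] GT by simp
    \<comment> \<open>The two transposed terms contribute equally; the resulting 2 is cancelled by
      the 1/2 from the square root in the density.\<close>
    finally have dd: "det_deriv (?G y) (\<Sum>i\<in>UNIV. a i q *\<^sub>R dG (axis i 1)) = - 2 * (\<Sum>i\<in>UNIV. C i q (a i)) * det (?G y)"
      by (simp add: det_deriv_mult_left M_def sum_negf)
    have lin: "det_deriv (?G y) (\<Sum>i\<in>UNIV. a i q *\<^sub>R dG (axis i 1)) = (\<Sum>i\<in>UNIV. a i q * det_deriv (?G y) (dG (axis i 1)))"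
    proof -
      have z: "det_deriv (?G y) 0 = 0" using det_deriv_scale[of "?G y" 0 0] by simp
      show ?thesis by (induction rule: finite_induct[OF finite[of UNIV]]) (simp_all add: z det_deriv_add det_deriv_scale)
    qed
    have Ca: "C i q (a j) = da j (axis i 1)" "C i q s = ds (axis i 1)" for i j
      using C_apply[OF qN a] C_apply[OF qN s(1)] q(2) by (simp_all add: da_def ds_def)
    have \<xi>s: "\<xi> q s = (\<Sum>i\<in>UNIV. a i q * ds (axis i 1))"
      by (subst C_rep[OF \<xi> qN]) (simp add: sum_fun_apply scaleR_fun_def a_def Ca)
    have Hd: "frechet_derivative (H i) (at y) (axis i 1)
        = (a i q * ds (axis i 1) + da i (axis i 1) * s q) * ?\<rho> y
          + a i q * s q * (det_deriv (?G y) (dG (axis i 1)) * (inverse (?\<rho> y) / 2))" for i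
    proof -
      have "((\<lambda>y. (a i \<circ> ?inv) y * (s \<circ> ?inv) y * ?\<rho> y) has_derivative
        (\<lambda>v. (a i \<circ> ?inv) y * (s \<circ> ?inv) y * (det_deriv (?G y) (dG v) * (inverse (?\<rho> y) / 2))
          + ((a i \<circ> ?inv) y * ds v + da i v * (s \<circ> ?inv) y) * ?\<rho> y)) (at y)"
        by (intro has_derivative_mult d1 d\<rho>)
      then have "(H i has_derivative (\<lambda>v. (a i \<circ> ?inv) y * (s \<circ> ?inv) y * (det_deriv (?G y) (dG v) * (inverse (?\<rho> y) / 2))
          + ((a i \<circ> ?inv) y * ds v + da i v * (s \<circ> ?inv) y) * ?\<rho> y)) (at y)"
        by (rule has_derivative_transform_within_open[OF _ oU yU]) (simp add: H_def)
      then show ?thesis by (simp add: frechet_derivative_at[symmetric] iy)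
    qed
    have "(\<Sum>i\<in>UNIV. frechet_derivative (H i) (at y) (axis i 1))
      = \<xi> q s * ?\<rho> y + s q * ((\<Sum>i\<in>UNIV. C i q (a i)) * ?\<rho> y
        + (\<Sum>i\<in>UNIV. a i q * det_deriv (?G y) (dG (axis i 1))) * (inverse (?\<rho> y) / 2))"
      by (simp add: Hd \<xi>s Ca sum.distrib sum_distrib_left sum_distrib_right algebra_simps)
    also have "(\<Sum>i\<in>UNIV. C i q (a i)) * ?\<rho> y + (\<Sum>i\<in>UNIV. a i q * det_deriv (?G y) (dG (axis i 1))) * (inverse (?\<rho> y) / 2) = 0"
    proof -
      have "det (?G y) = ?\<rho> y * ?\<rho> y" using pos by (simp add: vdens_def)
      then show ?thesis using \<rho>0 unfolding lin[symmetric] dd by (simp add: field_simps)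
    qed
    finally show ?thesis using True iy by (simp add: mult.commute)
  qed
  have "set_lebesgue_integral vol \<Omega> (\<lambda>q. \<xi> q s) = (\<integral>y. (\<Sum>i\<in>UNIV. frechet_derivative (H i) (at y) (axis i 1)) \<partial>lborel)"
    unfolding point
    by (rule vol_integral[OF U \<Omega>_sub(3,2) borel_measurable_continuous_onI[OF smooth_funs_continuous[OF vf_apply[OF \<xi> s(1)]]]])
  also have "\<dots> = (\<Sum>i\<in>UNIV. \<integral>y. frechet_derivative (H i) (at y) (axis i 1) \<partial>lborel)"
    by (rule Bochner_Integration.integral_sum) (rule integral_partial_derivative_eq_0(2)[OF Hs \<phi>K Hout])
  also have "\<dots> = 0" using integral_partial_derivative_eq_0(1)[OF Hs \<phi>K Hout] by simp
  finally show ?thesis .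
qed

end

section \<open>The mixed scalar curvature in an adapted frame\<close>

context connection
begin

lemma curvature_tangent:
  assumes "u \<in> tangent A q" "v \<in> tangent A q" "w \<in> tangent A q"
  shows "curvature A nab q u v w \<in> tangent A q"
proof -
  have "curvature A nab q u v w = Rm (extend_vec A q u) (extend_vec A q v) (extend_vec A q w) q"
    using curvature_eq_Rm[of "extend_vec A q u" "extend_vec A q v" "extend_vec A q w" q] assms by simp
  then show ?thesis using assms by simp
qed

lemma
  assumes [simp]: "u \<in> tangent A q" "u' \<in> tangent A q" "v \<in> tangent A q" "w \<in> tangent A q"
  shows curvature_add1: "curvature A nab q (u + u') v w = curvature A nab q u v w + curvature A nab q u' v w"
    and curvature_scale1: "curvature A nab q (c *\<^sub>R u) v w = c *\<^sub>R curvature A nab q u v w"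
    and curvature_add2: "curvature A nab q v (u + u') w = curvature A nab q v u w + curvature A nab q v u' w"
    and curvature_scale2: "curvature A nab q v (c *\<^sub>R u) w = c *\<^sub>R curvature A nab q v u w"
    and curvature_add3: "curvature A nab q v w (u + u') = curvature A nab q v w u + curvature A nab q v w u'"
    and curvature_scale3: "curvature A nab q v w (c *\<^sub>R u) = c *\<^sub>R curvature A nab q v w u"
proof -
  let ?X = "extend_vec A q"
  have eq: "curvature A nab q a b d = Rm X Y Z q"
    if "X \<in> smooth_vfields A" "Y \<in> smooth_vfields A" "Z \<in> smooth_vfields A" "X q = a" "Y q = b" "Z q = d" for X Y Z a b d
    using curvature_eq_Rm[OF that(1-3), of q] that by simp
  have anti: "curvature A nab q a b d = - curvature A nab q b a d"
    if "a \<in> tangent A q" "b \<in> tangent A q" "d \<in> tangent A q" for a b d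
    using eq[of "?X a" "?X b" "?X d"] eq[of "?X b" "?X a" "?X d"] Rm_antisym[of "?X a" "?X b" "?X d" q] that by simp
  show 1: "curvature A nab q (u + u') v w = curvature A nab q u v w + curvature A nab q u' v w"
    using eq[of "\<lambda>r. ?X u r + ?X u' r" "?X v" "?X w" "u + u'" v w] eq[of "?X u" "?X v" "?X w" u v w]
      eq[of "?X u'" "?X v" "?X w" u' v w] Rm_add_left[of "?X u" "?X u'" "?X v" "?X w" q] by simp
  show 2: "curvature A nab q (c *\<^sub>R u) v w = c *\<^sub>R curvature A nab q u v w"
    using eq[of "\<lambda>r. c *\<^sub>R ?X u r" "?X v" "?X w" "c *\<^sub>R u" v w] eq[of "?X u" "?X v" "?X w" u v w]
      Rm_scale_left[of "\<lambda>r. c" "?X u" "?X v" "?X w" q] by simp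
  show "curvature A nab q v (u + u') w = curvature A nab q v u w + curvature A nab q v u' w"
    using 1 anti[of v "u + u'" w] anti[of v u w] anti[of v u' w] by simp
  show "curvature A nab q v (c *\<^sub>R u) w = c *\<^sub>R curvature A nab q v u w"
    using 2 anti[of v "c *\<^sub>R u" w] anti[of v u w] by simp
  show "curvature A nab q v w (u + u') = curvature A nab q v w u + curvature A nab q v w u'"
    using eq[of "?X v" "?X w" "\<lambda>r. ?X u r + ?X u' r" v w "u + u'"] eq[of "?X v" "?X w" "?X u" v w u]
      eq[of "?X v" "?X w" "?X u'" v w u'] Rm_add_right[of "?X v" "?X w" "?X u" "?X u'" q] by simp
  show "curvature A nab q v w (c *\<^sub>R u) = c *\<^sub>R curvature A nab q v w u"
    using eq[of "?X v" "?X w" "\<lambda>r. c *\<^sub>R ?X u r" v w "c *\<^sub>R u"] eq[of "?X v" "?X w" "?X u" v w u]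
      Rm_scale_right[of "\<lambda>r. c" "?X v" "?X w" "?X u" q] by simp
qed

end

context riemannian
begin

lemma contorted_affine:
  assumes T: "smooth_tensor12 A T"
  shows "affine_connection A (contorted_connection A g T)"
proof -
  interpret LC: connection A LC by unfold_locales (rule levi_civita_affine)
  have Tl: "T p (a *\<^sub>R u + b *\<^sub>R v) w = a *\<^sub>R T p u w + b *\<^sub>R T p v w"
    "T p w (a *\<^sub>R u + b *\<^sub>R v) = a *\<^sub>R T p w u + b *\<^sub>R T p w v"
    if "u \<in> tangent A p" "v \<in> tangent A p" "w \<in> tangent A p" for p u v w a b
    using T that unfolding smooth_tensor12_def by blast+
  have Ts: "(\<lambda>p. T p (X p) (Y p)) \<in> smooth_vfields A" if "X \<in> smooth_vfields A" "Y \<in> smooth_vfields A" for X Y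
    using T that unfolding smooth_tensor12_def by blast
  have Tadd: "T p (u + v) w = T p u w + T p v w" "T p w (u + v) = T p w u + T p w v"
    if "u \<in> tangent A p" "v \<in> tangent A p" "w \<in> tangent A p" for p u v w
    using Tl[of u p v w 1 1] that by simp_all
  have Tsc: "T p (a *\<^sub>R u) w = a *\<^sub>R T p u w" "T p w (a *\<^sub>R u) = a *\<^sub>R T p w u"
    if "u \<in> tangent A p" "w \<in> tangent A p" for p u w a
    using Tl[of u p 0 w a 0] that by simp_all
  show ?thesis
    unfolding affine_connection_def vf_plus_eq contorted_connection_def
    by (intro ballI conjI)
      (auto simp: Ts Tadd Tsc LC.nab_add_left LC.nab_scale_left LC.nab_add_right LC.nab_scale_right scaleR_right_distrib)
qed

section \<open>Traces over orthonormal bases\<close>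

lemma span_tangent: "S \<subseteq> tangent A p \<Longrightarrow> span S \<subseteq> tangent A p"
  by (rule span_minimal[OF _ subspace_tangent])

lemma orthonormal_basis_expand:
  assumes B: "orthonormal_basis g q V B" and V: "V \<subseteq> tangent A q" and v: "v \<in> V"
  shows "v = (\<Sum>f\<in>B. g q v f *\<^sub>R f)"
proof -
  have fin: "finite B" and sp: "span B = V" and on: "\<And>u v. u \<in> B \<Longrightarrow> v \<in> B \<Longrightarrow> g q u v = (if u = v then 1 else 0)"
    using B unfolding orthonormal_basis_def by auto
  have Bt: "b \<in> tangent A q" if "b \<in> B" for b using that sp V span_superset[of B] by auto
  obtain u where u: "v = (\<Sum>w\<in>B. u w *\<^sub>R w)" using v sp span_finite[OF fin] by auto
  have "g q v f = u f" if f: "f \<in> B" for f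
  proof -
    have "g q v f = (\<Sum>w\<in>B. u w * g q w f)" unfolding u using Bt f by (subst g_sum_left) auto
    also have "\<dots> = (\<Sum>w\<in>B. if w = f then u w else 0)" by (intro sum.cong refl) (simp add: on f)
    finally show ?thesis using fin f by simp
  qed
  then show ?thesis using u by simp
qed

text \<open>Expand each vector of \<open>B\<close> in \<open>B'\<close>. The coefficient of
  \<open>b f f'\<close> is the sum over \<open>B\<close> of \<open>g f e * g f' e\<close>, which is
  \<open>g f f'\<close>.\<close>

lemma trace_independent:
  fixes b :: "'a tvec \<Rightarrow> 'a tvec \<Rightarrow> real"
  assumes B: "orthonormal_basis g q V B" and B': "orthonormal_basis g q V B'" and V: "V \<subseteq> tangent A q"
    and add: "\<And>u v w. u \<in> tangent A q \<Longrightarrow> v \<in> tangent A q \<Longrightarrow> w \<in> tangent A q \<Longrightarrow> b (u + v) w = b u w + b v w"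
      "\<And>u v w. u \<in> tangent A q \<Longrightarrow> v \<in> tangent A q \<Longrightarrow> w \<in> tangent A q \<Longrightarrow> b w (u + v) = b w u + b w v"
    and scale: "\<And>c u w. u \<in> tangent A q \<Longrightarrow> w \<in> tangent A q \<Longrightarrow> b (c *\<^sub>R u) w = c * b u w"
      "\<And>c u w. u \<in> tangent A q \<Longrightarrow> w \<in> tangent A q \<Longrightarrow> b w (c *\<^sub>R u) = c * b w u"
  shows "(\<Sum>e\<in>B. b e e) = (\<Sum>e\<in>B'. b e e)"
proof -
  have fin: "finite B" "finite B'" and sp: "span B = V" "span B' = V"
    and on': "\<And>u v. u \<in> B' \<Longrightarrow> v \<in> B' \<Longrightarrow> g q u v = (if u = v then 1 else 0)"
    using B B' unfolding orthonormal_basis_def by auto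
  have BV: "e \<in> V" if "e \<in> B \<or> e \<in> B'" for e using that sp span_superset[of B] span_superset[of B'] by auto
  have Vt: "e \<in> tangent A q" if "e \<in> V" for e using that V by auto
  have z: "b 0 w = 0" "b w 0 = 0" if "w \<in> tangent A q" for w
    using scale(1)[of 0 w 0] scale(2)[of 0 w 0] that by auto
  have B't: "f \<in> tangent A q" if "f \<in> B'" for f using that BV Vt by auto
  have s12: "b (\<Sum>f\<in>S. c f *\<^sub>R f) w = (\<Sum>f\<in>S. c f * b f w) \<and> b w (\<Sum>f\<in>S. c f *\<^sub>R f) = (\<Sum>f\<in>S. c f * b w f)"
    if "finite S" "S \<subseteq> B'" and w: "w \<in> tangent A q" for S c w
    using that(1,2)
  proof (induction S)
    case (insert f S)
    have t: "c f *\<^sub>R f \<in> tangent A q" "(\<Sum>f\<in>S. c f *\<^sub>R f) \<in> tangent A q" "f \<in> tangent A q"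
      using insert.prems B't by (auto intro!: tangent_sum tangent_scaleR)
    show ?case
      unfolding sum.insert[OF insert.hyps(1,2)] add(1)[OF t(1,2) w] add(2)[OF t(1,2) w] scale(1)[OF t(3) w] scale(2)[OF t(3) w]
      using insert.IH insert.prems by simp
  qed (use z w in auto)
  note s1 = s12[THEN conjunct1] and s2 = s12[THEN conjunct2]
  have "b e e = (\<Sum>f\<in>B'. \<Sum>f'\<in>B'. g q f e * g q f' e * b f f')" if e: "e \<in> B" for e
  proof -
    have ex: "e = (\<Sum>f\<in>B'. g q e f *\<^sub>R f)" by (rule orthonormal_basis_expand[OF B' V]) (use e BV in auto)
    have et: "e \<in> tangent A q" using e BV Vt by auto
    have "b e e = b (\<Sum>f\<in>B'. g q e f *\<^sub>R f) e" using ex by simp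
    also have "\<dots> = (\<Sum>f\<in>B'. g q e f * b f e)" by (rule s1[OF fin(2) _ et]) simp
    also have "\<dots> = (\<Sum>f\<in>B'. g q e f * (\<Sum>f'\<in>B'. g q e f' * b f f'))"
    proof (rule sum.cong[OF refl])
      fix f assume f: "f \<in> B'"
      have "b f e = b f (\<Sum>f\<in>B'. g q e f *\<^sub>R f)" using ex by simp
      also have "\<dots> = (\<Sum>f'\<in>B'. g q e f' * b f f')" by (rule s2[OF fin(2)]) (use f BV Vt in auto)
      finally show "g q e f * b f e = g q e f * (\<Sum>f'\<in>B'. g q e f' * b f f')" by simp
    qed
    also have "\<dots> = (\<Sum>f\<in>B'. \<Sum>f'\<in>B'. g q f e * g q f' e * b f f')"
      using et BV Vt g_sym[OF et] by (auto simp: sum_distrib_left mult.assoc intro!: sum.cong)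
    finally show ?thesis .
  qed
  then have "(\<Sum>e\<in>B. b e e) = (\<Sum>e\<in>B. \<Sum>f\<in>B'. \<Sum>f'\<in>B'. g q f e * g q f' e * b f f')" by simp
  also have "\<dots> = (\<Sum>f\<in>B'. \<Sum>f'\<in>B'. (\<Sum>e\<in>B. g q f e * g q f' e) * b f f')"
  proof -
    have "(\<Sum>e\<in>B. \<Sum>f\<in>B'. \<Sum>f'\<in>B'. g q f e * g q f' e * b f f')
        = (\<Sum>f\<in>B'. \<Sum>e\<in>B. \<Sum>f'\<in>B'. g q f e * g q f' e * b f f')" by (rule sum.swap)
    also have "\<dots> = (\<Sum>f\<in>B'. \<Sum>f'\<in>B'. \<Sum>e\<in>B. g q f e * g q f' e * b f f')"
      by (rule sum.cong[OF refl], rule sum.swap)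
    finally show ?thesis by (simp add: sum_distrib_right)
  qed
  also have "\<dots> = (\<Sum>f\<in>B'. \<Sum>f'\<in>B'. if f' = f then b f f' else 0)"
  proof (intro sum.cong refl)
    fix f f' assume f: "f \<in> B'" "f' \<in> B'"
    have t: "f \<in> tangent A q" "f' \<in> tangent A q" "\<And>e. e \<in> B \<Longrightarrow> e \<in> tangent A q" using f BV Vt by auto
    have "g q f f' = g q (\<Sum>e\<in>B. g q f e *\<^sub>R e) f'"
      using orthonormal_basis_expand[OF B V, of f] f BV by simp
    also have "\<dots> = (\<Sum>e\<in>B. g q f e * g q e f')" using t by (subst g_sum_left) auto
    also have "\<dots> = (\<Sum>e\<in>B. g q f e * g q f' e)" using t g_sym[OF t(2)] by simp
    finally show "(\<Sum>e\<in>B. g q f e * g q f' e) * b f f' = (if f' = f then b f f' else 0)"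
      using on'[OF f] by auto
  qed
  also have "\<dots> = (\<Sum>f\<in>B'. b f f)" using fin by simp
  finally show ?thesis .
qed

text \<open>The fibres of \<open>lab\<close> partition the indices, and each unordered pair with
  different labels contributes one term in each order. This passes from pairs of distributions to
  ordered pairs of frame indices.\<close>

lemma sum_labels:
  fixes F :: "'n \<Rightarrow> 'n \<Rightarrow> real" and lab :: "'n \<Rightarrow> nat"
  assumes lab: "\<And>i. lab i \<in> {1..4}"
  shows "(\<Sum>\<mu>\<in>{1..4}. \<Sum>\<nu>\<in>{1..<\<mu>}. \<Sum>i\<in>{i. lab i = \<nu>}. \<Sum>j\<in>{j. lab j = \<mu>}. F i j + F j i)
    = (\<Sum>i\<in>UNIV. \<Sum>j\<in>UNIV. if lab i \<noteq> lab j then F i j else 0)"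
proof -
  let ?G = "\<lambda>i j. F i j + F j i"
  have "(\<Sum>\<nu>\<in>{1..<\<mu>}. \<Sum>i\<in>{i. lab i = \<nu>}. \<Sum>j\<in>{j. lab j = \<mu>}. ?G i j)
      = (\<Sum>j\<in>{j. lab j = \<mu>}. \<Sum>i\<in>UNIV. if lab i < lab j then ?G i j else 0)" if "\<mu> \<in> {1..4}" for \<mu>
  proof -
    have "(\<Sum>\<nu>\<in>{1..<\<mu>}. \<Sum>i\<in>{i. lab i = \<nu>}. \<Sum>j\<in>{j. lab j = \<mu>}. ?G i j)
        = (\<Sum>\<nu>\<in>{1..<\<mu>}. \<Sum>i\<in>{i \<in> {i. lab i < \<mu>}. lab i = \<nu>}. \<Sum>j\<in>{j. lab j = \<mu>}. ?G i j)"
      by (intro sum.cong refl) auto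
    also have "\<dots> = (\<Sum>i\<in>{i. lab i < \<mu>}. \<Sum>j\<in>{j. lab j = \<mu>}. ?G i j)"
      by (rule sum.group) (use lab in auto)
    also have "\<dots> = (\<Sum>j\<in>{j. lab j = \<mu>}. \<Sum>i\<in>{i. lab i < \<mu>}. ?G i j)" by (rule sum.swap)
    also have "\<dots> = (\<Sum>j\<in>{j. lab j = \<mu>}. \<Sum>i\<in>UNIV. if lab i < lab j then ?G i j else 0)"
      by (rule sum.cong[OF refl]) (simp add: sum.If_cases)
    finally show ?thesis .
  qed
  then have "(\<Sum>\<mu>\<in>{1..4}. \<Sum>\<nu>\<in>{1..<\<mu>}. \<Sum>i\<in>{i. lab i = \<nu>}. \<Sum>j\<in>{j. lab j = \<mu>}. ?G i j)
      = (\<Sum>\<mu>\<in>{1..4}. \<Sum>j\<in>{j \<in> UNIV. lab j = \<mu>}. \<Sum>i\<in>UNIV. if lab i < lab j then ?G i j else 0)"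
    by simp
  also have "\<dots> = (\<Sum>j\<in>UNIV. \<Sum>i\<in>UNIV. if lab i < lab j then ?G i j else 0)"
    by (rule sum.group) (use lab in auto)
  also have "\<dots> = (\<Sum>j\<in>UNIV. \<Sum>i\<in>UNIV. if lab i < lab j then F i j else 0) + (\<Sum>j\<in>UNIV. \<Sum>i\<in>UNIV. if lab i < lab j then F j i else 0)"
    unfolding sum.distrib[symmetric] by (intro sum.cong refl) simp
  also have "(\<Sum>j\<in>UNIV. \<Sum>i\<in>UNIV. if lab i < lab j then F i j else 0) = (\<Sum>i\<in>UNIV. \<Sum>j\<in>UNIV. if lab i < lab j then F i j else 0)"
    by (rule sum.swap)
  also have "\<dots> + (\<Sum>j\<in>UNIV. \<Sum>i\<in>UNIV. if lab i < lab j then F j i else 0)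
      = (\<Sum>i\<in>UNIV. \<Sum>j\<in>UNIV. if lab i \<noteq> lab j then F i j else 0)"
    unfolding sum.distrib[symmetric] by (intro sum.cong refl) auto
  finally show ?thesis .
qed

text \<open>The bases picked by \<open>onb\<close> vary uncontrollably with the point. Trace
  independence, applied once for each of the two distributions, replaces them by an adapted
  frame.\<close>

lemma mixed_scalar_curvature_frame:
  assumes T: "smooth_tensor12 A T" and e: "ON q e" and lab: "\<And>i. lab i \<in> {1..4}"
    and D: "\<And>\<mu>. \<mu> \<in> {1..4} \<Longrightarrow> D \<mu> q = span (e ` {i. lab i = \<mu>})"
  shows "mixed_scalar_curvature A D g T q = (1/2) * (\<Sum>i\<in>UNIV. \<Sum>j\<in>UNIV. if lab i \<noteq> lab j
    then g q (curvature A (contorted_connection A g T) q (e i) (e j) (e i)) (e j) else 0)"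
proof -
  interpret nb: connection A "contorted_connection A g T"
    by unfold_locales (rule contorted_affine[OF T])
  let ?R = "curvature A (contorted_connection A g T) q"
  note et = ON_D(1)[OF e] and eo = ON_D(2)[OF e]
  have inj: "inj e" by (rule orthonormal_inj_independent(1)[of UNIV e q]) (use et eo in auto)
  have ob: "orthonormal_basis g q (D \<mu> q) (e ` {i. lab i = \<mu>})" if "\<mu> \<in> {1..4}" for \<mu>
    unfolding orthonormal_basis_def D[OF that] using eo inj by (auto simp: inj_eq)
  have onb: "orthonormal_basis g q (D \<mu> q) (onb g q (D \<mu> q))" if "\<mu> \<in> {1..4}" for \<mu>
    unfolding onb_def by (rule someI[of "orthonormal_basis g q (D \<mu> q)", OF ob[OF that]])
  have Dt: "D \<mu> q \<subseteq> tangent A q" if "\<mu> \<in> {1..4}" for \<mu>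
    unfolding D[OF that] by (rule span_tangent) (use et in auto)
  have onbt: "u \<in> tangent A q" if "u \<in> onb g q (D \<mu> q)" "\<mu> \<in> {1..4}" for u \<mu>
  proof -
    have "u \<in> span (onb g q (D \<mu> q))" using that(1) by (rule span_base)
    then show ?thesis using onb[OF that(2)] Dt[OF that(2)] unfolding orthonormal_basis_def by auto
  qed
  let ?F = "\<lambda>u v. g q (?R u v u) v + g q (?R v u v) u"
  have Fsum: "(\<Sum>u\<in>onb g q (D \<nu> q). \<Sum>v\<in>onb g q (D \<mu> q). ?F u v)
      = (\<Sum>i\<in>{i. lab i = \<nu>}. \<Sum>j\<in>{j. lab j = \<mu>}. ?F (e i) (e j))" if \<mu>: "\<mu> \<in> {1..4}" and \<nu>: "\<nu> \<in> {1..4}" for \<mu> \<nu>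
  proof -
    have inner: "(\<Sum>v\<in>onb g q (D \<mu> q). ?F u v) = (\<Sum>j\<in>{j. lab j = \<mu>}. ?F u (e j))" if u: "u \<in> tangent A q" for u
    proof -
      have "(\<Sum>v\<in>onb g q (D \<mu> q). ?F u v) = (\<Sum>v\<in>e ` {j. lab j = \<mu>}. ?F u v)"
        by (rule trace_independent[OF onb[OF \<mu>] ob[OF \<mu>] Dt[OF \<mu>], where b="\<lambda>v v'. g q (?R u v u) v' + g q (?R v u v') u"])
          (use u in \<open>auto simp: nb.curvature_tangent nb.curvature_add1 nb.curvature_add2 nb.curvature_add3
            nb.curvature_scale1 nb.curvature_scale2 nb.curvature_scale3 algebra_simps\<close>)
      then show ?thesis using inj by (simp add: sum.reindex inj_on_subset)
    qed
    have "(\<Sum>u\<in>onb g q (D \<nu> q). \<Sum>v\<in>onb g q (D \<mu> q). ?F u v) = (\<Sum>u\<in>onb g q (D \<nu> q). \<Sum>j\<in>{j. lab j = \<mu>}. ?F u (e j))"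
      by (intro sum.cong refl inner) (use onbt \<nu> in auto)
    also have "\<dots> = (\<Sum>j\<in>{j. lab j = \<mu>}. \<Sum>u\<in>onb g q (D \<nu> q). ?F u (e j))" by (rule sum.swap)
    also have "\<dots> = (\<Sum>j\<in>{j. lab j = \<mu>}. \<Sum>u\<in>e ` {i. lab i = \<nu>}. ?F u (e j))"
      by (intro sum.cong refl trace_independent[OF onb[OF \<nu>] ob[OF \<nu>] Dt[OF \<nu>], where b="\<lambda>u u'. g q (?R u (e _) u') (e _) + g q (?R (e _) u (e _)) u'"])
        (use et in \<open>auto simp: nb.curvature_tangent nb.curvature_add1 nb.curvature_add2 nb.curvature_add3
            nb.curvature_scale1 nb.curvature_scale2 nb.curvature_scale3 algebra_simps\<close>)
    also have "\<dots> = (\<Sum>j\<in>{j. lab j = \<mu>}. \<Sum>i\<in>{i. lab i = \<nu>}. ?F (e i) (e j))"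
      using inj by (simp add: sum.reindex inj_on_subset)
    also have "\<dots> = (\<Sum>i\<in>{i. lab i = \<nu>}. \<Sum>j\<in>{j. lab j = \<mu>}. ?F (e i) (e j))" by (rule sum.swap)
    finally show ?thesis .
  qed
  have "mixed_scalar_curvature A D g T q = (1/2) * (\<Sum>\<mu>\<in>{1..4}. \<Sum>\<nu>\<in>{1..<\<mu>}.
      \<Sum>i\<in>{i. lab i = \<nu>}. \<Sum>j\<in>{j. lab j = \<mu>}. ?F (e i) (e j))"
    unfolding mixed_scalar_curvature_def Let_def by (intro arg_cong[where f="(*) (1/2)"] sum.cong refl Fsum) auto
  then show ?thesis using sum_labels[OF lab, of "\<lambda>i j. g q (?R (e i) (e j) (e i)) (e j)"] by simp
qed

end

section \<open>Sectional curvature terms of a metric connection\<close>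

locale metric_connection = riemannian A g + connection A nab
  for A :: "('a::t2_space, 'n::finite) atlas" and g nab +
  assumes compatible: "metric_compatible A g nab"
begin

lemma ip_deriv:
  "X \<in> smooth_vfields A \<Longrightarrow> Y \<in> smooth_vfields A \<Longrightarrow> Z \<in> smooth_vfields A \<Longrightarrow>
    X p (ip Y Z) = g p (nab X Y p) (Z p) + g p (Y p) (nab X Z p)"
  using compatible unfolding metric_compatible_def by blast

text \<open>Metric compatibility shifts the outer covariant derivatives onto scalar products. No
  iterated covariant derivative remains, so the dependence on a metric-compatible contorsion is at
  most quadratic.\<close>

lemma sec_formula:
  assumes X: "X \<in> smooth_vfields A" and Y: "Y \<in> smooth_vfields A"
  shows "g p (Rm X Y X p) (Y p) = Y p (ip (nab X X) Y) - ip (nab X X) (nab Y Y) p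
    - X p (ip (nab Y X) Y) + ip (nab Y X) (nab X Y) p + ip (nab (lie_bracket X Y) X) Y p"
  using X Y ip_deriv[of Y "nab X X" Y p] ip_deriv[of X "nab Y X" Y p] by (simp add: Rm_def)

text \<open>The curvature of a metric connection is a skew endomorphism and antisymmetric in its two
  arguments. No Bianchi identity is involved, so torsion is allowed.\<close>

lemma sec_sym:
  assumes X: "X \<in> smooth_vfields A" and Y: "Y \<in> smooth_vfields A"
  shows "g p (Rm X Y X p) (Y p) = g p (Rm Y X Y p) (X p)"
proof -
  have a: "V p (ip (nab W W) V) = V p (\<lambda>r. W r (ip W V)) - V p (ip W (nab W V))"
    if V: "V \<in> smooth_vfields A" and W: "W \<in> smooth_vfields A" for V W
  proof -
    have "ip (nab W W) V = (\<lambda>r. W r (ip W V) - ip W (nab W V) r)" using ip_deriv[OF W W V] by auto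
    then show ?thesis using V W by (simp add: tangent_diff_fun[OF vf_tangent[OF V]])
  qed
  have "lie_bracket Y X = (\<lambda>r. - lie_bracket X Y r)" by (rule ext) (rule lie_bracket_antisym)
  then have br: "nab (lie_bracket Y X) Y p = - nab (lie_bracket X Y) Y p"
    using nab_scale_left[OF lie_bracket_vf[OF X Y] Y smooth_funs_const, of "-1"] by simp
  have "lie_bracket X Y p (ip X Y) = ip (nab (lie_bracket X Y) X) Y p + ip X (nab (lie_bracket X Y) Y) p"
    using ip_deriv X Y by auto
  then have d: "X p (\<lambda>r. Y r (ip X Y)) - Y p (\<lambda>r. X r (ip X Y))
      = ip (nab (lie_bracket X Y) X) Y p + ip X (nab (lie_bracket X Y) Y) p"
    by (simp add: lie_bracket_apply)
  show ?thesis
    unfolding sec_formula[OF X Y] sec_formula[OF Y X] a[OF X Y] a[OF Y X]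
    using X Y d br ip_sym[OF X Y] ip_sym[of X "nab X Y"] ip_sym[of Y "nab Y X"] g_sym[of "nab X X p" p "nab Y Y p"]
      g_sym[of "nab Y X p" p "nab X Y p"] g_sym[of "nab (lie_bracket X Y) Y p" p "X p"]
    by simp
qed

end

section \<open>Families of tensors\<close>

context smooth_manifold
begin

lemma tangent_chain:
  assumes v: "v \<in> tangent A p" and f: "f \<in> smooth_funs A" and h: "(h has_real_derivative h') (at (f p))"
    and hf: "(\<lambda>q. h (f q)) \<in> smooth_funs A"
  shows "v (\<lambda>q. h (f q)) = h' * v f"
proof -
  obtain U \<phi> where U: "(U, \<phi>) \<in> A" "p \<in> U" by (rule chart_ex)
  obtain x M where x: "\<And>i. x i \<in> smooth_funs A" "open M" "p \<in> M" "\<And>i q. q \<in> M \<Longrightarrow> x i q = \<phi> q $ i"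
    by (rule coord_fun_ex[OF U]) blast
  have c: "coord_vec A U \<phi> i p (\<lambda>q. h (f q)) = h' * coord_vec A U \<phi> i p f" for i
  proof -
    have "((f \<circ> inv_into U \<phi>) has_derivative frechet_derivative (f \<circ> inv_into U \<phi>) (at (\<phi> p))) (at (\<phi> p))"
      using smooth_on_has_derivative[OF smooth_funsD[OF f U(1)]] U(2) by blast
    moreover have "(h has_derivative (*) h') (at ((f \<circ> inv_into U \<phi>) (\<phi> p)))"
      using h chart_inv[OF U] by (simp add: has_field_derivative_def)
    ultimately have "((\<lambda>y. h ((f \<circ> inv_into U \<phi>) y)) has_derivative (\<lambda>v. h' * frechet_derivative (f \<circ> inv_into U \<phi>) (at (\<phi> p)) v)) (at (\<phi> p))"
      by (rule has_derivative_compose)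
    then have "(((\<lambda>q. h (f q)) \<circ> inv_into U \<phi>) has_derivative (\<lambda>v. h' * frechet_derivative (f \<circ> inv_into U \<phi>) (at (\<phi> p)) v)) (at (\<phi> p))"
      by (simp add: o_def)
    then show ?thesis using f hf unfolding coord_vec_def by (simp add: frechet_derivative_at[symmetric])
  qed
  have rep: "v k = (\<Sum>i\<in>UNIV. v (x i) * coord_vec A U \<phi> i p k)" for k
  proof -
    have "v k = (\<Sum>i\<in>UNIV. v (x i) *\<^sub>R coord_vec A U \<phi> i p) k"
      by (rule fun_cong[OF tangent_coord_rep[OF U v x]])
    then show ?thesis by (simp only: sum_fun_apply scaleR_fun_def real_scaleR_def)
  qed
  have "v (\<lambda>q. h (f q)) = (\<Sum>i\<in>UNIV. h' * (v (x i) * coord_vec A U \<phi> i p f))"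
    unfolding rep[of "\<lambda>q. h (f q)"] c by (intro sum.cong refl) simp
  then show ?thesis unfolding rep[of f] sum_distrib_left .
qed

text \<open>The coefficients of the deformed connections lie in this class, and hence so do those of their
  curvatures, because it is closed under products and derivations.\<close>

inductive_set expfam :: "('a \<Rightarrow> real) \<Rightarrow> (real \<Rightarrow> 'a \<Rightarrow> real) set" for \<sigma> where
  expfam_base: "f \<in> smooth_funs A \<Longrightarrow> (\<lambda>t q. t ^ a * exp (b * t * \<sigma> q) * f q) \<in> expfam \<sigma>"
| expfam_add: "F \<in> expfam \<sigma> \<Longrightarrow> G \<in> expfam \<sigma> \<Longrightarrow> (\<lambda>t q. F t q + G t q) \<in> expfam \<sigma>"

lemma expfam_fun: "f \<in> smooth_funs A \<Longrightarrow> (\<lambda>t q. f q) \<in> expfam \<sigma>"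
  using expfam_base[of f 0 0 \<sigma>] by simp

lemma expfam_mult:
  assumes "F \<in> expfam \<sigma>" "G \<in> expfam \<sigma>" shows "(\<lambda>t q. F t q * G t q) \<in> expfam \<sigma>"
  using assms(1)
proof induction
  case (expfam_base f a b)
  show ?case using assms(2)
  proof induction
    case (expfam_base h c d)
    have "(\<lambda>t q. t ^ (a + c) * exp ((b + d) * t * \<sigma> q) * (f q * h q)) \<in> expfam \<sigma>"
      by (rule expfam.expfam_base) (use expfam_base \<open>f \<in> smooth_funs A\<close> in auto)
    moreover have "t ^ (a + c) * exp ((b + d) * t * \<sigma> q) * (f q * h q)
        = t ^ a * exp (b * t * \<sigma> q) * f q * (t ^ c * exp (d * t * \<sigma> q) * h q)" for t q
      by (simp add: power_add exp_add distrib_right)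
    ultimately show ?case by simp
  next
    case (expfam_add F G)
    from expfam.expfam_add[OF expfam_add.IH] show ?case by (simp add: distrib_left)
  qed
next
  case (expfam_add F G)
  from expfam.expfam_add[OF expfam_add.IH] show ?case by (simp add: distrib_right)
qed

lemma expfam_scale: "F \<in> expfam \<sigma> \<Longrightarrow> (\<lambda>t q. c * F t q) \<in> expfam \<sigma>"
  using expfam_mult[OF expfam_fun[OF smooth_funs_const]] by simp

lemma expfam_diff: "F \<in> expfam \<sigma> \<Longrightarrow> G \<in> expfam \<sigma> \<Longrightarrow> (\<lambda>t q. F t q - G t q) \<in> expfam \<sigma>"
  using expfam_add[OF _ expfam_scale[of G \<sigma> "-1"], of F] by simp

lemma expfam_sum: "(\<And>i. i \<in> I \<Longrightarrow> F i \<in> expfam \<sigma>) \<Longrightarrow> (\<lambda>t q. \<Sum>i\<in>I. F i t q) \<in> expfam \<sigma>"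
  by (induction I rule: infinite_finite_induct) (simp_all add: expfam_add expfam_fun)

lemma expfam_t: "(\<lambda>t q. t) \<in> expfam \<sigma>"
  using expfam_base[of "\<lambda>q. 1" 1 0 \<sigma>] by simp

lemma expfam_exp: "(\<lambda>t q. exp (b * t * \<sigma> q)) \<in> expfam \<sigma>"
  using expfam_base[of "\<lambda>q. 1" 0 b \<sigma>] by simp

lemma exp_smooth: assumes "\<sigma> \<in> smooth_funs A" shows "(\<lambda>q. exp (c * \<sigma> q)) \<in> smooth_funs A"
  by (rule smooth_funs_compose[OF smooth_funs_scale[OF assms] smooth_on_exp])

lemma expfam_smooth:
  assumes "F \<in> expfam \<sigma>" "\<sigma> \<in> smooth_funs A" shows "F t \<in> smooth_funs A"
  using assms(1)
proof induction
  case (expfam_base f a b)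
  have "(\<lambda>q. t ^ a * exp ((b * t) * \<sigma> q) * f q) \<in> smooth_funs A"
    by (intro smooth_funs_mult smooth_funs_const exp_smooth assms expfam_base)
  then show ?case by simp
qed auto

text \<open>The chain rule brings down the factor \<open>b * t\<close> times the derivative of
  \<open>\<sigma>\<close>; this is where the powers of \<open>t\<close> in
  \<open>expfam_base\<close> come from.\<close>

lemma expfam_deriv:
  assumes F: "F \<in> expfam \<sigma>" and \<sigma>: "\<sigma> \<in> smooth_funs A" and X: "X \<in> smooth_vfields A"
  shows "(\<lambda>t q. X q (F t)) \<in> expfam \<sigma>"
  using F
proof induction
  case (expfam_base f a b)
  have eq: "X q (\<lambda>q. t ^ a * exp (b * t * \<sigma> q) * f q)
      = t ^ a * exp (b * t * \<sigma> q) * X q f + b * (t ^ Suc a * exp (b * t * \<sigma> q) * (X q \<sigma> * f q))" for t q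
  proof -
    have e: "(\<lambda>q. exp (b * t * \<sigma> q)) \<in> smooth_funs A" by (rule exp_smooth[OF \<sigma>])
    have ch: "X q (\<lambda>q. exp (b * t * \<sigma> q)) = b * t * exp (b * t * \<sigma> q) * X q \<sigma>"
    proof (rule tangent_chain[OF vf_tangent[OF X, of q] \<sigma>, of "\<lambda>z. exp (b * t * z)", OF _ e])
      show "((\<lambda>z. exp (b * t * z)) has_real_derivative b * t * exp (b * t * \<sigma> q)) (at (\<sigma> q))"
        by (auto intro!: derivative_eq_intros)
    qed
    have "X q (\<lambda>q. exp (b * t * \<sigma> q) * f q) = exp (b * t * \<sigma> q) * X q f + f q * X q (\<lambda>q. exp (b * t * \<sigma> q))"
      by (rule tangent_mult[OF vf_tangent[OF X] e expfam_base])
    moreover have "X q (\<lambda>q. t ^ a * (exp (b * t * \<sigma> q) * f q)) = t ^ a * X q (\<lambda>q. exp (b * t * \<sigma> q) * f q)"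
      by (rule tangent_scale_fun[OF vf_tangent[OF X]]) (use e expfam_base in auto)
    ultimately show ?thesis using ch by (simp add: algebra_simps)
  qed
  have "(\<lambda>t q. t ^ a * exp (b * t * \<sigma> q) * X q f + b * (t ^ Suc a * exp (b * t * \<sigma> q) * (X q \<sigma> * f q))) \<in> expfam \<sigma>"
    by (intro expfam_add expfam_scale expfam.expfam_base) (use X \<sigma> expfam_base in auto)
  then show ?case using eq by simp
next
  case (expfam_add F G)
  have "X q (\<lambda>q. F t q + G t q) = X q (F t) + X q (G t)" for t q
    by (rule tangent_add_fun[OF vf_tangent[OF X] expfam_smooth[OF expfam_add.hyps(1) \<sigma>] expfam_smooth[OF expfam_add.hyps(2) \<sigma>]])
  then show ?case using expfam.expfam_add[OF expfam_add.IH] by simp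
qed

lemma expfam_family:
  assumes F: "F \<in> expfam \<sigma>" and \<sigma>: "\<sigma> \<in> smooth_funs A"
  shows "smooth_family A \<epsilon> F"
  unfolding smooth_family_def
proof clarify
  fix U \<phi> assume U: "(U, \<phi>) \<in> A"
  let ?S = "{-\<epsilon><..<\<epsilon>} \<times> \<phi> ` U"
  have S: "open ?S" using chart_open_image[OF U] by (intro open_Times) auto
  have t: "smooth_on (\<lambda>z. fst z) ?S" by (rule smooth_on_linear[OF bounded_linear_fst S])
  have x: "smooth_on (\<lambda>z. f (inv_into U \<phi> (snd z))) ?S" if "f \<in> smooth_funs A" for f
    using smooth_on_compose[OF S chart_open_image[OF U] smooth_on_linear[OF bounded_linear_snd S] smooth_funsD[OF that U]]
    by auto
  show "smooth_on (\<lambda>(t, x). F t (inv_into U \<phi> x)) ?S"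
    using F
  proof induction
    case (expfam_base f a b)
    have p: "smooth_on (\<lambda>z. fst z ^ a) ?S" by (induction a) (auto intro!: smooth_on_const smooth_on_mult S t)
    have "smooth_on (\<lambda>z. exp (b * fst z * \<sigma> (inv_into U \<phi> (snd z)))) ?S"
      by (intro smooth_on_compose[OF S open_UNIV _ smooth_on_exp] smooth_on_mult smooth_on_const S t x \<sigma>) auto
    then have "smooth_on (\<lambda>z. fst z ^ a * exp (b * fst z * \<sigma> (inv_into U \<phi> (snd z))) * f (inv_into U \<phi> (snd z))) ?S"
      by (intro smooth_on_mult S p x expfam_base)
    then show ?case by (simp add: case_prod_beta)
  next
    case (expfam_add F G)
    from smooth_on_add[OF S expfam_add.IH] show ?case by (simp add: case_prod_beta)
  qed
qed

lemma expfam_tendsto: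
  assumes "F \<in> expfam \<sigma>" shows "((\<lambda>t. F t q) \<longlongrightarrow> F 0 q) (at 0)"
  using assms
proof induction
  case (expfam_base f a b)
  have "isCont (\<lambda>t. t ^ a * exp (b * t * \<sigma> q) * f q) 0" by (intro continuous_intros)
  then show ?case by (simp add: isCont_def)
qed (auto intro: tendsto_add)

text \<open>Provides the majorant for dominated convergence in
  \<open>exp_quotient_limit\<close>.\<close>

lemma expfam_bound:
  assumes "F \<in> expfam \<sigma>" and \<sigma>: "\<sigma> \<in> smooth_funs A" and K: "compact K"
  shows "\<exists>B. \<forall>t q. \<bar>t\<bar> \<le> 1 \<longrightarrow> q \<in> K \<longrightarrow> \<bar>F t q\<bar> \<le> B"
  using assms(1)
proof induction
  case (expfam_base f a b)
  have bd: "\<exists>B. \<forall>q\<in>K. \<bar>h q\<bar> \<le> B" if "h \<in> smooth_funs A" for h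
    using compact_imp_bounded[OF compact_continuous_image[OF smooth_funs_continuous[OF that] K]]
    unfolding bounded_iff by auto
  obtain B1 B2 where B: "\<And>q. q \<in> K \<Longrightarrow> \<bar>\<sigma> q\<bar> \<le> B1" "\<And>q. q \<in> K \<Longrightarrow> \<bar>f q\<bar> \<le> B2"
    using bd[OF \<sigma>] bd[OF expfam_base] by blast
  have "\<bar>t ^ a * exp (b * t * \<sigma> q) * f q\<bar> \<le> 1 * exp (\<bar>b\<bar> * 1 * B1) * B2" if t: "\<bar>t\<bar> \<le> 1" and q: "q \<in> K" for t q
  proof -
    have "b * t * \<sigma> q \<le> \<bar>b\<bar> * \<bar>t\<bar> * \<bar>\<sigma> q\<bar>" by (metis abs_ge_self abs_mult)
    also have "\<dots> \<le> \<bar>b\<bar> * 1 * B1" using t B(1)[OF q] by (intro mult_mono) auto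
    finally have "exp (b * t * \<sigma> q) \<le> exp (\<bar>b\<bar> * 1 * B1)" by simp
    moreover have "\<bar>t ^ a\<bar> \<le> 1" using t by (simp add: power_abs power_le_one)
    ultimately show ?thesis using B(2)[OF q] unfolding abs_mult abs_exp_cancel by (intro mult_mono) auto
  qed
  then show ?case by blast
next
  case (expfam_add F G)
  then obtain B1 B2 where "\<And>t q. \<bar>t\<bar> \<le> 1 \<Longrightarrow> q \<in> K \<Longrightarrow> \<bar>F t q\<bar> \<le> B1" "\<And>t q. \<bar>t\<bar> \<le> 1 \<Longrightarrow> q \<in> K \<Longrightarrow> \<bar>G t q\<bar> \<le> B2" by blast
  then have "\<bar>F t q + G t q\<bar> \<le> B1 + B2" if "\<bar>t\<bar> \<le> 1" "q \<in> K" for t q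
    using that abs_triangle_ineq[of "F t q" "G t q"] by fastforce
  then show ?case by blast
qed

text \<open>Finite combinations with coefficients in \<open>expfam\<close>: statements about
  families of fields reduce to functions by induction, and \<open>vfam_apply\<close> and
  \<open>vfam_ip\<close> lead back to \<open>expfam\<close>.\<close>

inductive_set vfam :: "('a \<Rightarrow> real) \<Rightarrow> (real \<Rightarrow> 'a vfield) set" for \<sigma> where
  vfam_base: "F \<in> expfam \<sigma> \<Longrightarrow> X \<in> smooth_vfields A \<Longrightarrow> (\<lambda>t q. F t q *\<^sub>R X q) \<in> vfam \<sigma>"
| vfam_add: "V \<in> vfam \<sigma> \<Longrightarrow> W \<in> vfam \<sigma> \<Longrightarrow> (\<lambda>t q. V t q + W t q) \<in> vfam \<sigma>"

lemma vfam_vf: "X \<in> smooth_vfields A \<Longrightarrow> (\<lambda>t q. X q) \<in> vfam \<sigma>"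
  using vfam_base[OF expfam_fun[OF smooth_funs_const[of 1]]] by simp

lemma vfam_smooth:
  assumes "V \<in> vfam \<sigma>" "\<sigma> \<in> smooth_funs A" shows "V t \<in> smooth_vfields A"
  using assms(1)
proof induction
  case (vfam_base F X)
  then show ?case by (intro vf_scale expfam_smooth[OF _ assms(2)])
next
  case (vfam_add V W)
  show ?case by (rule vf_add[OF vfam_add.IH])
qed

lemma vfam_mult:
  assumes "V \<in> vfam \<sigma>" "F \<in> expfam \<sigma>" shows "(\<lambda>t q. F t q *\<^sub>R V t q) \<in> vfam \<sigma>"
  using assms(1)
proof induction
  case (vfam_base G X)
  from vfam.vfam_base[OF expfam_mult[OF assms(2) vfam_base(1)] vfam_base(2)] show ?case by simp
next
  case (vfam_add V W)
  from vfam.vfam_add[OF vfam_add.IH] show ?case unfolding scaleR_right_distrib .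
qed

lemma vfam_diff: "V \<in> vfam \<sigma> \<Longrightarrow> W \<in> vfam \<sigma> \<Longrightarrow> (\<lambda>t q. V t q - W t q) \<in> vfam \<sigma>"
  using vfam_add[OF _ vfam_mult[OF _ expfam_fun[OF smooth_funs_const[of "-1"]]], of V \<sigma> W] by simp

lemma vfam_apply:
  assumes "V \<in> vfam \<sigma>" "f \<in> smooth_funs A" shows "(\<lambda>t q. V t q f) \<in> expfam \<sigma>"
  using assms(1)
proof induction
  case (vfam_base F X)
  from expfam_mult[OF vfam_base(1) expfam_fun[OF vf_apply[OF vfam_base(2) assms(2)]]]
  show ?case by (simp add: scaleR_fun_def)
next
  case (vfam_add V W)
  from expfam_add[OF vfam_add.IH] show ?case unfolding plus_fun_apply .
qed

end

lemma (in connection) vfam_nab: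
  assumes "V \<in> vfam \<sigma>" and \<sigma>: "\<sigma> \<in> smooth_funs A" and Y: "Y \<in> smooth_vfields A"
  shows "(\<lambda>t. nab Y (V t)) \<in> vfam \<sigma>"
  using assms(1)
proof induction
  case (vfam_base F X)
  have "(\<lambda>t q. Y q (F t) *\<^sub>R X q + F t q *\<^sub>R nab Y X q) \<in> vfam \<sigma>"
    by (rule vfam_add[OF vfam.vfam_base[OF expfam_deriv[OF vfam_base(1) \<sigma> Y] vfam_base(2)]
        vfam.vfam_base[OF vfam_base(1) nab_vf[OF Y vfam_base(2)]]])
  then show ?case unfolding nab_scale_right[OF Y vfam_base(2) expfam_smooth[OF vfam_base(1) \<sigma>]] .
next
  case (vfam_add V W)
  have "(\<lambda>t q. nab Y (V t) q + nab Y (W t) q) \<in> vfam \<sigma>" by (rule vfam.vfam_add[OF vfam_add.IH])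
  then show ?case unfolding nab_add_right[OF Y vfam_smooth[OF vfam_add.hyps(1) \<sigma>] vfam_smooth[OF vfam_add.hyps(2) \<sigma>]] .
qed

lemma (in riemannian) vfam_ip:
  assumes "V \<in> vfam \<sigma>" "\<sigma> \<in> smooth_funs A" "Y \<in> smooth_vfields A" shows "(\<lambda>t q. g q (V t q) (Y q)) \<in> expfam \<sigma>"
  using assms(1)
proof induction
  case (vfam_base F X)
  from expfam_mult[OF vfam_base(1) expfam_fun[OF g_smooth[OF vfam_base(2) assms(3)]]]
  show ?case using assms(3) vfam_base(2) by simp
next
  case (vfam_add V W)
  note t = vf_tangent[OF vfam_smooth[OF vfam_add.hyps(1) assms(2)]] vf_tangent[OF vfam_smooth[OF vfam_add.hyps(2) assms(2)]]
  from expfam_add[OF vfam_add.IH] show ?case unfolding g_add_left[OF t vf_tangent[OF assms(3)]] .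
qed

section \<open>Families of (1,2)-tensors\<close>

context smooth_manifold
begin

lemma tensor12_lin:
  assumes T: "smooth_tensor12 A T"
  shows "u \<in> tangent A p \<Longrightarrow> v \<in> tangent A p \<Longrightarrow> w \<in> tangent A p \<Longrightarrow> T p (u + v) w = T p u w + T p v w"
    and "u \<in> tangent A p \<Longrightarrow> v \<in> tangent A p \<Longrightarrow> w \<in> tangent A p \<Longrightarrow> T p w (u + v) = T p w u + T p w v"
    and "u \<in> tangent A p \<Longrightarrow> w \<in> tangent A p \<Longrightarrow> T p (a *\<^sub>R u) w = a *\<^sub>R T p u w"
    and "u \<in> tangent A p \<Longrightarrow> w \<in> tangent A p \<Longrightarrow> T p w (a *\<^sub>R u) = a *\<^sub>R T p w u"
proof -
  have l: "T p (a *\<^sub>R u + b *\<^sub>R v) w = a *\<^sub>R T p u w + b *\<^sub>R T p v w \<and>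
    T p w (a *\<^sub>R u + b *\<^sub>R v) = a *\<^sub>R T p w u + b *\<^sub>R T p w v"
    if "u \<in> tangent A p" "v \<in> tangent A p" "w \<in> tangent A p" for u v w a b
    using T that unfolding smooth_tensor12_def by blast
  show "u \<in> tangent A p \<Longrightarrow> v \<in> tangent A p \<Longrightarrow> w \<in> tangent A p \<Longrightarrow> T p (u + v) w = T p u w + T p v w"
    "u \<in> tangent A p \<Longrightarrow> v \<in> tangent A p \<Longrightarrow> w \<in> tangent A p \<Longrightarrow> T p w (u + v) = T p w u + T p w v"
    using l[of u v w 1 1] by simp_all
  show "u \<in> tangent A p \<Longrightarrow> w \<in> tangent A p \<Longrightarrow> T p (a *\<^sub>R u) w = a *\<^sub>R T p u w"
    "u \<in> tangent A p \<Longrightarrow> w \<in> tangent A p \<Longrightarrow> T p w (a *\<^sub>R u) = a *\<^sub>R T p w u"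
    using l[of u 0 w a 0] by simp_all
qed

lemma tensor12_vf [simp, intro]:
  "smooth_tensor12 A T \<Longrightarrow> X \<in> smooth_vfields A \<Longrightarrow> Y \<in> smooth_vfields A \<Longrightarrow> (\<lambda>p. T p (X p) (Y p)) \<in> smooth_vfields A"
  unfolding smooth_tensor12_def by blast

lemma tensor12_tangent:
  assumes "smooth_tensor12 A T" "u \<in> tangent A p" "v \<in> tangent A p" shows "T p u v \<in> tangent A p"
  using vf_tangent[OF tensor12_vf[OF assms(1) extend_vec_vf[OF assms(2)] extend_vec_vf[OF assms(3)]], of p] assms by simp

lemma smooth_tensor12I:
  assumes "\<And>p u v w. u \<in> tangent A p \<Longrightarrow> v \<in> tangent A p \<Longrightarrow> w \<in> tangent A p \<Longrightarrow> T p (u + v) w = T p u w + T p v w"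
    and "\<And>p u v w. u \<in> tangent A p \<Longrightarrow> v \<in> tangent A p \<Longrightarrow> w \<in> tangent A p \<Longrightarrow> T p w (u + v) = T p w u + T p w v"
    and "\<And>p a u w. u \<in> tangent A p \<Longrightarrow> w \<in> tangent A p \<Longrightarrow> T p (a *\<^sub>R u) w = a *\<^sub>R T p u w"
    and "\<And>p a u w. u \<in> tangent A p \<Longrightarrow> w \<in> tangent A p \<Longrightarrow> T p w (a *\<^sub>R u) = a *\<^sub>R T p w u"
    and "\<And>X Y. X \<in> smooth_vfields A \<Longrightarrow> Y \<in> smooth_vfields A \<Longrightarrow> (\<lambda>p. T p (X p) (Y p)) \<in> smooth_vfields A"
  shows "smooth_tensor12 A T"
  unfolding smooth_tensor12_def using assms by simp

definition tfam :: "('a \<Rightarrow> real) \<Rightarrow> (real \<Rightarrow> 'a tensor12) \<Rightarrow> bool"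
  where "tfam \<sigma> \<tau> \<longleftrightarrow> (\<forall>t. smooth_tensor12 A (\<tau> t)) \<and>
    (\<forall>X\<in>smooth_vfields A. \<forall>Y\<in>smooth_vfields A. (\<lambda>t q. \<tau> t q (X q) (Y q)) \<in> vfam \<sigma>)"

lemma tfam_right:
  assumes \<tau>: "tfam \<sigma> \<tau>" and \<sigma>: "\<sigma> \<in> smooth_funs A" and V: "V \<in> vfam \<sigma>" and Y: "Y \<in> smooth_vfields A"
  shows "(\<lambda>t q. \<tau> t q (Y q) (V t q)) \<in> vfam \<sigma>"
  using V
proof induction
  case (vfam_base F X)
  have "(\<lambda>t q. F t q *\<^sub>R \<tau> t q (Y q) (X q)) \<in> vfam \<sigma>"
    by (rule vfam_mult[OF _ vfam_base(1)]) (use \<tau> Y vfam_base(2) in \<open>auto simp: tfam_def\<close>)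
  moreover have "\<tau> t q (Y q) (F t q *\<^sub>R X q) = F t q *\<^sub>R \<tau> t q (Y q) (X q)" for t q
    using \<tau> Y vfam_base(2) tensor12_lin(4)[of "\<tau> t"] unfolding tfam_def by simp
  ultimately show ?case by simp
next
  case (vfam_add V W)
  have "\<tau> t q (Y q) (V t q + W t q) = \<tau> t q (Y q) (V t q) + \<tau> t q (Y q) (W t q)" for t q
    using \<tau> Y vfam_smooth[OF vfam_add.hyps(1) \<sigma>] vfam_smooth[OF vfam_add.hyps(2) \<sigma>] tensor12_lin(2)[of "\<tau> t"]
    unfolding tfam_def by simp
  then show ?case using vfam.vfam_add[OF vfam_add.IH] by (simp only:)
qed

lemma tfam_variation:
  assumes \<tau>: "tfam \<sigma> \<tau>" and \<sigma>: "\<sigma> \<in> smooth_funs A" and T: "\<tau> 0 = T"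
    and supp: "\<And>p t u v. p \<notin> K \<Longrightarrow> u \<in> tangent A p \<Longrightarrow> v \<in> tangent A p \<Longrightarrow> \<tau> t p u v = T p u v"
    and K: "closure K \<subseteq> \<Omega>"
  shows "tensor_variation A \<Omega> T 1 \<tau>"
  unfolding tensor_variation_def
proof (intro conjI ballI)
  show "\<tau> 0 = T" by (rule T)
  show "smooth_tensor12 A (\<tau> t)" for t using \<tau> unfolding tfam_def by blast
  show "smooth_family A 1 (\<lambda>t p. \<tau> t p (X p) (Y p) f)"
    if "X \<in> smooth_vfields A" "Y \<in> smooth_vfields A" "f \<in> smooth_funs A" for X Y f
    using expfam_family[OF vfam_apply[OF _ that(3)] \<sigma>, of "\<lambda>t q. \<tau> t q (X q) (Y q)" 1] \<tau> that unfolding tfam_def by blast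
  fix t :: real
  have "{p. \<exists>u\<in>tangent A p. \<exists>v\<in>tangent A p. \<exists>f\<in>smooth_funs A. deriv (\<lambda>s. \<tau> s p u v f) t \<noteq> 0} \<subseteq> K"
  proof clarify
    fix p u v f assume u: "u \<in> tangent A p" "v \<in> tangent A p" and d: "deriv (\<lambda>s. \<tau> s p u v f) t \<noteq> 0"
    show "p \<in> K"
    proof (rule ccontr)
      assume "p \<notin> K"
      then have "(\<lambda>s. \<tau> s p u v f) = (\<lambda>s. T p u v f)" using supp u by auto
      then show False using d by simp
    qed
  qed
  then show "closure {p. \<exists>u\<in>tangent A p. \<exists>v\<in>tangent A p. \<exists>f\<in>smooth_funs A. deriv (\<lambda>s. \<tau> s p u v f) t \<noteq> 0} \<subseteq> \<Omega>"
    using K closure_mono by blast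
qed simp

end

lemma (in riemannian) tfam_curvature:
  assumes \<tau>: "tfam \<sigma> \<tau>" and \<sigma>: "\<sigma> \<in> smooth_funs A"
    and XYZ: "X \<in> smooth_vfields A" "Y \<in> smooth_vfields A" "Z \<in> smooth_vfields A"
  shows "(\<lambda>t. connection.Rm (contorted_connection A g (\<tau> t)) X Y Z) \<in> vfam \<sigma>"
proof -
  interpret LC: connection A LC by unfold_locales (rule levi_civita_affine)
  have nb: "connection A (contorted_connection A g (\<tau> t))" for t
    by unfold_locales (use contorted_affine \<tau> in \<open>auto simp: tfam_def\<close>)
  have 1: "(\<lambda>t. contorted_connection A g (\<tau> t) V (W t)) \<in> vfam \<sigma>" if "V \<in> smooth_vfields A" "W \<in> vfam \<sigma>" for V W
    unfolding contorted_connection_def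
    by (rule vfam_add[OF LC.vfam_nab[OF that(2) \<sigma> that(1)] tfam_right[OF \<tau> \<sigma> that(2,1)]])
  have 2: "(\<lambda>t. contorted_connection A g (\<tau> t) V W) \<in> vfam \<sigma>" if "V \<in> smooth_vfields A" "W \<in> smooth_vfields A" for V W
    using 1[OF that(1) vfam_vf[OF that(2)]] by simp
  have "(\<lambda>t q. contorted_connection A g (\<tau> t) Y (contorted_connection A g (\<tau> t) X Z) q
      - contorted_connection A g (\<tau> t) X (contorted_connection A g (\<tau> t) Y Z) q
      + contorted_connection A g (\<tau> t) (lie_bracket X Y) Z q) \<in> vfam \<sigma>"
    by (intro vfam_add vfam_diff 1 2 XYZ lie_bracket_vf)
  then show ?thesis unfolding connection.Rm_def[OF nb, abs_def] .
qed

section \<open>The first variation with respect to the contorsion\<close>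

context riemannian
begin

text \<open>For a smooth tensor this is the pointwise form of metric compatibility of the contorted
  connection; \<open>contorted_metric_connection\<close> and \<open>contorsion_skew\<close> give the
  two directions.\<close>

definition skew_tensor :: "'a tensor12 \<Rightarrow> bool"
  where "skew_tensor T \<longleftrightarrow> (\<forall>p. \<forall>u\<in>tangent A p. \<forall>v\<in>tangent A p. \<forall>w\<in>tangent A p. g p (T p u v) w = - g p v (T p u w))"

lemma skew_tensorD: "skew_tensor T \<Longrightarrow> u \<in> tangent A p \<Longrightarrow> v \<in> tangent A p \<Longrightarrow> w \<in> tangent A p \<Longrightarrow> g p (T p u v) w = - g p v (T p u w)"
  unfolding skew_tensor_def by blast

lemma levi_civita_connection: "metric_connection A g LC"
  by unfold_locales (rule levi_civita_affine levi_civita_metric)+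

lemma contorted_metric_connection:
  assumes T: "smooth_tensor12 A T" and skew: "skew_tensor T"
  shows "metric_connection A g (contorted_connection A g T)"
proof -
  interpret LC: metric_connection A g LC by (rule levi_civita_connection)
  have "metric_compatible A g (contorted_connection A g T)"
    unfolding metric_compatible_def contorted_connection_def
  proof (intro ballI allI)
    fix X Y Z p assume [simp]: "X \<in> smooth_vfields A" "Y \<in> smooth_vfields A" "Z \<in> smooth_vfields A"
    have t: "T p (X p) (Y p) \<in> tangent A p" "T p (X p) (Z p) \<in> tangent A p" by (auto intro!: tensor12_tangent[OF T])
    show "X p (ip Y Z) = g p (LC X Y p + T p (X p) (Y p)) (Z p) + g p (Y p) (LC X Z p + T p (X p) (Z p))"
      using LC.ip_deriv[of X Y Z p] skew_tensorD[OF skew, of "X p" p "Y p" "Z p"] t by simp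
  qed
  then show ?thesis
    by unfold_locales (use contorted_affine[OF T] in auto)
qed

lemma contorsion_skew:
  assumes "metric_contorsion A g T"
  shows "skew_tensor T"
  unfolding skew_tensor_def
proof (intro allI ballI)
  fix p u v w assume [simp]: "u \<in> tangent A p" "v \<in> tangent A p" "w \<in> tangent A p"
  interpret LC: metric_connection A g LC by (rule levi_civita_connection)
  have T: "smooth_tensor12 A T" and m: "metric_compatible A g (contorted_connection A g T)"
    using assms unfolding metric_contorsion_def by auto
  let ?X = "extend_vec A p u" and ?Y = "extend_vec A p v" and ?Z = "extend_vec A p w"
  have t: "T p u v \<in> tangent A p" "T p u w \<in> tangent A p" by (auto intro!: tensor12_tangent[OF T])
  have m': "X p (ip Y Z) = g p (contorted_connection A g T X Y p) (Z p) + g p (Y p) (contorted_connection A g T X Z p)"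
    if "X \<in> smooth_vfields A" "Y \<in> smooth_vfields A" "Z \<in> smooth_vfields A" for X Y Z
    using m that unfolding metric_compatible_def by simp
  have "?X p (ip ?Y ?Z) = g p (contorted_connection A g T ?X ?Y p) (?Z p) + g p (?Y p) (contorted_connection A g T ?X ?Z p)"
    by (rule m') auto
  then show "g p (T p u v) w = - g p v (T p u w)"
    using LC.ip_deriv[of ?X ?Y ?Z p] t by (simp add: contorted_connection_def)
qed

end

text \<open>\<open>lab i\<close> is the number of the distribution that contains \<open>E i\<close>.
  The fields \<open>E\<close> are global, but orthonormal and adapted only on \<open>W\<close>,
  which contains the closure of \<open>\<Omega>\<close>.\<close>

locale adapted_chart = chart_domain A g U \<phi> N x C \<Omega>
  for A :: "('a::{t2_space, second_countable_topology}, 'n::finite) atlas" and g U \<phi> N x C \<Omega> +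
  fixes T :: "'a tensor12" and D :: "nat \<Rightarrow> 'a distribution" and E :: "'n \<Rightarrow> 'a vfield" and W :: "'a set" and lab :: "'n \<Rightarrow> nat"
  assumes T: "metric_contorsion A g T"
    and E [simp, intro]: "\<And>i. E i \<in> smooth_vfields A" and on: "\<And>q. q \<in> W \<Longrightarrow> ON q (\<lambda>i. E i q)"
    and W: "open W" "closure \<Omega> \<subseteq> W"
    and lab: "\<And>i. lab i \<in> {1..4}"
    and D: "\<And>\<mu> q. \<mu> \<in> {1..4} \<Longrightarrow> q \<in> W \<Longrightarrow> D \<mu> q = span ((\<lambda>i. E i q) ` {i. lab i = \<mu>})"
    and crit: "critical_contorsion A D g T"
begin

lemma T_tensor [simp, intro]: "smooth_tensor12 A T" and T_skew: "skew_tensor T"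
  using T contorsion_skew[OF T] unfolding metric_contorsion_def by auto

abbreviation nb where "nb \<equiv> contorted_connection A g T"

sublocale NB: metric_connection A g nb
  by (rule contorted_metric_connection[OF T_tensor T_skew])

lemma \<Omega>W: "q \<in> \<Omega> \<Longrightarrow> q \<in> W"
  using W(2) closure_subset by blast

lemma on_g: "q \<in> W \<Longrightarrow> g q (E i q) (E j q) = (if i = j then 1 else 0)"
  using ON_D(2)[OF on] by simp

definition msum :: "('n \<Rightarrow> 'n \<Rightarrow> 'a \<Rightarrow> real) \<Rightarrow> 'a \<Rightarrow> real"
  where "msum f q = (\<Sum>i\<in>UNIV. \<Sum>j\<in>UNIV. if lab i \<noteq> lab j then f i j q else 0)"

lemma msum_smooth: assumes "\<And>i j. f i j \<in> smooth_funs A" shows "msum f \<in> smooth_funs A"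
proof -
  have "(\<lambda>q. if lab i \<noteq> lab j then f i j q else 0) \<in> smooth_funs A" for i j
    using assms[of i j] by (cases "lab i = lab j") auto
  then show ?thesis unfolding msum_def[abs_def] by (intro smooth_funs_sum)
qed

definition secf :: "'a tensor12 \<Rightarrow> 'n \<Rightarrow> 'n \<Rightarrow> 'a \<Rightarrow> real"
  where "secf T' i j q = g q (connection.Rm (contorted_connection A g T') (E i) (E j) (E i) q) (E j q)"

lemma secf_smooth: assumes "smooth_tensor12 A T'" shows "secf T' i j \<in> smooth_funs A"
proof -
  interpret c: connection A "contorted_connection A g T'" by unfold_locales (rule contorted_affine[OF assms])
  show ?thesis unfolding secf_def[abs_def] by (intro g_smooth c.Rm_vf E)
qed

lemma mixed_curvature_msum:
  assumes T': "smooth_tensor12 A T'" and q: "q \<in> W"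
  shows "mixed_scalar_curvature A D g T' q = (1/2) * msum (secf T') q"
proof -
  interpret c: connection A "contorted_connection A g T'" by unfold_locales (rule contorted_affine[OF T'])
  show ?thesis
    using mixed_scalar_curvature_frame[OF T' on[OF q], where lab=lab and D=D] lab D q
    unfolding msum_def secf_def c.curvature_eq_Rm[OF E E E, symmetric] by simp
qed

lemma action_msum:
  assumes "smooth_tensor12 A T'"
  shows "action A D \<Omega> g T' = set_lebesgue_integral vol \<Omega> (\<lambda>q. (1/2) * msum (secf T') q)"
  unfolding action_def vol_def[symmetric]
  by (rule set_lebesgue_integral_cong) (use \<Omega>_sub(3) mixed_curvature_msum[OF assms] \<Omega>W in auto)

definition cc :: "'a tensor12 \<Rightarrow> 'a vfield \<Rightarrow> 'a vfield \<Rightarrow> 'a vfield"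
  where "cc B X Y = (\<lambda>p. B p (X p) (Y p))"

lemma cc_vf [simp, intro]: "smooth_tensor12 A B \<Longrightarrow> X \<in> smooth_vfields A \<Longrightarrow> Y \<in> smooth_vfields A \<Longrightarrow> cc B X Y \<in> smooth_vfields A"
  unfolding cc_def by (rule tensor12_vf[of B X Y])

text \<open>The part linear in \<open>B\<close> of \<open>sec_formula\<close> for the contorsion
  \<open>T + t B\<close>.\<close>

definition dsec :: "'a tensor12 \<Rightarrow> 'a vfield \<Rightarrow> 'a vfield \<Rightarrow> 'a \<Rightarrow> real"
  where "dsec B X Y p = Y p (ip (cc B X X) Y) - X p (ip (cc B Y X) Y) - ip (cc B X X) (nb Y Y) p
    - ip (nb X X) (cc B Y Y) p + ip (cc B Y X) (nb X Y) p + ip (nb Y X) (cc B X Y) p + ip (cc B (lie_bracket X Y) X) Y p"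

lemma dsec_smooth:
  assumes B: "smooth_tensor12 A B" and X: "X \<in> smooth_vfields A" and Y: "Y \<in> smooth_vfields A"
  shows "dsec B X Y \<in> smooth_funs A"
  unfolding dsec_def[abs_def]
  by (intro smooth_funs_add smooth_funs_diff g_smooth vf_apply[OF X g_smooth] vf_apply[OF Y g_smooth]
      cc_vf NB.nab_vf lie_bracket_vf B X Y)

text \<open>For skew \<open>B\<close> all connections with contorsion \<open>T + t B\<close> are
  metric, and \<open>sec_formula\<close> makes each curvature term a polynomial of degree 2 in
  \<open>t\<close>. The derivative of the action is then read off from the coefficients, without
  differentiating under the integral.\<close>

lemma first_variation:
  assumes B: "smooth_tensor12 A B" and skew: "skew_tensor B"
    and supp: "\<And>p u v. p \<notin> K \<Longrightarrow> u \<in> tangent A p \<Longrightarrow> v \<in> tangent A p \<Longrightarrow> B p u v = 0" and K: "closure K \<subseteq> \<Omega>"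
  shows "set_lebesgue_integral vol \<Omega> (msum (\<lambda>i j. dsec B (E i) (E j))) = 0"
proof -
  define \<tau> where "\<tau> t = (\<lambda>p u v. T p u v + t *\<^sub>R B p u v)" for t
  have Bt [simp]: "B p u v \<in> tangent A p" if "u \<in> tangent A p" "v \<in> tangent A p" for p u v
    by (rule tensor12_tangent[OF B that])
  have Tt [simp]: "T p u v \<in> tangent A p" if "u \<in> tangent A p" "v \<in> tangent A p" for p u v
    by (rule tensor12_tangent[OF T_tensor that])
  have \<tau>s [simp]: "smooth_tensor12 A (\<tau> t)" for t
    unfolding \<tau>_def
    by (rule smooth_tensor12I)
      (auto simp: tensor12_lin[OF B] tensor12_lin[OF T_tensor] scaleR_right_distrib add.assoc add.left_commute mult.commute
        intro!: vf_add vf_scale tensor12_vf[OF T_tensor] tensor12_vf[OF B])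
  have \<tau>skew: "skew_tensor (\<tau> t)" for t
    unfolding skew_tensor_def \<tau>_def
    using skew_tensorD[OF T_skew] skew_tensorD[OF skew] by (auto simp: algebra_simps)
  \<comment> \<open>The dependence on \<open>t\<close> is linear, so the exponent function of the
    family may be taken to be 0.\<close>
  have tf: "tfam (\<lambda>q. 0) \<tau>" unfolding tfam_def
  proof (intro conjI allI ballI)
    fix X Y assume XY: "X \<in> smooth_vfields A" "Y \<in> smooth_vfields A"
    show "(\<lambda>t q. \<tau> t q (X q) (Y q)) \<in> vfam (\<lambda>q. 0)"
      unfolding \<tau>_def
      by (rule vfam_add[OF vfam_vf[OF tensor12_vf[OF T_tensor XY]] vfam_base[OF expfam_t tensor12_vf[OF B XY]]])
  qed simp
  have "tensor_variation A \<Omega> T 1 \<tau>"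
  proof (rule tfam_variation[OF tf smooth_funs_const _ _ K])
    show "\<tau> 0 = T" by (simp add: \<tau>_def)
    show "\<tau> t p u v = T p u v" if "p \<notin> K" "u \<in> tangent A p" "v \<in> tangent A p" for p t u v
      using supp[OF that] by (simp add: \<tau>_def)
  qed
  then have der: "((\<lambda>t. action A D \<Omega> g (\<tau> t)) has_real_derivative 0) (at 0)"
    using crit \<Omega>_domain unfolding critical_contorsion_def by blast
  define e where "e i j = (\<lambda>p. ip (cc B (E j) (E i)) (cc B (E i) (E j)) p - ip (cc B (E i) (E i)) (cc B (E j) (E j)) p)" for i j
  have e: "e i j \<in> smooth_funs A" for i j unfolding e_def using B by auto
  have sec: "secf (\<tau> t) i j p = secf T i j p + t * dsec B (E i) (E j) p + t\<^sup>2 * e i j p" for t i j p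
  proof -
    interpret c: metric_connection A g "contorted_connection A g (\<tau> t)"
      by (rule contorted_metric_connection[OF \<tau>s \<tau>skew])
    have nt: "contorted_connection A g (\<tau> t) X Y = (\<lambda>p. nb X Y p + t *\<^sub>R cc B X Y p)" for X Y
      by (rule ext) (simp add: contorted_connection_def \<tau>_def cc_def)
    have d: "V p (\<lambda>r. g r (nb X Y r + t *\<^sub>R cc B X Y r) (Z r)) = V p (ip (nb X Y) Z) + t * V p (ip (cc B X Y) Z)"
      if "V \<in> smooth_vfields A" "X \<in> smooth_vfields A" "Y \<in> smooth_vfields A" "Z \<in> smooth_vfields A" for V X Y Z
    proof -
      have "(\<lambda>r. g r (nb X Y r + t *\<^sub>R cc B X Y r) (Z r)) = (\<lambda>r. ip (nb X Y) Z r + t * ip (cc B X Y) Z r)"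
        using that B by auto
      then show ?thesis
        using that B tangent_add_fun[OF vf_tangent[OF that(1), of p], of "ip (nb X Y) Z" "\<lambda>r. t * ip (cc B X Y) Z r"]
          tangent_scale_fun[OF vf_tangent[OF that(1), of p], of "ip (cc B X Y) Z" t] by auto
    qed
    have m: "NB.Rm = connection.Rm nb" ..
    show ?thesis
      unfolding secf_def c.sec_formula[OF E E] NB.sec_formula[OF E E] nt d[OF E E E E] dsec_def e_def
      using B by (simp add: power2_eq_square algebra_simps)
  qed
  have ms: "msum (secf (\<tau> t)) q = msum (secf T) q + t * msum (\<lambda>i j. dsec B (E i) (E j)) q + t\<^sup>2 * msum e q" for t q
    unfolding msum_def sum_distrib_left sum.distrib[symmetric]
    by (intro sum.cong refl) (simp add: sec)
  have s1: "set_integrable vol \<Omega> (msum (secf T))" "set_integrable vol \<Omega> (msum (\<lambda>i j. dsec B (E i) (E j)))" "set_integrable vol \<Omega> (msum e)"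
    using secf_smooth[OF T_tensor] dsec_smooth[OF B E E] e by (auto intro!: smooth_set_integrable msum_smooth)
  let ?I = "\<lambda>f. set_lebesgue_integral vol \<Omega> f"
  have "action A D \<Omega> g (\<tau> t) = (1/2) * (?I (msum (secf T)) + t * ?I (msum (\<lambda>i j. dsec B (E i) (E j))) + t\<^sup>2 * ?I (msum e))" for t
    unfolding action_msum[OF \<tau>s] ms using s1 by (simp add: set_integral_add set_integral_mult_right)
  then have at: "(\<lambda>t. action A D \<Omega> g (\<tau> t)) = (\<lambda>t. (1/2) * (?I (msum (secf T)) + t * ?I (msum (\<lambda>i j. dsec B (E i) (E j))) + t\<^sup>2 * ?I (msum e)))"
    by (rule ext)
  have "((\<lambda>t. action A D \<Omega> g (\<tau> t)) has_real_derivative (1/2) * ?I (msum (\<lambda>i j. dsec B (E i) (E j)))) (at 0)"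
    unfolding at by (auto intro!: derivative_eq_intros)
  from DERIV_unique[OF der this] show ?thesis by simp
qed

section \<open>Test tensors and the resulting Euler-Lagrange equations\<close>

definition test :: "('a \<Rightarrow> real) \<Rightarrow> 'n \<Rightarrow> 'n \<Rightarrow> 'n \<Rightarrow> 'a tensor12"
  where "test s k l m p u v = (s p * g p (E k p) u) *\<^sub>R (g p (E l p) v *\<^sub>R E m p - g p (E m p) v *\<^sub>R E l p)"

lemma test_tensor:
  assumes s: "s \<in> smooth_funs A" shows "smooth_tensor12 A (test s k l m)"
proof (rule smooth_tensor12I)
  fix X Y assume "X \<in> smooth_vfields A" "Y \<in> smooth_vfields A"
  then show "(\<lambda>p. test s k l m p (X p) (Y p)) \<in> smooth_vfields A"
    unfolding test_def using s by (intro vf_scale vf_diff smooth_funs_mult g_smooth E)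
qed (auto simp: test_def algebra_simps)

text \<open>As an endomorphism of the second argument, the test tensor is a multiple of the
  infinitesimal rotation in the plane of \<open>E l\<close> and \<open>E m\<close>.\<close>

lemma test_skew: "skew_tensor (test s k l m)"
  unfolding skew_tensor_def test_def
proof (intro allI ballI)
  fix p u v w assume t: "u \<in> tangent A p" "v \<in> tangent A p" "w \<in> tangent A p"
  show "g p ((s p * g p (E k p) u) *\<^sub>R (g p (E l p) v *\<^sub>R E m p - g p (E m p) v *\<^sub>R E l p)) w
    = - g p v ((s p * g p (E k p) u) *\<^sub>R (g p (E l p) w *\<^sub>R E m p - g p (E m p) w *\<^sub>R E l p))"
    using t g_sym[of v p "E l p"] g_sym[of v p "E m p"] by (simp add: algebra_simps)
qed

lemma test_variation:
  assumes s: "s \<in> smooth_funs A" "closure {q. s q \<noteq> 0} \<subseteq> \<Omega>"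
  shows "set_lebesgue_integral vol \<Omega> (msum (\<lambda>i j. dsec (test s k l m) (E i) (E j))) = 0"
  by (rule first_variation[OF test_tensor[OF s(1)] test_skew _ s(2)]) (simp add: test_def)

lemma test_frame:
  assumes "q \<in> W"
  shows "cc (test s k l m) (E i) (E j) q = (if i = k then s q *\<^sub>R ((if j = l then E m q else 0) - (if j = m then E l q else 0)) else 0)"
  unfolding cc_def test_def by (auto simp: on_g[OF assms])

lemma test_frame_ip:
  assumes "q \<in> W"
  shows "ip (cc (test s k l m) (E i) (E j)) (E h) q
    = s q * (if i = k then (if j = l \<and> m = h then 1 else 0) - (if j = m \<and> l = h then 1 else 0) else 0)"
  unfolding test_frame[OF assms] by (auto simp: on_g[OF assms])

lemma test_frame_deriv:
  assumes q: "q \<in> W" and s: "s \<in> smooth_funs A"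
  shows "E r q (ip (cc (test s k l m) (E i) (E j)) (E h))
    = (if i = k then (if j = l \<and> m = h then 1 else 0) - (if j = m \<and> l = h then 1 else 0) else 0) * E r q s"
proof -
  let ?c = "(if i = k then (if j = l \<and> m = h then 1 else 0) - (if j = m \<and> l = h then 1 else 0) else 0) :: real"
  have "E r q (ip (cc (test s k l m) (E i) (E j)) (E h)) = E r q (\<lambda>q. ?c * s q)"
    by (rule vf_apply_local[OF E _ _ W(1) q]) (use s test_tensor[OF s] test_frame_ip in \<open>auto simp: mult.commute\<close>)
  then show ?thesis using tangent_scale_fun[OF vf_tangent[OF E] s, of r q ?c] by simp
qed

lemma nb_unit: assumes q: "q \<in> W" and X: "X \<in> smooth_vfields A" shows "g q (nb X (E k) q) (E k q) = 0" "g q (E k q) (nb X (E k) q) = 0"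
proof -
  have "X q (ip (E k) (E k)) = X q (\<lambda>q. 1)"
    by (rule vf_apply_local[OF X _ _ W(1) q]) (use on_g in auto)
  then have "X q (ip (E k) (E k)) = 0" using tangent_const[OF vf_tangent[OF X]] by simp
  then show "g q (nb X (E k) q) (E k q) = 0" "g q (E k q) (nb X (E k) q) = 0"
    using NB.ip_deriv[OF X E E, of q k k] g_sym[of "E k q" q "nb X (E k) q"] X by auto
qed

lemma nb_skew: assumes q: "q \<in> W" and X: "X \<in> smooth_vfields A" shows "g q (nb X (E k) q) (E l q) = - g q (nb X (E l) q) (E k q)"
proof -
  have "X q (ip (E k) (E l)) = X q (\<lambda>q. if k = l then 1 else 0)"
    by (rule vf_apply_local[OF X _ _ W(1) q]) (use on_g in auto)
  then have "X q (ip (E k) (E l)) = 0" using tangent_const[OF vf_tangent[OF X]] by simp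
  then show ?thesis using NB.ip_deriv[OF X E E, of q k l] g_sym[of "E k q" q "nb X (E l) q"] X by auto
qed

lemma bracket_swap: "g q (E k q) (lie_bracket (E i) (E j) q) = - g q (E k q) (lie_bracket (E j) (E i) q)"
  using lie_bracket_antisym[of "E i" "E j" q] by simp

text \<open>Choosing \<open>l = k\<close> singles out the trace terms: summed over the free index,
  the last two lines give the components along \<open>E m\<close> of the mean curvatures. It is also
  the choice in which a derivative of \<open>s\<close> survives.\<close>

lemma dsec_test_A:
  assumes q: "q \<in> W" and s: "s \<in> smooth_funs A" and km: "k \<noteq> m" and ij: "i \<noteq> j"
  shows "dsec (test s k k m) (E i) (E j) q =
    (if i = k \<and> j = m then E m q s + s q * g q (E k q) (lie_bracket (E k) (E m) q) else 0)
    + (if j = k \<and> i = m then E m q s + s q * g q (E k q) (lie_bracket (E k) (E m) q) else 0)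
    - (if i = k then s q * g q (E m q) (nb (E j) (E j) q) else 0)
    - (if j = k then s q * g q (E m q) (nb (E i) (E i) q) else 0)"
proof -
  have br: "ip (cc (test s k k m) (lie_bracket (E i) (E j)) (E i)) (E j) q
      = s q * g q (E k q) (lie_bracket (E i) (E j) q) * ((if i = k \<and> m = j then 1 else 0) - (if i = m \<and> k = j then 1 else 0))"
    unfolding cc_def test_def using on_g[OF q] by auto
  show ?thesis
    unfolding dsec_def br test_frame_deriv[OF q s] test_frame[OF q]
    using km ij nb_unit[OF q, of _ k] bracket_swap[of q k m k] g_sym[of "nb (E i) (E i) q" q "E m q"]
    by (cases "i = k"; cases "j = k") (auto simp: algebra_simps)
qed

text \<open>With \<open>k\<close> and \<open>m\<close> in one distribution and \<open>l\<close> in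
  another, the scalar products that would be differentiated vanish. The resulting equation is
  therefore pointwise.\<close>

lemma dsec_test_B:
  assumes q: "q \<in> W" and s: "s \<in> smooth_funs A" and km: "k \<noteq> m" and l: "lab l \<noteq> lab k" "lab m = lab k" and ij: "lab i \<noteq> lab j"
  shows "dsec (test s k l m) (E i) (E j) q =
    (if i = k \<and> j = l then s q * g q (nb (E l) (E k) q) (E m q) else 0)
    + (if i = l \<and> j = k then s q * g q (nb (E l) (E k) q) (E m q) else 0)
    + (if i = l \<and> j = m then s q * g q (E k q) (lie_bracket (E l) (E m) q) else 0)
    + (if i = m \<and> j = l then s q * g q (E k q) (lie_bracket (E l) (E m) q) else 0)"
proof -
  have lm: "l \<noteq> m" "l \<noteq> k" "i \<noteq> j" using l ij by auto
  have br: "ip (cc (test s k l m) (lie_bracket (E i) (E j)) (E i)) (E j) q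
      = s q * g q (E k q) (lie_bracket (E i) (E j) q) * ((if i = l \<and> m = j then 1 else 0) - (if i = m \<and> l = j then 1 else 0))"
    unfolding cc_def test_def using on_g[OF q] by auto
  show ?thesis
    unfolding dsec_def br test_frame_deriv[OF q s] test_frame[OF q]
    using km lm l ij bracket_swap[of q k m l] g_sym[of "nb (E l) (E k) q" q "E m q"]
    by (cases "i = k"; cases "j = k"; cases "i = l"; cases "j = l") (auto simp: algebra_simps)
qed

lemma msum_delta: "msum (\<lambda>i j q. if i = k \<and> j = m then a q else 0) q = (if lab k \<noteq> lab m then a q else 0)"
proof -
  have "msum (\<lambda>i j q. if i = k \<and> j = m then a q else 0) q
      = (\<Sum>i\<in>UNIV. \<Sum>j\<in>UNIV. if j = m then (if i = k then (if lab k \<noteq> lab m then a q else 0) else 0) else 0)"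
    unfolding msum_def by (intro sum.cong refl) auto
  then show ?thesis by simp
qed

lemma msum_left: "msum (\<lambda>i j q. if i = k then f j q else 0) q = (\<Sum>j\<in>UNIV. if lab k \<noteq> lab j then f j q else 0)"
proof -
  have "msum (\<lambda>i j q. if i = k then f j q else 0) q
      = (\<Sum>i\<in>UNIV. if i = k then (\<Sum>j\<in>UNIV. if lab k \<noteq> lab j then f j q else 0) else 0)"
    unfolding msum_def by (rule sum.cong[OF refl]) (auto intro!: sum.cong sum.neutral)
  then show ?thesis by simp
qed

lemma msum_right: "msum (\<lambda>i j q. if j = k then f i q else 0) q = (\<Sum>j\<in>UNIV. if lab k \<noteq> lab j then f j q else 0)"
proof -
  have "msum (\<lambda>i j q. if j = k then f i q else 0) q = (\<Sum>i\<in>UNIV. \<Sum>j\<in>UNIV. if j = k then (if lab k \<noteq> lab i then f i q else 0) else 0)"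
    unfolding msum_def by (intro sum.cong refl) auto
  then show ?thesis by simp
qed

lemma msum_add: "msum (\<lambda>i j q. f i j q + h i j q) q = msum f q + msum h q"
  and msum_diff: "msum (\<lambda>i j q. f i j q - h i j q) q = msum f q - msum h q"
  unfolding msum_def sum.distrib[symmetric] sum_subtractf[symmetric] by (intro sum.cong refl; simp)+

lemma msum_cong: "(\<And>i j. lab i \<noteq> lab j \<Longrightarrow> f i j q = h i j q) \<Longrightarrow> msum f q = msum h q"
  unfolding msum_def by (intro sum.cong refl) auto

text \<open>Up to normalisation, the component along \<open>E m\<close> of the mean curvature, taken
  with \<open>nb\<close>, of the complement of the distribution of \<open>E k\<close>.\<close>

definition mcurv :: "'n \<Rightarrow> 'n \<Rightarrow> 'a \<Rightarrow> real"
  where "mcurv k m q = (\<Sum>j\<in>UNIV. if lab k \<noteq> lab j then g q (E m q) (nb (E j) (E j) q) else 0)"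

lemma mcurv_smooth: "mcurv k m \<in> smooth_funs A"
proof -
  have "(\<lambda>q. if lab k \<noteq> lab j then g q (E m q) (nb (E j) (E j) q) else 0) \<in> smooth_funs A" for j
    by (cases "lab k = lab j") auto
  then show ?thesis unfolding mcurv_def[abs_def] by (intro smooth_funs_sum)
qed

text \<open>Kept in integrated form, since the derivative of \<open>s\<close> along
  \<open>E m\<close> remains. It is absent when \<open>k\<close> and \<open>m\<close> have the same
  label, integrates to 0 when \<open>E m\<close> is a Reeb field, and cancels when two values of
  \<open>k\<close> are compared.\<close>

lemma euler_lagrange_A:
  assumes s: "s \<in> smooth_funs A" "closure {q. s q \<noteq> 0} \<subseteq> \<Omega>" and km: "k \<noteq> m"
  shows "set_lebesgue_integral vol \<Omega> (\<lambda>q. (if lab k \<noteq> lab m then E m q s + s q * g q (E k q) (lie_bracket (E k) (E m) q) else 0)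
    - s q * mcurv k m q) = 0"
proof -
  let ?d = "\<lambda>q. E m q s + s q * g q (E k q) (lie_bracket (E k) (E m) q)"
  let ?f = "\<lambda>j q. s q * g q (E m q) (nb (E j) (E j) q)"
  have fs: "(\<Sum>j\<in>UNIV. if lab k \<noteq> lab j then ?f j q else 0) = s q * mcurv k m q" for q
    unfolding mcurv_def sum_distrib_left by (intro sum.cong refl) auto
  have "msum (\<lambda>i j. dsec (test s k k m) (E i) (E j)) q = 2 * ((if lab k \<noteq> lab m then ?d q else 0) - s q * mcurv k m q)"
    if q: "q \<in> \<Omega>" for q
  proof -
    have "msum (\<lambda>i j. dsec (test s k k m) (E i) (E j)) q
      = msum (\<lambda>i j q. (if i = k \<and> j = m then ?d q else 0) + (if j = k \<and> i = m then ?d q else 0)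
        - (if i = k then ?f j q else 0) - (if j = k then ?f i q else 0)) q"
      by (rule msum_cong) (rule dsec_test_A[OF \<Omega>W[OF q] s(1) km], auto)
    also have "\<dots> = msum (\<lambda>i j q. (if i = k \<and> j = m then ?d q else 0)) q + msum (\<lambda>i j q. (if i = m \<and> j = k then ?d q else 0)) q
        - msum (\<lambda>i j q. (if i = k then ?f j q else 0)) q - msum (\<lambda>i j q. (if j = k then ?f i q else 0)) q"
      by (simp only: msum_add msum_diff conj_commute)
    also have "\<dots> = 2 * ((if lab k \<noteq> lab m then ?d q else 0) - s q * mcurv k m q)"
      unfolding msum_delta msum_left msum_right fs by auto
    finally show ?thesis .
  qed
  then have "set_lebesgue_integral vol \<Omega> (msum (\<lambda>i j. dsec (test s k k m) (E i) (E j)))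
      = set_lebesgue_integral vol \<Omega> (\<lambda>q. 2 * ((if lab k \<noteq> lab m then ?d q else 0) - s q * mcurv k m q))"
    using \<Omega>_sub(3) by (intro set_lebesgue_integral_cong) auto
  also have "\<dots> = 2 * set_lebesgue_integral vol \<Omega> (\<lambda>q. (if lab k \<noteq> lab m then ?d q else 0) - s q * mcurv k m q)"
    by (simp only: set_integral_mult_right)
  finally show ?thesis using test_variation[OF s, of k k m] by simp
qed

text \<open>Since \<open>nb\<close> is metric, it says that \<open>nb (E l) (E m)\<close> and the
  bracket of \<open>E l\<close> and \<open>E m\<close> have the same component along
  \<open>E k\<close>. It will be used with a Reeb field for \<open>E l\<close>.\<close>

lemma euler_lagrange_B:
  assumes km: "k \<noteq> m" and l: "lab l \<noteq> lab k" "lab m = lab k" and q: "q \<in> \<Omega>"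
  shows "g q (nb (E l) (E k) q) (E m q) = - g q (E k q) (lie_bracket (E l) (E m) q)"
proof -
  let ?F = "\<lambda>q. g q (nb (E l) (E k) q) (E m q) + g q (E k q) (lie_bracket (E l) (E m) q)"
  have "?F q = 0"
  proof (rule fundamental_lemma[OF _ _ q])
    show "?F \<in> smooth_funs A" by auto
    fix s assume s: "s \<in> smooth_funs A" "closure {q. s q \<noteq> 0} \<subseteq> \<Omega>"
    have "msum (\<lambda>i j. dsec (test s k l m) (E i) (E j)) q = 2 * (s q * ?F q)" if q: "q \<in> \<Omega>" for q
    proof -
      let ?a = "\<lambda>q. s q * g q (nb (E l) (E k) q) (E m q)" and ?b = "\<lambda>q. s q * g q (E k q) (lie_bracket (E l) (E m) q)"
      have "msum (\<lambda>i j. dsec (test s k l m) (E i) (E j)) q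
        = msum (\<lambda>i j q. (if i = k \<and> j = l then ?a q else 0) + (if i = l \<and> j = k then ?a q else 0)
          + (if i = l \<and> j = m then ?b q else 0) + (if i = m \<and> j = l then ?b q else 0)) q"
        by (rule msum_cong) (rule dsec_test_B[OF \<Omega>W[OF q] s(1) km l])
      also have "\<dots> = 2 * (s q * ?F q)"
        unfolding msum_add msum_delta using l by (auto simp: algebra_simps)
      finally show ?thesis .
    qed
    then have "set_lebesgue_integral vol \<Omega> (msum (\<lambda>i j. dsec (test s k l m) (E i) (E j)))
        = set_lebesgue_integral vol \<Omega> (\<lambda>q. 2 * (s q * ?F q))"
      using \<Omega>_sub(3) by (intro set_lebesgue_integral_cong) auto
    also have "\<dots> = 2 * set_lebesgue_integral vol \<Omega> (\<lambda>q. s q * ?F q)" by (simp only: set_integral_mult_right)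
    finally show "set_lebesgue_integral vol \<Omega> (\<lambda>q. s q * ?F q) = 0" using test_variation[OF s, of k l m] by simp
  qed
  then show ?thesis by simp
qed

end

section \<open>Critical contorsions of 3-Sasaki metrics\<close>

context riemannian
begin

lemma killing_vf: "killing_field A g \<xi> \<Longrightarrow> \<xi> \<in> smooth_vfields A"
  unfolding killing_field_def by blast

lemma killing_deriv:
  "killing_field A g \<xi> \<Longrightarrow> X \<in> smooth_vfields A \<Longrightarrow> Y \<in> smooth_vfields A \<Longrightarrow>
    \<xi> p (ip X Y) = g p (lie_bracket \<xi> X p) (Y p) + g p (X p) (lie_bracket \<xi> Y p)"
  unfolding killing_field_def by blast

lemma lie_bracket_LC:
  assumes "X \<in> smooth_vfields A" "Y \<in> smooth_vfields A" shows "lie_bracket X Y p = LC X Y p - LC Y X p"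
proof -
  have "LC X Y - LC Y X = lie_bracket X Y"
    using levi_civita_torsion_free assms unfolding torsion_free_def by blast
  then show ?thesis by (metis minus_apply)
qed

lemma killing_skew:
  assumes k: "killing_field A g \<xi>" and X: "X \<in> smooth_vfields A" and Y: "Y \<in> smooth_vfields A"
  shows "g p (LC X \<xi> p) (Y p) = - g p (X p) (LC Y \<xi> p)"
proof -
  interpret LC: metric_connection A g LC by (rule levi_civita_connection)
  note \<xi> = killing_vf[OF k]
  show ?thesis using killing_deriv[OF k X Y, of p] LC.ip_deriv[OF \<xi> X Y, of p] X Y \<xi>
    by (simp add: lie_bracket_LC)
qed

text \<open>Differentiate the constant product along any \<open>w\<close> and apply the skewness of
  the two covariant derivatives: this gives \<open>LC \<xi> \<zeta> = - LC \<zeta> \<xi>\<close>,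
  and the difference of the two sides is the bracket.\<close>

lemma killing_orthonormal_LC:
  assumes k: "killing_field A g \<xi>" "killing_field A g \<zeta>" and c: "\<And>p. g p (\<xi> p) (\<zeta> p) = c"
  shows "LC \<xi> \<zeta> p = (1/2) *\<^sub>R lie_bracket \<xi> \<zeta> p"
proof -
  interpret LC: metric_connection A g LC by (rule levi_civita_connection)
  note vf = killing_vf[OF k(1)] killing_vf[OF k(2)]
  have "LC \<xi> \<zeta> p = - LC \<zeta> \<xi> p"
  proof (rule tangent_eqI_g)
    fix w assume w: "w \<in> tangent A p"
    let ?W = "extend_vec A p w"
    have "?W p (ip \<xi> \<zeta>) = 0" using c tangent_const[OF w, of c] w by simp
    then have "g p (LC ?W \<xi> p) (\<zeta> p) + g p (\<xi> p) (LC ?W \<zeta> p) = 0"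
      using LC.ip_deriv[OF extend_vec_vf[OF w] vf, of p] by simp
    then show "g p (LC \<xi> \<zeta> p) w = g p (- LC \<zeta> \<xi> p) w"
      using killing_skew[OF k(1) extend_vec_vf[OF w] vf(2), of p] killing_skew[OF k(2) vf(1) extend_vec_vf[OF w], of p] vf w
        g_sym[of w p "LC \<zeta> \<xi> p"] by simp
  qed (use vf in auto)
  then have "lie_bracket \<xi> \<zeta> p = 2 *\<^sub>R LC \<xi> \<zeta> p"
    using lie_bracket_LC[OF vf, of p] by (simp add: scaleR_2)
  then show ?thesis by simp
qed

end

text \<open>\<open>ix a\<close> is the frame index of the Reeb field \<open>\<xi> a\<close>. The
  equivalence in the second part of \<open>ix\<close> expresses that each of the first three
  distributions is a line.\<close>

locale sasaki_chart = adapted_chart A g U \<phi> N x C \<Omega> T D E W lab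
  for A :: "('a::{t2_space, second_countable_topology}, 'n::finite) atlas" and g U \<phi> N x C \<Omega> T D E W lab +
  fixes \<xi> :: "nat \<Rightarrow> 'a vfield" and ix :: "nat \<Rightarrow> 'n"
  assumes sas: "three_sasaki A g \<xi>" and no_mixed: "no_mixed_contorsion g D T"
    and ix: "\<And>a. a \<in> {1..3} \<Longrightarrow> E (ix a) = \<xi> a" "\<And>a i. a \<in> {1..3} \<Longrightarrow> lab i = a \<longleftrightarrow> i = ix a"
    and dim: "CARD('n) > 4"
begin

sublocale LC: metric_connection A g LC
  by (rule levi_civita_connection)

abbreviation H where "H \<equiv> {i. lab i = 4}"

lemma lab_ix: "a \<in> {1..3} \<Longrightarrow> lab (ix a) = a"
  using ix(2) by blast

lemma E_ix [simp]: "E (ix (Suc 0)) = \<xi> (Suc 0)" "E (ix 2) = \<xi> 2" "E (ix 3) = \<xi> 3"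
  by (rule ix(1), simp)+

lemma lab_ix' [simp]: "lab (ix (Suc 0)) = Suc 0" "lab (ix 2) = 2" "lab (ix 3) = 3"
  by (rule lab_ix, simp)+

lemma ix_inj: "a \<in> {1..3} \<Longrightarrow> b \<in> {1..3} \<Longrightarrow> ix a = ix b \<longleftrightarrow> a = b"
  using lab_ix by metis

lemma ix_H: "a \<in> {1..3} \<Longrightarrow> ix a \<notin> H"
  using lab_ix by force

lemma killing: "a \<in> {1..3} \<Longrightarrow> killing_field A g (\<xi> a)"
  using sas unfolding three_sasaki_def sasakian_field_def by blast

lemma \<xi>_vf: "a \<in> {1..3} \<Longrightarrow> \<xi> a \<in> smooth_vfields A"
  by (rule killing_vf[OF killing])

lemma \<xi>_on: "a \<in> {1..3} \<Longrightarrow> b \<in> {1..3} \<Longrightarrow> g p (\<xi> a p) (\<xi> b p) = (if a = b then 1 else 0)"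
  using sas unfolding three_sasaki_def by blast

lemma lab_cases: obtains a where "a \<in> {1..3}" "i = ix a" | "i \<in> H"
proof -
  have "lab i = 4 \<or> lab i \<in> {1..3}" using lab[of i] by auto
  then show ?thesis using that ix(2)[of "lab i" i] by auto
qed

lemma UNIV_split: "UNIV = insert (ix 1) (insert (ix 2) (insert (ix 3) H))"
proof -
  have "i \<in> insert (ix 1) (insert (ix 2) (insert (ix 3) H))" for i
    by (rule lab_cases[of i]) (auto simp: atLeastAtMost_iff le_Suc_eq numeral_3_eq_3 numeral_2_eq_2)
  then show ?thesis by blast
qed

lemma sum_split: "(\<Sum>i\<in>UNIV. f i) = f (ix 1) + f (ix 2) + f (ix 3) + (\<Sum>i\<in>H. f i)" for f :: "'n \<Rightarrow> real"
proof -
  have "ix 1 \<notin> H" "ix 2 \<notin> H" "ix 3 \<notin> H" "ix 1 \<noteq> ix 2" "ix 1 \<noteq> ix 3" "ix 2 \<noteq> ix 3" using ix_H ix_inj by auto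
  then show ?thesis by (subst UNIV_split) (simp add: add.assoc)
qed

lemma H_other: "\<exists>k\<in>H. k \<noteq> m"
proof (rule ccontr)
  assume "\<not> ?thesis"
  then have "H \<subseteq> {m}" by blast
  then have "UNIV \<subseteq> {ix 1, ix 2, ix 3, m}" using UNIV_split by blast
  then have "CARD('n) \<le> card {ix 1, ix 2, ix 3, m}" by (intro card_mono) auto
  also have "\<dots> \<le> 4" by (simp add: card_insert_if)
  finally show False using dim by simp
qed

lemma three_distinct:
  assumes "a \<in> {1..3::nat}" obtains b c where "b \<in> {1..3}" "c \<in> {1..3}" "a \<noteq> b" "a \<noteq> c" "b \<noteq> c"
proof -
  have "a = 1 \<or> a = 2 \<or> a = 3" using assms by auto
  then show ?thesis using that[of 2 3] that[of 1 3] that[of 1 2] by auto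
qed

lemma sum_split3:
  fixes f :: "'n \<Rightarrow> real"
  assumes "a \<in> {1..3}" "b \<in> {1..3}" "c \<in> {1..3}" "a \<noteq> b" "a \<noteq> c" "b \<noteq> c"
  shows "(\<Sum>i\<in>UNIV. f i) = f (ix a) + f (ix b) + f (ix c) + (\<Sum>i\<in>H. f i)"
proof -
  have "f (ix a) + f (ix b) + f (ix c) = f (ix 1) + f (ix 2) + f (ix 3)"
    using assms by (auto simp: atLeastAtMost_iff le_Suc_eq numeral_3_eq_3 numeral_2_eq_2)
  then show ?thesis unfolding sum_split by simp
qed

text \<open>\<open>e\<close> is the sign of the orientation of the triple \<open>a, b, c\<close>;
  all ordered pairs of distinct Reeb fields are treated at once.\<close>

lemma brackets:
  assumes "a \<in> {1..3}" "b \<in> {1..3}" "a \<noteq> b"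
  obtains c e where "c \<in> {1..3}" "c \<noteq> a" "c \<noteq> b" "e * e = (1::real)"
    "\<And>p. lie_bracket (\<xi> a) (\<xi> b) p = (2 * e) *\<^sub>R \<xi> c p" "\<And>p. lie_bracket (\<xi> c) (\<xi> a) p = (2 * e) *\<^sub>R \<xi> b p"
proof -
  have s: "(2 *\<^sub>R X) p = (2::real) *\<^sub>R X p" for X :: "'a vfield" and p by (simp only: scaleR_fun_def[of 2 X])
  have b: "lie_bracket (\<xi> 1) (\<xi> 2) p = 2 *\<^sub>R \<xi> 3 p" "lie_bracket (\<xi> 2) (\<xi> 3) p = 2 *\<^sub>R \<xi> 1 p" "lie_bracket (\<xi> 3) (\<xi> 1) p = 2 *\<^sub>R \<xi> 2 p" for p
    using sas s unfolding three_sasaki_def by metis+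
  have n: "lie_bracket (\<xi> 2) (\<xi> 1) p = (2 * -1) *\<^sub>R \<xi> 3 p" "lie_bracket (\<xi> 3) (\<xi> 2) p = (2 * -1) *\<^sub>R \<xi> 1 p" "lie_bracket (\<xi> 1) (\<xi> 3) p = (2 * -1) *\<^sub>R \<xi> 2 p" for p
    using b[of p] lie_bracket_antisym[of "\<xi> 2" "\<xi> 1" p] lie_bracket_antisym[of "\<xi> 3" "\<xi> 2" p] lie_bracket_antisym[of "\<xi> 1" "\<xi> 3" p] by simp_all
  have "a = 1 \<or> a = 2 \<or> a = 3" "b = 1 \<or> b = 2 \<or> b = 3" using assms by auto
  then show ?thesis
    using assms(3) that[of 3 1] that[of 2 1] that[of 1 1] that[of 3 "-1"] that[of 2 "-1"] that[of 1 "-1"] b n by auto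
qed

section \<open>Brackets of Reeb fields with the frame\<close>

lemma lie_bracket_self: "lie_bracket X X p = 0"
  by (rule ext) (simp add: lie_bracket_apply)

lemma bracket_unit: assumes q: "q \<in> W" and a: "a \<in> {1..3}" shows "g q (E k q) (lie_bracket (\<xi> a) (E k) q) = 0"
proof -
  have "\<xi> a q (ip (E k) (E k)) = \<xi> a q (\<lambda>q. 1)"
    by (rule vf_apply_local[OF \<xi>_vf[OF a] _ _ W(1) q]) (use on_g in auto)
  then show ?thesis
    using killing_deriv[OF killing[OF a] E E, of q k k] tangent_const[OF vf_tangent[OF \<xi>_vf[OF a]]] \<xi>_vf[OF a]
      g_sym[of "E k q" q "lie_bracket (\<xi> a) (E k) q"] by simp
qed

text \<open>The flow of a Killing field preserves \<open>g\<close>, so the bracket with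
  \<open>\<xi> a\<close> acts by a skew matrix in an orthonormal frame.\<close>

lemma bracket_skew: assumes q: "q \<in> W" and a: "a \<in> {1..3}"
  shows "g q (E k q) (lie_bracket (\<xi> a) (E l) q) = - g q (E l q) (lie_bracket (\<xi> a) (E k) q)"
proof -
  have "\<xi> a q (ip (E k) (E l)) = \<xi> a q (\<lambda>q. if k = l then 1 else 0)"
    by (rule vf_apply_local[OF \<xi>_vf[OF a] _ _ W(1) q]) (use on_g in auto)
  then show ?thesis
    using killing_deriv[OF killing[OF a] E E, of q k l] tangent_const[OF vf_tangent[OF \<xi>_vf[OF a]]] \<xi>_vf[OF a]
      g_sym[of "E l q" q "lie_bracket (\<xi> a) (E k) q"] by simp
qed

text \<open>Brackets of Reeb fields are vertical; by skewness the bracket of a Reeb field with a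
  horizontal field has no vertical component.\<close>

lemma bracket_vertical: assumes q: "q \<in> W" and a: "a \<in> {1..3}" and b: "b \<in> {1..3}" and k: "k \<in> H"
  shows "g q (\<xi> b q) (lie_bracket (\<xi> a) (E k) q) = 0"
proof -
  have "g q (E k q) (lie_bracket (\<xi> a) (\<xi> b) q) = 0"
  proof (cases "a = b")
    case True
    then show ?thesis by (simp add: lie_bracket_self)
  next
    case False
    then obtain c e where c: "c \<in> {1..3}" "lie_bracket (\<xi> a) (\<xi> b) q = (2 * e) *\<^sub>R \<xi> c q"
      using brackets[OF a b False] by metis
    then show ?thesis using on_g[OF q, of k "ix c"] ix ix_H[OF c(1)] k \<xi>_vf[OF c(1)] by auto
  qed
  then show ?thesis using bracket_skew[OF q a, of "ix b" k] ix(1)[OF b] by simp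
qed

section \<open>Vanishing of the mean curvatures\<close>

lemma mcurv_H: "k \<in> H \<Longrightarrow> mcurv k m q = g q (E m q) (nb (\<xi> 1) (\<xi> 1) q) + g q (E m q) (nb (\<xi> 2) (\<xi> 2) q) + g q (E m q) (nb (\<xi> 3) (\<xi> 3) q)"
proof -
  assume k: "k \<in> H"
  let ?f = "\<lambda>j. if lab k \<noteq> lab j then g q (E m q) (nb (E j) (E j) q) else 0"
  have "(\<Sum>j\<in>H. ?f j) = 0" using k by (intro sum.neutral) auto
  then show ?thesis unfolding mcurv_def sum_split using k by simp
qed

lemma mcurv_ix:
  assumes "a \<in> {1..3}"
  shows "mcurv (ix a) m q = (\<Sum>j\<in>UNIV. g q (E m q) (nb (E j) (E j) q)) - g q (E m q) (nb (\<xi> a) (\<xi> a) q)"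
proof -
  let ?f = "\<lambda>j. g q (E m q) (nb (E j) (E j) q)"
  have "(\<Sum>j\<in>UNIV. ?f j) = (\<Sum>j\<in>UNIV. if lab (ix a) \<noteq> lab j then ?f j else 0) + (\<Sum>j\<in>UNIV. if j = ix a then ?f j else 0)"
    unfolding sum.distrib[symmetric]
  proof (rule sum.cong[OF refl])
    fix j show "?f j = (if lab (ix a) \<noteq> lab j then ?f j else 0) + (if j = ix a then ?f j else 0)"
      using ix(2)[OF assms, of j] lab_ix[OF assms] by (cases "j = ix a") simp_all
  qed
  also have "(\<Sum>j\<in>UNIV. if j = ix a then ?f j else 0) = ?f (ix a)" by (subst sum.delta) auto
  finally show ?thesis unfolding mcurv_def ix(1)[OF assms] by (simp only: add_diff_cancel_right')
qed

text \<open>In \<open>euler_lagrange_A\<close> with \<open>E m\<close> equal to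
  \<open>\<xi> a\<close>, the derivative of \<open>s\<close> integrates to 0 because Killing fields
  are divergence free, and the bracket term vanishes by \<open>bracket_unit\<close>.\<close>

lemma mcurv_vertical:
  assumes a: "a \<in> {1..3}" and k: "k \<noteq> ix a" and q: "q \<in> \<Omega>" shows "mcurv k (ix a) q = 0"
proof (rule fundamental_lemma[OF mcurv_smooth _ q])
  fix s assume s: "s \<in> smooth_funs A" "closure {q. s q \<noteq> 0} \<subseteq> \<Omega>"
  have lk: "lab k \<noteq> lab (ix a)" using k ix(2)[OF a, of k] lab_ix[OF a] by metis
  have "set_lebesgue_integral vol \<Omega> (\<lambda>q. (if lab k \<noteq> lab (ix a) then E (ix a) q s + s q * g q (E k q) (lie_bracket (E k) (E (ix a)) q) else 0)
    - s q * mcurv k (ix a) q) = set_lebesgue_integral vol \<Omega> (\<lambda>q. \<xi> a q s - s q * mcurv k (ix a) q)"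
  proof (rule set_lebesgue_integral_cong[OF _ allI[OF impI]])
    show "\<Omega> \<in> sets vol" using \<Omega>_sub(3) by simp
    fix q assume "q \<in> \<Omega>"
    then have "g q (E k q) (lie_bracket (E k) (\<xi> a) q) = 0"
      using bracket_unit[OF \<Omega>W a, of q k] lie_bracket_antisym[of "E k" "\<xi> a" q] \<xi>_vf[OF a] by simp
    then show "(if lab k \<noteq> lab (ix a) then E (ix a) q s + s q * g q (E k q) (lie_bracket (E k) (E (ix a)) q) else 0)
      - s q * mcurv k (ix a) q = \<xi> a q s - s q * mcurv k (ix a) q" using lk by (simp add: ix(1)[OF a])
  qed
  also have "\<dots> = set_lebesgue_integral vol \<Omega> (\<lambda>q. \<xi> a q s) - set_lebesgue_integral vol \<Omega> (\<lambda>q. s q * mcurv k (ix a) q)"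
    using s(1) mcurv_smooth[of k "ix a"] vf_apply[OF \<xi>_vf[OF a] s(1)] by (intro set_integral_diff smooth_set_integrable) auto
  finally show "set_lebesgue_integral vol \<Omega> (\<lambda>q. s q * mcurv k (ix a) q) = 0"
    using euler_lagrange_A[OF s k] killing_divergence_free[OF killing[OF a] s] by simp
qed

text \<open>For horizontal \<open>k\<close> the equation contains no derivative of \<open>s\<close>;
  since \<open>mcurv k m\<close> is the same for all horizontal \<open>k\<close>, a single
  \<open>k0 \<noteq> m\<close> suffices. For Reeb indices the bracket term is 0, and the derivative
  term is the same for all of them, so it cancels in differences.\<close>

lemma mcurv_horizontal:
  assumes m: "m \<in> H" and q: "q \<in> \<Omega>"
  shows "k \<in> H \<Longrightarrow> mcurv k m q = 0" and "a \<in> {1..3} \<Longrightarrow> b \<in> {1..3} \<Longrightarrow> mcurv (ix a) m q = mcurv (ix b) m q"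
proof -
  obtain k0 where k0: "k0 \<in> H" "k0 \<noteq> m" using H_other by blast
  have "mcurv k0 m q = 0"
  proof (rule fundamental_lemma[OF mcurv_smooth _ q])
    fix s assume s: "s \<in> smooth_funs A" "closure {q. s q \<noteq> 0} \<subseteq> \<Omega>"
    have "set_lebesgue_integral vol \<Omega> (\<lambda>q. - (s q * mcurv k0 m q)) = 0"
      using euler_lagrange_A[OF s k0(2)] k0(1) m by simp
    then show "set_lebesgue_integral vol \<Omega> (\<lambda>q. s q * mcurv k0 m q) = 0"
      by (simp add: set_integral_uminus[OF smooth_set_integrable] s mcurv_smooth)
  qed
  then show "mcurv k m q = 0" if "k \<in> H" using mcurv_H[OF k0(1)] mcurv_H[OF that] by simp
  assume ab: "a \<in> {1..3}" "b \<in> {1..3}"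
  have "mcurv (ix a) m q - mcurv (ix b) m q = 0"
  proof (rule fundamental_lemma[OF _ _ q])
    show "(\<lambda>q. mcurv (ix a) m q - mcurv (ix b) m q) \<in> smooth_funs A" using mcurv_smooth by auto
    fix s assume s: "s \<in> smooth_funs A" "closure {q. s q \<noteq> 0} \<subseteq> \<Omega>"
    have ms: "set_integrable vol \<Omega> (\<lambda>q. E m q s)" "set_integrable vol \<Omega> (\<lambda>q. s q * mcurv i m q)" for i
      using s mcurv_smooth[of i m] vf_apply[OF E s(1)] by (auto intro: smooth_set_integrable)
    have e: "set_lebesgue_integral vol \<Omega> (\<lambda>q. E m q s) = set_lebesgue_integral vol \<Omega> (\<lambda>q. s q * mcurv (ix a) m q)"
      if a: "a \<in> {1..3}" for a
    proof -
      have ne: "ix a \<noteq> m" "lab (ix a) \<noteq> lab m" using m ix_H[OF a] by auto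
      have "set_lebesgue_integral vol \<Omega> (\<lambda>q. (if lab (ix a) \<noteq> lab m then E m q s + s q * g q (E (ix a) q) (lie_bracket (E (ix a)) (E m) q) else 0)
          - s q * mcurv (ix a) m q) = set_lebesgue_integral vol \<Omega> (\<lambda>q. E m q s - s q * mcurv (ix a) m q)"
        using ne bracket_vertical[OF \<Omega>W a a m] \<Omega>_sub(3) by (intro set_lebesgue_integral_cong) (auto simp: ix(1)[OF a])
      then show ?thesis using euler_lagrange_A[OF s ne(1)] set_integral_diff(2)[OF ms(1) ms(2)[of "ix a"]] by simp
    qed
    have "set_lebesgue_integral vol \<Omega> (\<lambda>q. s q * mcurv (ix a) m q - s q * mcurv (ix b) m q) = 0"
      using e[OF ab(1)] e[OF ab(2)] set_integral_diff(2)[OF ms(2) ms(2), of "ix a" "ix b"] by simp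
    then show "set_lebesgue_integral vol \<Omega> (\<lambda>q. s q * (mcurv (ix a) m q - mcurv (ix b) m q)) = 0"
      by (simp add: right_diff_distrib)
  qed
  then show "mcurv (ix a) m q = mcurv (ix b) m q" by simp
qed

text \<open>A linear system for \<open>?v j\<close>, the component along \<open>\<xi> a\<close> of
  \<open>nb (E j) (E j)\<close>: the entry at \<open>ix a\<close> is 0 by metric compatibility, the
  three vertical entries add up to 0, and the total over all indices equals each of the other two
  vertical entries.\<close>

lemma mean_vertical:
  assumes a: "a \<in> {1..3}" and q: "q \<in> \<Omega>"
  shows "b \<in> {1..3} \<Longrightarrow> g q (\<xi> a q) (nb (\<xi> b) (\<xi> b) q) = 0"
    and "(\<Sum>k\<in>H. g q (\<xi> a q) (nb (E k) (E k) q)) = 0"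
proof -
  let ?v = "\<lambda>j. g q (\<xi> a q) (nb (E j) (E j) q)"
  have 0: "?v (ix a) = 0" using nb_unit(2)[OF \<Omega>W[OF q] \<xi>_vf[OF a], of "ix a"] by (simp add: ix(1)[OF a])
  have tot: "(\<Sum>j\<in>UNIV. ?v j) = ?v (ix b)" if b: "b \<in> {1..3}" "b \<noteq> a" for b
    using mcurv_vertical[OF a _ q, of "ix b"] mcurv_ix[OF b(1), of "ix a" q] ix_inj[OF a b(1)] b by (simp add: ix(1)[OF a] ix(1)[OF b(1)])
  obtain d c where bc: "d \<in> {1..3}" "c \<in> {1..3}" "a \<noteq> d" "a \<noteq> c" "d \<noteq> c" using a by (rule three_distinct)
  obtain k where k: "k \<in> H" using H_other by blast
  have "mcurv k (ix a) q = 0" by (rule mcurv_vertical[OF a _ q]) (use k ix_H[OF a] in blast)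
  then have "?v (ix 1) + ?v (ix 2) + ?v (ix 3) = 0" using mcurv_H[OF k, of "ix a" q] by (simp add: ix(1)[OF a])
  then have "(\<Sum>j\<in>UNIV. ?v j) = (\<Sum>j\<in>H. ?v j)" unfolding sum_split by simp
  moreover have "(\<Sum>j\<in>UNIV. ?v j) = ?v (ix a) + ?v (ix d) + ?v (ix c) + (\<Sum>j\<in>H. ?v j)"
    by (rule sum_split3) (use a bc in auto)
  \<comment> \<open>The entries at \<open>ix d\<close> and \<open>ix c\<close> both equal the total,
    and they add up to 0.\<close>
  ultimately have z: "(\<Sum>j\<in>UNIV. ?v j) = 0" "(\<Sum>j\<in>H. ?v j) = 0" using 0 tot[of d] tot[of c] bc by auto
  show "(\<Sum>k\<in>H. g q (\<xi> a q) (nb (E k) (E k) q)) = 0" by (rule z(2))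
  show "g q (\<xi> a q) (nb (\<xi> b) (\<xi> b) q) = 0" if "b \<in> {1..3}" using z(1) tot[OF that] 0 that by (cases "b = a") (simp_all add: ix(1)[OF that] ix(1)[OF a])
qed

text \<open>The three vertical terms are equal, because each is the total minus the same mean
  curvature, and their sum is 0.\<close>

lemma mean_horizontal:
  assumes m: "m \<in> H" and q: "q \<in> \<Omega>" and a: "a \<in> {1..3}"
  shows "g q (E m q) (nb (\<xi> a) (\<xi> a) q) = 0"
proof -
  have s: "g q (E m q) (nb (\<xi> 1) (\<xi> 1) q) + g q (E m q) (nb (\<xi> 2) (\<xi> 2) q) + g q (E m q) (nb (\<xi> 3) (\<xi> 3) q) = 0"
    using mcurv_horizontal(1)[OF m q m] mcurv_H[OF m, of m q] by simp
  have "g q (E m q) (nb (\<xi> a) (\<xi> a) q) = g q (E m q) (nb (\<xi> b) (\<xi> b) q)" if "b \<in> {1..3}" for b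
    using mcurv_horizontal(2)[OF m q a that] mcurv_ix[OF a, of m q] mcurv_ix[OF that, of m q] by simp
  from this[of 1] this[of 2] this[of 3] s show ?thesis by simp
qed

lemma frame_eqI:
  assumes "q \<in> W" "u \<in> tangent A q" "v \<in> tangent A q" "\<And>b. b \<in> {1..3} \<Longrightarrow> g q (\<xi> b q) u = g q (\<xi> b q) v"
    and "\<And>k. k \<in> H \<Longrightarrow> g q (E k q) u = g q (E k q) v"
  shows "u = v"
proof -
  have "g q (E i q) u = g q (E i q) v" for i
    by (rule lab_cases[of i]) (use assms(4,5) ix(1) in auto)
  then have "g q u (E i q) = g q v (E i q)" for i using assms g_sym by auto
  then show ?thesis using ON_expand[OF on[OF assms(1)] assms(2)] ON_expand[OF on[OF assms(1)] assms(3)] by simp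
qed

lemma nb_self: "q \<in> \<Omega> \<Longrightarrow> a \<in> {1..3} \<Longrightarrow> nb (\<xi> a) (\<xi> a) q = 0"
  by (rule frame_eqI) (use \<Omega>W mean_vertical(1) mean_horizontal \<xi>_vf in auto)

section \<open>The critical connection along the Reeb fields\<close>

lemma no_mixed_frame:
  assumes q: "q \<in> W" and ijk: "lab i \<noteq> lab j" "lab j \<noteq> lab k" "lab i \<noteq> lab k"
  shows "g q (T q (E i q) (E j q)) (E k q) = 0"
proof -
  have "E i q \<in> D (lab i) q" for i using D[OF lab q, of i] by (auto intro: span_base)
  then show ?thesis using no_mixed lab ijk unfolding no_mixed_contorsion_def by blast
qed

lemma T_tan [simp]: "u \<in> tangent A q \<Longrightarrow> v \<in> tangent A q \<Longrightarrow> T q u v \<in> tangent A q"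
  by (rule tensor12_tangent[OF T_tensor])

text \<open>Here the hypothesis on the mixed components of \<open>T\<close> enters: the three
  arguments lie in pairwise different distributions, so \<open>T\<close> does not
  contribute.\<close>

lemma nb_vertical_component:
  assumes q: "q \<in> W" and a: "a \<in> {1..3}" and b: "b \<in> {1..3}" "a \<noteq> b" and k: "k \<noteq> ix a" "k \<noteq> ix b"
  shows "g q (nb (\<xi> a) (\<xi> b) q) (E k q) = g q (LC (\<xi> a) (\<xi> b) q) (E k q)"
proof -
  have "lab k \<noteq> a" "lab k \<noteq> b" using k ix(2) a b by auto
  then have "g q (T q (\<xi> a q) (\<xi> b q)) (E k q) = 0"
    using no_mixed_frame[OF q, of "ix a" "ix b" k] a b lab_ix by (simp add: ix(1))
  then show ?thesis using \<xi>_vf[OF a] \<xi>_vf[OF b(1)] by (simp add: contorted_connection_def)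
qed

lemma LC_\<xi>: "a \<in> {1..3} \<Longrightarrow> b \<in> {1..3} \<Longrightarrow> LC (\<xi> a) (\<xi> b) p = (1/2) *\<^sub>R lie_bracket (\<xi> a) (\<xi> b) p"
  by (rule killing_orthonormal_LC[OF killing killing \<xi>_on])

text \<open>The component along \<open>\<xi> a\<close> vanishes by skewness and
  \<open>nb_self\<close>, the one along \<open>\<xi> b\<close> by unit length; all others agree with
  those of the Levi-Civita connection, where two Killing fields with constant product give half the
  bracket.\<close>

lemma nb_\<xi>:
  assumes q: "q \<in> \<Omega>" and a: "a \<in> {1..3}" and b: "b \<in> {1..3}"
  shows "nb (\<xi> a) (\<xi> b) q = (1/2) *\<^sub>R lie_bracket (\<xi> a) (\<xi> b) q"
proof (cases "a = b")
  case True
  then show ?thesis using nb_self[OF q a] by (simp add: lie_bracket_self)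
next
  case False
  note [simp] = \<xi>_vf[OF a] \<xi>_vf[OF b]
  obtain c e where ce: "c \<in> {1..3}" "c \<noteq> a" "c \<noteq> b" "lie_bracket (\<xi> a) (\<xi> b) q = (2 * e) *\<^sub>R \<xi> c q"
    by (rule brackets[OF a b False]) blast
  have "g q (E k q) (nb (\<xi> a) (\<xi> b) q) = g q (E k q) (LC (\<xi> a) (\<xi> b) q)" for k
  proof -
    consider "k = ix a" | "k = ix b" | "k \<noteq> ix a" "k \<noteq> ix b" by blast
    then show ?thesis
    proof cases
      case 1
      have "g q (nb (\<xi> a) (\<xi> b) q) (\<xi> a q) = 0"
        using nb_skew[OF \<Omega>W[OF q] \<xi>_vf[OF a], of "ix b" "ix a"] nb_self[OF q a] by (simp add: ix(1)[OF a] ix(1)[OF b])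
      then show ?thesis using 1 a b False ce g_sym[of "\<xi> a q" q "nb (\<xi> a) (\<xi> b) q"] \<xi>_vf[OF ce(1)]
        by (simp add: ix(1)[OF a] ix(1)[OF b] LC_\<xi>[OF a b] \<xi>_on[OF a ce(1)] \<xi>_on[OF b ce(1)])
    next
      case 2
      then show ?thesis using nb_unit(2)[OF \<Omega>W[OF q] \<xi>_vf[OF a], of "ix b"] a b ce \<xi>_vf[OF ce(1)]
        by (simp add: ix(1)[OF a] ix(1)[OF b] LC_\<xi>[OF a b] \<xi>_on[OF a ce(1)] \<xi>_on[OF b ce(1)])
    next
      case 3
      then show ?thesis using nb_vertical_component[OF \<Omega>W[OF q] a b False 3]
          g_sym[of "E k q" q "nb (\<xi> a) (\<xi> b) q"] g_sym[of "E k q" q "LC (\<xi> a) (\<xi> b) q"] \<xi>_vf[OF ce(1)] by simp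
    qed
  qed
  then have "nb (\<xi> a) (\<xi> b) q = LC (\<xi> a) (\<xi> b) q"
    by (intro frame_eqI[OF \<Omega>W[OF q]]) (simp_all add: ix(1)[symmetric])
  then show ?thesis using LC_\<xi>[OF a b] by simp
qed

text \<open>Vertical components: metric compatibility moves the derivative onto
  \<open>\<xi> b\<close>, where it is half a bracket of Reeb fields and so vertical. Horizontal
  components: \<open>euler_lagrange_B\<close> off the diagonal, unit length on it.\<close>

lemma nb_\<xi>_horizontal:
  assumes q: "q \<in> \<Omega>" and a: "a \<in> {1..3}" and k: "k \<in> H"
  shows "nb (\<xi> a) (E k) q = lie_bracket (\<xi> a) (E k) q"
proof (rule frame_eqI[OF \<Omega>W[OF q]])
  note [simp] = \<xi>_vf[OF a]
  show "nb (\<xi> a) (E k) q \<in> tangent A q" "lie_bracket (\<xi> a) (E k) q \<in> tangent A q" by auto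
  show "g q (\<xi> b q) (nb (\<xi> a) (E k) q) = g q (\<xi> b q) (lie_bracket (\<xi> a) (E k) q)" if b: "b \<in> {1..3}" for b
  proof -
    have "g q (E k q) (nb (\<xi> a) (\<xi> b) q) = 0"
      using bracket_skew[OF \<Omega>W[OF q] a, of k "ix b"] bracket_vertical[OF \<Omega>W[OF q] a b k] nb_\<xi>[OF q a b] \<xi>_vf[OF b]
      by (simp add: ix(1)[OF b])
    then show ?thesis using bracket_vertical[OF \<Omega>W[OF q] a b k] nb_skew[OF \<Omega>W[OF q] \<xi>_vf[OF a], of k "ix b"]
        g_sym[of "\<xi> b q" q "nb (\<xi> a) (E k) q"] g_sym[of "E k q" q "nb (\<xi> a) (\<xi> b) q"] \<xi>_vf[OF b] by (simp add: ix(1)[OF b])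
  qed
  show "g q (E m q) (nb (\<xi> a) (E k) q) = g q (E m q) (lie_bracket (\<xi> a) (E k) q)" if m: "m \<in> H" for m
  proof (cases "k = m")
    case True
    then show ?thesis using nb_unit(2)[OF \<Omega>W[OF q] \<xi>_vf[OF a], of k] bracket_unit[OF \<Omega>W[OF q] a, of k] by simp
  next
    case False
    have "lab (ix a) \<noteq> lab k" "lab m = lab k" using m k lab_ix[OF a] a by auto
    from euler_lagrange_B[OF False this q] show ?thesis
      using bracket_skew[OF \<Omega>W[OF q] a, of m k] g_sym[of "E m q" q "nb (\<xi> a) (E k) q"] by (simp add: ix(1)[OF a])
  qed
qed

section \<open>Mixed sectional curvatures of the critical connection\<close>

lemma secf_formula:
  "secf T i j p = E j p (ip (nb (E i) (E i)) (E j)) - ip (nb (E i) (E i)) (nb (E j) (E j)) p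
    - E i p (ip (nb (E j) (E i)) (E j)) + ip (nb (E j) (E i)) (nb (E i) (E j)) p + ip (nb (lie_bracket (E i) (E j)) (E i)) (E j) p"
  unfolding secf_def by (rule NB.sec_formula[OF E E])

lemma secf_sym: "secf T i j p = secf T j i p"
  unfolding secf_def by (rule NB.sec_sym[OF E E])

lemma deriv_zero:
  assumes "X \<in> smooth_vfields A" "f \<in> smooth_funs A" "q \<in> \<Omega>" "\<And>r. r \<in> \<Omega> \<Longrightarrow> f r = 0"
  shows "X q f = 0"
proof -
  have "X q f = X q (\<lambda>r. 0)" by (rule vf_apply_local[OF assms(1,2) smooth_funs_const \<Omega>(1) assms(3,4)])
  then show ?thesis using tangent_const[OF vf_tangent[OF assms(1)], of q 0] by simp
qed

text \<open>With \<open>nb (\<xi> a) (\<xi> b) = e \<xi> c\<close> the product term gives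
  \<open>- e * e\<close> and the bracket term \<open>2 * e * e\<close>; the differentiated scalar
  products are 0 on all of \<open>\<Omega>\<close>.\<close>

lemma secf_vertical:
  assumes q: "q \<in> \<Omega>" and a: "a \<in> {1..3}" and b: "b \<in> {1..3}" "a \<noteq> b"
  shows "secf T (ix a) (ix b) q = 1"
proof -
  obtain c e where ce: "c \<in> {1..3}" "c \<noteq> a" "c \<noteq> b" "e * e = 1"
    "\<And>p. lie_bracket (\<xi> a) (\<xi> b) p = (2 * e) *\<^sub>R \<xi> c p" "\<And>p. lie_bracket (\<xi> c) (\<xi> a) p = (2 * e) *\<^sub>R \<xi> b p"
    by (rule brackets[OF a b]) blast
  note [simp] = \<xi>_vf[OF a] \<xi>_vf[OF b(1)] \<xi>_vf[OF ce(1)]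
  have ba: "lie_bracket (\<xi> b) (\<xi> a) p = - ((2 * e) *\<^sub>R \<xi> c p)" for p
    using lie_bracket_antisym[of "\<xi> b" "\<xi> a" p] ce(5) by simp
  have d1: "\<xi> b q (ip (nb (\<xi> a) (\<xi> a)) (\<xi> b)) = 0" by (rule deriv_zero[OF \<xi>_vf[OF b(1)] _ q]) (use q in \<open>auto simp: nb_self[OF _ a]\<close>)
  have d2: "\<xi> a q (ip (nb (\<xi> b) (\<xi> a)) (\<xi> b)) = 0"
    by (rule deriv_zero[OF \<xi>_vf[OF a] _ q]) (use q ce(3) in \<open>auto simp: nb_\<xi>[OF _ b(1) a] ba \<xi>_on[OF ce(1) b(1)]\<close>)
  have "lie_bracket (\<xi> a) (\<xi> b) = (\<lambda>p. (2 * e) *\<^sub>R \<xi> c p)" using ce(5) by auto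
  then have "nb (lie_bracket (\<xi> a) (\<xi> b)) (\<xi> a) q = (2 * e) *\<^sub>R nb (\<xi> c) (\<xi> a) q"
    using NB.nab_scale_left[OF \<xi>_vf[OF ce(1)] \<xi>_vf[OF a] smooth_funs_const, of "2 * e"] by simp
  then show ?thesis
    unfolding secf_formula ix(1)[OF a] ix(1)[OF b(1)] using d1 d2 nb_self[OF q a] ce(4)
    by (simp add: nb_\<xi>[OF q a b(1)] nb_\<xi>[OF q b(1) a] nb_\<xi>[OF q ce(1) a] ce(5,6) ba \<xi>_on[OF ce(1) ce(1)] \<xi>_on[OF b(1) b(1)])
qed

text \<open>The product term and the bracket term pair the skew matrix of the bracket with
  \<open>\<xi> a\<close> with the matrix of \<open>nb (E k) (\<xi> a)\<close> and with its
  transpose, so they cancel in the sum. What remains is the derivative along \<open>\<xi> a\<close>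
  of the trace that vanishes by \<open>mean_vertical\<close>.\<close>

lemma secf_horizontal:
  assumes q: "q \<in> \<Omega>" and a: "a \<in> {1..3}"
  shows "(\<Sum>k\<in>H. secf T (ix a) k q) = 0"
proof -
  note [simp] = \<xi>_vf[OF a]
  note W = \<Omega>W[OF q]
  define c where "c k l = g q (E l q) (lie_bracket (\<xi> a) (E k) q)" for k l
  define B where "B k l = g q (nb (E k) (\<xi> a) q) (E l q)" for k l
  have c: "c k l = - c l k" for k l unfolding c_def using bracket_skew[OF W a, of l k] .
  have br: "lie_bracket (\<xi> a) (E k) q = (\<Sum>l\<in>UNIV. c k l *\<^sub>R E l q)" if "k \<in> H" for k
    using ON_expand[OF on[OF W], of "lie_bracket (\<xi> a) (E k) q"] g_sym unfolding c_def by simp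
  have c0: "c k (ix b) = 0" if "k \<in> H" "b \<in> {1..3}" for k b
    unfolding c_def using bracket_vertical[OF W a that(2,1)] by (simp add: ix(1)[OF that(2)])
  have bH: "lie_bracket (\<xi> a) (E k) q = (\<Sum>l\<in>H. c k l *\<^sub>R E l q)" if k: "k \<in> H" for k
  proof -
    have "c k l = 0" if "l \<notin> H" for l using c0[OF k] by (cases l rule: lab_cases) (use that in auto)
    then show ?thesis unfolding br[OF k] by (intro sum.mono_neutral_right) auto
  qed
  have nbl: "nb (lie_bracket (\<xi> a) (E k)) (\<xi> a) q = (\<Sum>l\<in>H. c k l *\<^sub>R nb (E l) (\<xi> a) q)" if k: "k \<in> H" for k
  proof -
    have "nb (lie_bracket (\<xi> a) (E k)) (\<xi> a) q = nb (\<lambda>p. \<Sum>l\<in>H. c k l *\<^sub>R E l p) (\<xi> a) q"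
      by (rule NB.nab_local_left) (use bH[OF k] in \<open>auto intro!: vf_sum vf_scale\<close>)
    also have "\<dots> = (\<Sum>l\<in>H. c k l *\<^sub>R nb (E l) (\<xi> a) q)"
      using tensorial_sum[where F="\<lambda>X. nb X (\<xi> a) q" and p=q and I=H and a="\<lambda>l p. c k l" and X=E]
      by (auto simp: NB.nab_add_left NB.nab_scale_left)
    finally show ?thesis .
  qed
  have t1: "ip (nb (E k) (\<xi> a)) (nb (\<xi> a) (E k)) q = (\<Sum>l\<in>H. c k l * B k l)" if k: "k \<in> H" for k
    unfolding nb_\<xi>_horizontal[OF q a k] bH[OF k] B_def by (simp add: g_sum_right)
  have t2: "ip (nb (lie_bracket (\<xi> a) (E k)) (\<xi> a)) (E k) q = (\<Sum>l\<in>H. c k l * B l k)" if k: "k \<in> H" for k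
    unfolding nbl[OF k] B_def by (simp add: g_sum_left)
  have sw: "(\<Sum>k\<in>H. \<Sum>l\<in>H. c k l * B l k) = - (\<Sum>k\<in>H. \<Sum>l\<in>H. c k l * B k l)"
  proof -
    have "(\<Sum>k\<in>H. \<Sum>l\<in>H. c k l * B l k) = (\<Sum>l\<in>H. \<Sum>k\<in>H. c k l * B l k)" by (rule sum.swap)
    also have "\<dots> = (\<Sum>l\<in>H. \<Sum>k\<in>H. - (c l k * B l k))" by (intro sum.cong refl) (subst c, simp)
    finally show ?thesis by (simp add: sum_negf)
  qed
  let ?f = "\<lambda>k r. g r (\<xi> a r) (nb (E k) (E k) r)"
  have z1: "E k q (ip (nb (\<xi> a) (\<xi> a)) (E k)) = 0" for k by (rule deriv_zero[OF E _ q]) (use q in \<open>auto simp: nb_self[OF _ a]\<close>)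
  have z2: "\<xi> a q (ip (nb (E k) (\<xi> a)) (E k)) = - \<xi> a q (?f k)" for k
  proof -
    have "\<xi> a q (ip (nb (E k) (\<xi> a)) (E k)) = \<xi> a q (\<lambda>r. (-1) * ?f k r)"
    proof (rule vf_apply_local[OF \<xi>_vf[OF a] _ _ \<Omega>(1) q])
      fix r assume r: "r \<in> \<Omega>"
      show "g r (nb (E k) (\<xi> a) r) (E k r) = - 1 * ?f k r"
        using nb_skew[OF \<Omega>W[OF r] E, of k "ix a" k] g_sym[of "nb (E k) (E k) r" r "\<xi> a r"] by (simp add: ix(1)[OF a])
    qed auto
    then show ?thesis using tangent_scale_fun[OF vf_tangent[OF \<xi>_vf[OF a]], of "?f k" q "-1"] by simp
  qed
  have "(\<Sum>k\<in>H. \<xi> a q (?f k)) = \<xi> a q (\<lambda>r. \<Sum>k\<in>H. ?f k r)"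
    by (rule tangent_sum_fun[symmetric]) auto
  also have "\<dots> = 0" by (rule deriv_zero[OF \<xi>_vf[OF a] _ q]) (use q mean_vertical(2)[OF a] in auto)
  finally have s0: "(\<Sum>k\<in>H. \<xi> a q (?f k)) = 0" .
  have "secf T (ix a) k q = \<xi> a q (?f k) + (\<Sum>l\<in>H. c k l * B k l) + (\<Sum>l\<in>H. c k l * B l k)" if k: "k \<in> H" for k
    unfolding secf_formula ix(1)[OF a] t1[OF k] t2[OF k] z1 z2 using nb_self[OF q a] by simp
  then have "(\<Sum>k\<in>H. secf T (ix a) k q) = (\<Sum>k\<in>H. \<xi> a q (?f k) + (\<Sum>l\<in>H. c k l * B k l) + (\<Sum>l\<in>H. c k l * B l k))"
    by (intro sum.cong) auto
  also have "\<dots> = 0" unfolding sum.distrib s0 sw by simp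
  finally show ?thesis .
qed

text \<open>Grouped by the first index, because the deformation will weight
  \<open>secf T' i j\<close> by a factor that depends on \<open>i\<close> alone.\<close>

definition msec :: "'a tensor12 \<Rightarrow> 'n \<Rightarrow> 'a \<Rightarrow> real"
  where "msec T' i q = (\<Sum>j\<in>UNIV. if lab i \<noteq> lab j then secf T' i j q else 0)"

lemma msec_vertical:
  assumes q: "q \<in> \<Omega>" and a: "a \<in> {1..3}" shows "msec T (ix a) q = 2"
proof -
  obtain b c where bc: "b \<in> {1..3}" "c \<in> {1..3}" "a \<noteq> b" "a \<noteq> c" "b \<noteq> c" using a by (rule three_distinct)
  have "(\<Sum>k\<in>H. if lab (ix a) \<noteq> lab k then secf T (ix a) k q else 0) = 0"
    using secf_horizontal[OF q a] lab_ix[OF a] a by simp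
  then show ?thesis
    unfolding msec_def sum_split3[OF a bc] using secf_vertical[OF q a] bc lab_ix a by simp
qed

text \<open>By symmetry, the horizontal rows add up to the three horizontal sums at the Reeb fields,
  which vanish. The total is 2 for each Reeb field, and the row of \<open>\<xi> 1\<close> is
  removed.\<close>

lemma msec_rest: assumes q: "q \<in> \<Omega>" shows "(\<Sum>i\<in>UNIV - {ix 1}. msec T i q) = 4"
proof -
  have "(\<Sum>i\<in>H. msec T i q) = (\<Sum>i\<in>H. secf T (ix 1) i q + secf T (ix 2) i q + secf T (ix 3) i q)"
    unfolding msec_def sum_split by (intro sum.cong refl) (auto simp: lab_ix secf_sym[of _ "ix _"])
  also have "\<dots> = 0" unfolding sum.distrib using secf_horizontal[OF q] by simp
  finally have "(\<Sum>i\<in>UNIV. msec T i q) = 6" unfolding sum_split using msec_vertical[OF q] by simp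
  then show ?thesis using msec_vertical[OF q, of 1] by (simp add: sum_diff1)
qed

end

section \<open>Volume-preserving deformations along a unit Killing field\<close>

locale killing_deformation = riemannian2 A g
  for A :: "('a::{t2_space, second_countable_topology}, 'n::finite) atlas" and g +
  fixes \<zeta> :: "'a vfield" and \<sigma> :: "'a \<Rightarrow> real"
  assumes k: "killing_field A g \<zeta>" and unit: "\<And>p. g p (\<zeta> p) (\<zeta> p) = 1" and \<sigma> [simp, intro]: "\<sigma> \<in> smooth_funs A"
begin

sublocale LC: metric_connection A g LC
  by (rule levi_civita_connection)

lemma \<zeta> [simp, intro]: "\<zeta> \<in> smooth_vfields A"
  by (rule killing_vf[OF k])

definition \<eta> :: "'a \<Rightarrow> 'a tvec \<Rightarrow> real" where "\<eta> p u = g p u (\<zeta> p)"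

definition dsig :: "'a tvec \<Rightarrow> real" where "dsig u = u \<sigma>"

definition ex :: "real \<Rightarrow> real \<Rightarrow> 'a \<Rightarrow> real" where "ex b t p = exp (b * t * \<sigma> p)"

definition grad :: "'a vfield"
  where "grad = (SOME X. X \<in> smooth_vfields A \<and> (\<forall>Y\<in>smooth_vfields A. \<forall>p. g p (X p) (Y p) = Y p \<sigma>))"

definition D\<zeta> :: "'a \<Rightarrow> 'a tvec \<Rightarrow> 'a tvec" where "D\<zeta> p u = LC (extend_vec A p u) \<zeta> p"

lemma grad_vf [simp, intro]: "grad \<in> smooth_vfields A" and g_grad [simp]: "u \<in> tangent A p \<Longrightarrow> g p (grad p) u = dsig u"
proof -
  obtain X where "X \<in> smooth_vfields A" "\<And>Y p. Y \<in> smooth_vfields A \<Longrightarrow> g p (X p) (Y p) = Y p \<sigma>"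
    by (rule riesz[of "\<lambda>Y p. Y p \<sigma>"]) (auto simp: scaleR_fun_def)
  then have "\<exists>X. X \<in> smooth_vfields A \<and> (\<forall>Y\<in>smooth_vfields A. \<forall>p. g p (X p) (Y p) = Y p \<sigma>)" by blast
  from someI_ex[OF this] have G: "grad \<in> smooth_vfields A" "\<forall>Y\<in>smooth_vfields A. \<forall>p. g p (grad p) (Y p) = Y p \<sigma>"
    unfolding grad_def by auto
  show "grad \<in> smooth_vfields A" by (rule G(1))
  assume u: "u \<in> tangent A p"
  have "g p (grad p) (extend_vec A p u p) = extend_vec A p u p \<sigma>" by (rule G(2)[rule_format, OF extend_vec_vf[OF u]])
  then show "g p (grad p) u = dsig u" using u by (simp add: dsig_def)
qed

lemma dsig_lin [simp]: "dsig (u + v) = dsig u + dsig v" "dsig (a *\<^sub>R u) = a * dsig u"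
  by (simp_all add: dsig_def scaleR_fun_def)

lemma dsig_smooth [simp, intro]: "X \<in> smooth_vfields A \<Longrightarrow> (\<lambda>p. dsig (X p)) \<in> smooth_funs A"
  unfolding dsig_def by auto

lemma \<eta>_lin [simp]:
  "u \<in> tangent A p \<Longrightarrow> v \<in> tangent A p \<Longrightarrow> \<eta> p (u + v) = \<eta> p u + \<eta> p v"
  "u \<in> tangent A p \<Longrightarrow> v \<in> tangent A p \<Longrightarrow> \<eta> p (u - v) = \<eta> p u - \<eta> p v"
  "u \<in> tangent A p \<Longrightarrow> \<eta> p (a *\<^sub>R u) = a * \<eta> p u"
  "\<eta> p (\<zeta> p) = 1"
  by (simp_all add: \<eta>_def unit)

lemma \<eta>_smooth [simp, intro]: "X \<in> smooth_vfields A \<Longrightarrow> (\<lambda>p. \<eta> p (X p)) \<in> smooth_funs A"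
  unfolding \<eta>_def by auto

lemma g_\<zeta> [simp]: "u \<in> tangent A p \<Longrightarrow> g p (\<zeta> p) u = \<eta> p u" "g p u (\<zeta> p) = \<eta> p u"
  using g_sym[of u p "\<zeta> p"] by (simp_all add: \<eta>_def)

lemma D\<zeta>_at: "X \<in> smooth_vfields A \<Longrightarrow> D\<zeta> p (X p) = LC X \<zeta> p"
  unfolding D\<zeta>_def by (rule LC.nab_local_left) auto

lemma D\<zeta>_tangent [simp]: "u \<in> tangent A p \<Longrightarrow> D\<zeta> p u \<in> tangent A p"
  unfolding D\<zeta>_def by auto

lemma D\<zeta>_vf [simp, intro]: "X \<in> smooth_vfields A \<Longrightarrow> (\<lambda>p. D\<zeta> p (X p)) \<in> smooth_vfields A"
  by (simp add: D\<zeta>_at)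

lemma D\<zeta>_lin [simp]:
  assumes "u \<in> tangent A p"
  shows "v \<in> tangent A p \<Longrightarrow> D\<zeta> p (u + v) = D\<zeta> p u + D\<zeta> p v" "D\<zeta> p (a *\<^sub>R u) = a *\<^sub>R D\<zeta> p u"
proof -
  note X = extend_vec_vf[OF assms] extend_vec_at[OF assms]
  show "D\<zeta> p (u + v) = D\<zeta> p u + D\<zeta> p v" if v: "v \<in> tangent A p"
    using D\<zeta>_at[OF vf_add[OF X(1) extend_vec_vf[OF v]], of p] LC.nab_add_left[OF X(1) \<zeta> extend_vec_vf[OF v]] X v
    by (simp add: D\<zeta>_def)
  show "D\<zeta> p (a *\<^sub>R u) = a *\<^sub>R D\<zeta> p u"
    using D\<zeta>_at[OF vf_scale[OF smooth_funs_const[of a] X(1)], of p] LC.nab_scale_left[OF X(1) \<zeta> smooth_funs_const, of a] X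
    by (simp add: D\<zeta>_def)
qed

lemma D\<zeta>_skew:
  assumes "u \<in> tangent A p" "v \<in> tangent A p" shows "g p (D\<zeta> p u) v = - g p u (D\<zeta> p v)"
  using killing_skew[OF k extend_vec_vf[OF assms(1)] extend_vec_vf[OF assms(2)], of p] assms by (simp add: D\<zeta>_def)

lemma ex_fam: "ex b \<in> expfam \<sigma>"
  using expfam_exp[of b \<sigma>] unfolding ex_def[abs_def] .

lemma ex_smooth [simp, intro]: "ex b t \<in> smooth_funs A"
  by (rule expfam_smooth[OF ex_fam \<sigma>])

lemma ex_pos [simp]: "0 < ex b t p"
  by (simp add: ex_def)

lemma ex_cancel: "ex b t p * ex (- b) t p = 1"
  by (simp add: ex_def exp_add[symmetric])

lemma ex_deriv: assumes u: "u \<in> tangent A p" shows "u (ex b t) = b * t * ex b t p * dsig u"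
proof -
  have d: "((\<lambda>z. exp (b * t * z)) has_real_derivative b * t * exp (b * t * \<sigma> p)) (at (\<sigma> p))"
    by (auto intro!: derivative_eq_intros)
  have "u (\<lambda>q. exp (b * t * \<sigma> q)) = b * t * exp (b * t * \<sigma> p) * u \<sigma>"
    by (rule tangent_chain[OF u \<sigma>, of "\<lambda>z. exp (b * t * z)", OF d]) (use ex_smooth[of b t] in \<open>simp add: ex_def[abs_def]\<close>)
  then show ?thesis by (simp add: ex_def[abs_def] dsig_def)
qed

section \<open>The deformed metric and its volume form\<close>

definition n1 :: real where "n1 = real CARD('n) - 1"

text \<open>The direction \<open>\<zeta>\<close> is scaled by \<open>exp (- n1 t \<sigma>)\<close> and its orthogonal complement, of
  dimension \<open>n1\<close>, by \<open>exp (t \<sigma>)\<close>, so that the volume form does not change.\<close>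

definition deformed :: "real \<Rightarrow> 'a rmetric"
  where "deformed t p u v = ex 1 t p * g p u v + (ex (- n1) t p - ex 1 t p) * (\<eta> p u * \<eta> p v)"

lemma deformed_0: "deformed 0 = g"
  by (rule ext)+ (simp add: deformed_def ex_def)

lemma deformed_family:
  "X \<in> smooth_vfields A \<Longrightarrow> Y \<in> smooth_vfields A \<Longrightarrow> (\<lambda>t p. deformed t p (X p) (Y p)) \<in> expfam \<sigma>"
  unfolding deformed_def by (intro expfam_add expfam_diff expfam_mult ex_fam expfam_fun g_smooth \<eta>_smooth smooth_funs_mult)

lemma deformed_riemannian: "riemannian A (deformed t)"
proof unfold_locales
  have pos: "0 < deformed t p u u" if u: "u \<in> tangent A p" "u \<noteq> 0" for p u
  proof -
    define w where "w = u - \<eta> p u *\<^sub>R \<zeta> p"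
    have w: "w \<in> tangent A p" unfolding w_def using u by simp
    have gw: "g p w w = g p u u - \<eta> p u * \<eta> p u" unfolding w_def using u by (simp add: algebra_simps)
    have e: "deformed t p u u = ex 1 t p * g p w w + ex (- n1) t p * (\<eta> p u * \<eta> p u)"
      unfolding deformed_def gw by (simp add: algebra_simps)
    show ?thesis
    proof (cases "w = 0")
      case True
      then have "u = \<eta> p u *\<^sub>R \<zeta> p" unfolding w_def by simp
      then have "\<eta> p u \<noteq> 0" using u(2) by (metis scaleR_zero_left)
      then have "0 < \<eta> p u * \<eta> p u" by (metis not_real_square_gt_zero)
      then show ?thesis unfolding e using True by simp
    next
      case False
      have "0 < ex 1 t p * g p w w" using g_pos[OF w False] by simp
      then show ?thesis unfolding e by (intro add_pos_nonneg) (simp_all add: less_imp_le)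
    qed
  qed
  show "riemannian_metric A (deformed t)"
    unfolding riemannian_metric_def
  proof (intro conjI allI ballI impI)
    fix p u v w a b assume t: "u \<in> tangent A p" "v \<in> tangent A p" "w \<in> tangent A p"
    show "deformed t p u v = deformed t p v u" using g_sym[OF t(1,2)] by (simp add: deformed_def)
    show "deformed t p (a *\<^sub>R u + b *\<^sub>R v) w = a * deformed t p u w + b * deformed t p v w"
      using t by (simp add: deformed_def algebra_simps)
    show "u \<noteq> 0 \<Longrightarrow> 0 < deformed t p u u" by (rule pos[OF t(1)])
  next
    fix X Y assume "X \<in> smooth_vfields A" "Y \<in> smooth_vfields A"
    then show "(\<lambda>p. deformed t p (X p) (Y p)) \<in> smooth_funs A"
      using expfam_smooth[OF deformed_family \<sigma>] by simp
  qed
qed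

text \<open>In an orthonormal basis containing \<open>\<zeta> p\<close> the deformed metric is
  diagonal. The exponent \<open>- n1\<close> occurs once and the exponent 1 occurs \<open>n1\<close>
  times, so the diagonal has product 1.\<close>

lemma deformed_det:
  assumes U: "(U, \<phi>) \<in> A" "p \<in> U"
  shows "det (\<chi> i j. deformed t p (coord_vec A U \<phi> i p) (coord_vec A U \<phi> j p))
    = det (\<chi> i j. g p (coord_vec A U \<phi> i p) (coord_vec A U \<phi> j p))"
proof -
  \<comment> \<open>Any index may be assigned to \<open>\<zeta>\<close>.\<close>
  obtain i0 :: 'n where True by blast
  obtain e where e: "ON p e" "\<And>i. i \<in> {i0} \<Longrightarrow> e i = \<zeta> p"
    by (rule ON_extend[of "{i0}" "\<lambda>i. \<zeta> p" p]) (use unit in auto)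
  note ct = coord_vec_tangent[OF U]
  let ?c = "\<lambda>i. coord_vec A U \<phi> i p"
  let ?d = "\<lambda>k. if k = i0 then ex (- n1) t p else ex 1 t p"
  let ?M = "(\<chi> k i. g p (?c i) (e k)) :: real^'n^'n" and ?D = "(\<chi> k l. if k = l then ?d k else 0) :: real^'n^'n"
  have "deformed t p (?c i) (?c j) = (\<Sum>k\<in>UNIV. g p (?c i) (e k) * (?d k * g p (?c j) (e k)))" for i j
  proof -
    have "(\<Sum>k\<in>UNIV. g p (?c i) (e k) * (?d k * g p (?c j) (e k)))
      = (\<Sum>k\<in>UNIV. ex 1 t p * (g p (?c i) (e k) * g p (?c j) (e k))
        + (if k = i0 then (ex (- n1) t p - ex 1 t p) * (\<eta> p (?c i) * \<eta> p (?c j)) else 0))"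
      by (intro sum.cong refl) (auto simp: e(2) algebra_simps)
    then show ?thesis unfolding deformed_def ON_expand_g[OF e(1) ct ct] by (simp add: sum.distrib sum_distrib_left)
  qed
  then have "(\<chi> i j. deformed t p (?c i) (?c j)) = transpose ?M ** (?D ** ?M)"
    by (simp add: matrix_matrix_mult_def transpose_def vec_eq_iff if_distrib[of "\<lambda>x. x * _"] cong: if_cong)
  then have "det (\<chi> i j. deformed t p (?c i) (?c j)) = det ?D * det (transpose ?M ** ?M)"
    by (simp add: det_mul det_transpose)
  moreover have "transpose ?M ** ?M = (\<chi> i j. g p (?c i) (?c j))"
    using gram_factor(1)[OF U e(1)] chart_inv[OF U] by (simp add: gram_def)
  moreover have "det ?D = 1"
  proof -
    have "det ?D = (\<Prod>k\<in>UNIV. ?d k)" by (subst det_diagonal) auto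
    also have "\<dots> = ex (- n1) t p * (\<Prod>k\<in>UNIV - {i0}. ex 1 t p)"
      by (subst prod.remove[of _ i0]) (auto intro!: prod.cong)
    also have "\<dots> = exp (- n1 * t * \<sigma> p) * exp (1 * t * \<sigma> p) ^ (CARD('n) - 1)" by (simp add: ex_def)
    also have "\<dots> = exp (- n1 * t * \<sigma> p + real (CARD('n) - 1) * (1 * t * \<sigma> p))"
      by (simp only: exp_of_nat_mult exp_add)
    also have "real (CARD('n) - 1) = n1" by (simp add: n1_def of_nat_diff)
    also have "exp (- n1 * t * \<sigma> p + n1 * (1 * t * \<sigma> p)) = 1" by simp
    finally show ?thesis .
  qed
  ultimately show ?thesis by simp
qed

lemma deformed_volume: "volume_form_measure A (deformed t) = volume_form_measure A g"
proof -
  have "(\<integral>\<^sup>+ x. ennreal (sqrt (det (\<chi> i j. deformed t (inv_into U \<phi> x) (coord_vec A U \<phi> i (inv_into U \<phi> x))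
          (coord_vec A U \<phi> j (inv_into U \<phi> x))))) * indicator (\<phi> ` B) x \<partial>lborel)
      = (\<integral>\<^sup>+ x. ennreal (sqrt (det (\<chi> i j. g (inv_into U \<phi> x) (coord_vec A U \<phi> i (inv_into U \<phi> x))
          (coord_vec A U \<phi> j (inv_into U \<phi> x))))) * indicator (\<phi> ` B) x \<partial>lborel)"
    if U: "(U, \<phi>) \<in> A" and B: "B \<subseteq> U" for U \<phi> B
  proof (rule nn_integral_cong)
    fix x
    show "ennreal (sqrt (det (\<chi> i j. deformed t (inv_into U \<phi> x) (coord_vec A U \<phi> i (inv_into U \<phi> x))
          (coord_vec A U \<phi> j (inv_into U \<phi> x))))) * indicator (\<phi> ` B) x
      = ennreal (sqrt (det (\<chi> i j. g (inv_into U \<phi> x) (coord_vec A U \<phi> i (inv_into U \<phi> x))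
          (coord_vec A U \<phi> j (inv_into U \<phi> x))))) * indicator (\<phi> ` B) x"
    proof (cases "x \<in> \<phi> ` B")
      case True
      then have "inv_into U \<phi> x \<in> U" using B chart_inv[OF U] by auto
      then show ?thesis using deformed_det[OF U] by simp
    qed simp
  qed
  then show ?thesis unfolding volume_form_measure_def
    by (intro arg_cong[where f=The] ext conj_cong refl ball_cong) (auto split: prod.splits)
qed

text \<open>Twice the difference of the two Levi-Civita connections, lowered with the deformed
  metric and raised with \<open>g\<close>. With the deformed metric written as a multiple of
  \<open>g\<close> plus a multiple of the square of \<open>\<eta>\<close>, the first term
  differentiates the first coefficient, the second term the second coefficient, and the third term
  differentiates \<open>\<eta>\<close>.\<close>

definition W :: "real \<Rightarrow> 'a tensor12"
  where "W t p u v = (t * ex 1 t p) *\<^sub>R (dsig u *\<^sub>R v + dsig v *\<^sub>R u - g p u v *\<^sub>R grad p)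
    - (t * (n1 * ex (- n1) t p + ex 1 t p)) *\<^sub>R ((dsig u * \<eta> p v + dsig v * \<eta> p u) *\<^sub>R \<zeta> p - (\<eta> p u * \<eta> p v) *\<^sub>R grad p)
    + (2 * (ex (- n1) t p - ex 1 t p)) *\<^sub>R (\<eta> p v *\<^sub>R D\<zeta> p u + \<eta> p u *\<^sub>R D\<zeta> p v)"

text \<open>The difference of the Levi-Civita connections of \<open>deformed t\<close> and \<open>g\<close>.\<close>

definition K :: "real \<Rightarrow> 'a tensor12"
  where "K t p u v = (1/2) *\<^sub>R (ex (- 1) t p *\<^sub>R W t p u v + ((ex n1 t p - ex (- 1) t p) * \<eta> p (W t p u v)) *\<^sub>R \<zeta> p)"

lemma W_tangent [simp]: "u \<in> tangent A p \<Longrightarrow> v \<in> tangent A p \<Longrightarrow> W t p u v \<in> tangent A p"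
  unfolding W_def by auto

lemma W_vfam:
  assumes X: "X \<in> smooth_vfields A" and Y: "Y \<in> smooth_vfields A"
  shows "(\<lambda>t q. W t q (X q) (Y q)) \<in> vfam \<sigma>"
  unfolding W_def
proof (rule vfam_add[OF vfam_diff[OF vfam_base vfam_base] vfam_base])
  show "(\<lambda>t q. t * ex 1 t q) \<in> expfam \<sigma>" by (rule expfam_mult[OF expfam_t ex_fam])
  show "(\<lambda>t q. t * (n1 * ex (- n1) t q + ex 1 t q)) \<in> expfam \<sigma>"
    by (intro expfam_mult expfam_t expfam_add expfam_scale ex_fam)
  show "(\<lambda>t q. 2 * (ex (- n1) t q - ex 1 t q)) \<in> expfam \<sigma>" by (intro expfam_scale expfam_diff ex_fam)
qed (use X Y in \<open>auto intro!: vf_add vf_diff vf_scale\<close>)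

lemma K_vfam:
  assumes X: "X \<in> smooth_vfields A" and Y: "Y \<in> smooth_vfields A"
  shows "(\<lambda>t q. K t q (X q) (Y q)) \<in> vfam \<sigma>"
proof -
  have e: "(\<lambda>t q. (ex n1 t q - ex (- 1) t q) * \<eta> q (W t q (X q) (Y q))) \<in> expfam \<sigma>"
    unfolding \<eta>_def by (rule expfam_mult[OF expfam_diff[OF ex_fam ex_fam] vfam_ip[OF W_vfam[OF X Y] \<sigma> \<zeta>]])
  show ?thesis unfolding K_def
    by (rule vfam_mult[OF vfam_add[OF vfam_mult[OF W_vfam[OF X Y] ex_fam] vfam_base[OF e \<zeta>]] expfam_fun[OF smooth_funs_const]])
qed

lemma W_sym: "u \<in> tangent A p \<Longrightarrow> v \<in> tangent A p \<Longrightarrow> W t p u v = W t p v u"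
  using g_sym[of u p v] by (simp add: W_def add.commute mult.commute)

lemma W_lin:
  assumes [simp]: "u \<in> tangent A p" "w \<in> tangent A p"
  shows "v \<in> tangent A p \<Longrightarrow> W t p (u + v) w = W t p u w + W t p v w" "W t p (a *\<^sub>R u) w = a *\<^sub>R W t p u w"
  unfolding W_def by (simp_all add: algebra_simps)

lemma K_tensor: "smooth_tensor12 A (K t)"
proof (rule smooth_tensor12I)
  fix p u v w a assume [simp]: "u \<in> tangent A p" "v \<in> tangent A p" "w \<in> tangent A p"
  have s: "K t p w u = K t p u w" if "u \<in> tangent A p" for u using W_sym[OF that \<open>w \<in> tangent A p\<close>, of t] unfolding K_def by simp
  show a: "K t p (u + v) w = K t p u w + K t p v w" unfolding K_def by (simp add: W_lin algebra_simps)
  show b: "K t p (a *\<^sub>R u) w = a *\<^sub>R K t p u w" unfolding K_def by (simp add: W_lin algebra_simps)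
  show "K t p w (u + v) = K t p w u + K t p w v" "K t p w (a *\<^sub>R u) = a *\<^sub>R K t p w u" using a b s by simp_all
next
  fix X Y assume "X \<in> smooth_vfields A" "Y \<in> smooth_vfields A"
  then show "(\<lambda>p. K t p (X p) (Y p)) \<in> smooth_vfields A" using vfam_smooth[OF K_vfam \<sigma>, of X Y t] by simp
qed

lemma K_tangent [simp]: "u \<in> tangent A p \<Longrightarrow> v \<in> tangent A p \<Longrightarrow> K t p u v \<in> tangent A p"
  by (rule tensor12_tangent[OF K_tensor])

text \<open>Raising the index by the inverse of the deformed metric means the factor
  \<open>ex n1\<close> along \<open>\<zeta>\<close> and \<open>ex (- 1)\<close> across it;
  \<open>K\<close> is half of \<open>W\<close> with these factors.\<close>

lemma deformed_K:
  assumes [simp]: "u \<in> tangent A p" "v \<in> tangent A p" "w \<in> tangent A p"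
  shows "deformed t p (K t p u v) w = (1/2) * g p (W t p u v) w"
proof -
  have e: "ex 1 t p * ex (- 1) t p = 1" "ex n1 t p * ex (- n1) t p = 1" using ex_cancel by auto
  have g: "g p (K t p u v) w = (1/2) * (ex (- 1) t p * g p (W t p u v) w + (ex n1 t p - ex (- 1) t p) * \<eta> p (W t p u v) * \<eta> p w)"
    unfolding K_def by simp
  have h: "\<eta> p (K t p u v) = (1/2) * ex n1 t p * \<eta> p (W t p u v)"
    unfolding K_def by (simp add: distrib_left left_diff_distrib)
  show ?thesis unfolding deformed_def g h using e by algebra
qed

text \<open>Symmetrising the last two slots yields twice the covariant derivative of
  \<open>deformed t\<close> in direction \<open>u\<close>, taken with the connection of
  \<open>g\<close>. This is the identity behind metric compatibility of
  \<open>LC + K\<close>.\<close>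

lemma g_W:
  assumes [simp]: "u \<in> tangent A p" "v \<in> tangent A p" "w \<in> tangent A p"
  shows "g p (W t p u v) w + g p (W t p u w) v
    = 2 * (t * ex 1 t p * dsig u * g p v w - t * (n1 * ex (- n1) t p + ex 1 t p) * dsig u * (\<eta> p v * \<eta> p w)
      + (ex (- n1) t p - ex 1 t p) * (\<eta> p v * g p (D\<zeta> p u) w + \<eta> p w * g p (D\<zeta> p u) v))"
  using D\<zeta>_skew[of v p w] g_sym[of v p w] g_sym[of v p "D\<zeta> p w"] g_sym[of u p v] g_sym[of u p w]
  unfolding W_def by (simp add: algebra_simps)

lemma deformed_deriv:
  assumes X: "X \<in> smooth_vfields A" and Y: "Y \<in> smooth_vfields A" and Z: "Z \<in> smooth_vfields A"
  shows "X p (\<lambda>q. deformed t q (Y q) (Z q)) = deformed t p (LC X Y p) (Z p) + deformed t p (Y p) (LC X Z p)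
    + (1/2) * (g p (W t p (X p) (Y p)) (Z p) + g p (W t p (X p) (Z p)) (Y p))"
proof -
  note [simp] = X Y Z
  note Xp = vf_tangent[OF X, of p]
  have e: "X p (\<lambda>q. \<eta> q (V q)) = \<eta> p (LC X V p) + g p (D\<zeta> p (X p)) (V p)" if V: "V \<in> smooth_vfields A" for V
    using LC.ip_deriv[OF X V \<zeta>, of p] g_sym[of "V p" p "LC X \<zeta> p"] V by (simp add: D\<zeta>_at)
  have "X p (\<lambda>q. deformed t q (Y q) (Z q))
    = X p (\<lambda>q. ex 1 t q * g q (Y q) (Z q)) + X p (\<lambda>q. (ex (- n1) t q - ex 1 t q) * (\<eta> q (Y q) * \<eta> q (Z q)))"
    unfolding deformed_def by (rule tangent_add_fun[OF Xp]) auto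
  also have "X p (\<lambda>q. ex 1 t q * g q (Y q) (Z q)) = ex 1 t p * X p (ip Y Z) + g p (Y p) (Z p) * X p (ex 1 t)"
    by (rule tangent_mult[OF Xp]) auto
  also have "X p (\<lambda>q. (ex (- n1) t q - ex 1 t q) * (\<eta> q (Y q) * \<eta> q (Z q)))
    = (ex (- n1) t p - ex 1 t p) * X p (\<lambda>q. \<eta> q (Y q) * \<eta> q (Z q)) + \<eta> p (Y p) * \<eta> p (Z p) * X p (\<lambda>q. ex (- n1) t q - ex 1 t q)"
    by (rule tangent_mult[OF Xp]) auto
  also have "X p (\<lambda>q. \<eta> q (Y q) * \<eta> q (Z q)) = \<eta> p (Y p) * X p (\<lambda>q. \<eta> q (Z q)) + \<eta> p (Z p) * X p (\<lambda>q. \<eta> q (Y q))"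
    by (rule tangent_mult[OF Xp]) auto
  also have "X p (\<lambda>q. ex (- n1) t q - ex 1 t q) = X p (ex (- n1) t) - X p (ex 1 t)"
    by (rule tangent_diff_fun[OF Xp]) auto
  finally show ?thesis
    unfolding ex_deriv[OF Xp] e[OF Y] e[OF Z] LC.ip_deriv[OF X Y Z] g_W[OF Xp vf_tangent[OF Y] vf_tangent[OF Z]]
    by (simp add: deformed_def algebra_simps)
qed

text \<open>\<open>LC + K\<close> is metric for the deformed metric by \<open>deformed_deriv\<close>
  and torsion free because \<open>K\<close> is symmetric; uniqueness does the rest.\<close>

lemma LC_deformed:
  assumes X: "X \<in> smooth_vfields A" and Y: "Y \<in> smooth_vfields A"
  shows "levi_civita A (deformed t) X Y = (\<lambda>p. LC X Y p + K t p (X p) (Y p))"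
proof -
  interpret R: riemannian A "deformed t" by (rule deformed_riemannian)
  let ?n = "contorted_connection A g (K t)"
  have mc: "metric_compatible A (deformed t) ?n"
    unfolding metric_compatible_def contorted_connection_def
  proof (intro ballI allI)
    fix X Y Z p assume [simp]: "X \<in> smooth_vfields A" "Y \<in> smooth_vfields A" "Z \<in> smooth_vfields A"
    have "deformed t p (Y p) (K t p (X p) (Z p)) = (1/2) * g p (W t p (X p) (Z p)) (Y p)"
      using R.g_sym[of "Y p" p "K t p (X p) (Z p)"] deformed_K[of "X p" p "Z p" "Y p" t] by simp
    then show "X p (\<lambda>q. deformed t q (Y q) (Z q)) = deformed t p (LC X Y p + K t p (X p) (Y p)) (Z p)
        + deformed t p (Y p) (LC X Z p + K t p (X p) (Z p))"
      using deformed_K[of "X p" p "Y p" "Z p" t] by (simp add: deformed_deriv)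
  qed
  have tf: "torsion_free A ?n"
    unfolding torsion_free_def
  proof (intro ballI ext)
    fix X Y :: "'a vfield" and p f assume [simp]: "X \<in> smooth_vfields A" "Y \<in> smooth_vfields A"
    have "K t p (X p) (Y p) = K t p (Y p) (X p)" using W_sym[of "X p" p "Y p" t] by (simp add: K_def)
    then have "?n X Y p - ?n Y X p = lie_bracket X Y p"
      by (simp add: contorted_connection_def lie_bracket_LC)
    then show "(?n X Y - ?n Y X) p f = lie_bracket X Y p f" by (metis minus_apply)
  qed
  have "?n X Y = levi_civita A (deformed t) X Y"
    by (rule R.levi_civita_unique[OF contorted_affine[OF K_tensor] mc tf X Y])
  then show ?thesis unfolding contorted_connection_def by simp
qed

end

section \<open>The metric variation\<close>

lemma abs_exp_minus_1: "\<bar>exp z - 1\<bar> \<le> \<bar>z\<bar> * exp \<bar>z\<bar>" for z :: real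
proof (cases "z \<ge> 0")
  case True
  have "exp z * (1 - z) \<le> exp z * exp (- z)" using exp_ge_add_one_self[of "- z"] by (intro mult_left_mono) auto
  then show ?thesis using True by (simp add: exp_minus algebra_simps)
next
  case False
  have "1 - exp z \<le> - z" using exp_ge_add_one_self[of z] by linarith
  also have "\<dots> \<le> - z * exp (- z)" using False by (simp add: mult_le_cancel_left1)
  finally show ?thesis using False by simp
qed

text \<open>Only the exponential weight is differentiated; \<open>F\<close> enters through its value
  at \<open>t = 0\<close>. Dominated convergence is applied along a sequence, which suffices where
  the derivative is already known to exist.\<close>

lemma (in chart_domain) exp_quotient_limit:
  assumes F: "F \<in> expfam \<sigma>" and \<sigma>: "\<sigma> \<in> smooth_funs A"
  shows "(\<lambda>n. set_lebesgue_integral vol \<Omega> (\<lambda>q. (exp (b * inverse (real (Suc n)) * \<sigma> q) - 1) * F (inverse (real (Suc n))) q)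
      / inverse (real (Suc n))) \<longlonglongrightarrow> set_lebesgue_integral vol \<Omega> (\<lambda>q. b * \<sigma> q * F 0 q)"
proof -
  define t where "t n = inverse (real (Suc n))" for n
  have t: "0 < t n" "t n \<le> 1" for n unfolding t_def by (auto simp: field_simps)
  have t0: "filterlim t (at 0) sequentially"
    unfolding filterlim_at using LIMSEQ_inverse_real_of_nat t(1) unfolding t_def
    by (simp del: of_nat_Suc add: less_imp_neq[symmetric])
  define h where "h n q = (exp (b * t n * \<sigma> q) - 1) / t n * F (t n) q" for n q
  obtain B1 where B1: "\<And>q. q \<in> \<Omega> \<Longrightarrow> \<bar>\<sigma> q\<bar> \<le> B1" by (rule smooth_bounded[OF \<sigma>], rule that)
  obtain B2 where B2: "\<And>t q. \<bar>t\<bar> \<le> 1 \<Longrightarrow> q \<in> closure \<Omega> \<Longrightarrow> \<bar>F t q\<bar> \<le> B2"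
    using expfam_bound[OF F \<sigma> \<Omega>(3)] by blast
  let ?B = "\<bar>b\<bar> * B1 * exp (\<bar>b\<bar> * B1) * B2"
  have B: "0 \<le> \<bar>b\<bar> * B1" "0 \<le> B2" if "q \<in> \<Omega>" for q
    using order_trans[OF abs_ge_zero B1[OF that]] order_trans[OF abs_ge_zero B2[of 0 q]] that closure_subset[of \<Omega>] by auto
  have hb: "\<bar>h n q\<bar> \<le> ?B" if q: "q \<in> \<Omega>" for n q
  proof -
    have z: "\<bar>b * t n * \<sigma> q\<bar> = t n * (\<bar>b\<bar> * \<bar>\<sigma> q\<bar>)" using t(1)[of n] by (simp add: abs_mult)
    have z1: "\<bar>b\<bar> * \<bar>\<sigma> q\<bar> \<le> \<bar>b\<bar> * B1" using B1[OF q] by (intro mult_left_mono) auto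
    have "t n * (\<bar>b\<bar> * \<bar>\<sigma> q\<bar>) \<le> 1 * (\<bar>b\<bar> * B1)" using t[of n] by (intro mult_mono z1) auto
    then have z2: "exp \<bar>b * t n * \<sigma> q\<bar> \<le> exp (\<bar>b\<bar> * B1)" unfolding z by simp
    have "\<bar>exp (b * t n * \<sigma> q) - 1\<bar> \<le> t n * (\<bar>b\<bar> * \<bar>\<sigma> q\<bar>) * exp \<bar>b * t n * \<sigma> q\<bar>"
      using abs_exp_minus_1[of "b * t n * \<sigma> q"] unfolding z .
    then have "\<bar>(exp (b * t n * \<sigma> q) - 1) / t n\<bar> \<le> \<bar>b\<bar> * \<bar>\<sigma> q\<bar> * exp \<bar>b * t n * \<sigma> q\<bar>"
      using t(1)[of n] by (simp add: abs_divide divide_le_eq mult_ac)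
    also have "\<dots> \<le> \<bar>b\<bar> * B1 * exp (\<bar>b\<bar> * B1)" using B(1)[OF q] by (intro mult_mono z1 z2) auto
    finally have "\<bar>(exp (b * t n * \<sigma> q) - 1) / t n\<bar> \<le> \<bar>b\<bar> * B1 * exp (\<bar>b\<bar> * B1)" .
    moreover have "\<bar>F (t n) q\<bar> \<le> B2" using B2[of "t n" q] t[of n] q closure_subset[of \<Omega>] by auto
    ultimately show ?thesis unfolding h_def abs_mult using B[OF q] by (intro mult_mono) auto
  qed
  have lim: "(\<lambda>n. h n q) \<longlonglongrightarrow> b * \<sigma> q * F 0 q" for q
  proof -
    have "((\<lambda>s. exp (b * s * \<sigma> q)) has_real_derivative b * \<sigma> q) (at 0)"
      by (auto intro!: derivative_eq_intros)
    then have "((\<lambda>s. (exp (b * s * \<sigma> q) - 1) / s) \<longlongrightarrow> b * \<sigma> q) (at 0)"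
      by (simp add: has_field_derivative_iff)
    then show ?thesis unfolding h_def
      by (intro tendsto_mult filterlim_compose[OF _ t0, of "\<lambda>s. (exp (b * s * \<sigma> q) - 1) / s"]
          filterlim_compose[OF expfam_tendsto[OF F] t0])
  qed
  have hm: "h n \<in> borel_measurable borel" for n
  proof -
    have "(\<lambda>q. exp ((b * t n) * \<sigma> q)) \<in> smooth_funs A" by (rule exp_smooth[OF \<sigma>])
    then have "(\<lambda>q. (1 / t n) * ((exp (b * t n * \<sigma> q) - 1) * F (t n) q)) \<in> smooth_funs A"
      by (intro smooth_funs_scale smooth_funs_mult smooth_funs_diff smooth_funs_const expfam_smooth[OF F \<sigma>])
    then have "h n \<in> smooth_funs A" unfolding h_def[abs_def] by simp
    then show ?thesis by (rule borel_measurable_continuous_onI[OF smooth_funs_continuous])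
  qed
  have "(\<lambda>n. \<integral>q. indicator \<Omega> q *\<^sub>R h n q \<partial>vol) \<longlonglongrightarrow> (\<integral>q. indicator \<Omega> q *\<^sub>R (b * \<sigma> q * F 0 q) \<partial>vol)"
  proof (rule integral_dominated_convergence[where w="\<lambda>q. indicator \<Omega> q *\<^sub>R ?B"])
    show "integrable vol (\<lambda>q. indicator \<Omega> q *\<^sub>R ?B)"
      using set_integrable_bounded[of "\<lambda>q. ?B" "\<bar>?B\<bar>"] unfolding set_integrable_def by simp
    show "AE q in vol. (\<lambda>n. indicator \<Omega> q *\<^sub>R h n q) \<longlonglongrightarrow> indicator \<Omega> q *\<^sub>R (b * \<sigma> q * F 0 q)"
      by (intro AE_I2 tendsto_intros lim)
    show "AE q in vol. norm (indicator \<Omega> q *\<^sub>R h n q) \<le> indicator \<Omega> q *\<^sub>R ?B" for n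
      by (rule AE_I2) (auto simp: indicator_def hb)
    show "(\<lambda>q. indicator \<Omega> q *\<^sub>R h n q) \<in> borel_measurable vol" for n
      using hm[of n] \<Omega>_sub(3) by (intro borel_measurable_scaleR borel_measurable_indicator) (auto simp: sets_vol measurable_cong_sets[OF sets_vol refl])
    have "(\<lambda>q. b * \<sigma> q * F 0 q) \<in> smooth_funs A"
      using smooth_funs_mult[OF smooth_funs_scale[OF \<sigma>, of b] expfam_smooth[OF F \<sigma>, of 0]] .
    then have "(\<lambda>q. b * \<sigma> q * F 0 q) \<in> borel_measurable borel"
      by (rule borel_measurable_continuous_onI[OF smooth_funs_continuous])
    then show "(\<lambda>q. indicator \<Omega> q *\<^sub>R (b * \<sigma> q * F 0 q)) \<in> borel_measurable vol"
      using \<Omega>_sub(3) by (intro borel_measurable_scaleR borel_measurable_indicator) (auto simp: sets_vol measurable_cong_sets[OF sets_vol refl])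
  qed
  moreover have "(\<integral>q. indicator \<Omega> q *\<^sub>R h n q \<partial>vol)
      = set_lebesgue_integral vol \<Omega> (\<lambda>q. (exp (b * t n * \<sigma> q) - 1) * F (t n) q) / t n" for n
  proof -
    have "h n = (\<lambda>q. (exp (b * t n * \<sigma> q) - 1) * F (t n) q / t n)" unfolding h_def[abs_def] by simp
    then show ?thesis unfolding set_lebesgue_integral_def[symmetric] by (simp only: set_integral_divide_zero)
  qed
  ultimately show ?thesis unfolding t_def[symmetric] set_lebesgue_integral_def[of vol \<Omega> "\<lambda>q. b * \<sigma> q * F 0 q"] by simp
qed

lemma (in riemannian) ortho_compl_span:
  assumes "S q \<subseteq> tangent A q"
  shows "ortho_compl A g (\<lambda>p. span (S p)) q = {v\<in>tangent A q. \<forall>w\<in>S q. g q v w = 0}"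
proof -
  have "g q v w = 0" if v: "v \<in> tangent A q" "\<forall>w\<in>S q. g q v w = 0" and w: "w \<in> span (S q)" for v w
  proof -
    have "w \<in> tangent A q \<and> g q v w = 0"
      using w
    proof (induction rule: span_induct_alt)
      case base
      show ?case by (rule conjI[OF tangent_zero g_zero_right[OF v(1)]])
    next
      case (step c x y)
      have "x \<in> tangent A q" "g q v x = 0" using step(1) assms v(2) by blast+
      then have "c *\<^sub>R x + y \<in> tangent A q" "g q v (c *\<^sub>R x + y) = 0" using step(2) v(1) by simp_all
      then show ?case by (rule conjI)
    qed
    then show ?thesis by blast
  qed
  then show ?thesis unfolding ortho_compl_def by (auto intro: span_base)
qed

lemma (in riemannian) sasaki_distr_4:
  assumes "three_sasaki A g \<xi>"
  shows "sasaki_distr A g \<xi> 4 q = {v\<in>tangent A q. \<forall>a\<in>{1..3}. g q v (\<xi> a q) = 0}"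
proof -
  have t: "\<xi> a q \<in> tangent A q" if "a \<in> {1..3}" for a
    by (rule vf_tangent[OF killing_vf]) (use assms that in \<open>auto simp: three_sasaki_def sasakian_field_def\<close>)
  have "{1..3::nat} = {1, 2, 3}" by auto
  then show ?thesis
    using ortho_compl_span[of "\<lambda>q. {\<xi> 1 q, \<xi> 2 q, \<xi> 3 q}" q] t[of 1] t[of 2] t[of 3]
    unfolding sasaki_distr_def by simp
qed

locale sasaki_deformation = sasaki_chart A g U \<phi> N x C \<Omega> T D E W lab \<xi> ix
  for A :: "('a::{t2_space, second_countable_topology}, 'n::finite) atlas" and g U \<phi> N x C \<Omega> T D E W lab \<xi> ix +
  fixes \<sigma> :: "'a \<Rightarrow> real" and \<zeta> :: "'a vfield" and i1 :: 'n
  assumes cmet: "critical_metric_fixed_volume A D g T" and DD: "D = sasaki_distr A g \<xi>"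
    and \<sigma>: "\<sigma> \<in> smooth_funs A" "closure {q. \<sigma> q \<noteq> 0} \<subseteq> \<Omega>"
    and \<zeta>: "\<zeta> = \<xi> 1" and i1: "i1 = ix 1"
begin

lemma one_mem: "1 \<in> {1..3::nat}" by simp

lemma E_i1: "E i1 = \<zeta>"
  unfolding \<zeta> i1 by (rule ix(1)[OF one_mem])

lemma lab_i1: "lab i = 1 \<longleftrightarrow> i = i1"
  unfolding i1 by (rule ix(2)[OF one_mem])

sublocale KD: killing_deformation A g \<zeta> \<sigma>
  unfolding \<zeta> using killing[OF one_mem] \<xi>_on[OF one_mem one_mem] \<sigma>(1) by unfold_locales simp_all

section \<open>Admissibility of the deformation\<close>

lemma D_orthogonal:
  assumes "\<mu> \<in> {1..4}" "\<nu> \<in> {1..4}" "\<mu> \<noteq> \<nu>" "u \<in> D \<mu> p" "v \<in> D \<nu> p"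
  shows "g p u v = 0"
proof -
  have s: "\<exists>c. u = c *\<^sub>R \<xi> a p" if "a \<in> {1..3}" "u \<in> D a p" for a u
    using that unfolding DD sasaki_distr_def by (auto simp: span_singleton)
  have h: "u \<in> tangent A p" "a \<in> {1..3} \<Longrightarrow> g p u (\<xi> a p) = 0" if "u \<in> D 4 p" for a u
    using that unfolding DD sasaki_distr_4[OF sas] by auto
  have v: "a \<in> {1..3} \<Longrightarrow> \<xi> a p \<in> tangent A p" for a by (rule vf_tangent[OF \<xi>_vf])
  consider "\<mu> \<in> {1..3}" "\<nu> \<in> {1..3}" | "\<mu> = 4" "\<nu> \<in> {1..3}" | "\<mu> \<in> {1..3}" "\<nu> = 4"
    using assms(1-3) by fastforce
  then show ?thesis
  proof cases
    case 1
    obtain c d where "u = c *\<^sub>R \<xi> \<mu> p" "v = d *\<^sub>R \<xi> \<nu> p" using s[OF 1(1) assms(4)] s[OF 1(2) assms(5)] by blast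
    then show ?thesis using v[OF 1(1)] v[OF 1(2)] \<xi>_on[OF 1] assms(3) by simp
  next
    case 2
    obtain d where "v = d *\<^sub>R \<xi> \<nu> p" using s[OF 2(2) assms(5)] by blast
    then show ?thesis using v[OF 2(2)] h(1)[of u] h(2)[of u \<nu>] assms(4) 2 by simp
  next
    case 3
    obtain d where "u = d *\<^sub>R \<xi> \<mu> p" using s[OF 3(1) assms(4)] by blast
    then show ?thesis using v[OF 3(1)] h(1)[of v] h(2)[of v \<mu>] assms(5) 3 g_sym[of v p "\<xi> \<mu> p"] by simp
  qed
qed

text \<open>\<open>\<eta>\<close> vanishes on every distribution except that of
  \<open>\<xi> 1\<close>, so between different distributions the deformed metric is a multiple of
  \<open>g\<close>.\<close>

lemma deformed_orthogonal:
  assumes "\<mu> \<in> {1..4}" "\<nu> \<in> {1..4}" "\<mu> \<noteq> \<nu>" "u \<in> D \<mu> p" "v \<in> D \<nu> p"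
  shows "KD.deformed t p u v = 0"
proof -
  have x: "\<zeta> p \<in> D 1 p" unfolding DD \<zeta> sasaki_distr_def by (auto intro: span_base)
  have "KD.\<eta> p w = 0" if "\<kappa> \<in> {1..4}" "\<kappa> \<noteq> 1" "w \<in> D \<kappa> p" for \<kappa> w
    unfolding KD.\<eta>_def by (rule D_orthogonal[of \<kappa> 1]) (use that x in auto)
  then have "KD.\<eta> p u = 0 \<or> KD.\<eta> p v = 0" using assms by metis
  then show ?thesis using D_orthogonal[OF assms] by (auto simp: KD.deformed_def)
qed

lemma deformed_variation: "adapted_variation A D \<Omega> g 1 KD.deformed" "volume_preserving A \<Omega> 1 KD.deformed"
proof -
  have "{p. \<exists>u\<in>tangent A p. \<exists>v\<in>tangent A p. deriv (\<lambda>s. KD.deformed s p u v) t \<noteq> 0} \<subseteq> {q. \<sigma> q \<noteq> 0}" for t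
    by (auto simp: KD.deformed_def KD.ex_def)
  then have c: "closure {p. \<exists>u\<in>tangent A p. \<exists>v\<in>tangent A p. deriv (\<lambda>s. KD.deformed s p u v) t \<noteq> 0} \<subseteq> \<Omega>" for t
    using closure_mono \<sigma>(2) by blast
  show "adapted_variation A D \<Omega> g 1 KD.deformed"
    unfolding adapted_variation_def
  proof (intro conjI ballI impI allI)
    show "KD.deformed 0 = g" by (rule KD.deformed_0)
    show "riemannian_metric A (KD.deformed t)" for t by (rule riemannian.metric[OF KD.deformed_riemannian])
    show "smooth_family A 1 (\<lambda>t p. KD.deformed t p (X p) (Y p))" if "X \<in> smooth_vfields A" "Y \<in> smooth_vfields A" for X Y
      by (rule expfam_family[OF KD.deformed_family[OF that] \<sigma>(1)])
    show "KD.deformed t p u v = 0" if "\<mu> \<in> {1..4}" "\<nu> \<in> {1..4}" "\<mu> \<noteq> \<nu>" "u \<in> D \<mu> p" "v \<in> D \<nu> p" for t \<mu> \<nu> p u v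
      by (rule deformed_orthogonal[OF that])
  qed (use c in auto)
  show "volume_preserving A \<Omega> 1 KD.deformed" unfolding volume_preserving_def KD.deformed_volume by simp
qed

text \<open>The contorsion, relative to \<open>g\<close>, of the connection that \<open>T\<close>
  defines for the deformed metric. It need not be skew for \<open>g\<close>.\<close>

definition \<tau> :: "real \<Rightarrow> 'a tensor12" where "\<tau> t = (\<lambda>p u v. T p u v + KD.K t p u v)"

lemma \<tau>_tensor: "smooth_tensor12 A (\<tau> t)"
proof (rule smooth_tensor12I)
  fix X Y assume "X \<in> smooth_vfields A" "Y \<in> smooth_vfields A"
  then show "(\<lambda>p. \<tau> t p (X p) (Y p)) \<in> smooth_vfields A"
    unfolding \<tau>_def by (intro vf_add tensor12_vf[OF T_tensor] tensor12_vf[OF KD.K_tensor])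
qed (simp_all add: \<tau>_def tensor12_lin[OF T_tensor] tensor12_lin[OF KD.K_tensor] scaleR_right_distrib)

lemma \<tau>_tfam: "tfam \<sigma> \<tau>"
  unfolding tfam_def
proof (intro conjI allI ballI \<tau>_tensor)
  fix X Y assume XY: "X \<in> smooth_vfields A" "Y \<in> smooth_vfields A"
  show "(\<lambda>t q. \<tau> t q (X q) (Y q)) \<in> vfam \<sigma>"
    unfolding \<tau>_def by (rule vfam_add[OF vfam_vf[OF tensor12_vf[OF T_tensor XY]] KD.K_vfam[OF XY]])
qed

lemma \<tau>_0: "\<tau> 0 = T"
proof (intro ext)
  fix p u v f
  have "KD.W 0 p u v = 0" by (simp add: KD.W_def KD.ex_def)
  then have "KD.K 0 p u v = 0" by (simp add: KD.K_def KD.ex_def)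
  then show "\<tau> 0 p u v f = T p u v f" by (simp add: \<tau>_def)
qed

text \<open>\<open>K\<close> also involves the differential of \<open>\<sigma>\<close>, which need
  not vanish at a zero of \<open>\<sigma>\<close>; outside the closed support both do.\<close>

lemma \<tau>_supp:
  assumes p: "p \<notin> closure {q. \<sigma> q \<noteq> 0}" and u: "u \<in> tangent A p" and v: "v \<in> tangent A p"
  shows "\<tau> t p u v = T p u v"
proof -
  have z: "\<sigma> q = 0" if "q \<notin> closure {q. \<sigma> q \<noteq> 0}" for q
    using that closure_subset[of "{q. \<sigma> q \<noteq> 0}"] by auto
  note p0 = z[OF p]
  have d: "KD.dsig w = 0" if w: "w \<in> tangent A p" for w
  proof -
    have "w \<sigma> = w (\<lambda>q. 0)"
    proof (rule tangent_local[OF w \<sigma>(1) smooth_funs_const])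
      show "open (- closure {q. \<sigma> q \<noteq> 0})" by (rule open_Compl[OF closed_closure])
      show "p \<in> - closure {q. \<sigma> q \<noteq> 0}" using p by simp
      show "\<sigma> q = 0" if "q \<in> - closure {q. \<sigma> q \<noteq> 0}" for q using z that by blast
    qed
    then show ?thesis using tangent_const[OF w, of 0] by (simp add: KD.dsig_def)
  qed
  have "KD.grad p = 0" by (rule tangent_eqI_g) (auto simp: d)
  then have "KD.W t p u v = 0" using d u v p0 by (simp add: KD.W_def KD.ex_def)
  then have "KD.K t p u v = 0" by (simp add: KD.K_def KD.ex_def p0)
  then show ?thesis by (simp add: \<tau>_def)
qed

lemma deformed_connection:
  "X \<in> smooth_vfields A \<Longrightarrow> Y \<in> smooth_vfields A \<Longrightarrow>
    contorted_connection A (KD.deformed t) T X Y = contorted_connection A g (\<tau> t) X Y"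
  by (rule ext) (simp add: contorted_connection_def KD.LC_deformed \<tau>_def add_ac)

lemma deformed_curvature:
  assumes "u \<in> tangent A p" "v \<in> tangent A p" "w \<in> tangent A p"
  shows "curvature A (contorted_connection A (KD.deformed t) T) p u v w = curvature A (contorted_connection A g (\<tau> t)) p u v w"
proof -
  interpret c: connection A "contorted_connection A g (\<tau> t)" by unfold_locales (rule contorted_affine[OF \<tau>_tensor])
  show ?thesis unfolding curvature_def Let_def using assms by (simp add: deformed_connection)
qed

section \<open>Mixed scalar curvature of the deformed metric\<close>

definition wt :: "real \<Rightarrow> 'n \<Rightarrow> 'a \<Rightarrow> real"
  where "wt t i q = (if i = i1 then KD.ex (- KD.n1) t q else KD.ex 1 t q)"

lemma wt_pos: "0 < wt t i q"
  by (simp add: wt_def)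

lemma deformed_frame:
  assumes q: "q \<in> W" and u: "u \<in> tangent A q"
  shows "KD.deformed t q u (E i q) = wt t i q * g q u (E i q)"
proof (cases "i = i1")
  case True
  then show ?thesis by (simp add: wt_def KD.deformed_def E_i1 algebra_simps)
next
  case False
  then have "KD.\<eta> q (E i q) = 0" using on_g[OF q, of i i1] unfolding KD.\<eta>_def E_i1 by simp
  then show ?thesis using False by (simp add: wt_def KD.deformed_def)
qed

text \<open>The deformed metric keeps the frame orthogonal, so \<open>r i *\<^sub>R E i\<close> is
  orthonormal for it. The curvature operator is that of \<open>\<tau> t\<close> over
  \<open>g\<close>; only the normalisation and the final contraction see the deformed
  metric.\<close>

lemma mixed_curvature_deformed:
  assumes q: "q \<in> W"
  shows "mixed_scalar_curvature A D (KD.deformed t) T q = (1/2) * (\<Sum>i\<in>UNIV. inverse (wt t i q) * msec (\<tau> t) i q)"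
proof -
  interpret R: riemannian A "KD.deformed t" by (rule KD.deformed_riemannian)
  interpret c: connection A "contorted_connection A g (\<tau> t)" by unfold_locales (rule contorted_affine[OF \<tau>_tensor])
  interpret nR: connection A "contorted_connection A (KD.deformed t) T" by unfold_locales (rule R.contorted_affine[OF T_tensor])
  define r where "r i = inverse (sqrt (wt t i q))" for i
  have r: "r i \<noteq> 0" "r i * r i = inverse (wt t i q)" for i
    using wt_pos[of t i q] by (simp_all add: r_def inverse_mult_distrib[symmetric])
  let ?e = "\<lambda>i. r i *\<^sub>R E i q"
  have on': "R.ON q ?e" unfolding R.ON_def
  proof (intro conjI allI)
    show "?e i \<in> tangent A q" for i by simp
    show "KD.deformed t q (?e i) (?e j) = (if i = j then 1 else 0)" for i j
    proof -
      have "KD.deformed t q (?e i) (?e j) = r i * (r j * (wt t j q * (if i = j then 1 else 0)))"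
        by (simp add: deformed_frame[OF q vf_tangent[OF E]] on_g[OF q])
      also have "\<dots> = (r i * r i) * wt t i q * (if i = j then 1 else 0)" by simp
      finally show ?thesis unfolding r(2) using wt_pos[of t i q] by simp
    qed
  qed
  \<comment> \<open>Normalisation is by a common factor within each distribution, since
    \<open>\<zeta>\<close> alone spans the first one; hence the spans are unchanged.\<close>
  have sp: "D \<mu> q = span (?e ` {i. lab i = \<mu>})" if \<mu>: "\<mu> \<in> {1..4}" for \<mu>
  proof -
    obtain c where c: "c \<noteq> 0" "\<And>i. lab i = \<mu> \<Longrightarrow> r i = c"
    proof (cases "\<mu> = 1")
      case True
      show ?thesis by (rule that[of "r i1"]) (use True lab_i1 r(1) in auto)
    next
      case False
      then have "r i = inverse (sqrt (KD.ex 1 t q))" if "lab i = \<mu>" for i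
        using that lab_i1[of i] by (auto simp: r_def wt_def)
      moreover have "inverse (sqrt (KD.ex 1 t q)) \<noteq> 0"
        using real_sqrt_gt_zero[OF KD.ex_pos[of 1 t q]] by (metis inverse_nonzero_iff_nonzero less_irrefl)
      ultimately show ?thesis using that by metis
    qed
    have "?e ` {i. lab i = \<mu>} = (\<lambda>v. c *\<^sub>R v) ` ((\<lambda>i. E i q) ` {i. lab i = \<mu>})" using c(2) by force
    then show ?thesis using span_image_scale[of "(\<lambda>i. E i q) ` {i. lab i = \<mu>}" "\<lambda>v. c"] c(1) D[OF \<mu> q] by simp
  qed
  have term_eq: "KD.deformed t q (curvature A (contorted_connection A (KD.deformed t) T) q (?e i) (?e j) (?e i)) (?e j)
      = inverse (wt t i q) * secf (\<tau> t) i j q" for i j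
  proof -
    have ct: "c.Rm (E i) (E j) (E i) q \<in> tangent A q" by (rule vf_tangent) auto
    have "curvature A (contorted_connection A (KD.deformed t) T) q (?e i) (?e j) (?e i)
        = (r i * r j * r i) *\<^sub>R c.Rm (E i) (E j) (E i) q"
      using c.curvature_eq_Rm[OF E E E, of q i j i]
      by (simp add: deformed_curvature c.curvature_scale1[OF _ tangent_zero] c.curvature_scale2[OF _ tangent_zero]
          c.curvature_scale3[OF _ tangent_zero] mult_ac)
    then have "KD.deformed t q (curvature A (contorted_connection A (KD.deformed t) T) q (?e i) (?e j) (?e i)) (?e j)
        = (r i * r i) * (r j * r j) * KD.deformed t q (c.Rm (E i) (E j) (E i) q) (E j q)"
      using ct by (simp add: mult_ac)
    \<comment> \<open>The factor \<open>wt t j\<close> from the contraction cancels one of the two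
      inverse weights of the normalisation, leaving that of the first index.\<close>
    also have "\<dots> = inverse (wt t i q) * secf (\<tau> t) i j q"
      unfolding deformed_frame[OF q ct] r(2) secf_def using wt_pos[of t j q] by simp
    finally show ?thesis .
  qed
  have "mixed_scalar_curvature A D (KD.deformed t) T q = (1/2) * (\<Sum>i\<in>UNIV. \<Sum>j\<in>UNIV. if lab i \<noteq> lab j
      then KD.deformed t q (curvature A (contorted_connection A (KD.deformed t) T) q (?e i) (?e j) (?e i)) (?e j) else 0)"
    by (rule R.mixed_scalar_curvature_frame[OF T_tensor on', where lab=lab and D=D]) (use lab sp in auto)
  then show ?thesis unfolding term_eq msec_def sum_distrib_left if_distrib[of "(*) _"] mult_zero_right .
qed

definition M where "M t q = (1/2) * msec (\<tau> t) i1 q"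
definition R where "R t q = (1/2) * (\<Sum>i\<in>UNIV - {i1}. msec (\<tau> t) i q)"

lemma msec_fam: "(\<lambda>t. msec (\<tau> t) i) \<in> expfam \<sigma>"
proof -
  have "(\<lambda>t q. if lab i \<noteq> lab j then secf (\<tau> t) i j q else 0) \<in> expfam \<sigma>" for j
  proof (cases "lab i \<noteq> lab j")
    case True
    have "(\<lambda>t q. secf (\<tau> t) i j q) \<in> expfam \<sigma>"
      unfolding secf_def by (rule vfam_ip[OF tfam_curvature[OF \<tau>_tfam \<sigma>(1) E E E] \<sigma>(1) E])
    then show ?thesis using True by simp
  qed (use expfam_fun[OF smooth_funs_const[of 0]] in simp)
  then show ?thesis unfolding msec_def[abs_def] by (intro expfam_sum)
qed

lemma MR_fam: "M \<in> expfam \<sigma>" "R \<in> expfam \<sigma>"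
  unfolding M_def[abs_def] R_def[abs_def] by (intro expfam_scale expfam_sum msec_fam)+

lemma mixed_curvatures:
  assumes q: "q \<in> W"
  shows "mixed_scalar_curvature A D (KD.deformed t) T q = KD.ex KD.n1 t q * M t q + KD.ex (- 1) t q * R t q"
    and "mixed_scalar_curvature A D g (\<tau> t) q = M t q + R t q"
proof -
  have i: "inverse (KD.ex b t q) = KD.ex (- b) t q" for b
    by (simp add: KD.ex_def exp_minus)
  have "(\<Sum>i\<in>UNIV. inverse (wt t i q) * msec (\<tau> t) i q)
    = inverse (wt t i1 q) * msec (\<tau> t) i1 q + (\<Sum>i\<in>UNIV - {i1}. inverse (wt t i q) * msec (\<tau> t) i q)"
    by (rule sum.remove) auto
  also have "(\<Sum>i\<in>UNIV - {i1}. inverse (wt t i q) * msec (\<tau> t) i q) = KD.ex (- 1) t q * (\<Sum>i\<in>UNIV - {i1}. msec (\<tau> t) i q)"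
    unfolding sum_distrib_left by (rule sum.cong) (auto simp: wt_def i)
  finally have s: "(\<Sum>i\<in>UNIV. inverse (wt t i q) * msec (\<tau> t) i q)
    = KD.ex KD.n1 t q * msec (\<tau> t) i1 q + KD.ex (- 1) t q * (\<Sum>i\<in>UNIV - {i1}. msec (\<tau> t) i q)"
    by (simp add: wt_def i)
  show "mixed_scalar_curvature A D (KD.deformed t) T q = KD.ex KD.n1 t q * M t q + KD.ex (- 1) t q * R t q"
    unfolding mixed_curvature_deformed[OF q] s M_def R_def by (simp add: algebra_simps)
  have "msum (secf (\<tau> t)) q = (\<Sum>i\<in>UNIV. msec (\<tau> t) i q)" unfolding msum_def msec_def ..
  also have "\<dots> = msec (\<tau> t) i1 q + (\<Sum>i\<in>UNIV - {i1}. msec (\<tau> t) i q)" by (rule sum.remove) auto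
  finally show "mixed_scalar_curvature A D g (\<tau> t) q = M t q + R t q"
    unfolding mixed_curvature_msum[OF \<tau>_tensor q] M_def R_def by (simp add: algebra_simps)
qed

text \<open>Both actions have derivative 0, hence so has their difference, in which the curvature
  appears only multiplied by a weight minus 1. The limit of its quotient evaluates the curvature at
  \<open>t = 0\<close> and gives \<open>(n1 - 2)\<close> times the integral of
  \<open>\<sigma>\<close>.\<close>

lemma integral_\<sigma>: "set_lebesgue_integral vol \<Omega> \<sigma> = 0"
proof -
  let ?I = "\<lambda>f. set_lebesgue_integral vol \<Omega> f"
  let ?h = "\<lambda>t. ?I (\<lambda>q. (KD.ex KD.n1 t q - 1) * M t q) + ?I (\<lambda>q. (KD.ex (- 1) t q - 1) * R t q)"
  have "tensor_variation A \<Omega> T 1 \<tau>"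
    by (rule tfam_variation[where K="closure {q. \<sigma> q \<noteq> 0}", OF \<tau>_tfam \<sigma>(1) \<tau>_0 \<tau>_supp]) (use \<sigma>(2) in simp_all)
  then have d1: "((\<lambda>t. action A D \<Omega> g (\<tau> t)) has_real_derivative 0) (at 0)"
    using crit \<Omega>_domain unfolding critical_contorsion_def by blast
  have d2: "((\<lambda>t. action A D \<Omega> (KD.deformed t) T) has_real_derivative 0) (at 0)"
    using cmet \<Omega>_domain deformed_variation unfolding critical_metric_fixed_volume_def by blast
  \<comment> \<open>The connections and the volume forms agree, so the two actions differ by the
    weights alone.\<close>
  have h: "action A D \<Omega> (KD.deformed t) T - action A D \<Omega> g (\<tau> t) = ?h t" for t
  proof -
    have sm: "M t \<in> smooth_funs A" "R t \<in> smooth_funs A" using expfam_smooth MR_fam \<sigma>(1) by blast+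
    have si: "set_integrable vol \<Omega> (M t)" "set_integrable vol \<Omega> (R t)"
      "set_integrable vol \<Omega> (\<lambda>q. KD.ex KD.n1 t q * M t q)" "set_integrable vol \<Omega> (\<lambda>q. KD.ex (- 1) t q * R t q)"
      using sm by (auto intro!: smooth_set_integrable)
    have "action A D \<Omega> (KD.deformed t) T = ?I (\<lambda>q. KD.ex KD.n1 t q * M t q + KD.ex (- 1) t q * R t q)"
      unfolding action_def KD.deformed_volume vol_def[symmetric]
      by (rule set_lebesgue_integral_cong) (use \<Omega>_sub(3) mixed_curvatures(1) \<Omega>W in auto)
    moreover have "action A D \<Omega> g (\<tau> t) = ?I (\<lambda>q. M t q + R t q)"
      unfolding action_def vol_def[symmetric]
      by (rule set_lebesgue_integral_cong) (use \<Omega>_sub(3) mixed_curvatures(2) \<Omega>W in auto)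
    ultimately show ?thesis using si by (simp add: left_diff_distrib set_integral_add set_integral_diff)
  qed
  have "(?h has_real_derivative 0) (at 0)"
    using DERIV_diff[OF d2 d1] unfolding h by simp
  then have "((\<lambda>t. (?h t - ?h 0) / t) \<longlongrightarrow> 0) (at 0)" by (simp add: has_field_derivative_iff)
  moreover have "?h 0 = 0" by (simp add: KD.ex_def)
  ultimately have "((\<lambda>t. ?h t / t) \<longlongrightarrow> 0) (at 0)" by simp
  moreover have "filterlim (\<lambda>n. inverse (real (Suc n))) (at 0) sequentially"
    unfolding filterlim_at using LIMSEQ_inverse_real_of_nat by auto
  ultimately have "(\<lambda>n. ?h (inverse (real (Suc n))) / inverse (real (Suc n))) \<longlonglongrightarrow> 0"
    by (rule filterlim_compose)
  moreover have "(\<lambda>n. ?h (inverse (real (Suc n))) / inverse (real (Suc n))) \<longlonglongrightarrow>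
      ?I (\<lambda>q. KD.n1 * \<sigma> q * M 0 q) + ?I (\<lambda>q. - 1 * \<sigma> q * R 0 q)"
    unfolding add_divide_distrib KD.ex_def
    by (intro tendsto_add exp_quotient_limit MR_fam \<sigma>(1))
  ultimately have "?I (\<lambda>q. KD.n1 * \<sigma> q * M 0 q) + ?I (\<lambda>q. - 1 * \<sigma> q * R 0 q) = 0"
    by (rule LIMSEQ_unique[symmetric])
  \<comment> \<open>On \<open>\<Omega>\<close> the values at \<open>t = 0\<close> are
    \<open>M 0 = 1\<close> and \<open>R 0 = 2\<close>: half of 2 and half of 4, the factor 1/2 being
    that of the mixed scalar curvature.\<close>
  moreover have "?I (\<lambda>q. KD.n1 * \<sigma> q * M 0 q) = KD.n1 * ?I \<sigma>"
    unfolding set_integral_mult_right[symmetric]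
    by (rule set_lebesgue_integral_cong) (use \<Omega>_sub(3) msec_vertical[OF _ one_mem, folded i1] in \<open>auto simp: M_def \<tau>_0\<close>)
  moreover have "?I (\<lambda>q. - 1 * \<sigma> q * R 0 q) = - 2 * ?I \<sigma>"
    unfolding set_integral_mult_right[symmetric]
    by (rule set_lebesgue_integral_cong) (use \<Omega>_sub(3) msec_rest[folded i1] in \<open>auto simp: R_def \<tau>_0\<close>)
  ultimately have "(KD.n1 - 2) * ?I \<sigma> = 0" by (simp only: left_diff_distrib)
  \<comment> \<open>Dimension above 4 gives \<open>n1 \<ge> 4\<close>, so the factor of the integral
    is not 0.\<close>
  moreover have "KD.n1 > 2" using dim unfolding KD.n1_def by linarith
  ultimately show ?thesis by simp
qed

end

text \<open>Every test function with support in \<open>\<Omega>\<close> would have integral 0; the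
  fundamental lemma, applied to the constant function 1, refutes this.\<close>

lemma (in sasaki_chart) not_critical_metric:
  assumes DD: "D = sasaki_distr A g \<xi>" and p: "p \<in> \<Omega>"
  shows "\<not> critical_metric_fixed_volume A D g T"
proof
  assume c: "critical_metric_fixed_volume A D g T"
  have "(1::real) = 0"
  proof (rule fundamental_lemma[OF smooth_funs_const _ p])
    fix s assume s: "s \<in> smooth_funs A" "closure {q. s q \<noteq> 0} \<subseteq> \<Omega>"
    interpret S: sasaki_deformation A g U \<phi> N x C \<Omega> T D E W lab \<xi> ix s "\<xi> 1" "ix 1"
      by unfold_locales (use c DD s in auto)
    show "set_lebesgue_integral vol \<Omega> (\<lambda>q. s q * 1) = 0" using S.integral_\<sigma> by simp
  qed
  then show False by simp
qed

text \<open>The contradiction is local: a frame containing the Reeb fields near a single point and a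
  small coordinate ball around that point provide the setting of
  \<open>sasaki_chart\<close>.\<close>

lemma three_sasaki_not_critical:
  fixes A :: "('a::{t2_space, second_countable_topology}, 'n::finite) atlas"
  assumes atlas: "smooth_atlas A" and dim: "CARD('n) > 4" and sas: "three_sasaki A g \<xi>"
    and T: "metric_contorsion A g T" and no_mixed: "no_mixed_contorsion g (sasaki_distr A g \<xi>) T"
    and crit: "critical_contorsion A (sasaki_distr A g \<xi>) g T"
  shows "\<not> critical_metric_fixed_volume A (sasaki_distr A g \<xi>) g T"
proof -
  interpret riemannian2 A g
    by unfold_locales (use atlas sas in \<open>auto simp: three_sasaki_def\<close>)
  have vf: "\<xi> a \<in> smooth_vfields A" if "a \<in> {1..3}" for a
    by (rule killing_vf) (use sas that in \<open>auto simp: three_sasaki_def sasakian_field_def\<close>)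
  have on: "g q (\<xi> a q) (\<xi> b q) = (if a = b then 1 else 0)" if "a \<in> {1..3}" "b \<in> {1..3}" for a b q
    using sas that unfolding three_sasaki_def by blast
  \<comment> \<open>Any point serves.\<close>
  define p :: 'a where "p = undefined"
  obtain ix :: "nat \<Rightarrow> 'n" where ix: "inj_on ix {1..3}"
    using card_le_inj[of "{1..3::nat}" "UNIV :: 'n set"] dim by auto
  define J where "J = ix ` {1..3}"
  \<comment> \<open>Indices that do not carry a Reeb field receive 4, the number of the horizontal
    distribution.\<close>
  define lab where "lab i = (if i \<in> J then inv_into {1..3} ix i else 4)" for i
  have lab_ix: "lab (ix a) = a" if "a \<in> {1..3}" for a
    unfolding lab_def J_def using inv_into_f_f[OF ix that] that by simp
  have lab_J: "lab i \<in> {1..3}" "ix (lab i) = i" if "i \<in> J" for i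
    using that inv_into_into[of i ix "{1..3}"] f_inv_into_f[of i ix "{1..3}"] unfolding lab_def J_def by simp_all
  have lab4: "lab i = 4 \<longleftrightarrow> i \<notin> J" for i
    using lab_J(1)[of i] by (cases "i \<in> J") (auto simp: lab_def)
  have ix_iff: "lab i = a \<longleftrightarrow> i = ix a" if "a \<in> {1..3}" for a i
    using that lab_ix[OF that] lab_J(2)[of i] lab4[of i] by (cases "i \<in> J") auto
  have lab_inj: "lab i = lab j \<longleftrightarrow> i = j" if "i \<in> J" "j \<in> J" for i j
    using lab_J(2)[OF that(1)] lab_J(2)[OF that(2)] by metis
  have t: "\<xi> (lab i) p \<in> tangent A p" if "i \<in> J" for i by (rule vf_tangent[OF vf[OF lab_J(1)[OF that]]])
  have onJ: "g q (\<xi> (lab i) q) (\<xi> (lab j) q) = (if i = j then 1 else 0)" if "i \<in> J" "j \<in> J" for i j q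
    using on[OF lab_J(1)[OF that(1)] lab_J(1)[OF that(2)]] lab_inj[OF that] by simp
  obtain e where e: "ON p e" "\<And>i. i \<in> J \<Longrightarrow> e i = \<xi> (lab i) p"
    by (rule ON_extend[of J "\<lambda>i. \<xi> (lab i) p" p, OF t onJ], assumption, assumption, assumption, rule that)
  define F where "F i = (if i \<in> J then \<xi> (lab i) else extend_vec A p (e i))" for i
  have F: "F i \<in> smooth_vfields A" for i
    unfolding F_def using vf[OF lab_J(1)[of i]] ON_D(1)[OF e(1), of i] by simp
  have "F i p = e i" for i unfolding F_def using e(2)[of i] ON_D(1)[OF e(1), of i] by simp
  then have FON: "ON p (\<lambda>i. F i p)" using e(1) by simp
  have FJ: "g q (F i q) (F j q) = (if i = j then 1 else 0)" if "i \<in> J" "j \<in> J" for i j q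
    using onJ[OF that] that by (simp add: F_def)
  obtain E W where E: "\<And>i. E i \<in> smooth_vfields A" "\<And>i. i \<in> J \<Longrightarrow> E i = F i" "open W" "p \<in> W" "\<And>q. q \<in> W \<Longrightarrow> ON q (\<lambda>i. E i q)"
    by (rule frame_extend[OF F FON FJ], assumption, assumption, rule that)
  have E_ix: "E (ix a) = \<xi> a" if "a \<in> {1..3}" for a
    using E(2)[of "ix a"] that lab_ix[OF that] by (simp add: F_def J_def)
  obtain U \<phi> N x C \<Omega> where cd: "chart_domain A g U \<phi> N x C \<Omega>" "p \<in> \<Omega>" "closure \<Omega> \<subseteq> W"
    by (rule chart_domain_ex[OF E(3,4)])
  interpret chart_domain A g U \<phi> N x C \<Omega> by (rule cd(1))
  have D4: "sasaki_distr A g \<xi> 4 q = span ((\<lambda>i. E i q) ` {i. lab i = 4})" if q: "q \<in> W" for q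
  proof (rule set_eqI)
    fix v
    have gE: "g q (E i q) (\<xi> a q) = 0" if "lab i = 4" "a \<in> {1..3}" for i a
      using ON_D(2)[OF E(5)[OF q], of i "ix a"] that lab_ix[OF that(2)] unfolding E_ix[OF that(2)] by auto
    have "v \<in> tangent A q \<and> (\<forall>a\<in>{1..3}. g q v (\<xi> a q) = 0)" if "v \<in> span ((\<lambda>i. E i q) ` {i. lab i = 4})"
      using that
    proof (induction rule: span_induct_alt)
      case base
      have "\<forall>a\<in>{1..3}. g q 0 (\<xi> a q) = 0" using g_zero_left vf_tangent[OF vf] by blast
      then show ?case by (rule conjI[OF tangent_zero])
    next
      case (step c u w)
      obtain i where i: "u = E i q" "lab i = 4" using step(1) by blast
      have u: "u \<in> tangent A q" unfolding i by (rule vf_tangent[OF E(1)])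
      have "c *\<^sub>R u + w \<in> tangent A q" using u step(2) by simp
      moreover have "\<forall>a\<in>{1..3}. g q (c *\<^sub>R u + w) (\<xi> a q) = 0"
      proof
        fix a :: nat assume a: "a \<in> {1..3}"
        show "g q (c *\<^sub>R u + w) (\<xi> a q) = 0"
          using u step(2) vf_tangent[OF vf[OF a], of q] gE[OF i(2) a] a unfolding i(1) by simp
      qed
      ultimately show ?case by (rule conjI)
    qed
    moreover have "v \<in> span ((\<lambda>i. E i q) ` {i. lab i = 4})" if v: "v \<in> tangent A q" "\<forall>a\<in>{1..3}. g q v (\<xi> a q) = 0"
    proof -
      have "g q v (E i q) *\<^sub>R E i q \<in> span ((\<lambda>i. E i q) ` {i. lab i = 4})" for i
      proof (cases "i \<in> J")
        case True
        then have "E i = \<xi> (lab i)" using E(2) by (simp add: F_def)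
        then have "g q v (E i q) = 0" using v(2) lab_J(1)[OF True] by simp
        then show ?thesis by (simp only: scaleR_zero_left span_zero)
      next
        case False
        then show ?thesis using lab4 by (intro span_scale span_base) auto
      qed
      then have "(\<Sum>i\<in>UNIV. g q v (E i q) *\<^sub>R E i q) \<in> span ((\<lambda>i. E i q) ` {i. lab i = 4})" by (intro span_sum)
      then show ?thesis using ON_expand[OF E(5)[OF q] v(1)] by simp
    qed
    ultimately show "v \<in> sasaki_distr A g \<xi> 4 q \<longleftrightarrow> v \<in> span ((\<lambda>i. E i q) ` {i. lab i = 4})"
      unfolding sasaki_distr_4[OF sas] by blast
  qed
  have lab_range: "lab i \<in> {1..4}" for i
    using lab_J(1)[of i] lab4[of i] by (cases "i \<in> J") auto
  have D: "sasaki_distr A g \<xi> \<mu> q = span ((\<lambda>i. E i q) ` {i. lab i = \<mu>})" if "\<mu> \<in> {1..4}" "q \<in> W" for \<mu> q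
  proof (cases "\<mu> = 4")
    case True
    then show ?thesis using D4[OF that(2)] by simp
  next
    case False
    then have \<mu>: "\<mu> \<in> {1..3}" using that by auto
    then have "{i. lab i = \<mu>} = {ix \<mu>}" using ix_iff by blast
    then show ?thesis using False E_ix[OF \<mu>] by (simp add: sasaki_distr_def)
  qed
  interpret sasaki_chart A g U \<phi> N x C \<Omega> T "sasaki_distr A g \<xi>" E W lab \<xi> ix
    by unfold_locales (fact T E(1) E(5) E(3) cd(3) lab_range D crit sas no_mixed E_ix ix_iff dim)+
  show ?thesis by (rule not_critical_metric[OF refl cd(2)])
qed

theorem corollary13:
  fixes A :: "('a::{t2_space, second_countable_topology}, 'n::finite) atlas"
    and m :: nat
  assumes "smooth_atlas A"
    and "connected (UNIV :: 'a set)"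
    and "CARD('n) = 4 * m + 3"
    and "m > 0"
  shows "(\<forall>g \<xi> T.
      let D = sasaki_distr A g \<xi>;
          n\<^sub>4 = 4 * real m;
          S = mixed_scalar_curvature A D g T;
          rest = (\<lambda>p. \<Sum>\<nu>\<in>{1..4}. divergence A g
                    (proj_perp_trace A g (D \<nu>) T + perp_proj_trace A g (D \<nu>) T) p)
      in
        three_sasaki A g \<xi> \<and>
        metric_contorsion A g T \<and>
        critical_metric_fixed_volume A D g T \<and>
        critical_contorsion A D g T \<and>
        no_mixed_contorsion g D T \<longrightarrow>
        (\<exists>lam::real. \<forall>p.
          - ((4 + n\<^sub>4) / n\<^sub>4) * divergence A g
               (perp_proj_trace A g (D 4) T
                 + (\<Sum>\<nu>\<in>{1..4} - {4}. proj_perp_trace A g (D \<nu>) T)) p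
            = lam - 30 - 2 * S p + rest p
          \<and>
          - 9 * (\<Sum>a\<in>{1..3}. divergence A g
               ((\<lambda>q. ortho_proj g (ortho_compl A g (D a)) q (T q (\<xi> a q) (\<xi> a q)))
                 + (\<Sum>\<nu>\<in>{1..4} - {a}. proj_perp_trace A g (D \<nu>) T)) p)
            = lam + 10 + 2 * n\<^sub>4 - 2 * S p + rest p))
    \<and>
    \<not> (\<exists>g \<xi> T.
      let D = sasaki_distr A g \<xi>
      in
        three_sasaki A g \<xi> \<and>
        complete_metric A g \<and>
        metric_contorsion A g T \<and>
        no_mixed_contorsion g D T \<and>
        critical_metric A D g T \<and>
        critical_contorsion A D g T)"
proof -
  have dim: "CARD('n) > 4" using assms by simp
  have no: False
    if "three_sasaki A g \<xi>" "metric_contorsion A g T" "no_mixed_contorsion g (sasaki_distr A g \<xi>) T"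
      "critical_contorsion A (sasaki_distr A g \<xi>) g T" "critical_metric_fixed_volume A (sasaki_distr A g \<xi>) g T" for g \<xi> T
    using three_sasaki_not_critical[OF assms(1) dim that(1-4)] that(5) by contradiction
  \<comment> \<open>Volume-preserving variations form a subclass of all adapted variations, so the
    second claim reduces to the same contradiction.\<close>
  have fixed: "critical_metric_fixed_volume A D g T" if "critical_metric A D g T" for D g T
    using that unfolding critical_metric_def critical_metric_fixed_volume_def by blast
  show ?thesis unfolding Let_def using no fixed by blast
qed

end
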